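(* Let $\epsilon>0$, $\Omega_\epsilon=\mathbb{R}\times(0,\epsilon)$, and let $\alpha\in W^{1,\infty}(\mathbb{R})$ be real-valued. Then the negative Laplacian $-\Delta_\alpha^{\Omega_\epsilon}$ is the (unique) self-adjoint operator associated with the sesquilinear form $b_\alpha^{\Omega_\epsilon}$, i.e., $$b_\alpha^{\Omega_\epsilon}(\phi,\psi)=(\phi,-\Delta_\alpha^{\Omega_\epsilon}\psi)_{L^2(\Omega_\epsilon)}$$ for $\phi\in\mathrm{dom}\,b_\alpha^{\Omega_\epsilon}$ and $\psi\in\mathrm{dom}(-\Delta_\alpha^{\Omega_\epsilon})$.
   Context: $L^2(\Omega_\epsilon)$ is the complex Hilbert space with inner product $(\phi,\psi)_{L^2(\Omega_\epsilon)}=\int_{\Omega_\epsilon}\overline{\phi}\,\psi\,dx\,dy$. The operator $-\Delta_\alpha^{\Omega_\epsilon}:\mathrm{dom}(-\Delta_\alpha^{\Omega_\epsilon})\to L^2(\Omega_\epsilon)$ acts as the negative Laplacian $\psi\mapsto-\Delta\psi$, with domain the set of all $\psi\in H^2(\Omega_\epsilon)$ satisfying, in the sense of traces, for a.e. $x\in\mathbb{R}$, $$-\frac{\partial\psi}{\partial y}(x,0)-\alpha(x)\psi(x,0)=0,\qquad \frac{\partial\psi}{\partial y}(x,\epsilon)+\alpha(x)\psi(x,\epsilon)=0.$$ The sesquilinear form $b_\alpha^{\Omega_\epsilon}$ has domain $\mathrm{dom}\,b_\alpha^{\Omega_\epsilon}=H^1(\Omega_\epsilon)$ and is given by $$b_\alpha^{\Omega_\epsilon}(\phi,\psi)=\int_{\Omega_\epsilon}\overline{\nabla\phi}\cdot\nabla\psi\,dx\,dy+\int_{\mathbb{R}}\alpha(x)\Big(\overline{\mathrm{tr}(\phi)}(x,\epsilon)\,\mathrm{tr}(\psi)(x,\epsilon)-\overline{\mathrm{tr}(\phi)}(x,0)\,\mathrm{tr}(\psi)(x,0)\Big)dx,$$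 where $\mathrm{tr}(\phi)\in L^2(\partial\Omega_\epsilon)$ is the trace of $\phi\in H^1(\Omega_\epsilon)$; this form is closed and bounded below by $-\|\alpha\|_\infty^2$. For a densely defined, closed, lower bounded sesquilinear form $b$ on a Hilbert space $\mathcal H$, the self-adjoint operator $T_b$ associated with $b$ is defined by: $\psi\in\mathrm{dom}\,T_b$ and $T_b\psi=\eta$ if and only if $\psi\in\mathrm{dom}\,b$, $\eta\in\mathcal H$ and $b(\phi,\psi)=(\phi,\eta)$ for all $\phi\in\mathrm{dom}\,b$. *)

theory Defs
  imports "HOL-Analysis.Analysis"
begin

text \<open>
  Elements of function spaces are represented by functions, to be read modulo equality almost
  everywhere. All spaces below are closed under changing a function on a null set, and the values
  of a function outside the space of the measure are irrelevant. Every Lebesgue measurable function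
  agrees a.e. with a Borel measurable one, so Borel representatives and \<^const>\<open>lborel\<close> give the usual
  spaces.
\<close>

subsection \<open>Lebesgue spaces\<close>

abbreviation lborel_on :: "'a::euclidean_space set \<Rightarrow> 'a measure" where
  "lborel_on \<Omega> \<equiv> restrict_space lborel \<Omega>"

definition L2 :: "'a measure \<Rightarrow> ('a \<Rightarrow> complex) set" where
  "L2 M = {f \<in> borel_measurable M. integrable M (\<lambda>x. (norm (f x))\<^sup>2)}"

definition l2_inner :: "'a measure \<Rightarrow> ('a \<Rightarrow> complex) \<Rightarrow> ('a \<Rightarrow> complex) \<Rightarrow> complex" where
  "l2_inner M f g = (\<integral>x. cnj (f x) * g x \<partial>M)"

definition l2_norm :: "'a measure \<Rightarrow> ('a \<Rightarrow> complex) \<Rightarrow> real" where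
  "l2_norm M f = sqrt (\<integral>x. (norm (f x))\<^sup>2 \<partial>M)"

definition Linf :: "'a measure \<Rightarrow> ('a \<Rightarrow> real) set" where
  "Linf M = {f \<in> borel_measurable M. \<exists>C. AE x in M. \<bar>f x\<bar> \<le> C}"

subsection \<open>Weak derivatives and Sobolev spaces\<close>

definition dir_deriv ::
  "'a::real_normed_vector \<Rightarrow> ('a \<Rightarrow> 'b::real_normed_vector) \<Rightarrow> 'a \<Rightarrow> 'b" where
  "dir_deriv v f x = frechet_derivative f (at x) v"

text \<open>All iterated directional derivatives are (totally) differentiable everywhere; in finite
  dimension this is \<open>C\<^sup>\<infinity>\<close>.\<close>

definition smooth :: "('a::euclidean_space \<Rightarrow> 'b::real_normed_vector) \<Rightarrow> bool" where
  "smooth f \<longleftrightarrow> (\<forall>vs x. (fold dir_deriv vs f) differentiable (at x))"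

definition test_functions ::
  "'a::euclidean_space set \<Rightarrow> ('a \<Rightarrow> 'b::real_normed_vector) set" where
  "test_functions \<Omega> = {f. smooth f \<and> compact (closure {x. f x \<noteq> 0}) \<and> closure {x. f x \<noteq> 0} \<subseteq> \<Omega>}"

definition loc_integrable ::
  "'a::euclidean_space set \<Rightarrow> ('a \<Rightarrow> 'b::{banach, second_countable_topology}) \<Rightarrow> bool" where
  "loc_integrable \<Omega> f \<longleftrightarrow> (\<forall>K. compact K \<and> K \<subseteq> \<Omega> \<longrightarrow> set_integrable lborel K f)"

text \<open>By linearity, real test functions suffice also when \<open>f\<close> and \<open>g\<close> are complex-valued.\<close>

definition weak_deriv ::
  "'a::euclidean_space set \<Rightarrow> 'a \<Rightarrow> ('a \<Rightarrow> 'b::{banach, second_countable_topology}) \<Rightarrow> ('a \<Rightarrow> 'b) \<Rightarrow> bool" where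
  "weak_deriv \<Omega> v f g \<longleftrightarrow> loc_integrable \<Omega> f \<and> loc_integrable \<Omega> g \<and>
     (\<forall>\<phi> :: 'a \<Rightarrow> real. \<phi> \<in> test_functions \<Omega> \<longrightarrow>
       (\<integral>x. dir_deriv v \<phi> x *\<^sub>R f x \<partial>lborel_on \<Omega>) = - (\<integral>x. \<phi> x *\<^sub>R g x \<partial>lborel_on \<Omega>))"

text \<open>A representative of the weak derivative, which is unique up to null sets if it exists.\<close>

definition wderiv ::
  "'a::euclidean_space set \<Rightarrow> 'a \<Rightarrow> ('a \<Rightarrow> complex) \<Rightarrow> 'a \<Rightarrow> complex" where
  "wderiv \<Omega> v f = (SOME g. weak_deriv \<Omega> v f g)"

primrec sobolev :: "'a::euclidean_space set \<Rightarrow> nat \<Rightarrow> ('a \<Rightarrow> complex) set" where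
  "sobolev \<Omega> 0 = L2 (lborel_on \<Omega>)"
| "sobolev \<Omega> (Suc k) =
     {f \<in> L2 (lborel_on \<Omega>). \<forall>i\<in>Basis. \<exists>g \<in> sobolev \<Omega> k. weak_deriv \<Omega> i f g}"

abbreviation H1 :: "'a::euclidean_space set \<Rightarrow> ('a \<Rightarrow> complex) set" where
  "H1 \<Omega> \<equiv> sobolev \<Omega> 1"

abbreviation H2 :: "'a::euclidean_space set \<Rightarrow> ('a \<Rightarrow> complex) set" where
  "H2 \<Omega> \<equiv> sobolev \<Omega> 2"

definition H1_norm :: "'a::euclidean_space set \<Rightarrow> ('a \<Rightarrow> complex) \<Rightarrow> real" where
  "H1_norm \<Omega> f = sqrt ((l2_norm (lborel_on \<Omega>) f)\<^sup>2 +
     (\<Sum>i\<in>Basis. (l2_norm (lborel_on \<Omega>) (wderiv \<Omega> i f))\<^sup>2))"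

definition W1inf :: "(real \<Rightarrow> real) set" where
  "W1inf = {f \<in> Linf lborel. \<exists>g \<in> Linf lborel. weak_deriv UNIV 1 f g}"

subsection \<open>Unbounded operators\<close>

text \<open>
  An operator in \<open>L\<^sup>2\<close> is represented by its graph, a set of pairs of representatives. A
  set that equals its own adjoint is automatically a linear subspace closed under equality a.e., and
  if its domain is dense it is single-valued up to equality a.e.
\<close>

definition densely_defined ::
  "'a measure \<Rightarrow> (('a \<Rightarrow> complex) \<times> ('a \<Rightarrow> complex)) set \<Rightarrow> bool" where
  "densely_defined M A \<longleftrightarrow> Domain A \<subseteq> L2 M \<and>
     (\<forall>f \<in> L2 M. \<forall>e>0. \<exists>\<psi> \<in> Domain A. l2_norm M (\<lambda>x. f x - \<psi> x) < e)"

definition adjoint_op ::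
  "'a measure \<Rightarrow> (('a \<Rightarrow> complex) \<times> ('a \<Rightarrow> complex)) set \<Rightarrow> (('a \<Rightarrow> complex) \<times> ('a \<Rightarrow> complex)) set" where
  "adjoint_op M A = {(u, v). u \<in> L2 M \<and> v \<in> L2 M \<and>
     (\<forall>(\<psi>, \<eta>) \<in> A. l2_inner M u \<eta> = l2_inner M v \<psi>)}"

definition self_adjoint ::
  "'a measure \<Rightarrow> (('a \<Rightarrow> complex) \<times> ('a \<Rightarrow> complex)) set \<Rightarrow> bool" where
  "self_adjoint M A \<longleftrightarrow> densely_defined M A \<and> adjoint_op M A = A"

text \<open>The operator associated with a sesquilinear form \<open>b\<close> with form domain \<open>D\<close>.\<close>

definition form_operator ::
  "'a measure \<Rightarrow> ('a \<Rightarrow> complex) set \<Rightarrow> (('a \<Rightarrow> complex) \<Rightarrow> ('a \<Rightarrow> complex) \<Rightarrow> complex) \<Rightarrow>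
    (('a \<Rightarrow> complex) \<times> ('a \<Rightarrow> complex)) set" where
  "form_operator M D b =
     {(\<psi>, \<eta>). \<psi> \<in> D \<and> \<eta> \<in> L2 M \<and> (\<forall>\<phi>\<in>D. b \<phi> \<psi> = l2_inner M \<phi> \<eta>)}"

subsection \<open>The strip, boundary traces, and the Robin Laplacian\<close>

definition strip :: "real \<Rightarrow> (real \<times> real) set" where
  "strip \<epsilon> = UNIV \<times> {0<..<\<epsilon>}"

text \<open>
  The trace operator is the continuous extension from \<open>H\<^sup>1\<close> of the strip to \<open>L\<^sup>2\<close> of its boundary of
  the restriction map on \<open>C\<^sub>c\<^sup>\<infinity>(\<real>\<^sup>2)\<close>; the boundary is the union of the lines \<open>y = 0\<close> and \<open>y = \<epsilon>\<close>,
  each with one-dimensional Lebesgue measure.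
\<close>

definition is_trace :: "real \<Rightarrow> (real \<times> real \<Rightarrow> complex) \<Rightarrow> (real \<times> real \<Rightarrow> complex) \<Rightarrow> bool" where
  "is_trace \<epsilon> \<phi> t \<longleftrightarrow>
     (\<forall>y\<in>{0, \<epsilon>}. (\<lambda>x. t (x, y)) \<in> L2 lborel) \<and>
     (\<exists>u :: nat \<Rightarrow> real \<times> real \<Rightarrow> complex.
        (\<forall>n. u n \<in> test_functions UNIV) \<and>
        (\<lambda>n. H1_norm (strip \<epsilon>) (\<lambda>z. u n z - \<phi> z)) \<longlonglongrightarrow> 0 \<and>
        (\<forall>y\<in>{0, \<epsilon>}. (\<lambda>n. l2_norm lborel (\<lambda>x. u n (x, y) - t (x, y))) \<longlonglongrightarrow> 0))"

text \<open>A representative of the trace of \<open>\<phi>\<close>, for \<open>\<phi>\<close> in \<open>H\<^sup>1\<close> of the strip.\<close>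

definition tr :: "real \<Rightarrow> (real \<times> real \<Rightarrow> complex) \<Rightarrow> real \<times> real \<Rightarrow> complex" where
  "tr \<epsilon> \<phi> = (SOME t. is_trace \<epsilon> \<phi> t)"

definition neg_laplacian ::
  "'a::euclidean_space set \<Rightarrow> ('a \<Rightarrow> complex) \<Rightarrow> 'a \<Rightarrow> complex" where
  "neg_laplacian \<Omega> \<psi> x = - (\<Sum>i\<in>Basis. wderiv \<Omega> i (wderiv \<Omega> i \<psi>) x)"

definition robin_dom :: "real \<Rightarrow> (real \<Rightarrow> real) \<Rightarrow> (real \<times> real \<Rightarrow> complex) set" where
  "robin_dom \<epsilon> \<alpha> = {\<psi> \<in> H2 (strip \<epsilon>). AE x in lborel.
     - tr \<epsilon> (wderiv (strip \<epsilon>) (0, 1) \<psi>) (x, 0) - complex_of_real (\<alpha> x) * tr \<epsilon> \<psi> (x, 0) = 0 \<and>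
     tr \<epsilon> (wderiv (strip \<epsilon>) (0, 1) \<psi>) (x, \<epsilon>) + complex_of_real (\<alpha> x) * tr \<epsilon> \<psi> (x, \<epsilon>) = 0}"

definition robin_laplacian ::
  "real \<Rightarrow> (real \<Rightarrow> real) \<Rightarrow> ((real \<times> real \<Rightarrow> complex) \<times> (real \<times> real \<Rightarrow> complex)) set" where
  "robin_laplacian \<epsilon> \<alpha> = {(\<psi>, \<eta>). \<psi> \<in> robin_dom \<epsilon> \<alpha> \<and> \<eta> \<in> L2 (lborel_on (strip \<epsilon>)) \<and>
     (AE z in lborel_on (strip \<epsilon>). \<eta> z = neg_laplacian (strip \<epsilon>) \<psi> z)}"

definition robin_form ::
  "real \<Rightarrow> (real \<Rightarrow> real) \<Rightarrow> (real \<times> real \<Rightarrow> complex) \<Rightarrow> (real \<times> real \<Rightarrow> complex) \<Rightarrow> complex" where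
  "robin_form \<epsilon> \<alpha> \<phi> \<psi> =
     (\<integral>z. (\<Sum>i\<in>Basis. cnj (wderiv (strip \<epsilon>) i \<phi> z) * wderiv (strip \<epsilon>) i \<psi> z) \<partial>lborel_on (strip \<epsilon>)) +
     (\<integral>x. complex_of_real (\<alpha> x) *
        (cnj (tr \<epsilon> \<phi> (x, \<epsilon>)) * tr \<epsilon> \<psi> (x, \<epsilon>) - cnj (tr \<epsilon> \<phi> (x, 0)) * tr \<epsilon> \<psi> (x, 0)) \<partial>lborel)"

end

theory Submission
  imports Defs
begin

text \<open>
  The form is freed of traces: by Green's formula the boundary term of \<open>b(\<phi>, \<psi>)\<close> is the integral of
  \<open>\<alpha> (\<partial>\<^sub>y (cnj \<phi>) \<psi> + cnj \<phi> \<partial>\<^sub>y \<psi>)\<close> over the strip. Both this formula and the trace operator come from the density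
  of \<open>C\<^sub>c\<^sup>\<infinity>(\<real>\<^sup>2)\<close> in \<open>H\<^sup>1\<close> of the strip: near each boundary line one mollifies with a kernel that only looks into
  the strip.

  If \<open>\<psi>\<close> satisfies \<open>b(\<phi>, \<psi>) = (\<phi>, \<eta>)\<close> for all \<open>\<phi>\<close> in \<open>H\<^sup>1\<close>, then, since \<open>\<alpha>\<close> is bounded with bounded weak
  derivative, \<open>\<alpha> \<psi>\<close> is in \<open>H\<^sup>1\<close>. Testing with second differences of \<open>\<psi>\<close> along the strip bounds the tangential
  difference quotients of its gradient in \<open>L\<^sup>2\<close>. This gives all second derivatives except \<open>\<partial>\<^sub>y \<partial>\<^sub>y \<psi>\<close>, which
  the equation supplies. So \<open>\<psi>\<close> is in \<open>H\<^sup>2\<close>, and Green's formula, tested with functions that have prescribed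
  boundary values, yields the Robin condition. The converse inclusion is Green's formula again.

  The form plus a large multiple of the inner product is coercive on \<open>H\<^sup>1\<close>, so by Riesz' theorem the shifted operator is
  surjective. A symmetric, densely defined operator with a surjective real shift is self-adjoint, and a
  self-adjoint operator has no proper self-adjoint restriction.
\<close>

section \<open>Square-integrable functions\<close>

text \<open>The boundary term is not small against the gradient, and traces and weak derivatives are
  only chosen representatives, fixed up to null sets. The volume version of the form settles both.
  Its indefinite part is twice the real part of the pairing of \<open>fy\<close> with
  \<open>\<alpha> f\<close>, at most half of the squared norm of \<open>fy\<close> plus
  \<open>2 * C^2\<close> times that of \<open>f\<close>, whence the shift
  \<open>2 * C^2 + 1\<close>. It is also continuous when a function and its first derivatives
  converge in L2, so the limit of a minimising sequence solves the equation without its traces being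
  followed.

  The strip is invariant under translations in the first variable, so tangential differences are
  admissible up to the boundary with no cutoff and no flattening.

  No quotient by null functions is formed. Riesz' theorem is therefore proved directly, by
  minimising a real functional on functions; imaginary parts are recovered by replacing a test
  function by \<open>\<i>\<close> times it. Since an operator is a set of pairs of representatives,
  self-adjointness is an equality of such sets, and almost everywhere equality has to be turned back
  into membership at the end.\<close>

lemma cnj_measurable [measurable]:
  assumes "f \<in> borel_measurable M" shows "(\<lambda>x. cnj (f x)) \<in> borel_measurable M"
  by (rule measurable_compose[OF assms borel_measurable_continuous_onI]) (intro continuous_intros)

lemma L2_measurable: "f \<in> L2 M \<Longrightarrow> f \<in> borel_measurable M"
  by (simp add: L2_def)

lemma L2_integrable_sq: "f \<in> L2 M \<Longrightarrow> integrable M (\<lambda>x. (norm (f x))^2)"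
  by (simp add: L2_def)

lemma L2_nn_integral: "f \<in> L2 M \<Longrightarrow> (\<integral>\<^sup>+x. ennreal ((norm (f x))^2) \<partial>M) = ennreal ((l2_norm M f)^2)"
  unfolding l2_norm_def by (subst nn_integral_eq_integral[OF L2_integrable_sq]) auto

text \<open>A finite extended integral is already integrability, so membership and norm bound come
  together. The estimates that rest on Tonelli or Fatou pass through this lemma.\<close>

lemma L2_I_bound:
  assumes "f \<in> borel_measurable M" "(\<integral>\<^sup>+x. ennreal ((norm (f x))^2) \<partial>M) \<le> ennreal (c^2)" "c \<ge> 0"
  shows "f \<in> L2 M" "l2_norm M f \<le> c"
proof -
  have "integrable M (\<lambda>x. (norm (f x))^2)"
    using assms by (intro integrableI_bounded) (auto simp: le_less_trans)
  then show *: "f \<in> L2 M" using assms by (simp add: L2_def)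
  have "(l2_norm M f)^2 \<le> c^2" using assms L2_nn_integral[OF *] by (simp add: ennreal_le_iff)
  then show "l2_norm M f \<le> c" using assms(3) by (rule power2_le_imp_le)
qed

lemma l2_norm_nonneg: "0 \<le> l2_norm M f"
  by (simp add: l2_norm_def)

lemma l2_norm_sq: "(l2_norm M f)^2 = (\<integral>x. (norm (f x))^2 \<partial>M)"
  by (simp add: l2_norm_def)

lemma l2_norm_cong:
  assumes "f \<in> borel_measurable M" "g \<in> borel_measurable M" "AE x in M. f x = g x"
  shows "l2_norm M f = l2_norm M g"
  unfolding l2_norm_def by (intro arg_cong[where f=sqrt] integral_cong_AE) (use assms in auto)

lemma L2_cong:
  assumes "f \<in> L2 M" "g \<in> borel_measurable M" "AE x in M. f x = g x"
  shows "g \<in> L2 M"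
proof -
  have "integrable M (\<lambda>x. (norm (g x))^2) = integrable M (\<lambda>x. (norm (f x))^2)"
    by (intro integrable_cong_AE) (use assms L2_measurable[OF assms(1)] in auto)
  then show ?thesis using assms by (simp add: L2_def)
qed

lemma L2_add:
  assumes "f \<in> L2 M" "g \<in> L2 M" shows "(\<lambda>x. f x + g x) \<in> L2 M"
proof -
  note [measurable] = assms[THEN L2_measurable]
  have "(norm (f x + g x))^2 \<le> 2 * (norm (f x))^2 + 2 * (norm (g x))^2" for x
  proof -
    have "(norm (f x + g x))^2 \<le> (norm (f x) + norm (g x))^2" by (intro power_mono norm_triangle_ineq) auto
    also have "\<dots> \<le> 2 * (norm (f x))^2 + 2 * (norm (g x))^2" using sum_squares_bound[of "norm (f x)" "norm (g x)"]
      by (simp add: power2_sum)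
    finally show ?thesis .
  qed
  then have "AE x in M. norm ((norm (f x + g x))^2) \<le> norm (2 * (norm (f x))^2 + 2 * (norm (g x))^2)"
    by (intro AE_I2) simp
  moreover have "integrable M (\<lambda>x. 2 * (norm (f x))^2 + 2 * (norm (g x))^2)"
    using assms[THEN L2_integrable_sq] by simp
  ultimately have "integrable M (\<lambda>x. (norm (f x + g x))^2)"
    by (intro Bochner_Integration.integrable_bound[where g="\<lambda>x. (norm (f x + g x))^2"]) measurable
  then show ?thesis by (simp add: L2_def)
qed

lemma L2_bounded_mult:
  fixes g :: "_ \<Rightarrow> complex"
  assumes "f \<in> L2 M" "g \<in> borel_measurable M" "AE x in M. norm (g x) \<le> C"
  shows "(\<lambda>x. g x * f x) \<in> L2 M"
proof -
  note [measurable] = assms(1)[THEN L2_measurable] assms(2)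
  have "integrable M (\<lambda>x. (norm (g x * f x))^2)"
  proof (rule Bochner_Integration.integrable_bound[where f="\<lambda>x. C^2 * (norm (f x))^2"])
    show "AE x in M. norm ((norm (g x * f x))^2) \<le> norm (C^2 * (norm (f x))^2)"
      using assms(3) by eventually_elim (auto simp: norm_mult power_mult_distrib intro!: mult_right_mono power_mono)
  qed (use assms(1)[THEN L2_integrable_sq] in auto)
  then show ?thesis by (simp add: L2_def)
qed

lemma L2_cmult: "f \<in> L2 M \<Longrightarrow> (\<lambda>x. c * f x) \<in> L2 M"
  by (rule L2_bounded_mult[where C="norm c"]) auto

lemma L2_uminus: "f \<in> L2 M \<Longrightarrow> (\<lambda>x. - f x) \<in> L2 M"
  using L2_cmult[of f M "-1"] by simp

lemma L2_diff: "f \<in> L2 M \<Longrightarrow> g \<in> L2 M \<Longrightarrow> (\<lambda>x. f x - g x) \<in> L2 M"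
  using L2_add[of f M "\<lambda>x. - g x"] L2_uminus[of g M] by simp

lemma L2_zero: "(\<lambda>x. 0) \<in> L2 M"
  by (simp add: L2_def)

lemma L2_cnj: "f \<in> L2 M \<Longrightarrow> (\<lambda>x. cnj (f x)) \<in> L2 M"
  unfolding L2_def by (simp add: cnj_measurable)

section \<open>Inner product and norm of \<open>L2\<close>\<close>

lemma L2_integrable_mult:
  assumes "f \<in> L2 M" "g \<in> L2 M" shows "integrable M (\<lambda>x. f x * g x)"
proof (rule Bochner_Integration.integrable_bound[where f="\<lambda>x. (norm (f x))^2 + (norm (g x))^2"])
  note [measurable] = assms[THEN L2_measurable]
  show "(\<lambda>x. f x * g x) \<in> borel_measurable M" by simp
  show "AE x in M. norm (f x * g x) \<le> norm ((norm (f x))^2 + (norm (g x))^2)"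
  proof (rule AE_I2)
    fix x
    have "2 * (norm (f x) * norm (g x)) \<le> (norm (f x))^2 + (norm (g x))^2"
      using sum_squares_bound[of "norm (f x)" "norm (g x)"] by simp
    moreover have "0 \<le> norm (f x) * norm (g x)" by simp
    ultimately show "norm (f x * g x) \<le> norm ((norm (f x))^2 + (norm (g x))^2)"
      unfolding norm_mult by (simp only: real_norm_def)
  qed
qed (use assms[THEN L2_integrable_sq] in auto)

lemma L2_integrable_inner: "f \<in> L2 M \<Longrightarrow> g \<in> L2 M \<Longrightarrow> integrable M (\<lambda>x. cnj (f x) * g x)"
  by (intro L2_integrable_mult L2_cnj)

lemma l2_inner_self: "l2_inner M f f = complex_of_real ((l2_norm M f)^2)"
  unfolding l2_norm_sq l2_inner_def integral_complex_of_real[symmetric]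
  by (intro Bochner_Integration.integral_cong refl) (metis complex_norm_square mult.commute of_real_power)

lemma l2_inner_commute: "cnj (l2_inner M f g) = l2_inner M g f"
  unfolding l2_inner_def using Bochner_Integration.integral_cnj[of M "\<lambda>x. cnj (f x) * g x"]
  by (simp add: mult.commute)

lemma l2_inner_add_right:
  "f \<in> L2 M \<Longrightarrow> g \<in> L2 M \<Longrightarrow> h \<in> L2 M \<Longrightarrow> l2_inner M f (\<lambda>x. g x + c * h x) = l2_inner M f g + c * l2_inner M f h"
  unfolding l2_inner_def
  using L2_integrable_inner[of f M g] L2_integrable_inner[of f M h]
  by (simp add: distrib_left mult.left_commute[of _ c])

lemma l2_inner_add_left:
  "f \<in> L2 M \<Longrightarrow> g \<in> L2 M \<Longrightarrow> h \<in> L2 M \<Longrightarrow> l2_inner M (\<lambda>x. g x + c * h x) f = l2_inner M g f + cnj c * l2_inner M h f"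
  using l2_inner_add_right[of f M g h c] l2_inner_commute
  by (metis complex_cnj_add complex_cnj_mult)

lemma l2_inner_diff_right:
  "f \<in> L2 M \<Longrightarrow> g \<in> L2 M \<Longrightarrow> h \<in> L2 M \<Longrightarrow> l2_inner M f (\<lambda>x. g x - h x) = l2_inner M f g - l2_inner M f h"
  using l2_inner_add_right[of f M g h "-1"] by simp

lemma l2_inner_diff_left:
  "f \<in> L2 M \<Longrightarrow> g \<in> L2 M \<Longrightarrow> h \<in> L2 M \<Longrightarrow> l2_inner M (\<lambda>x. g x - h x) f = l2_inner M g f - l2_inner M h f"
  using l2_inner_add_left[of f M g h "-1"] by simp

lemma l2_inner_cong:
  assumes "f \<in> borel_measurable M" "f' \<in> borel_measurable M" "g \<in> borel_measurable M" "g' \<in> borel_measurable M"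
    "AE x in M. f x = f' x" "AE x in M. g x = g' x"
  shows "l2_inner M f g = l2_inner M f' g'"
  unfolding l2_inner_def
proof (rule integral_cong_AE)
  show "AE x in M. cnj (f x) * g x = cnj (f' x) * g' x" using assms(5,6) by eventually_elim simp
qed (use assms(1-4) in measurable)

text \<open>The discriminant criterion. It yields the Cauchy-Schwarz inequality and, with
  \<open>a\<close> as an error, the first-order condition for an almost minimiser. The sign of
  \<open>c\<close> has to be derived, hence the case of negative \<open>c\<close>.\<close>

lemma quadratic_nonneg_imp:
  fixes a b c :: real
  assumes "\<And>t. 0 \<le> a + 2 * t * b + t^2 * c" shows "b^2 \<le> a * c"
proof (cases "c = 0")
  case True
  have "b = 0"
  proof (rule ccontr)
    assume "b \<noteq> 0"
    \<comment> \<open>For this \<open>t\<close> the affine function \<open>a + 2 * t * b\<close>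
      takes the value -1.\<close>
    then have "2 * (-(a+1)/(2*b)) * b = -(a+1)" by simp
    then show False using assms[of "-(a+1)/(2*b)"] True by simp
  qed
  then show ?thesis using True by simp
next
  case False
  have "c > 0"
  proof (rule ccontr)
    assume "\<not> c > 0"
    then have c: "c < 0" using False by simp
    \<comment> \<open>\<open>T\<close> is chosen so large that the quadratic term absorbs the two
      others: the upper bound collapses to \<open>T * c\<close>, which is negative.\<close>
    define T where "T = 1 + (\<bar>a\<bar> + 2*\<bar>b\<bar>) / (- c)"
    have T: "T \<ge> 1" "T * (-c) = - c + \<bar>a\<bar> + 2*\<bar>b\<bar>" using c by (auto simp: T_def field_simps divide_nonneg_nonpos)
    have T0: "T \<ge> 0" using T(1) by simp
    have "a + 2*T*b + T^2*c \<le> \<bar>a\<bar> * T + 2*T*\<bar>b\<bar> - T * (T * (-c))"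
    proof -
      have "\<bar>a\<bar> * 1 \<le> \<bar>a\<bar> * T" using T(1) by (intro mult_left_mono) auto
      then have "a \<le> \<bar>a\<bar> * T" by linarith
      moreover have "T * b \<le> T * \<bar>b\<bar>" using T0 by (intro mult_left_mono) auto
      ultimately show ?thesis by (simp add: power2_eq_square)
    qed
    also have "\<dots> = T * c" unfolding T(2) by (simp add: algebra_simps)
    also have "\<dots> < 0" using T(1) c by (simp add: mult_pos_neg)
    finally show False using assms[of T] by simp
  qed
  have "0 \<le> a + 2 * (-b/c) * b + (-b/c)^2 * c" by (rule assms)
  also have "\<dots> = a - b^2 / c" using \<open>c > 0\<close> by (simp add: field_simps power2_eq_square)
  finally show ?thesis using \<open>c > 0\<close> by (simp add: field_simps)
qed

lemma L2_integrable_norm_mult: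
  assumes "f \<in> L2 M" "g \<in> L2 M" shows "integrable M (\<lambda>x. norm (f x) * norm (g x))"
  using integrable_norm[OF L2_integrable_mult[OF assms]] by (simp add: norm_mult)

text \<open>Discriminant of the integral of \<open>(norm f + t * norm g)^2\<close>. The version with
  moduli, rather than with the inner product, is what the triangle inequality and the trace estimate
  use.\<close>

lemma l2_Cauchy_Schwarz_norm:
  assumes "f \<in> L2 M" "g \<in> L2 M"
  shows "(\<integral>x. norm (f x) * norm (g x) \<partial>M) \<le> l2_norm M f * l2_norm M g"
proof -
  let ?b = "\<integral>x. norm (f x) * norm (g x) \<partial>M"
  have "?b^2 \<le> (l2_norm M f)^2 * (l2_norm M g)^2"
  proof (rule quadratic_nonneg_imp)
    fix t :: real
    have "0 \<le> (\<integral>x. (norm (f x) + t * norm (g x))^2 \<partial>M)" by simp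
    also have "\<dots> = (\<integral>x. (norm (f x))^2 + 2 * t * (norm (f x) * norm (g x)) + t^2 * (norm (g x))^2 \<partial>M)"
      by (simp add: power2_sum power_mult_distrib algebra_simps)
    also have "\<dots> = (l2_norm M f)^2 + 2 * t * ?b + t^2 * (l2_norm M g)^2"
      unfolding l2_norm_sq
      using assms[THEN L2_integrable_sq] L2_integrable_norm_mult[OF assms] by simp
    finally show "0 \<le> (l2_norm M f)^2 + 2 * t * ?b + t^2 * (l2_norm M g)^2" .
  qed
  then have "?b^2 \<le> (l2_norm M f * l2_norm M g)^2" by (simp add: power_mult_distrib)
  then show ?thesis by (rule power2_le_imp_le) (simp add: l2_norm_nonneg)
qed

lemma l2_Cauchy_Schwarz:
  assumes "f \<in> L2 M" "g \<in> L2 M" shows "norm (l2_inner M f g) \<le> l2_norm M f * l2_norm M g"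
proof -
  have "norm (l2_inner M f g) \<le> (\<integral>x. norm (cnj (f x) * g x) \<partial>M)"
    unfolding l2_inner_def by (rule integral_norm_bound)
  also have "\<dots> = (\<integral>x. norm (f x) * norm (g x) \<partial>M)" by (simp add: norm_mult)
  finally show ?thesis using l2_Cauchy_Schwarz_norm[OF assms] by simp
qed

lemma l2_norm_triangle:
  assumes "f \<in> L2 M" "g \<in> L2 M"
  shows "l2_norm M (\<lambda>x. f x + g x) \<le> l2_norm M f + l2_norm M g"
proof (rule power2_le_imp_le)
  have "(l2_norm M (\<lambda>x. f x + g x))^2 \<le> (\<integral>x. (norm (f x) + norm (g x))^2 \<partial>M)"
    unfolding l2_norm_sq
  proof (rule integral_mono)
    show "integrable M (\<lambda>x. (norm (f x + g x))^2)" using L2_add[OF assms] by (rule L2_integrable_sq)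
    show "integrable M (\<lambda>x. (norm (f x) + norm (g x))^2)"
      using assms[THEN L2_integrable_sq] L2_integrable_norm_mult[OF assms]
      by (simp add: power2_sum mult.assoc)
  qed (intro power_mono norm_triangle_ineq norm_ge_zero)
  also have "\<dots> = (l2_norm M f)^2 + (l2_norm M g)^2 + 2 * (\<integral>x. norm (f x) * norm (g x) \<partial>M)"
    unfolding l2_norm_sq
    using assms[THEN L2_integrable_sq] L2_integrable_norm_mult[OF assms]
    by (simp add: power2_sum mult.assoc)
  also have "\<dots> \<le> (l2_norm M f + l2_norm M g)^2"
    using l2_Cauchy_Schwarz_norm[OF assms] by (simp add: power2_sum)
  finally show "(l2_norm M (\<lambda>x. f x + g x))^2 \<le> (l2_norm M f + l2_norm M g)^2" .
qed (simp add: l2_norm_nonneg)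

lemma l2_norm_cmult: "l2_norm M (\<lambda>x. c * f x) = norm c * l2_norm M f"
  by (simp add: l2_norm_def norm_mult power_mult_distrib real_sqrt_mult)

lemma l2_norm_minus_commute: "l2_norm M (\<lambda>x. f x - g x) = l2_norm M (\<lambda>x. g x - f x)"
  by (simp add: l2_norm_def norm_minus_commute)

lemma l2_norm_triangle_diff:
  assumes "f \<in> L2 M" "g \<in> L2 M" "h \<in> L2 M"
  shows "l2_norm M (\<lambda>x. f x - h x) \<le> l2_norm M (\<lambda>x. f x - g x) + l2_norm M (\<lambda>x. g x - h x)"
  using l2_norm_triangle[OF L2_diff[OF assms(1,2)] L2_diff[OF assms(2,3)]] by simp

lemma l2_norm_le_diff:
  assumes "f \<in> L2 M" "g \<in> L2 M"
  shows "l2_norm M f \<le> l2_norm M g + l2_norm M (\<lambda>x. f x - g x)"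
  using l2_norm_triangle[OF assms(2) L2_diff[OF assms]] by simp

lemma l2_norm_bounded_mult:
  fixes g :: "_ \<Rightarrow> complex"
  assumes "f \<in> L2 M" "g \<in> borel_measurable M" "AE x in M. norm (g x) \<le> C" "C \<ge> 0"
  shows "l2_norm M (\<lambda>x. g x * f x) \<le> C * l2_norm M f"
proof (rule L2_I_bound)
  note [measurable] = assms(1)[THEN L2_measurable] assms(2)
  show "(\<lambda>x. g x * f x) \<in> borel_measurable M" by measurable
  have "(\<integral>\<^sup>+x. ennreal ((norm (g x * f x))^2) \<partial>M) \<le> (\<integral>\<^sup>+x. ennreal ((norm (C * f x))^2) \<partial>M)"
  proof (rule nn_integral_mono_AE)
    show "AE x in M. ennreal ((norm (g x * f x))^2) \<le> ennreal ((norm (C * f x))^2)"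
      using assms(3) by eventually_elim (use assms(4) in \<open>auto simp: norm_mult intro!: ennreal_leI power_mono mult_right_mono\<close>)
  qed
  also have "\<dots> = ennreal ((C * l2_norm M f)^2)"
    using L2_nn_integral[OF L2_cmult[OF assms(1), of C]] assms(4) by (simp add: l2_norm_cmult)
  finally show "(\<integral>\<^sup>+x. ennreal ((norm (g x * f x))^2) \<partial>M) \<le> ennreal ((C * l2_norm M f)^2)" .
qed (use assms(4) in \<open>simp add: l2_norm_nonneg\<close>)

lemma l2_norm_eq_0_AE:
  assumes "f \<in> L2 M" "l2_norm M f = 0" shows "AE x in M. f x = 0"
proof -
  have "(\<integral>x. (norm (f x))^2 \<partial>M) = 0" using assms(2) l2_norm_sq[of M f] by simp
  then have "AE x in M. (norm (f x))^2 = 0"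
    using integral_nonneg_eq_0_iff_AE[OF L2_integrable_sq[OF assms(1)]] by simp
  then show ?thesis by simp
qed

section \<open>Limits and completeness in \<open>L2\<close>\<close>

lemma l2_inner_tendsto:
  assumes "\<And>n. u n \<in> L2 M" "f \<in> L2 M" "\<And>n. v n \<in> L2 M" "g \<in> L2 M"
    and u: "(\<lambda>n. l2_norm M (\<lambda>x. u n x - f x)) \<longlonglongrightarrow> 0" and v: "(\<lambda>n. l2_norm M (\<lambda>x. v n x - g x)) \<longlonglongrightarrow> 0"
  shows "(\<lambda>n. l2_inner M (u n) (v n)) \<longlonglongrightarrow> l2_inner M f g"
proof -
  have "(\<lambda>n. l2_inner M (u n) (v n) - l2_inner M f g) \<longlonglongrightarrow> 0"
  proof (rule Lim_null_comparison)
    let ?a = "\<lambda>n. l2_norm M (\<lambda>x. u n x - f x)" and ?b = "\<lambda>n. l2_norm M (\<lambda>x. v n x - g x)"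
    show "\<forall>\<^sub>F n in sequentially. norm (l2_inner M (u n) (v n) - l2_inner M f g)
        \<le> ?a n * (l2_norm M g + ?b n) + l2_norm M f * ?b n"
    proof (rule always_eventually, rule allI)
      fix n
      have "l2_inner M (u n) (v n) - l2_inner M f g
        = l2_inner M (\<lambda>x. u n x - f x) (v n) + l2_inner M f (\<lambda>x. v n x - g x)"
        using assms by (simp add: l2_inner_diff_left l2_inner_diff_right)
      also have "norm \<dots> \<le> ?a n * l2_norm M (v n) + l2_norm M f * ?b n"
        by (intro norm_triangle_le add_mono l2_Cauchy_Schwarz L2_diff assms)
      also have "\<dots> \<le> ?a n * (l2_norm M g + ?b n) + l2_norm M f * ?b n"
        by (intro add_mono mult_left_mono l2_norm_le_diff l2_norm_nonneg order_refl assms)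
      finally show "norm (l2_inner M (u n) (v n) - l2_inner M f g)
        \<le> ?a n * (l2_norm M g + ?b n) + l2_norm M f * ?b n" .
    qed
    show "(\<lambda>n. ?a n * (l2_norm M g + ?b n) + l2_norm M f * ?b n) \<longlonglongrightarrow> 0"
      using u v by (auto intro!: tendsto_eq_intros)
  qed
  then show ?thesis by (rule LIM_zero_cancel)
qed

lemma L2_tendsto_diff:
  assumes "\<And>n. u n \<in> L2 M" "f \<in> L2 M" "\<And>n. v n \<in> L2 M" "g \<in> L2 M"
    and "(\<lambda>n. l2_norm M (\<lambda>x. u n x - f x)) \<longlonglongrightarrow> 0" "(\<lambda>n. l2_norm M (\<lambda>x. v n x - g x)) \<longlonglongrightarrow> 0"
  shows "(\<lambda>n. l2_norm M (\<lambda>x. (u n x + c * v n x) - (f x + c * g x))) \<longlonglongrightarrow> 0"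
proof (rule Lim_null_comparison)
  show "(\<lambda>n. l2_norm M (\<lambda>x. u n x - f x) + norm c * l2_norm M (\<lambda>x. v n x - g x)) \<longlonglongrightarrow> 0"
    using assms(5,6) by (auto intro!: tendsto_eq_intros)
  show "\<forall>\<^sub>F n in sequentially. norm (l2_norm M (\<lambda>x. (u n x + c * v n x) - (f x + c * g x)))
    \<le> l2_norm M (\<lambda>x. u n x - f x) + norm c * l2_norm M (\<lambda>x. v n x - g x)"
  proof (rule always_eventually, rule allI)
    fix n
    have "l2_norm M (\<lambda>x. (u n x + c * v n x) - (f x + c * g x)) = l2_norm M (\<lambda>x. (u n x - f x) + c * (v n x - g x))"
      by (simp add: algebra_simps)
    also have "\<dots> \<le> l2_norm M (\<lambda>x. u n x - f x) + l2_norm M (\<lambda>x. c * (v n x - g x))"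
      by (intro l2_norm_triangle L2_diff L2_cmult assms)
    finally show "norm (l2_norm M (\<lambda>x. (u n x + c * v n x) - (f x + c * g x)))
      \<le> l2_norm M (\<lambda>x. u n x - f x) + norm c * l2_norm M (\<lambda>x. v n x - g x)"
      by (simp add: l2_norm_cmult l2_norm_nonneg)
  qed
qed

text \<open>Riesz-Fischer. Along a subsequence with steps below \<open>(1/4)^k\<close> the series of
  squared increments with weights \<open>4^k\<close> has finite integral, so it is finite almost
  everywhere and the subsequence converges there. Fatou's lemma then gives convergence in
  norm.\<close>

lemma L2_complete:
  assumes f: "\<And>n. f n \<in> L2 M"
    and Cauchy: "\<And>e. e > 0 \<Longrightarrow> \<exists>N. \<forall>m\<ge>N. \<forall>n\<ge>N. l2_norm M (\<lambda>x. f m x - f n x) < e"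
  obtains g where "g \<in> L2 M" "(\<lambda>n. l2_norm M (\<lambda>x. f n x - g x)) \<longlonglongrightarrow> 0"
proof -
  note [measurable] = f[THEN L2_measurable]
  have "\<exists>N. \<forall>k. \<forall>m\<ge>N k. \<forall>n\<ge>N k. l2_norm M (\<lambda>x. f m x - f n x) < (1/4)^k"
    by (rule choice, rule allI, rule Cauchy) simp
  then obtain N where N: "\<And>k m n. m \<ge> N k \<Longrightarrow> n \<ge> N k \<Longrightarrow> l2_norm M (\<lambda>x. f m x - f n x) < (1/4)^k" by blast
  \<comment> \<open>The maximum over all earlier thresholds makes \<open>N j \<le> r k\<close> for
    every \<open>j \<le> k\<close>, although \<open>N\<close> need not be monotone.\<close>
  define r where "r k = Max (N ` {..k})" for k
  have r: "N j \<le> r k" if "j \<le> k" for j k unfolding r_def using that by (intro Max_ge) auto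
  let ?d = "\<lambda>k x. f (r (Suc k)) x - f (r k) x"
  have d: "l2_norm M (?d k) < (1/4)^k" for k by (rule N) (auto intro: r)
  have "(\<integral>\<^sup>+x. (\<Sum>k. ennreal (4^k * (norm (?d k x))^2)) \<partial>M) = (\<Sum>k. \<integral>\<^sup>+x. ennreal (4^k * (norm (?d k x))^2) \<partial>M)"
    by (rule nn_integral_suminf) simp
  also have "\<dots> \<le> (\<Sum>k. ennreal ((1/4)^k))"
  proof (intro suminf_le summableI)
    fix k
    have "(\<integral>\<^sup>+x. ennreal (4^k * (norm (?d k x))^2) \<partial>M) = ennreal (4^k) * (\<integral>\<^sup>+x. ennreal ((norm (?d k x))^2) \<partial>M)"
      by (subst nn_integral_cmult[symmetric]) (auto simp: ennreal_mult)
    also have "\<dots> = ennreal (4^k * (l2_norm M (?d k))^2)"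
      by (subst L2_nn_integral[OF L2_diff[OF f f]]) (simp add: ennreal_mult)
    also have "\<dots> \<le> ennreal (4^k * ((1/4)^k)^2)"
      using d[of k] by (intro ennreal_leI mult_left_mono power_mono) (auto simp: l2_norm_nonneg)
    also have "4^k * ((1/4)^k)^2 = ((1/4)^k::real)" by (simp add: power2_eq_square power_divide)
    finally show "(\<integral>\<^sup>+x. ennreal (4^k * (norm (?d k x))^2) \<partial>M) \<le> ennreal ((1/4)^k)" .
  qed
  also have "(\<Sum>k. ennreal ((1/4)^k)) = ennreal (\<Sum>k. (1/4)^k)"
    by (rule suminf_ennreal2) (simp_all add: summable_geometric)
  finally have le: "(\<integral>\<^sup>+x. (\<Sum>k. ennreal (4^k * (norm (?d k x))^2)) \<partial>M) \<le> ennreal (\<Sum>k. (1/4)^k)" .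
  have "(\<integral>\<^sup>+x. (\<Sum>k. ennreal (4^k * (norm (?d k x))^2)) \<partial>M) < \<infinity>"
    by (rule le_less_trans[OF le]) simp
  then have "(\<integral>\<^sup>+x. (\<Sum>k. ennreal (4^k * (norm (?d k x))^2)) \<partial>M) \<noteq> \<infinity>" by (rule less_imp_neq)
  then have "AE x in M. (\<Sum>k. ennreal (4^k * (norm (?d k x))^2)) \<noteq> \<infinity>"
    by (rule nn_integral_PInf_AE[rotated]) measurable
  then have conv: "AE x in M. convergent (\<lambda>k. f (r k) x)"
  proof eventually_elim
    fix x assume fin: "(\<Sum>k. ennreal (4^k * (norm (?d k x))^2)) \<noteq> \<infinity>"
    define C where "C = enn2real (\<Sum>k. ennreal (4^k * (norm (?d k x))^2))"
    have C: "(\<Sum>k. ennreal (4^k * (norm (?d k x))^2)) = ennreal C" "C \<ge> 0"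
      unfolding C_def using fin by (simp_all only: ennreal_enn2real less_top[symmetric] infinity_ennreal_def enn2real_nonneg not_False_eq_True)
    \<comment> \<open>A single term is at most the sum \<open>C\<close> of the series, and the
      weight \<open>4^k\<close> becomes geometric decay with ratio 1/2.\<close>
    have dk: "norm (?d k x) \<le> sqrt C * (1/2)^k" for k
    proof -
      have "(\<Sum>k\<in>{k}. ennreal (4^k * (norm (?d k x))^2)) \<le> ennreal C" unfolding C(1)[symmetric]
        by (rule sum_le_suminf) (simp_all only: summableI finite.intros zero_le)
      then have "ennreal (4^k * (norm (?d k x))^2) \<le> ennreal C" by (simp only: sum.insert finite.emptyI sum.empty empty_iff not_False_eq_True add_0_right)
      then have "4^k * (norm (?d k x))^2 \<le> C" using C(2) by (simp add: ennreal_le_iff)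
      then have "sqrt (4^k * (norm (?d k x))^2) \<le> sqrt C" by (rule real_sqrt_le_mono)
      moreover have "sqrt (4^k) = 2^k" by (metis real_sqrt_four real_sqrt_power)
      ultimately have "2^k * norm (?d k x) \<le> sqrt C" by (simp add: real_sqrt_mult)
      then show ?thesis by (simp add: field_simps)
    qed
    have sm: "summable (\<lambda>k. sqrt C * (1/2)^k)" by (intro summable_mult summable_geometric) simp
    have "summable (\<lambda>k. ?d k x)"
      by (rule summable_comparison_test'[OF sm, of 0], rule dk)
    then have "convergent (\<lambda>n. f (r n) x - f (r 0) x)"
      unfolding summable_iff_convergent sum_lessThan_telescope[of "\<lambda>k. f (r k) x"] .
    then show "convergent (\<lambda>k. f (r k) x)" by (simp only: convergent_diff_const_right_iff)
  qed
  define g where "g x = lim (\<lambda>k. f (r k) x)" for x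
  have g[measurable]: "g \<in> borel_measurable M" unfolding g_def by (rule borel_measurable_lim_metric) simp
  \<comment> \<open>Fatou is applied in the second index only, so the bound holds for every
    \<open>n\<close> beyond the threshold and not just along the subsequence.\<close>
  have bound: "(\<integral>\<^sup>+x. ennreal ((norm (f n x - g x))^2) \<partial>M) \<le> ennreal (((1/4)^k)^2)" if "n \<ge> N k" for n k
  proof -
    have "(\<integral>\<^sup>+x. ennreal ((norm (f n x - g x))^2) \<partial>M) = (\<integral>\<^sup>+x. liminf (\<lambda>j. ennreal ((norm (f n x - f (r j) x))^2)) \<partial>M)"
    proof (rule nn_integral_cong_AE)
      show "AE x in M. ennreal ((norm (f n x - g x))^2) = liminf (\<lambda>j. ennreal ((norm (f n x - f (r j) x))^2))"
        using conv
      proof eventually_elim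
        fix x assume "convergent (\<lambda>k. f (r k) x)"
        then have "(\<lambda>k. f (r k) x) \<longlonglongrightarrow> g x" unfolding g_def by (simp add: convergent_LIMSEQ_iff)
        then have "(\<lambda>j. ennreal ((norm (f n x - f (r j) x))^2)) \<longlonglongrightarrow> ennreal ((norm (f n x - g x))^2)"
          by (intro tendsto_ennrealI tendsto_intros)
        then show "ennreal ((norm (f n x - g x))^2) = liminf (\<lambda>j. ennreal ((norm (f n x - f (r j) x))^2))"
          by (intro lim_imp_Liminf[symmetric]) auto
      qed
    qed
    also have "\<dots> \<le> liminf (\<lambda>j. \<integral>\<^sup>+x. ennreal ((norm (f n x - f (r j) x))^2) \<partial>M)"
      by (rule nn_integral_liminf) simp
    also have "\<dots> \<le> ennreal (((1/4)^k)^2)"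
    proof (rule Liminf_le)
      show "\<forall>\<^sub>F j in sequentially. (\<integral>\<^sup>+x. ennreal ((norm (f n x - f (r j) x))^2) \<partial>M) \<le> ennreal (((1/4)^k)^2)"
        using eventually_ge_at_top[of k]
      proof eventually_elim
        fix j assume "k \<le> j"
        then have "l2_norm M (\<lambda>x. f n x - f (r j) x) < (1/4)^k" using that by (intro N r) auto
        then show "(\<integral>\<^sup>+x. ennreal ((norm (f n x - f (r j) x))^2) \<partial>M) \<le> ennreal (((1/4)^k)^2)"
          by (subst L2_nn_integral[OF L2_diff[OF f f]]) (intro ennreal_leI power_mono, auto simp: l2_norm_nonneg)
      qed
    qed simp
    finally show ?thesis .
  qed
  have g_diff: "(\<lambda>x. f n x - g x) \<in> L2 M" "l2_norm M (\<lambda>x. f n x - g x) \<le> (1/4)^k" if "n \<ge> N k" for n k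
    by (rule L2_I_bound[OF _ bound[OF that]]; simp)+
  have "g \<in> L2 M"
    using L2_diff[OF f[of "N 0"] g_diff(1)[of 0 "N 0"]] by simp
  moreover have "(\<lambda>n. l2_norm M (\<lambda>x. f n x - g x)) \<longlonglongrightarrow> 0"
  proof (rule LIMSEQ_I)
    fix e :: real assume "e > 0"
    then obtain k where k: "(1/4::real)^k < e" using real_arch_pow_inv[of e "1/4"] by auto
    show "\<exists>no. \<forall>n\<ge>no. norm (l2_norm M (\<lambda>x. f n x - g x) - 0) < e"
    proof (intro exI allI impI)
      fix n assume "N k \<le> n"
      from g_diff(2)[OF this] k show "norm (l2_norm M (\<lambda>x. f n x - g x) - 0) < e"
        by (simp add: l2_norm_nonneg)
    qed
  qed
  ultimately show ?thesis by (rule that)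
qed

text \<open>The form in which minimising sequences deliver the Cauchy property: a bound on squared
  distances by the reciprocals of the indices.\<close>

lemma L2_complete_rate:
  assumes f: "\<And>n. f n \<in> L2 M"
    and rate: "\<And>m n. (l2_norm M (\<lambda>x. f m x - f n x))^2 \<le> K * (1 / real (Suc m) + 1 / real (Suc n))"
  obtains g where "g \<in> L2 M" "(\<lambda>n. l2_norm M (\<lambda>x. f n x - g x)) \<longlonglongrightarrow> 0"
proof (rule L2_complete[OF f])
  fix e :: real assume e: "e > 0"
  have K: "0 \<le> K"
  proof -
    have "0 \<le> K * (1 / real (Suc 0) + 1 / real (Suc 0))" by (rule order_trans[OF zero_le_power2 rate])
    then show ?thesis by simp
  qed
  have e2: "0 < e^2" using e by simp
  obtain N where N: "2 * K / e^2 < real N" using reals_Archimedean2 by blast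
  have N0: "0 < real N" by (rule le_less_trans[OF _ N]) (use K e2 in simp)
  have "l2_norm M (\<lambda>x. f m x - f n x) < e" if mn: "m \<ge> N" "n \<ge> N" for m n
  proof -
    have "1 / real (Suc m) \<le> 1 / real N" "1 / real (Suc n) \<le> 1 / real N"
      using mn N0 by (auto intro!: divide_left_mono)
    then have "K * (1 / real (Suc m) + 1 / real (Suc n)) \<le> K * (2 / real N)" using K by (intro mult_left_mono) simp_all
    also have "\<dots> < e^2" using N N0 e2 by (simp add: pos_divide_less_eq mult.commute)
    finally have "(l2_norm M (\<lambda>x. f m x - f n x))^2 < e^2" using rate[of m n] by linarith
    then show ?thesis by (rule power2_less_imp_less) (use e in simp)
  qed
  then show "\<exists>N. \<forall>m\<ge>N. \<forall>n\<ge>N. l2_norm M (\<lambda>x. f m x - f n x) < e" by blast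
qed (rule that)

subsection \<open>Riesz representation by minimisation\<close>

text \<open>The minimising sequence of \<open>u \<mapsto> B u u - 2 * F u\<close> is Cauchy for \<^term>\<open>B\<close> by the parallelogram
  law, and its limit, in any completion, represents \<^term>\<open>F\<close>.\<close>

lemma riesz_minimizing_sequence:
  fixes V :: "('a \<Rightarrow> complex) set" and B :: "('a \<Rightarrow> complex) \<Rightarrow> ('a \<Rightarrow> complex) \<Rightarrow> real"
  assumes zero: "(\<lambda>z. 0) \<in> V"
    and add: "\<And>u v t. u \<in> V \<Longrightarrow> v \<in> V \<Longrightarrow> (\<lambda>z. u z + complex_of_real t * v z) \<in> V"
    and B_add: "\<And>u v w t. u \<in> V \<Longrightarrow> v \<in> V \<Longrightarrow> w \<in> V \<Longrightarrow> B w (\<lambda>z. u z + complex_of_real t * v z) = B w u + t * B w v"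
    and B_sym: "\<And>u v. u \<in> V \<Longrightarrow> v \<in> V \<Longrightarrow> B u v = B v u"
    and B_pos: "\<And>u. u \<in> V \<Longrightarrow> 0 \<le> B u u"
    and F_add: "\<And>u v t. u \<in> V \<Longrightarrow> v \<in> V \<Longrightarrow> F (\<lambda>z. u z + complex_of_real t * v z) = F u + t * F v"
    and F_bound: "\<And>u. u \<in> V \<Longrightarrow> (F u)^2 \<le> C * B u u"
  obtains u where "\<And>n. u n \<in> V"
    "\<And>m n. B (\<lambda>z. u m z - u n z) (\<lambda>z. u m z - u n z) \<le> 2 / Suc m + 2 / Suc n"
    "\<And>v. v \<in> V \<Longrightarrow> (\<lambda>n. B v (u n)) \<longlonglongrightarrow> F v"
proof -
  define J where "J u = B u u - 2 * F u" for u
  have J_add: "J (\<lambda>z. u z + complex_of_real t * v z) = J u + 2 * t * (B v u - F v) + t^2 * B v v"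
    if "u \<in> V" "v \<in> V" for u v t
  proof -
    let ?w = "\<lambda>z. u z + complex_of_real t * v z"
    have w: "?w \<in> V" using that by (rule add)
    have "B ?w ?w = B ?w u + t * B ?w v" by (rule B_add[OF that w])
    also have "B ?w u = B u ?w" using that w by (intro B_sym)
    also have "B ?w v = B v ?w" using that w by (intro B_sym)
    also have "B u ?w = B u u + t * B u v" by (rule B_add) (use that in auto)
    also have "B v ?w = B v u + t * B v v" by (rule B_add) (use that in auto)
    also have "B u v = B v u" using that by (rule B_sym)
    finally show ?thesis unfolding J_def F_add[OF that] by (simp add: algebra_simps power2_eq_square)
  qed
  \<comment> \<open>By the arithmetic-geometric mean inequality \<open>F u\<close> is at most
    \<open>(\<bar>C\<bar> + B u u) / 2\<close>, so twice \<open>F u\<close> costs no more than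
    \<open>B u u\<close> and a constant.\<close>
  have J_low: "- \<bar>C\<bar> \<le> J u" if "u \<in> V" for u
  proof -
    have "(F u)^2 \<le> \<bar>C\<bar> * B u u" using F_bound[OF that] B_pos[OF that]
      by (meson abs_ge_self mult_right_mono order_trans)
    also have "\<dots> \<le> ((\<bar>C\<bar> + B u u) / 2)^2"
      using zero_le_power2[of "\<bar>C\<bar> - B u u"] by (simp add: power2_eq_square field_simps)
    finally have "(F u)^2 \<le> ((\<bar>C\<bar> + B u u) / 2)^2" .
    moreover have "0 \<le> (\<bar>C\<bar> + B u u) / 2" using B_pos[OF that] by simp
    ultimately have "F u \<le> (\<bar>C\<bar> + B u u) / 2" by (rule power2_le_imp_le)
    then show ?thesis unfolding J_def by (simp add: field_simps)
  qed
  define m where "m = (INF u\<in>V. J u)"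
  have bdd: "bdd_below (J ` V)" using J_low by (intro bdd_belowI[of _ "-\<bar>C\<bar>"]) auto
  have m: "m \<le> J u" if "u \<in> V" for u unfolding m_def using bdd that by (rule cINF_lower)
  have "\<exists>u. u \<in> V \<and> J u \<le> m + 1 / Suc n" for n
  proof -
    have "m < m + 1 / Suc n" by simp
    then obtain u where "u \<in> V" "J u < m + 1 / Suc n"
      unfolding m_def using cINF_less_iff[OF _ bdd] zero by blast
    then show ?thesis by force
  qed
  then obtain u where u: "\<And>n. u n \<in> V" "\<And>n. J (u n) \<le> m + 1 / Suc n" by metis
  show ?thesis
  proof (rule that)
    show "u n \<in> V" for n by (rule u)
    fix j n
    let ?d = "\<lambda>z. u j z - u n z"
    have d: "?d \<in> V" using add[OF u(1) u(1), of j "-1" n] by simp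
    define r where "r = B ?d (u n) - F ?d"
    define q where "q = B ?d ?d"
    \<comment> \<open>The midpoint of \<open>u n\<close> and \<open>u j\<close> is compared with the
      infimum. Eliminating \<open>r\<close> between the values at parameters 1/2 and 1 bounds
      \<open>q\<close> by twice the sum of the excesses of \<open>J (u n)\<close> and
      \<open>J (u j)\<close> over \<open>m\<close>.\<close>
    have 1: "J (\<lambda>z. u n z + complex_of_real (1/2) * ?d z) = J (u n) + r + q / 4"
      unfolding J_add[OF u(1) d] r_def q_def by (simp add: power2_eq_square)
    have "J (\<lambda>z. u n z + complex_of_real 1 * ?d z) = J (u n) + 2 * r + q"
      unfolding J_add[OF u(1) d] r_def q_def by simp
    then have 2: "J (u j) = J (u n) + 2 * r + q" by simp
    have "m \<le> J (\<lambda>z. u n z + complex_of_real (1/2) * ?d z)" by (rule m, rule add[OF u(1) d])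
    then have "m \<le> J (u n) + r + q / 4" unfolding 1 .
    with 2 u(2)[of n] u(2)[of j] have "q \<le> 2 * (1 / Suc j) + 2 * (1 / Suc n)" by linarith
    then show "B ?d ?d \<le> 2 / Suc j + 2 / Suc n" unfolding q_def by simp
  next
    fix v assume v: "v \<in> V"
    \<comment> \<open>On the line through \<open>u n\<close> in direction \<open>v\<close> the
      functional never falls below \<open>m\<close>, and at \<open>u n\<close> it is within
      \<open>1 / Suc n\<close> of it. The discriminant turns this into an approximate Euler-Lagrange
      equation, which holds although \<open>V\<close> may contain no minimiser.\<close>
    have bnd: "(B v (u n) - F v)^2 \<le> (1 / Suc n) * B v v" for n
    proof (rule quadratic_nonneg_imp)
      fix t :: real
      have "m \<le> J (\<lambda>z. u n z + complex_of_real t * v z)" by (rule m, rule add[OF u(1) v])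
      then show "0 \<le> 1 / Suc n + 2 * t * (B v (u n) - F v) + t^2 * B v v"
        unfolding J_add[OF u(1) v] using u(2)[of n] by linarith
    qed
    have "(\<lambda>n. (1 / Suc n) * B v v) \<longlonglongrightarrow> 0 * B v v"
      by (intro tendsto_mult tendsto_const LIMSEQ_Suc lim_1_over_n)
    then have "(\<lambda>n. (1 / Suc n) * B v v) \<longlonglongrightarrow> 0" by simp
    then have "(\<lambda>n. (B v (u n) - F v)^2) \<longlonglongrightarrow> 0"
      by (rule Lim_null_comparison[rotated]) (use bnd in simp)
    then have "(\<lambda>n. sqrt ((B v (u n) - F v)^2)) \<longlonglongrightarrow> sqrt 0" by (rule tendsto_real_sqrt)
    then have "(\<lambda>n. B v (u n) - F v) \<longlonglongrightarrow> 0" by (simp add: tendsto_rabs_zero_iff)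
    then show "(\<lambda>n. B v (u n)) \<longlonglongrightarrow> F v" by (rule LIM_zero_cancel)
  qed
qed

section \<open>Smooth functions and test functions\<close>

lemma dir_deriv_eqI: "(f has_derivative D) (at x) \<Longrightarrow> dir_deriv v f x = D v"
  unfolding dir_deriv_def by (simp flip: frechet_derivative_at)

lemma smooth_differentiable: "smooth f \<Longrightarrow> f differentiable (at x)"
  unfolding smooth_def by (drule spec[of _ "[]"]) simp

lemma smooth_dir_deriv: "smooth f \<Longrightarrow> smooth (dir_deriv v f)"
  unfolding smooth_def
proof (intro allI)
  fix vs x assume "\<forall>vs x. (fold dir_deriv vs f) differentiable (at x)"
  then have "(fold dir_deriv (v # vs) f) differentiable (at x)" by blast
  then show "(fold dir_deriv vs (dir_deriv v f)) differentiable (at x)" by simp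
qed

lemma smooth_has_derivative: "smooth f \<Longrightarrow> (f has_derivative (\<lambda>v. dir_deriv v f x)) (at x)"
  unfolding dir_deriv_def using smooth_differentiable frechet_derivative_works by blast

lemma smooth_continuous: "smooth f \<Longrightarrow> continuous_on S f"
  using smooth_differentiable by (intro continuous_at_imp_continuous_on ballI differentiable_imp_continuous_within)

lemma smooth_borel: "smooth f \<Longrightarrow> f \<in> borel_measurable borel"
  by (intro borel_measurable_continuous_onI smooth_continuous)

text \<open>Smoothness concerns all iterated derivatives at once, so it is proved by exhibiting a
  class of differentiable functions closed under directional derivatives. The basic smoothness
  proofs below consist in the choice of that class.\<close>

lemma smooth_coinduct:
  assumes "f \<in> S" and D: "\<And>g x. g \<in> S \<Longrightarrow> g differentiable (at x)" and S: "\<And>g v. g \<in> S \<Longrightarrow> dir_deriv v g \<in> S"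
  shows "smooth f"
  unfolding smooth_def
proof (intro allI)
  fix vs x
  have "fold dir_deriv vs f \<in> S" using \<open>f \<in> S\<close> by (induction vs arbitrary: f) (auto intro: S)
  then show "(fold dir_deriv vs f) differentiable (at x)" by (rule D)
qed

lemma smooth_const: "smooth (\<lambda>x. c)"
proof (rule smooth_coinduct[of _ "range (\<lambda>c x. c)"])
  fix g :: "'a \<Rightarrow> 'b" and v assume "g \<in> range (\<lambda>c x. c)"
  then obtain c where "g = (\<lambda>x. c)" by blast
  then have "dir_deriv v g = (\<lambda>x. 0)" unfolding dir_deriv_def by simp
  then show "dir_deriv v g \<in> range (\<lambda>c x. c)" by blast
qed auto

lemma smooth_bounded_linear:
  assumes "bounded_linear L" shows "smooth L"
proof (rule smooth_coinduct[of _ "insert L (range (\<lambda>c x. c))"])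
  have d: "dir_deriv v L = (\<lambda>x. L v)" for v
    using assms by (intro ext dir_deriv_eqI) (rule bounded_linear_imp_has_derivative)
  fix g v assume "g \<in> insert L (range (\<lambda>c x. c))"
  then consider "g = L" | c where "g = (\<lambda>x. c)" by blast
  then show "dir_deriv v g \<in> insert L (range (\<lambda>c x. c))"
  proof cases
    case 1 then show ?thesis using d by auto
  next
    case 2
    then have "dir_deriv v g = (\<lambda>x. 0)" unfolding dir_deriv_def by simp
    then show ?thesis by blast
  qed
qed (use assms in \<open>auto intro: bounded_linear_imp_differentiable\<close>)

text \<open>Products alone are not stable under differentiation, but sums of products are, by the
  Leibniz rule. Addition of smooth functions is the special case of products with the constant
  1.\<close>

inductive_set smooth_products :: "('a::euclidean_space \<Rightarrow> 'b::real_normed_vector) set" where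
  "smooth f \<Longrightarrow> smooth g \<Longrightarrow> (\<lambda>x. f x *\<^sub>R g x) \<in> smooth_products"
| "h \<in> smooth_products \<Longrightarrow> k \<in> smooth_products \<Longrightarrow> (\<lambda>x. h x + k x) \<in> smooth_products"

lemma dir_deriv_scaleR:
  assumes "smooth f" "smooth g"
  shows "dir_deriv v (\<lambda>x. f x *\<^sub>R g x) = (\<lambda>x. dir_deriv v f x *\<^sub>R g x + f x *\<^sub>R dir_deriv v g x)"
proof
  fix x
  have "((\<lambda>x. f x *\<^sub>R g x) has_derivative (\<lambda>v. f x *\<^sub>R dir_deriv v g x + dir_deriv v f x *\<^sub>R g x)) (at x)"
    using smooth_has_derivative[OF assms(1)] smooth_has_derivative[OF assms(2)] by (rule has_derivative_scaleR)
  then show "dir_deriv v (\<lambda>x. f x *\<^sub>R g x) x = dir_deriv v f x *\<^sub>R g x + f x *\<^sub>R dir_deriv v g x"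
    by (simp add: dir_deriv_eqI)
qed

lemma smooth_products_closed:
  assumes "h \<in> smooth_products"
  shows "(\<forall>x. h differentiable (at x)) \<and> (\<forall>v. dir_deriv v h \<in> smooth_products)"
  using assms
proof induction
  case (1 f g)
  have "(\<lambda>x. f x *\<^sub>R g x) differentiable (at x)" for x
    using smooth_has_derivative[OF 1(1)] smooth_has_derivative[OF 1(2)]
    by (auto simp: differentiable_def intro!: has_derivative_scaleR)
  moreover have "dir_deriv v (\<lambda>x. f x *\<^sub>R g x) \<in> smooth_products" for v
    unfolding dir_deriv_scaleR[OF 1] by (intro smooth_products.intros smooth_dir_deriv 1)
  ultimately show ?case by blast
next
  case (2 h k)
  have "dir_deriv v (\<lambda>x. h x + k x) = (\<lambda>x. dir_deriv v h x + dir_deriv v k x)" for v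
    using 2 by (intro ext dir_deriv_eqI) (auto simp: dir_deriv_def frechet_derivative_works intro!: derivative_intros)
  then have "dir_deriv v (\<lambda>x. h x + k x) \<in> smooth_products" for v
    using 2 by (simp add: smooth_products.intros)
  moreover have "(\<lambda>x. h x + k x) differentiable (at x)" for x using 2 by (intro differentiable_add) auto
  ultimately show ?case by blast
qed

lemma smooth_of_products: "h \<in> smooth_products \<Longrightarrow> smooth h"
  by (rule smooth_coinduct[of _ smooth_products]) (auto dest: smooth_products_closed)

lemma smooth_scaleR: "smooth f \<Longrightarrow> smooth g \<Longrightarrow> smooth (\<lambda>x. f x *\<^sub>R g x)"
  by (rule smooth_of_products, rule smooth_products.intros(1))

lemma smooth_add: "smooth f \<Longrightarrow> smooth g \<Longrightarrow> smooth (\<lambda>x. f x + g x)"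
proof -
  assume *: "smooth f" "smooth g"
  have "smooth (\<lambda>x. 1 *\<^sub>R f x + 1 *\<^sub>R g x)"
    by (rule smooth_of_products, rule smooth_products.intros(2); rule smooth_products.intros(1)) (intro smooth_const *)+
  then show ?thesis by simp
qed

lemma dir_deriv_add: "smooth f \<Longrightarrow> smooth g \<Longrightarrow> dir_deriv v (\<lambda>x. f x + g x) = (\<lambda>x. dir_deriv v f x + dir_deriv v g x)"
  by (intro ext dir_deriv_eqI has_derivative_add smooth_has_derivative)

lemma smooth_mult: fixes f :: "_ \<Rightarrow> real" shows "smooth f \<Longrightarrow> smooth g \<Longrightarrow> smooth (\<lambda>x. f x * g x)"
  using smooth_scaleR[of f g] by simp

lemma dir_deriv_bounded_linear:
  assumes "bounded_linear L" "smooth f"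
  shows "dir_deriv v (\<lambda>x. L (f x)) = (\<lambda>x. L (dir_deriv v f x))"
  by (intro ext dir_deriv_eqI bounded_linear.has_derivative[OF assms(1)] smooth_has_derivative assms(2))

lemma smooth_compose_linear:
  assumes L: "bounded_linear L" and "smooth f" shows "smooth (\<lambda>x. L (f x))"
proof (rule smooth_coinduct[of _ "{\<lambda>x. L (g x) |g. smooth g}"])
  show "(\<lambda>x. L (f x)) \<in> {\<lambda>x. L (g x) |g. smooth g}" using assms by blast
next
  fix h x assume "h \<in> {\<lambda>x. L (g x) |g. smooth g}"
  then obtain g where g: "h = (\<lambda>x. L (g x))" "smooth g" by blast
  show "h differentiable (at x)"
    unfolding g(1) differentiable_def
    using bounded_linear.has_derivative[OF L smooth_has_derivative[OF g(2)]] by blast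
next
  fix h v assume "h \<in> {\<lambda>x. L (g x) |g. smooth g}"
  then obtain g where g: "h = (\<lambda>x. L (g x))" "smooth g" by blast
  show "dir_deriv v h \<in> {\<lambda>x. L (g x) |g. smooth g}"
    unfolding g(1) dir_deriv_bounded_linear[OF L g(2)] using smooth_dir_deriv[OF g(2)] by blast
qed

lemma dir_deriv_affine:
  assumes "bounded_linear L" "smooth f"
  shows "dir_deriv v (\<lambda>x. f (L x + c)) = (\<lambda>x. dir_deriv (L v) f (L x + c))"
proof
  fix x
  have "((\<lambda>x. L x + c) has_derivative L) (at x)"
    using has_derivative_add[OF bounded_linear_imp_has_derivative[OF assms(1)] has_derivative_const] by simp
  from has_derivative_compose[OF this smooth_has_derivative[OF assms(2)]]
  show "dir_deriv v (\<lambda>x. f (L x + c)) x = dir_deriv (L v) f (L x + c)" by (rule dir_deriv_eqI)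
qed

lemma smooth_affine:
  assumes L: "bounded_linear L" and f: "smooth f" shows "smooth (\<lambda>x. f (L x + c))"
proof (rule smooth_coinduct[of _ "{\<lambda>x. g (L x + c) |g. smooth g}"])
  show "(\<lambda>x. f (L x + c)) \<in> {\<lambda>x. g (L x + c) |g. smooth g}" using assms by blast
next
  fix h x assume "h \<in> {\<lambda>x. g (L x + c) |g. smooth g}"
  then obtain g where g: "h = (\<lambda>x. g (L x + c))" "smooth g" by blast
  have "((\<lambda>x. L x + c) has_derivative L) (at x)"
    using has_derivative_add[OF bounded_linear_imp_has_derivative[OF L] has_derivative_const] by simp
  from has_derivative_compose[OF this smooth_has_derivative[OF g(2)]]
  show "h differentiable (at x)" unfolding g(1) differentiable_def by blast
next
  fix h v assume "h \<in> {\<lambda>x. g (L x + c) |g. smooth g}"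
  then obtain g where g: "h = (\<lambda>x. g (L x + c))" "smooth g" by blast
  show "dir_deriv v h \<in> {\<lambda>x. g (L x + c) |g. smooth g}"
    unfolding g(1) dir_deriv_affine[OF L g(2)] using smooth_dir_deriv[OF g(2)] by blast
qed

lemma smooth_translate: "smooth f \<Longrightarrow> smooth (\<lambda>x. f (x + c))"
  and dir_deriv_translate: "smooth f \<Longrightarrow> dir_deriv v (\<lambda>x. f (x + c)) = (\<lambda>x. dir_deriv v f (x + c))"
  using smooth_affine[OF bounded_linear_ident] dir_deriv_affine[OF bounded_linear_ident] by auto

lemma smooth_reflect: "smooth f \<Longrightarrow> smooth (\<lambda>x. f (c - x))"
  and dir_deriv_reflect: "smooth f \<Longrightarrow> dir_deriv v (\<lambda>x. f (c - x)) = (\<lambda>x. - dir_deriv v f (c - x))"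
proof -
  assume f: "smooth f"
  have L: "bounded_linear (\<lambda>x::'a. - x)" by (intro bounded_linear_minus bounded_linear_ident)
  show "smooth (\<lambda>x. f (c - x))" using smooth_affine[OF L f, of c] by simp
  have "linear (\<lambda>v. dir_deriv v f y)" for y
    using has_derivative_linear[OF smooth_has_derivative[OF f]] .
  then have "dir_deriv (- v) f y = - dir_deriv v f y" for y by (rule linear_neg)
  then show "dir_deriv v (\<lambda>x. f (c - x)) = (\<lambda>x. - dir_deriv v f (c - x))"
    using dir_deriv_affine[OF L f, of v c] by simp
qed

text \<open>Splitting one factor into real and imaginary part reduces the complex product to real
  scalar multiplication.\<close>

lemma smooth_complex_mult:
  fixes f g :: "_ \<Rightarrow> complex"
  assumes "smooth f" "smooth g" shows "smooth (\<lambda>x. f x * g x)"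
proof -
  have "smooth (\<lambda>x. Re (f x) *\<^sub>R g x + Im (f x) *\<^sub>R (\<i> * g x))"
    by (intro smooth_add smooth_scaleR smooth_compose_linear[OF bounded_linear_Re] smooth_compose_linear[OF bounded_linear_Im]
        smooth_compose_linear[OF bounded_linear_mult_right] assms)
  moreover have "Re (f x) *\<^sub>R g x + Im (f x) *\<^sub>R (\<i> * g x) = f x * g x" for x
    by (simp add: complex_eq_iff)
  ultimately show ?thesis by simp
qed

lemma dir_deriv_complex_mult:
  fixes f g :: "_ \<Rightarrow> complex"
  assumes "smooth f" "smooth g"
  shows "dir_deriv v (\<lambda>x. f x * g x) = (\<lambda>x. dir_deriv v f x * g x + f x * dir_deriv v g x)"
proof
  fix x
  have "((\<lambda>x. f x * g x) has_derivative (\<lambda>v. f x * dir_deriv v g x + dir_deriv v f x * g x)) (at x)"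
    using smooth_has_derivative[OF assms(1)] smooth_has_derivative[OF assms(2)] by (rule has_derivative_mult)
  then show "dir_deriv v (\<lambda>x. f x * g x) x = dir_deriv v f x * g x + f x * dir_deriv v g x"
    by (simp add: dir_deriv_eqI)
qed

lemma smooth_cnj: "smooth f \<Longrightarrow> smooth (\<lambda>x. cnj (f x))"
  and smooth_of_real: "smooth h \<Longrightarrow> smooth (\<lambda>x. complex_of_real (h x))"
  and smooth_cmult: "smooth f \<Longrightarrow> smooth (\<lambda>x. c * f x)"
  by (rule smooth_compose_linear[OF bounded_linear_cnj] smooth_compose_linear[OF bounded_linear_of_real]
      smooth_compose_linear[OF bounded_linear_mult_right]; assumption)+

lemma dir_deriv_cnj: "smooth f \<Longrightarrow> dir_deriv v (\<lambda>x. cnj (f x)) = (\<lambda>x. cnj (dir_deriv v f x))"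
  and dir_deriv_of_real: "smooth h \<Longrightarrow> dir_deriv v (\<lambda>x. complex_of_real (h x)) = (\<lambda>x. complex_of_real (dir_deriv v h x))"
  and dir_deriv_cmult: "smooth f \<Longrightarrow> dir_deriv v (\<lambda>x. c * f x) = (\<lambda>x. c * dir_deriv v f x)" for f :: "_ \<Rightarrow> complex"
  by (rule dir_deriv_bounded_linear[OF bounded_linear_cnj] dir_deriv_bounded_linear[OF bounded_linear_of_real]
      dir_deriv_bounded_linear[OF bounded_linear_mult_right]; assumption)+

section \<open>Products, quotients and the smooth transition function\<close>

lemma smooth_prod:
  fixes f :: "_ \<Rightarrow> _ \<Rightarrow> real"
  assumes "finite I" "\<And>i. i \<in> I \<Longrightarrow> smooth (f i)" shows "smooth (\<lambda>x. \<Prod>i\<in>I. f i x)"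
  using assms by (induction I) (auto intro: smooth_const smooth_mult)

text \<open>The stable class consists of all \<open>g / d ^ k\<close> with \<open>g\<close> smooth:
  differentiating changes the numerator and raises the exponent by one.\<close>

lemma smooth_quotient:
  fixes f d :: "_ \<Rightarrow> real"
  assumes f: "smooth f" and d: "smooth d" and nz: "\<And>x. d x \<noteq> 0"
  shows "smooth (\<lambda>x. f x / d x)"
proof (rule smooth_coinduct[of _ "{\<lambda>x. g x / d x ^ k |g k. smooth g}"])
  show "(\<lambda>x. f x / d x) \<in> {\<lambda>x. g x / d x ^ k |g k. smooth g}"
    using f by (intro CollectI exI[of _ f] exI[of _ 1]) simp
  have D: "((\<lambda>x. g x / d x ^ k) has_derivative (\<lambda>v. (dir_deriv v g x * d x - k * g x * dir_deriv v d x) / d x ^ Suc k)) (at x)"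
    if "smooth g" for g k x
  proof -
    have "((\<lambda>x. g x / d x ^ k) has_derivative
      (\<lambda>v. - g x * (inverse (d x ^ k) * (k * dir_deriv v d x * d x ^ (k - 1)) * inverse (d x ^ k)) + dir_deriv v g x / d x ^ k)) (at x)"
      using that by (intro has_derivative_divide has_derivative_power smooth_has_derivative d) (use nz in simp_all)
    \<comment> \<open>For \<open>k = 0\<close> the truncated exponent \<open>k - 1\<close> does no
      harm because of the factor \<open>k\<close>; the case distinction is there for this
      reason.\<close>
    moreover have "- g x * (inverse (d x ^ k) * (k * a * d x ^ (k - 1)) * inverse (d x ^ k)) + b / d x ^ k
      = (b * d x - k * g x * a) / d x ^ Suc k" for a b :: real
      using nz[of x] by (cases k) (simp_all add: field_simps)
    ultimately show ?thesis by simp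
  qed
  fix h v x assume "h \<in> {\<lambda>x. g x / d x ^ k |g k. smooth g}"
  then obtain g k where g: "h = (\<lambda>x. g x / d x ^ k)" "smooth g" by blast
  show "h differentiable (at x)" unfolding g(1) differentiable_def using D[OF g(2)] by blast
  have "dir_deriv v h = (\<lambda>x. (dir_deriv v g x * d x - k * g x * dir_deriv v d x) / d x ^ Suc k)"
    unfolding g(1) by (intro ext dir_deriv_eqI[OF D[OF g(2)]])
  moreover have "smooth (\<lambda>x. dir_deriv v g x * d x + (- k * g x) * dir_deriv v d x)"
    by (intro smooth_add smooth_mult smooth_dir_deriv smooth_const g d)
  ultimately show "dir_deriv v h \<in> {\<lambda>x. g x / d x ^ k |g k. smooth g}"
    by (intro CollectI exI[of _ "\<lambda>x. dir_deriv v g x * d x - k * g x * dir_deriv v d x"] exI[of _ "Suc k"]) simp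
qed

text \<open>Differentiating \<open>exp (- (1 / x))\<close> produces powers of \<open>1 / x\<close>,
  counted by \<open>k\<close>. The linear combinations of these functions are stable under
  differentiation, which makes each of them smooth across the origin.\<close>

definition flat :: "nat \<Rightarrow> real \<Rightarrow> real" where
  "flat k x = (if x > 0 then (1 / x) ^ k * exp (- (1 / x)) else 0)"

lemma flat_tendsto: "(flat k \<longlongrightarrow> 0) (at_right 0)"
proof -
  have "((\<lambda>x. inverse x ^ k / exp (inverse x)) \<longlongrightarrow> (0::real)) (at_right 0)"
    by (rule filterlim_compose[OF tendsto_power_div_exp_0 filterlim_inverse_at_top_right])
  then show ?thesis
    by (rule Lim_transform_eventually)
       (auto simp: eventually_at_filter flat_def inverse_eq_divide exp_minus field_simps)
qed

lemma flat_has_derivative: "(flat k has_real_derivative (flat (k + 2) x - k * flat (k + 1) x)) (at x)"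
proof -
  consider "x > 0" | "x < 0" | "x = 0" by linarith
  then show ?thesis
  proof cases
    case 1
    have u: "((\<lambda>x. 1 / x) has_real_derivative - (1 / x^2)) (at x)"
      using 1 by (auto intro!: derivative_eq_intros simp: power2_eq_square)
    have e: "((\<lambda>x. exp (- (1 / x))) has_real_derivative exp (- (1 / x)) * (1 / x^2)) (at x)"
      using DERIV_fun_exp[OF DERIV_minus[OF u]] by simp
    note DERIV_mult[OF DERIV_power[OF u, of k] e]
    moreover have "real k * (- (1/x^2) * (1/x)^(k - Suc 0)) * exp (- (1/x)) + exp (- (1/x)) * (1/x^2) * (1/x)^k
      = flat (k + 2) x - k * flat (k + 1) x"
      using 1 by (cases k) (simp_all add: flat_def field_simps power2_eq_square)
    ultimately have "((\<lambda>x. (1 / x) ^ k * exp (- (1 / x))) has_real_derivative (flat (k + 2) x - k * flat (k + 1) x)) (at x)"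
      by simp
    then show ?thesis
      by (rule has_field_derivative_transform_within_open[where S="{0<..}"]) (use 1 in \<open>auto simp: flat_def\<close>)
  next
    case 2
    have "((\<lambda>x. 0) has_real_derivative 0) (at x)" by simp
    then have "(flat k has_real_derivative 0) (at x)"
      by (rule has_field_derivative_transform_within_open[where S="{..<0}"]) (use 2 in \<open>auto simp: flat_def\<close>)
    then show ?thesis using 2 by (simp add: flat_def)
  next
    case 3
    have "((\<lambda>y. (flat k y - flat k 0) / (y - 0)) \<longlongrightarrow> 0) (at_left 0)"
      by (rule Lim_transform_eventually[OF tendsto_const]) (auto simp: eventually_at_filter flat_def)
    \<comment> \<open>On the right of the origin the difference quotient is the next function
      \<open>flat (Suc k)\<close>, which tends to 0.\<close>
    moreover have "((\<lambda>y. (flat k y - flat k 0) / (y - 0)) \<longlongrightarrow> 0) (at_right 0)"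
      by (rule Lim_transform_eventually[OF flat_tendsto[of "Suc k"]]) (auto simp: eventually_at_filter flat_def)
    ultimately have "((\<lambda>y. (flat k y - flat k 0) / (y - 0)) \<longlongrightarrow> 0) (at 0)" by (rule filterlim_split_at)
    then show ?thesis unfolding 3 has_field_derivative_iff by (simp add: flat_def)
  qed
qed

inductive_set flat_span :: "(real \<Rightarrow> real) set" where
  "(\<lambda>x. c * flat k x) \<in> flat_span"
| "f \<in> flat_span \<Longrightarrow> g \<in> flat_span \<Longrightarrow> (\<lambda>x. f x + g x) \<in> flat_span"

lemma smooth_flat: "smooth (flat k)"
proof (rule smooth_coinduct[of _ flat_span])
  show "flat k \<in> flat_span" using flat_span.intros(1)[of 1 k] by simp
  have *: "(\<forall>x. f differentiable (at x)) \<and> (\<forall>v. dir_deriv v f \<in> flat_span)" if "f \<in> flat_span" for f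
    using that
  proof induction
    case (1 c k)
    have D: "((\<lambda>x. c * flat k x) has_derivative (\<lambda>v. c * (flat (k + 2) x - k * flat (k + 1) x) * v)) (at x)" for x
      using DERIV_cmult[OF flat_has_derivative, of c k x] by (simp add: has_field_derivative_def)
    have "dir_deriv v (\<lambda>x. c * flat k x) = (\<lambda>x. (c * v) * flat (k+2) x + (- c * k * v) * flat (k+1) x)" for v
      by (rule ext, subst dir_deriv_eqI[OF D]) (simp add: algebra_simps)
    then have "dir_deriv v (\<lambda>x. c * flat k x) \<in> flat_span" for v by (simp only: flat_span.intros)
    with D show ?case by (auto simp: differentiable_def)
  next
    case (2 f g)
    have "dir_deriv v (\<lambda>x. f x + g x) = (\<lambda>x. dir_deriv v f x + dir_deriv v g x)" for v
      using 2 by (intro ext dir_deriv_eqI) (auto simp: dir_deriv_def frechet_derivative_works intro!: derivative_intros)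
    then show ?case using 2 by (simp add: flat_span.intros)
  qed
  show "f differentiable (at x)" "dir_deriv v f \<in> flat_span" if "f \<in> flat_span" for f x v
    using *[OF that] by blast+
qed

text \<open>The usual smooth transition, 0 on the left of 0 and 1 on the right of 1. The denominator
  is positive because \<open>x\<close> and \<open>1 - x\<close> are never both nonpositive.\<close>

definition step :: "real \<Rightarrow> real" where
  "step x = flat 0 x / (flat 0 x + flat 0 (1 - x))"

lemma flat_0_nonneg: "0 \<le> flat 0 x" and flat_0_pos: "x > 0 \<Longrightarrow> 0 < flat 0 x"
  by (simp_all add: flat_def)

lemma step_denominator: "0 < flat 0 x + flat 0 (1 - x)"
proof (cases "x > 0")
  case True then show ?thesis using flat_0_pos[of x] flat_0_nonneg[of "1 - x"] by simp
next
  case False then show ?thesis using flat_0_pos[of "1 - x"] flat_0_nonneg[of x] by simp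
qed

lemma smooth_step: "smooth step"
proof -
  have "smooth (\<lambda>x. flat 0 x / (flat 0 x + flat 0 (1 - x)))"
    by (intro smooth_quotient smooth_add smooth_reflect smooth_flat) (use step_denominator in \<open>auto simp: less_le\<close>)
  then show ?thesis by (simp add: step_def[abs_def])
qed

lemma step_nonneg: "0 \<le> step x" and step_le_1: "step x \<le> 1"
  and step_0: "x \<le> 0 \<Longrightarrow> step x = 0" and step_1: "x \<ge> 1 \<Longrightarrow> step x = 1"
  using step_denominator[of x] flat_0_nonneg[of x] flat_0_nonneg[of "1 - x"]
  by (auto simp: step_def flat_def)

lemma smooth_step_affine:
  assumes "bounded_linear L" shows "smooth (\<lambda>x. step (L x + c))"
  by (rule smooth_affine[OF assms smooth_step])

subsection \<open>Test functions\<close>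

lemma test_functionsI:
  assumes "smooth f" "compact K" "K \<subseteq> \<Omega>" "\<And>x. x \<notin> K \<Longrightarrow> f x = 0"
  shows "f \<in> test_functions \<Omega>"
proof -
  have "closure {x. f x \<noteq> 0} \<subseteq> K"
    using assms by (intro closure_minimal compact_imp_closed) auto
  moreover from this have "compact (closure {x. f x \<noteq> 0})"
    using assms(2) by (metis closed_closure compact_Int_closed inf.absorb_iff2)
  ultimately show ?thesis using assms(1,3) by (auto simp: test_functions_def)
qed

text \<open>The support is closed, so at a point off it the function vanishes on a whole
  neighbourhood; hence one \<open>K\<close> serves for the function and its derivatives.\<close>

lemma test_functionsE:
  assumes "f \<in> test_functions \<Omega>"
  obtains K where "compact K" "K \<subseteq> \<Omega>" "\<And>x. x \<notin> K \<Longrightarrow> f x = 0" "\<And>x v. x \<notin> K \<Longrightarrow> dir_deriv v f x = 0"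
proof (rule that)
  let ?K = "closure {x. f x \<noteq> 0}"
  show "compact ?K" "?K \<subseteq> \<Omega>" using assms by (auto simp: test_functions_def)
  show z: "f x = 0" if "x \<notin> ?K" for x using that closure_subset[of "{x. f x \<noteq> 0}"] by blast
  fix x v assume x: "x \<notin> ?K"
  have "((\<lambda>x. 0) has_derivative (\<lambda>v. 0)) (at x)" by simp
  then have "(f has_derivative (\<lambda>v. 0)) (at x)"
  proof (rule has_derivative_transform_within_open)
    show "open (- ?K)" by (rule open_Compl[OF closed_closure])
    show "x \<in> - ?K" unfolding Compl_iff by (rule x)
    show "0 = f y" if "y \<in> - ?K" for y using z[of y] that by (metis ComplD)
  qed
  then show "dir_deriv v f x = 0" by (rule dir_deriv_eqI)
qed

lemma test_functions_smooth: "f \<in> test_functions \<Omega> \<Longrightarrow> smooth f"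
  by (simp add: test_functions_def)

lemma test_functions_mono: "f \<in> test_functions \<Omega> \<Longrightarrow> \<Omega> \<subseteq> \<Omega>' \<Longrightarrow> f \<in> test_functions \<Omega>'"
  by (auto simp: test_functions_def)

lemma test_functions_zero: "(\<lambda>x. 0) \<in> test_functions \<Omega>"
  by (rule test_functionsI[where K="{}"]) (auto intro: smooth_const)

lemma test_functions_dir_deriv:
  assumes "f \<in> test_functions \<Omega>" shows "dir_deriv v f \<in> test_functions \<Omega>"
  using test_functionsE[OF assms] test_functionsI smooth_dir_deriv test_functions_smooth[OF assms] by metis

lemma test_functions_add:
  assumes "f \<in> test_functions \<Omega>" "g \<in> test_functions \<Omega>" shows "(\<lambda>x. f x + g x) \<in> test_functions \<Omega>"
proof -
  obtain K K' where K: "compact K" "K \<subseteq> \<Omega>" "\<And>x. x \<notin> K \<Longrightarrow> f x = 0" "compact K'" "K' \<subseteq> \<Omega>" "\<And>x. x \<notin> K' \<Longrightarrow> g x = 0"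
    using test_functionsE[OF assms(1)] test_functionsE[OF assms(2)] by metis
  show ?thesis
    by (rule test_functionsI[where K="K \<union> K'"])
       (use K in \<open>auto intro!: smooth_add compact_Un test_functions_smooth[OF assms(1)] test_functions_smooth[OF assms(2)]\<close>)
qed

lemma test_functions_scaleR:
  assumes "f \<in> test_functions \<Omega>" "smooth g" shows "(\<lambda>x. f x *\<^sub>R g x) \<in> test_functions \<Omega>"
proof -
  obtain K where "compact K" "K \<subseteq> \<Omega>" "\<And>x. x \<notin> K \<Longrightarrow> f x = 0" using test_functionsE[OF assms(1)] by metis
  then show ?thesis
    by (intro test_functionsI[where K=K]) (auto intro!: smooth_scaleR assms(2) test_functions_smooth[OF assms(1)])
qed

lemma test_functions_mult:
  fixes f :: "_ \<Rightarrow> complex"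
  assumes "f \<in> test_functions \<Omega>" "smooth g" shows "(\<lambda>x. g x * f x) \<in> test_functions \<Omega>"
proof -
  obtain K where "compact K" "K \<subseteq> \<Omega>" "\<And>x. x \<notin> K \<Longrightarrow> f x = 0" using test_functionsE[OF assms(1)] by metis
  then show ?thesis
    by (intro test_functionsI[where K=K]) (auto intro!: smooth_complex_mult assms(2) test_functions_smooth[OF assms(1)])
qed

lemma test_functions_compose_linear:
  assumes "f \<in> test_functions \<Omega>" "bounded_linear L" shows "(\<lambda>x. L (f x)) \<in> test_functions \<Omega>"
proof -
  obtain K where "compact K" "K \<subseteq> \<Omega>" "\<And>x. x \<notin> K \<Longrightarrow> f x = 0" using test_functionsE[OF assms(1)] by metis
  moreover have "smooth (\<lambda>x. L (f x))" by (rule smooth_compose_linear[OF assms(2) test_functions_smooth[OF assms(1)]])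
  ultimately show ?thesis
    by (intro test_functionsI[where K=K]) (auto simp: linear_0[OF bounded_linear.linear[OF assms(2)]])
qed

lemma test_functions_translate:
  assumes "f \<in> test_functions \<Omega>" "\<And>x. x \<in> \<Omega> \<Longrightarrow> x - c \<in> \<Omega>" shows "(\<lambda>x. f (x + c)) \<in> test_functions \<Omega>"
proof -
  obtain K where K: "compact K" "K \<subseteq> \<Omega>" "\<And>x. x \<notin> K \<Longrightarrow> f x = 0" using test_functionsE[OF assms(1)] by metis
  show ?thesis
  proof (rule test_functionsI[where K="(\<lambda>x. x - c) ` K"])
    show "smooth (\<lambda>x. f (x + c))" using assms by (intro smooth_translate test_functions_smooth)
    show "compact ((\<lambda>x. x - c) ` K)" by (intro compact_continuous_image continuous_intros K)
    show "(\<lambda>x. x - c) ` K \<subseteq> \<Omega>" using K(2) assms(2) by auto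
    show "f (x + c) = 0" if "x \<notin> (\<lambda>x. x - c) ` K" for x
      using that by (intro K(3)) (auto simp: image_iff dest: bspec[of _ _ "x + c"])
  qed
qed

section \<open>Bounds, integrability and Lipschitz continuity of test functions\<close>

lemma test_functions_bounded:
  assumes "f \<in> test_functions \<Omega>" obtains C where "C > 0" "\<And>x. norm (f x) \<le> C"
proof -
  obtain K where K: "compact K" "\<And>x. x \<notin> K \<Longrightarrow> f x = 0" using test_functionsE[OF assms] by metis
  have "compact (f ` K)"
    by (intro compact_continuous_image K smooth_continuous test_functions_smooth[OF assms])
  then have "bounded (f ` K)" by (rule compact_imp_bounded)
  then obtain B where "B > 0" "\<forall>y\<in>f ` K. norm y \<le> B" unfolding bounded_pos by blast
  then have "norm (f x) \<le> B" for x using K(2)[of x] by (cases "x \<in> K") auto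
  with \<open>B > 0\<close> show ?thesis by (rule that)
qed

lemma test_functions_borel: "f \<in> test_functions \<Omega> \<Longrightarrow> f \<in> borel_measurable borel"
  by (intro smooth_borel test_functions_smooth)

lemma test_functions_integrable:
  fixes f :: "'a::euclidean_space \<Rightarrow> 'b::{banach, second_countable_topology}"
  assumes "f \<in> test_functions \<Omega>" shows "integrable lborel f"
proof -
  obtain K where K: "compact K" "\<And>x. x \<notin> K \<Longrightarrow> f x = 0" using test_functionsE[OF assms] by metis
  have "integrable lborel (\<lambda>x. indicator K x *\<^sub>R f x)"
    using borel_integrable_compact[OF K(1) smooth_continuous[OF test_functions_smooth[OF assms]]] .
  moreover have "(\<lambda>x. indicator K x *\<^sub>R f x) = f" using K(2) by (auto simp: indicator_def fun_eq_iff)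
  ultimately show ?thesis by simp
qed

text \<open>The partial derivatives are again test functions and thus bounded. Expanding a direction
  in the basis bounds the total derivative, and the mean value inequality applies on the whole
  convex space.\<close>

lemma test_functions_Lipschitz:
  assumes "f \<in> test_functions \<Omega>" obtains L where "L > 0" "\<And>x y. norm (f x - f y) \<le> L * norm (x - y)"
proof -
  have "\<exists>C>0. \<forall>x. norm (dir_deriv i f x) \<le> C" for i
    by (rule test_functions_bounded[OF test_functions_dir_deriv[OF assms]]) blast
  then obtain C where C: "\<And>i. C i > 0" "\<And>i x. norm (dir_deriv i f x) \<le> C i" by metis
  let ?L = "\<Sum>i\<in>Basis. C i"
  have "norm (f x - f y) \<le> ?L * norm (x - y)" for x y
  proof (rule differentiable_bound[where S=UNIV])
    fix x
    show "(f has_derivative (\<lambda>v. dir_deriv v f x)) (at x)" by (rule smooth_has_derivative[OF test_functions_smooth[OF assms]])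
    then have lin: "linear (\<lambda>v. dir_deriv v f x)" by (rule has_derivative_linear)
    show "onorm (\<lambda>v. dir_deriv v f x) \<le> ?L"
    proof (rule onorm_le)
      fix v :: 'a
      have "dir_deriv v f x = dir_deriv (\<Sum>i\<in>Basis. (v \<bullet> i) *\<^sub>R i) f x" by (simp add: euclidean_representation)
      also have "\<dots> = (\<Sum>i\<in>Basis. (v \<bullet> i) *\<^sub>R dir_deriv i f x)"
        using linear_sum[OF lin, of "\<lambda>i. (v \<bullet> i) *\<^sub>R i" Basis] linear_scale[OF lin] by simp
      also have "norm \<dots> \<le> (\<Sum>i\<in>Basis. norm v * C i)"
        by (intro sum_norm_le) (auto intro!: mult_mono Basis_le_norm C)
      also have "\<dots> = ?L * norm v" unfolding sum_distrib_left[symmetric] by (rule mult.commute)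
      finally show "norm (dir_deriv v f x) \<le> ?L * norm v" .
    qed
  qed auto
  moreover have "?L > 0" using C(1) by (intro sum_pos) auto
  ultimately show ?thesis using that by blast
qed

subsection \<open>Approximation of boxes and mollifier kernels\<close>

text \<open>Each factor is 0 within distance \<open>1/n\<close> of its face and 1 beyond distance
  \<open>2/n\<close>. The offset -1 keeps the support in a closed box inside the open one, so the
  bumps are test functions that tend to the indicator of the open box.\<close>

definition box_bump :: "'a::euclidean_space \<Rightarrow> 'a \<Rightarrow> nat \<Rightarrow> 'a \<Rightarrow> real" where
  "box_bump a b n x = (\<Prod>i\<in>Basis. step (real n * (x \<bullet> i - a \<bullet> i) - 1) * step (real n * (b \<bullet> i - x \<bullet> i) - 1))"

lemma smooth_box_bump: "smooth (box_bump a b n)"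
proof -
  have 1: "smooth (\<lambda>x. step (real n * (x \<bullet> i - a \<bullet> i) - 1))" for i
    using smooth_step_affine[of "\<lambda>x. real n * (x \<bullet> i)" "- real n * (a \<bullet> i) - 1"]
    by (simp add: bounded_linear_mult_right bounded_linear_inner_left bounded_linear_compose algebra_simps bounded_linear_const_mult)
  have 2: "smooth (\<lambda>x. step (real n * (b \<bullet> i - x \<bullet> i) - 1))" for i
    using smooth_step_affine[of "\<lambda>x. - real n * (x \<bullet> i)" "real n * (b \<bullet> i) - 1"]
    by (simp add: bounded_linear_inner_left algebra_simps bounded_linear_const_mult bounded_linear_minus)
  show ?thesis unfolding box_bump_def[abs_def]
    by (intro smooth_prod smooth_mult 1 2) auto
qed

lemma box_bump_bounds: "0 \<le> box_bump a b n x" "box_bump a b n x \<le> 1"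
  unfolding box_bump_def by (auto intro!: prod_nonneg prod_le_1 mult_le_one simp: step_nonneg step_le_1)

lemma box_bump_eq_0:
  assumes "x \<notin> cbox (a + (\<Sum>i\<in>Basis. (1 / real n) *\<^sub>R i)) (b - (\<Sum>i\<in>Basis. (1 / real n) *\<^sub>R i))" "n > 0"
  shows "box_bump a b n x = 0"
proof -
  from assms obtain i where i: "i \<in> Basis" "x \<bullet> i < a \<bullet> i + 1 / n \<or> b \<bullet> i - 1 / n < x \<bullet> i"
    by (auto simp: mem_box inner_simps not_le)
  have "step (real n * (x \<bullet> i - a \<bullet> i) - 1) * step (real n * (b \<bullet> i - x \<bullet> i) - 1) = 0"
    using i(2) assms(2) by (auto simp: field_simps intro!: step_0)
  then show ?thesis unfolding box_bump_def using i(1) by (auto intro!: prod_zero bexI[of _ i])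
qed

lemma cbox_shrink_subset_box:
  fixes a b :: "'a::euclidean_space"
  assumes "n > 0"
  shows "cbox (a + (\<Sum>i\<in>Basis. (1 / real n) *\<^sub>R i)) (b - (\<Sum>i\<in>Basis. (1 / real n) *\<^sub>R i)) \<subseteq> box a b"
proof
  fix x assume x: "x \<in> cbox (a + (\<Sum>i\<in>Basis. (1 / real n) *\<^sub>R i)) (b - (\<Sum>i\<in>Basis. (1 / real n) *\<^sub>R i))"
  have "a \<bullet> i < x \<bullet> i \<and> x \<bullet> i < b \<bullet> i" if "i \<in> Basis" for i
  proof -
    have "a \<bullet> i + 1 / n \<le> x \<bullet> i" "x \<bullet> i \<le> b \<bullet> i - 1 / n"
      using x that by (auto simp: mem_box inner_simps)
    moreover have "0 < 1 / real n" using assms by simp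
    ultimately show ?thesis by linarith
  qed
  then show "x \<in> box a b" by (simp add: mem_box)
qed

lemma box_bump_test_functions:
  assumes "n > 0" shows "box_bump a b n \<in> test_functions (box a b)"
  by (rule test_functionsI[OF smooth_box_bump compact_cbox cbox_shrink_subset_box[OF assms] box_bump_eq_0[OF _ assms]])

lemma box_bump_tendsto: "(\<lambda>n. box_bump a b (Suc n) x) \<longlonglongrightarrow> indicator (box a b) x"
proof (cases "x \<in> box a b")
  case True
  have ev: "\<forall>\<^sub>F n in sequentially. step (real (Suc n) * t - 1) = 1" if "t > 0" for t :: real
  proof -
    obtain N where N: "2 / t < real N" using reals_Archimedean2 by blast
    show ?thesis
    proof (rule eventually_sequentiallyI[of N])
      fix n assume "N \<le> n"
      then have "2 / t < real (Suc n)" using N by linarith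
      then show "step (real (Suc n) * t - 1) = 1" using that by (intro step_1) (simp add: field_simps)
    qed
  qed
  have "\<forall>\<^sub>F n in sequentially. \<forall>i\<in>Basis. step (real (Suc n) * (x \<bullet> i - a \<bullet> i) - 1) = 1 \<and> step (real (Suc n) * (b \<bullet> i - x \<bullet> i) - 1) = 1"
    using True by (intro eventually_ball_finite ballI eventually_conj ev) (auto simp: mem_box)
  then have "\<forall>\<^sub>F n in sequentially. box_bump a b (Suc n) x = 1"
    by eventually_elim (simp add: box_bump_def)
  then show ?thesis using True by (simp add: tendsto_eventually)
next
  case False
  have "box_bump a b (Suc n) x = 0" for n
  proof (rule box_bump_eq_0)
    show "x \<notin> cbox (a + (\<Sum>i\<in>Basis. (1 / real (Suc n)) *\<^sub>R i)) (b - (\<Sum>i\<in>Basis. (1 / real (Suc n)) *\<^sub>R i))"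
      using False cbox_shrink_subset_box[of "Suc n" a b] by blast
  qed simp
  then show ?thesis using False by simp
qed

text \<open>Kernels of total mass 1 exist inside every nonempty open set, in particular inside a
  half ball; the approximation near the boundary depends on this.\<close>

lemma test_functions_normalized_exists:
  fixes U :: "'a::euclidean_space set"
  assumes "open U" "x \<in> U"
  obtains \<rho> :: "'a \<Rightarrow> real" where "\<rho> \<in> test_functions U" "\<And>x. 0 \<le> \<rho> x" "(\<integral>x. \<rho> x \<partial>lborel) = 1"
proof -
  obtain a b where ab: "x \<in> box a b" "box a b \<subseteq> U" using open_contains_box[OF assms] by metis
  have "\<forall>\<^sub>F n in sequentially. 0 < box_bump a b (Suc n) x"
    using order_tendstoD(1)[OF box_bump_tendsto, of 0 a b x] ab(1) by simp
  then obtain n where n: "0 < box_bump a b (Suc n) x" by (metis eventually_sequentially order_refl)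
  let ?f = "box_bump a b (Suc n)"
  have f: "?f \<in> test_functions U" using box_bump_test_functions ab(2) by (rule test_functions_mono) simp
  have int: "integrable lborel ?f" by (rule test_functions_integrable[OF f])
  have "(\<integral>x. ?f x \<partial>lborel) \<noteq> 0"
  proof
    assume "(\<integral>x. ?f x \<partial>lborel) = 0"
    then have "AE x in lborel. ?f x = 0"
      using integral_nonneg_eq_0_iff_AE[OF int AE_I2[OF box_bump_bounds(1)]] by simp
    \<comment> \<open>The bump is positive at \<open>x\<close>, hence nonzero on a box of positive
      volume, so it cannot vanish almost everywhere.\<close>
    moreover have "open {x. ?f x \<noteq> 0}"
      using open_Collect_neq[OF smooth_continuous[OF smooth_box_bump] continuous_on_const] .
    moreover have "x \<in> {x. ?f x \<noteq> 0}" using n by simp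
    ultimately obtain c d where cd: "box c d \<subseteq> {x. ?f x \<noteq> 0}" "\<forall>i\<in>Basis. c \<bullet> i < d \<bullet> i"
      by (metis open_contains_box)
    from \<open>AE x in lborel. ?f x = 0\<close> have "AE x in lborel. x \<notin> box c d"
      by eventually_elim (use cd(1) in blast)
    then have "box c d \<in> null_sets lborel" by (subst AE_iff_null_sets) auto
    then have "emeasure lborel (box c d) = 0" by (rule null_setsD1)
    moreover have "emeasure lborel (box c d) = ennreal (\<Prod>i\<in>Basis. (d - c) \<bullet> i)"
      using cd(2) by (intro emeasure_lborel_box) (simp add: less_imp_le)
    moreover have "0 < (\<Prod>i\<in>Basis. (d - c) \<bullet> i)" using cd(2) by (intro prod_pos) (simp add: inner_diff_left)
    ultimately show False by (simp add: ennreal_eq_0_iff)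
  qed
  moreover have "0 \<le> (\<integral>x. ?f x \<partial>lborel)" by (intro Bochner_Integration.integral_nonneg box_bump_bounds)
  ultimately have c: "0 < (\<integral>x. ?f x \<partial>lborel)" by simp
  define \<rho> where "\<rho> x = ?f x / (\<integral>x. ?f x \<partial>lborel)" for x
  show ?thesis
  proof (rule that)
    have "(\<lambda>x. ?f x *\<^sub>R (1 / (\<integral>x. ?f x \<partial>lborel))) \<in> test_functions U"
      by (intro test_functions_scaleR f smooth_const)
    then show "\<rho> \<in> test_functions U" by (simp add: \<rho>_def[abs_def])
    show "0 \<le> \<rho> x" for x unfolding \<rho>_def by (intro divide_nonneg_pos box_bump_bounds(1) c)
    show "(\<integral>x. \<rho> x \<partial>lborel) = 1" using c by (simp add: \<rho>_def)
  qed
qed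

section \<open>The fundamental lemma of the calculus of variations\<close>

lemma cbox_minus_box_null: "cbox a b - box a b \<in> null_sets (lborel :: 'a::euclidean_space measure)"
proof -
  have "cbox a b - box a b \<in> null_sets lebesgue"
    using negligible_frontier_interval negligible_iff_null_sets by blast
  then show ?thesis by (simp add: null_sets_completion_iff)
qed

lemma box_Int_box:
  "box c d \<inter> box a b = box (\<Sum>i\<in>Basis. max (c \<bullet> i) (a \<bullet> i) *\<^sub>R i) (\<Sum>i\<in>Basis. min (d \<bullet> i) (b \<bullet> i) *\<^sub>R i :: 'a::euclidean_space)"
  by (rule set_eqI) (auto simp: mem_box)

text \<open>The bumps tend to the indicator of the open box, and \<open>F\<close> restricted to the
  closed box dominates; it is integrable because the closed box is a compact subset of
  \<open>\<Omega>\<close>.\<close>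

lemma integral_box_eq_0:
  fixes F :: "'a::euclidean_space \<Rightarrow> 'b::{banach, second_countable_topology}"
  assumes F: "loc_integrable \<Omega> F" and \<Omega>: "open \<Omega>"
    and zero: "\<And>\<phi> :: 'a \<Rightarrow> real. \<phi> \<in> test_functions \<Omega> \<Longrightarrow> (\<integral>x. \<phi> x *\<^sub>R F x \<partial>lborel_on \<Omega>) = 0"
    and ab: "cbox a b \<subseteq> \<Omega>"
  shows "(\<integral>x. indicator (box a b) x *\<^sub>R F x \<partial>lborel) = 0"
proof -
  have int: "integrable lborel (\<lambda>x. indicator (cbox a b) x *\<^sub>R F x)"
    using F ab compact_cbox unfolding loc_integrable_def set_integrable_def by blast
  let ?s = "\<lambda>n x. box_bump a b (Suc n) x *\<^sub>R (indicator (cbox a b) x *\<^sub>R F x)"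
  have test: "box_bump a b (Suc n) \<in> test_functions (box a b)" for n
    by (rule box_bump_test_functions) simp
  have out: "box_bump a b (Suc n) x = 0" if "x \<notin> box a b" for n x
    by (rule box_bump_eq_0) (use that cbox_shrink_subset_box[of "Suc n" a b] in auto)
  have z: "(\<integral>x. ?s n x \<partial>lborel) = 0" for n
  proof -
    have "box_bump a b (Suc n) \<in> test_functions \<Omega>"
      using test by (rule test_functions_mono) (use ab box_subset_cbox in blast)
    then have "0 = (\<integral>x. box_bump a b (Suc n) x *\<^sub>R F x \<partial>lborel_on \<Omega>)" by (simp add: zero)
    also have "\<dots> = (\<integral>x. indicator \<Omega> x *\<^sub>R box_bump a b (Suc n) x *\<^sub>R F x \<partial>lborel)"
      using \<Omega> by (intro integral_restrict_space) simp
    also have "\<dots> = (\<integral>x. ?s n x \<partial>lborel)"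
    proof (intro Bochner_Integration.integral_cong refl)
      fix x
      show "indicator \<Omega> x *\<^sub>R box_bump a b (Suc n) x *\<^sub>R F x = ?s n x"
      proof (cases "x \<in> box a b")
        case True
        then have "x \<in> cbox a b" "x \<in> \<Omega>" using ab box_subset_cbox by blast+
        then show ?thesis by simp
      qed (simp add: out)
    qed
    finally show ?thesis by simp
  qed
  have "(\<lambda>n. \<integral>x. ?s n x \<partial>lborel) \<longlonglongrightarrow> (\<integral>x. indicator (box a b) x *\<^sub>R F x \<partial>lborel)"
  proof (rule integral_dominated_convergence)
    show meas: "?s n \<in> borel_measurable lborel" for n
      using smooth_borel[OF smooth_box_bump] by (intro borel_measurable_scaleR[OF _ borel_measurable_integrable[OF int]]) simp
    have lim: "(\<lambda>n. ?s n x) \<longlonglongrightarrow> indicator (box a b) x *\<^sub>R F x" for x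
    proof -
      have "(\<lambda>n. ?s n x) \<longlonglongrightarrow> indicator (box a b) x *\<^sub>R (indicator (cbox a b) x *\<^sub>R F x)"
        by (intro tendsto_scaleR box_bump_tendsto tendsto_const)
      also have "indicator (box a b) x *\<^sub>R (indicator (cbox a b) x *\<^sub>R F x) = indicator (box a b) x *\<^sub>R F x"
        using box_subset_cbox[of a b] by (auto simp: indicator_def)
      finally show ?thesis .
    qed
    then show "AE x in lborel. (\<lambda>n. ?s n x) \<longlonglongrightarrow> indicator (box a b) x *\<^sub>R F x" by simp
    show "(\<lambda>x. indicator (box a b) x *\<^sub>R F x) \<in> borel_measurable lborel"
      by (rule borel_measurable_LIMSEQ_metric[OF meas lim])
    show "integrable lborel (\<lambda>x. norm (indicator (cbox a b) x *\<^sub>R F x))" by (rule integrable_norm[OF int])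
    show "AE x in lborel. norm (?s n x) \<le> norm (indicator (cbox a b) x *\<^sub>R F x)" for n
    proof (rule AE_I2)
      fix x
      have "\<bar>box_bump a b (Suc n) x\<bar> * norm (indicator (cbox a b) x *\<^sub>R F x) \<le> 1 * norm (indicator (cbox a b) x *\<^sub>R F x)"
        using box_bump_bounds[of a b "Suc n" x] by (intro mult_right_mono) auto
      then show "norm (?s n x) \<le> norm (indicator (cbox a b) x *\<^sub>R F x)"
        unfolding norm_scaleR[of "box_bump a b (Suc n) x"] mult_1_left .
    qed
  qed
  then show ?thesis unfolding z by (simp add: LIMSEQ_const_iff)
qed

text \<open>Open boxes form an intersection-stable generator of the Borel sets. The vanishing of
  integrals therefore spreads from boxes to all Borel sets, and a function whose integral over every
  Borel set is zero vanishes almost everywhere. The faces of the box are a null set.\<close>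

lemma fundamental_lemma_cbox:
  fixes F :: "'a::euclidean_space \<Rightarrow> 'b::{banach, second_countable_topology}"
  assumes F: "loc_integrable \<Omega> F" and \<Omega>: "open \<Omega>"
    and zero: "\<And>\<phi> :: 'a \<Rightarrow> real. \<phi> \<in> test_functions \<Omega> \<Longrightarrow> (\<integral>x. \<phi> x *\<^sub>R F x \<partial>lborel_on \<Omega>) = 0"
    and ab: "cbox a b \<subseteq> \<Omega>"
  shows "AE x in lborel. x \<in> cbox a b \<longrightarrow> F x = 0"
proof -
  let ?G = "\<lambda>x. indicator (box a b) x *\<^sub>R F x"
  have "set_integrable lborel (cbox a b) F"
    using F ab compact_cbox unfolding loc_integrable_def by blast
  then have "set_integrable lborel (box a b) F" by (rule set_integrable_subset) (auto simp: box_subset_cbox)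
  then have G: "integrable lborel ?G" unfolding set_integrable_def .
  have box0: "(\<integral>x. indicator (box c d) x *\<^sub>R ?G x \<partial>lborel) = 0" for c d
  proof -
    let ?c = "(\<Sum>i\<in>Basis. max (c \<bullet> i) (a \<bullet> i) *\<^sub>R i)" and ?d = "(\<Sum>i\<in>Basis. min (d \<bullet> i) (b \<bullet> i) *\<^sub>R i)"
    have "box c d \<inter> box a b = box ?c ?d" by (rule box_Int_box)
    then have eq: "indicator (box c d) x *\<^sub>R ?G x = indicator (box ?c ?d) x *\<^sub>R F x" for x
      by (metis (no_types, lifting) indicator_inter_arith scaleR_scaleR)
    have cd: "cbox ?c ?d \<subseteq> \<Omega>" using ab by (force simp: mem_box)
    show ?thesis unfolding eq by (rule integral_box_eq_0[OF F \<Omega> zero cd])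
  qed
  have set0: "(\<integral>x. indicator A x *\<^sub>R ?G x \<partial>lborel) = 0" if "A \<in> sets borel" for A
  proof -
    have "Int_stable (range (\<lambda>(c, d). box c d :: 'a set))"
      unfolding Int_stable_def by (auto simp: box_Int_box)
    moreover have "range (\<lambda>(c, d). box c d) \<subseteq> Pow (UNIV :: 'a set)" by simp
    moreover have "A \<in> sigma_sets UNIV (range (\<lambda>(c, d). box c d))"
      using that unfolding borel_eq_box by simp
    ultimately show ?thesis
    proof (induction rule: sigma_sets_induct_disjoint)
      case (basic A) then show ?case using box0 by force
    next
      case empty then show ?case by simp
    next
      case (compl A)
      then have A: "A \<in> sets lborel" unfolding sets_lborel borel_eq_box by simp
      have "(\<integral>x. indicator (UNIV - A) x *\<^sub>R ?G x \<partial>lborel) = (\<integral>x. ?G x - indicator A x *\<^sub>R ?G x \<partial>lborel)"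
        by (intro Bochner_Integration.integral_cong) (auto simp: indicator_def)
      also have "\<dots> = (\<integral>x. ?G x \<partial>lborel) - (\<integral>x. indicator A x *\<^sub>R ?G x \<partial>lborel)"
        by (intro Bochner_Integration.integral_diff G integrable_mult_indicator A)
      finally show ?case using compl.IH integral_box_eq_0[OF F \<Omega> zero ab] by simp
    next
      case (union A)
      have A: "A i \<in> sets lborel" for i using union(2) unfolding sets_lborel borel_eq_box by auto
      have "set_lebesgue_integral lborel (\<Union>i. A i) ?G = (\<Sum>i. set_lebesgue_integral lborel (A i) ?G)"
      proof (rule lebesgue_integral_countable_add)
        show "A i \<in> sets lborel" for i by (rule A)
        show "A i \<inter> A j = {}" if "i \<noteq> j" for i j using union(1) that by (auto simp: disjoint_family_on_def)
        show "set_integrable lborel (\<Union>i. A i) ?G"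
          unfolding set_integrable_def by (intro integrable_mult_indicator G sets.countable_UN) (use A in auto)
      qed
      then show ?case using union(3) unfolding set_lebesgue_integral_def by simp
    qed
  qed
  have "AE x in lborel. ?G x = 0"
    by (rule sigma_finite_measure.density_zero[OF sigma_finite_lborel G]) (use set0 in \<open>simp add: set_lebesgue_integral_def\<close>)
  moreover have "AE x in lborel. x \<notin> cbox a b - box a b"
    by (rule AE_not_in[OF cbox_minus_box_null])
  ultimately show ?thesis by eventually_elim auto
qed

text \<open>An open set is a countable union of closed boxes, so the exceptional null sets of the
  single boxes can be united.\<close>

lemma fundamental_lemma:
  fixes F :: "'a::euclidean_space \<Rightarrow> 'b::{banach, second_countable_topology}"
  assumes F: "loc_integrable \<Omega> F" and \<Omega>: "open \<Omega>"
    and zero: "\<And>\<phi> :: 'a \<Rightarrow> real. \<phi> \<in> test_functions \<Omega> \<Longrightarrow> (\<integral>x. \<phi> x *\<^sub>R F x \<partial>lborel_on \<Omega>) = 0"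
  shows "AE x in lborel_on \<Omega>. F x = 0"
proof -
  obtain D where D: "countable D" "D \<subseteq> Pow \<Omega>" "\<And>X. X \<in> D \<Longrightarrow> \<exists>a b. X = cbox a b" "\<Union>D = \<Omega>"
    by (rule open_countable_Union_open_cbox[OF \<Omega>]) blast
  have "AE x in lborel. \<forall>X\<in>D. x \<in> X \<longrightarrow> F x = 0"
    unfolding AE_ball_countable[OF D(1)]
  proof
    fix X assume X: "X \<in> D"
    then obtain a b where ab: "X = cbox a b" using D(3) by blast
    show "AE x in lborel. x \<in> X \<longrightarrow> F x = 0"
      unfolding ab by (rule fundamental_lemma_cbox[OF F \<Omega> zero]) (use X D(2) ab in auto)
  qed
  then have "AE x in lborel. x \<in> \<Omega> \<longrightarrow> F x = 0" by eventually_elim (use D(4) in blast)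
  then show ?thesis using \<Omega> by (subst AE_restrict_space_iff) auto
qed

section \<open>Local integrability\<close>

lemma open_inter_space_lborel: "open \<Omega> \<Longrightarrow> \<Omega> \<inter> space lborel \<in> sets lborel"
  by simp

text \<open>On a compact set, which has finite measure, the modulus is dominated by 1 plus its
  square.\<close>

lemma L2_loc_integrable:
  assumes f: "f \<in> L2 (lborel_on \<Omega>)" and \<Omega>: "open \<Omega>" shows "loc_integrable \<Omega> f"
  unfolding loc_integrable_def
proof (intro allI impI)
  fix K assume K: "compact K \<and> K \<subseteq> \<Omega>"
  then have KB: "K \<in> sets lborel" by (simp add: compact_imp_closed borel_closed)
  have m: "(\<lambda>x. indicator \<Omega> x *\<^sub>R f x) \<in> borel_measurable lborel"
    using L2_measurable[OF f] by (subst (asm) borel_measurable_restrict_space_iff[OF open_inter_space_lborel[OF \<Omega>]]) simp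
  have i: "integrable lborel (\<lambda>x. indicator \<Omega> x *\<^sub>R (norm (f x))^2)"
    using L2_integrable_sq[OF f] by (simp add: integrable_restrict_space[OF open_inter_space_lborel[OF \<Omega>]])
  have "integrable lborel (indicator K :: _ \<Rightarrow> real)"
    using K emeasure_compact_finite[of K] KB by (intro integrable_real_indicator) (auto simp: less_top)
  with i have "integrable lborel (\<lambda>x. indicator K x + indicator \<Omega> x *\<^sub>R (norm (f x))^2)" by (intro Bochner_Integration.integrable_add)
  then have "integrable lborel (\<lambda>x. indicator K x *\<^sub>R (indicator \<Omega> x *\<^sub>R f x))"
  proof (rule Bochner_Integration.integrable_bound)
    show "(\<lambda>x. indicator K x *\<^sub>R (indicator \<Omega> x *\<^sub>R f x)) \<in> borel_measurable lborel"
      using KB by (intro borel_measurable_scaleR m borel_measurable_indicator)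
    have "t \<le> 1 + t^2" for t :: real using zero_le_power2[of "t - 1/2"] by (simp add: power2_eq_square algebra_simps)
    then show "AE x in lborel. norm (indicator K x *\<^sub>R (indicator \<Omega> x *\<^sub>R f x)) \<le> norm (indicator K x + indicator \<Omega> x *\<^sub>R (norm (f x))^2)"
      by (intro AE_I2) (auto simp: indicator_def)
  qed
  moreover have "(\<lambda>x. indicator K x *\<^sub>R (indicator \<Omega> x *\<^sub>R f x)) = (\<lambda>x. indicator K x *\<^sub>R f x)"
    using K by (auto simp: indicator_def fun_eq_iff)
  ultimately show "set_integrable lborel K f" by (simp add: set_integrable_def)
qed

lemma loc_integrable_diff: "loc_integrable \<Omega> f \<Longrightarrow> loc_integrable \<Omega> g \<Longrightarrow> loc_integrable \<Omega> (\<lambda>x. f x - g x)"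
  unfolding loc_integrable_def by (blast intro: set_integral_diff(1))

lemma loc_integrable_test:
  fixes \<phi> :: "_ \<Rightarrow> real"
  assumes "loc_integrable \<Omega> f" "\<phi> \<in> test_functions \<Omega>" "open \<Omega>"
  shows "integrable (lborel_on \<Omega>) (\<lambda>x. \<phi> x *\<^sub>R f x)"
proof -
  obtain K where K: "compact K" "K \<subseteq> \<Omega>" "\<And>x. x \<notin> K \<Longrightarrow> \<phi> x = 0" by (rule test_functionsE[OF assms(2)]) blast
  obtain C where C: "C > 0" "\<And>x. norm (\<phi> x) \<le> C" by (rule test_functions_bounded[OF assms(2)]) blast
  have i: "integrable lborel (\<lambda>x. indicator K x *\<^sub>R f x)"
    using assms(1) K unfolding loc_integrable_def set_integrable_def by blast
  have "integrable lborel (\<lambda>x. \<phi> x *\<^sub>R (indicator K x *\<^sub>R f x))"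
  proof (rule Bochner_Integration.integrable_bound)
    show "integrable lborel (\<lambda>x. C *\<^sub>R (indicator K x *\<^sub>R f x))" by (rule integrable_scaleR_right[OF i])
    show "(\<lambda>x. \<phi> x *\<^sub>R (indicator K x *\<^sub>R f x)) \<in> borel_measurable lborel"
      using test_functions_borel[OF assms(2)] by (intro borel_measurable_scaleR[OF _ borel_measurable_integrable[OF i]]) simp
    show "AE x in lborel. norm (\<phi> x *\<^sub>R (indicator K x *\<^sub>R f x)) \<le> norm (C *\<^sub>R (indicator K x *\<^sub>R f x))"
    proof (rule AE_I2)
      fix x
      have "\<bar>\<phi> x\<bar> * norm (indicator K x *\<^sub>R f x) \<le> \<bar>C\<bar> * norm (indicator K x *\<^sub>R f x)"
        using C(1) C(2)[of x] by (intro mult_right_mono) auto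
      then show "norm (\<phi> x *\<^sub>R (indicator K x *\<^sub>R f x)) \<le> norm (C *\<^sub>R (indicator K x *\<^sub>R f x))"
        unfolding norm_scaleR[of "\<phi> x"] norm_scaleR[of C] .
    qed
  qed
  moreover have "(\<lambda>x. \<phi> x *\<^sub>R (indicator K x *\<^sub>R f x)) = (\<lambda>x. indicator \<Omega> x *\<^sub>R (\<phi> x *\<^sub>R f x))"
    using K(2,3) by (auto simp: indicator_def fun_eq_iff)
  ultimately show ?thesis by (simp add: integrable_restrict_space[OF open_inter_space_lborel[OF assms(3)]])
qed

text \<open>\<open>wderiv\<close> is chosen among weak derivatives, of which only local
  integrability is known; its measurability has to come from there. Exhausting
  \<open>\<Omega>\<close> by compact sets writes the zero extension as a pointwise limit of
  measurable functions. The empty set is treated apart, as it has no nonempty exhaustion to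
  enumerate.\<close>

lemma loc_integrable_measurable:
  fixes f :: "'a::euclidean_space \<Rightarrow> 'b::{banach, second_countable_topology}"
  assumes f: "loc_integrable \<Omega> f" and \<Omega>: "open \<Omega>" shows "f \<in> borel_measurable (lborel_on \<Omega>)"
proof (cases "\<Omega> = {}")
  case True
  then show ?thesis by (intro measurableI) (auto simp: space_restrict_space sets_restrict_space)
next
  case False
  obtain D where D: "countable D" "D \<subseteq> Pow \<Omega>" "\<And>X. X \<in> D \<Longrightarrow> \<exists>a b. X = cbox a b" "\<Union>D = \<Omega>"
    by (rule open_countable_Union_open_cbox[OF \<Omega>]) blast
  have "D \<noteq> {}" using D(4) False by auto
  then obtain X :: "nat \<Rightarrow> 'a set" where X: "range X = D" using D(1) by (metis uncountable_def)
  let ?K = "\<lambda>n. \<Union>i\<le>n. X i"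
  have K: "compact (?K n)" "?K n \<subseteq> \<Omega>" for n
    using X D(2,3) by (auto intro!: compact_UN) (metis compact_cbox rangeI)
  have "(\<lambda>x. indicator (?K n) x *\<^sub>R f x) \<in> borel_measurable lborel" for n
    using f K[of n] unfolding loc_integrable_def set_integrable_def by (blast intro: borel_measurable_integrable)
  moreover have "(\<lambda>n. indicator (?K n) x *\<^sub>R f x) \<longlonglongrightarrow> indicator \<Omega> x *\<^sub>R f x" for x
  proof (cases "x \<in> \<Omega>")
    case True
    then obtain i where "x \<in> X i" using D(4) X by auto
    then have "\<forall>\<^sub>F n in sequentially. indicator (?K n) x *\<^sub>R f x = indicator \<Omega> x *\<^sub>R f x"
      using True by (intro eventually_sequentiallyI[of i]) (auto simp: indicator_def)
    then show ?thesis by (rule tendsto_eventually)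
  next
    case False
    then have "x \<notin> ?K n" for n using K(2) by blast
    then show ?thesis using False by simp
  qed
  ultimately have "(\<lambda>x. indicator \<Omega> x *\<^sub>R f x) \<in> borel_measurable lborel"
    by (rule borel_measurable_LIMSEQ_metric)
  then show ?thesis by (simp add: borel_measurable_restrict_space_iff[OF open_inter_space_lborel[OF \<Omega>]])
qed

section \<open>Weak derivatives of square-integrable functions\<close>

lemma test_functions_L2:
  fixes \<phi> :: "'a::euclidean_space \<Rightarrow> complex"
  assumes "\<phi> \<in> test_functions \<Omega>'" "open \<Omega>" shows "\<phi> \<in> L2 (lborel_on \<Omega>)"
proof -
  have "(\<lambda>x. cnj (\<phi> x) * \<phi> x) \<in> test_functions \<Omega>'"
    by (intro test_functions_mult assms smooth_cnj test_functions_smooth[OF assms(1)])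
  then have "(\<lambda>x. Re (cnj (\<phi> x) * \<phi> x)) \<in> test_functions \<Omega>'"
    by (rule test_functions_compose_linear[OF _ bounded_linear_Re])
  then have i: "integrable lborel (\<lambda>x. Re (cnj (\<phi> x) * \<phi> x))" by (rule test_functions_integrable)
  have e: "Re (cnj (\<phi> x) * \<phi> x) = (norm (\<phi> x))^2" for x using cmod_power2[of "\<phi> x"] by (simp add: power2_eq_square)
  have "integrable lborel (\<lambda>x. (norm (\<phi> x))^2)" using i unfolding e .
  then have "integrable lborel (\<lambda>x. indicator \<Omega> x *\<^sub>R (norm (\<phi> x))^2)"
    using assms(2) by (intro integrable_mult_indicator) simp_all
  then have "integrable (lborel_on \<Omega>) (\<lambda>x. (norm (\<phi> x))^2)"
    by (simp add: integrable_restrict_space[OF open_inter_space_lborel[OF assms(2)]])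
  moreover have "\<phi> \<in> borel_measurable (lborel_on \<Omega>)"
    using test_functions_borel[OF assms(1)] by (intro measurable_restrict_space1) simp
  ultimately show ?thesis by (simp add: L2_def)
qed

text \<open>The definition tests with real functions. Applied to the real and the imaginary part of
  \<open>\<phi>\<close> it gives the sesquilinear identity, which is the working form from here
  on.\<close>

lemma weak_deriv_inner:
  fixes f g :: "'a::euclidean_space \<Rightarrow> complex"
  assumes w: "weak_deriv \<Omega> v f g" and \<phi>: "\<phi> \<in> test_functions \<Omega>" and \<Omega>: "open \<Omega>"
    and f: "f \<in> L2 (lborel_on \<Omega>)" and g: "g \<in> L2 (lborel_on \<Omega>)"
  shows "l2_inner (lborel_on \<Omega>) (dir_deriv v \<phi>) f = - l2_inner (lborel_on \<Omega>) \<phi> g"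
proof -
  let ?M = "lborel_on \<Omega>"
  let ?R = "\<lambda>x. Re (\<phi> x)" and ?I = "\<lambda>x. Im (\<phi> x)"
  have s: "smooth \<phi>" by (rule test_functions_smooth[OF \<phi>])
  have R: "?R \<in> test_functions \<Omega>" and I: "?I \<in> test_functions \<Omega>"
    using test_functions_compose_linear[OF \<phi> bounded_linear_Re] test_functions_compose_linear[OF \<phi> bounded_linear_Im] by auto
  have split: "l2_inner ?M \<psi> h = (\<integral>x. Re (\<psi> x) *\<^sub>R h x \<partial>?M) - \<i> * (\<integral>x. Im (\<psi> x) *\<^sub>R h x \<partial>?M)"
    if h: "h \<in> L2 ?M" and \<psi>: "\<psi> \<in> test_functions \<Omega>" for \<psi> h
  proof -
    have i: "integrable ?M (\<lambda>x. Re (\<psi> x) *\<^sub>R h x)" "integrable ?M (\<lambda>x. Im (\<psi> x) *\<^sub>R h x)"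
      by (intro loc_integrable_test L2_loc_integrable h \<Omega> test_functions_compose_linear[OF \<psi>] bounded_linear_Re bounded_linear_Im)+
    have "(\<integral>x. Re (\<psi> x) *\<^sub>R h x - \<i> * (Im (\<psi> x) *\<^sub>R h x) \<partial>?M) = (\<integral>x. Re (\<psi> x) *\<^sub>R h x \<partial>?M) - \<i> * (\<integral>x. Im (\<psi> x) *\<^sub>R h x \<partial>?M)"
      using Bochner_Integration.integral_diff[OF i(1) integrable_mult_right[OF i(2), of \<i>]]
      unfolding integral_mult_right_zero .
    moreover have "cnj (\<psi> x) * h x = Re (\<psi> x) *\<^sub>R h x - \<i> * (Im (\<psi> x) *\<^sub>R h x)" for x
      by (simp add: complex_eq_iff)
    ultimately show ?thesis unfolding l2_inner_def by simp
  qed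
  have "(\<integral>x. dir_deriv v ?R x *\<^sub>R f x \<partial>?M) = - (\<integral>x. ?R x *\<^sub>R g x \<partial>?M)"
    "(\<integral>x. dir_deriv v ?I x *\<^sub>R f x \<partial>?M) = - (\<integral>x. ?I x *\<^sub>R g x \<partial>?M)"
    using w R I unfolding weak_deriv_def by blast+
  then have "(\<integral>x. Re (dir_deriv v \<phi> x) *\<^sub>R f x \<partial>?M) = - (\<integral>x. ?R x *\<^sub>R g x \<partial>?M)"
    "(\<integral>x. Im (dir_deriv v \<phi> x) *\<^sub>R f x \<partial>?M) = - (\<integral>x. ?I x *\<^sub>R g x \<partial>?M)"
    unfolding dir_deriv_bounded_linear[OF bounded_linear_Re s] dir_deriv_bounded_linear[OF bounded_linear_Im s] .
  then show ?thesis
    unfolding split[OF f test_functions_dir_deriv[OF \<phi>]] split[OF g \<phi>] by simp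
qed

lemma weak_derivI:
  fixes f g :: "'a::euclidean_space \<Rightarrow> complex"
  assumes \<Omega>: "open \<Omega>" and f: "f \<in> L2 (lborel_on \<Omega>)" and g: "g \<in> L2 (lborel_on \<Omega>)"
    and w: "\<And>\<phi>. \<phi> \<in> test_functions \<Omega> \<Longrightarrow> l2_inner (lborel_on \<Omega>) (dir_deriv v \<phi>) f = - l2_inner (lborel_on \<Omega>) \<phi> g"
  shows "weak_deriv \<Omega> v f g"
  unfolding weak_deriv_def
proof (intro conjI allI impI)
  show "loc_integrable \<Omega> f" "loc_integrable \<Omega> g" by (intro L2_loc_integrable f g \<Omega>)+
  fix \<phi> :: "'a \<Rightarrow> real" assume \<phi>: "\<phi> \<in> test_functions \<Omega>"
  have "(\<lambda>x. complex_of_real (\<phi> x)) \<in> test_functions \<Omega>"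
    by (rule test_functions_compose_linear[OF \<phi> bounded_linear_of_real])
  from w[OF this] show "(\<integral>x. dir_deriv v \<phi> x *\<^sub>R f x \<partial>lborel_on \<Omega>) = - (\<integral>x. \<phi> x *\<^sub>R g x \<partial>lborel_on \<Omega>)"
    unfolding l2_inner_def dir_deriv_bounded_linear[OF bounded_linear_of_real test_functions_smooth[OF \<phi>]]
    by (simp add: scaleR_conv_of_real)
qed

lemma weak_deriv_unique:
  fixes f g :: "'a::euclidean_space \<Rightarrow> complex"
  assumes g: "weak_deriv \<Omega> v f g" and g': "weak_deriv \<Omega> v f g'" and \<Omega>: "open \<Omega>"
  shows "AE x in lborel_on \<Omega>. g x = g' x"
proof -
  have l: "loc_integrable \<Omega> g" "loc_integrable \<Omega> g'" using g g' by (auto simp: weak_deriv_def)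
  have "AE x in lborel_on \<Omega>. g x - g' x = 0"
  proof (rule fundamental_lemma[OF loc_integrable_diff[OF l] \<Omega>])
    fix \<phi> :: "'a \<Rightarrow> real" assume \<phi>: "\<phi> \<in> test_functions \<Omega>"
    have "(\<integral>x. \<phi> x *\<^sub>R (g x - g' x) \<partial>lborel_on \<Omega>) = (\<integral>x. \<phi> x *\<^sub>R g x \<partial>lborel_on \<Omega>) - (\<integral>x. \<phi> x *\<^sub>R g' x \<partial>lborel_on \<Omega>)"
      unfolding scaleR_diff_right using l by (intro Bochner_Integration.integral_diff loc_integrable_test \<phi> \<Omega>)
    moreover have "(\<integral>x. dir_deriv v \<phi> x *\<^sub>R f x \<partial>lborel_on \<Omega>) = - (\<integral>x. \<phi> x *\<^sub>R g x \<partial>lborel_on \<Omega>)"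
      using g \<phi> unfolding weak_deriv_def by blast
    moreover have "(\<integral>x. dir_deriv v \<phi> x *\<^sub>R f x \<partial>lborel_on \<Omega>) = - (\<integral>x. \<phi> x *\<^sub>R g' x \<partial>lborel_on \<Omega>)"
      using g' \<phi> unfolding weak_deriv_def by blast
    ultimately show "(\<integral>x. \<phi> x *\<^sub>R (g x - g' x) \<partial>lborel_on \<Omega>) = 0" by simp
  qed
  then show ?thesis by simp
qed

lemma wderiv_weak_deriv: "weak_deriv \<Omega> v f g \<Longrightarrow> weak_deriv \<Omega> v f (wderiv \<Omega> v f)"
  unfolding wderiv_def by (rule someI[of "weak_deriv \<Omega> v f"])

lemma wderiv_AE_eq:
  "weak_deriv \<Omega> v f g \<Longrightarrow> open \<Omega> \<Longrightarrow> AE x in lborel_on \<Omega>. wderiv \<Omega> v f x = g x"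
  by (rule weak_deriv_unique[OF wderiv_weak_deriv])

lemma wderiv_L2:
  assumes "weak_deriv \<Omega> v f g" "open \<Omega>" "g \<in> L2 (lborel_on \<Omega>)" shows "wderiv \<Omega> v f \<in> L2 (lborel_on \<Omega>)"
proof (rule L2_cong[OF assms(3)])
  show "wderiv \<Omega> v f \<in> borel_measurable (lborel_on \<Omega>)"
    using wderiv_weak_deriv[OF assms(1)] by (intro loc_integrable_measurable assms(2)) (simp add: weak_deriv_def)
  show "AE x in lborel_on \<Omega>. g x = wderiv \<Omega> v f x" using wderiv_AE_eq[OF assms(1,2)] by eventually_elim simp
qed

lemma weak_deriv_add:
  assumes "weak_deriv \<Omega> v f g" "weak_deriv \<Omega> v f' g'" "open \<Omega>"
    and L2: "f \<in> L2 (lborel_on \<Omega>)" "g \<in> L2 (lborel_on \<Omega>)" "f' \<in> L2 (lborel_on \<Omega>)" "g' \<in> L2 (lborel_on \<Omega>)"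
  shows "weak_deriv \<Omega> v (\<lambda>x. f x + c * f' x) (\<lambda>x. g x + c * g' x)"
proof (rule weak_derivI)
  fix \<phi> :: "_ \<Rightarrow> complex" assume \<phi>: "\<phi> \<in> test_functions \<Omega>"
  have [simp]: "\<phi> \<in> L2 (lborel_on \<Omega>)" "dir_deriv v \<phi> \<in> L2 (lborel_on \<Omega>)"
    using \<phi> assms(3) by (auto intro: test_functions_L2 test_functions_dir_deriv)
  show "l2_inner (lborel_on \<Omega>) (dir_deriv v \<phi>) (\<lambda>x. f x + c * f' x) = - l2_inner (lborel_on \<Omega>) \<phi> (\<lambda>x. g x + c * g' x)"
    using weak_deriv_inner[OF assms(1) \<phi> assms(3) L2(1,2)] weak_deriv_inner[OF assms(2) \<phi> assms(3) L2(3,4)]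
    by (simp add: l2_inner_add_right L2)
qed (intro L2_add L2_cmult L2 assms)+

lemma weak_deriv_cong:
  assumes "weak_deriv \<Omega> v f g" "open \<Omega>" "f \<in> L2 (lborel_on \<Omega>)" "g \<in> L2 (lborel_on \<Omega>)"
    "f' \<in> L2 (lborel_on \<Omega>)" "g' \<in> L2 (lborel_on \<Omega>)"
    "AE x in lborel_on \<Omega>. f x = f' x" "AE x in lborel_on \<Omega>. g x = g' x"
  shows "weak_deriv \<Omega> v f' g'"
proof (rule weak_derivI)
  fix \<phi> :: "_ \<Rightarrow> complex" assume \<phi>: "\<phi> \<in> test_functions \<Omega>"
  have m: "\<phi> \<in> borel_measurable (lborel_on \<Omega>)" "dir_deriv v \<phi> \<in> borel_measurable (lborel_on \<Omega>)"
    using \<phi> assms(2) by (auto intro!: L2_measurable test_functions_L2 test_functions_dir_deriv)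
  have "l2_inner (lborel_on \<Omega>) (dir_deriv v \<phi>) f' = l2_inner (lborel_on \<Omega>) (dir_deriv v \<phi>) f"
    using assms by (intro l2_inner_cong m L2_measurable) auto
  moreover have "l2_inner (lborel_on \<Omega>) \<phi> g' = l2_inner (lborel_on \<Omega>) \<phi> g"
    using assms by (intro l2_inner_cong m L2_measurable) auto
  ultimately show "l2_inner (lborel_on \<Omega>) (dir_deriv v \<phi>) f' = - l2_inner (lborel_on \<Omega>) \<phi> g'"
    using weak_deriv_inner[OF assms(1) \<phi> assms(2-4)] by simp
qed (use assms in auto)

text \<open>For a fixed test function both sides of the weak identity are continuous in L2. This is
  what keeps limits of approximating and of minimising sequences inside the Sobolev space.\<close>

lemma weak_deriv_closed:
  assumes w: "\<And>n. weak_deriv \<Omega> v (f n) (g n)" and \<Omega>: "open \<Omega>"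
    and L2: "\<And>n. f n \<in> L2 (lborel_on \<Omega>)" "\<And>n. g n \<in> L2 (lborel_on \<Omega>)" "F \<in> L2 (lborel_on \<Omega>)" "G \<in> L2 (lborel_on \<Omega>)"
    and lim: "(\<lambda>n. l2_norm (lborel_on \<Omega>) (\<lambda>x. f n x - F x)) \<longlonglongrightarrow> 0" "(\<lambda>n. l2_norm (lborel_on \<Omega>) (\<lambda>x. g n x - G x)) \<longlonglongrightarrow> 0"
  shows "weak_deriv \<Omega> v F G"
proof (rule weak_derivI)
  fix \<phi> :: "_ \<Rightarrow> complex" assume \<phi>: "\<phi> \<in> test_functions \<Omega>"
  have L2\<phi>: "\<phi> \<in> L2 (lborel_on \<Omega>)" "dir_deriv v \<phi> \<in> L2 (lborel_on \<Omega>)"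
    using \<phi> \<Omega> by (auto intro: test_functions_L2 test_functions_dir_deriv)
  have zero: "(\<lambda>n. l2_norm (lborel_on \<Omega>) (\<lambda>x. \<psi> x - \<psi> x)) \<longlonglongrightarrow> 0" for \<psi> by (simp add: l2_norm_def)
  have "(\<lambda>n. l2_inner (lborel_on \<Omega>) (dir_deriv v \<phi>) (f n)) \<longlonglongrightarrow> l2_inner (lborel_on \<Omega>) (dir_deriv v \<phi>) F"
    by (rule l2_inner_tendsto[OF L2\<phi>(2) L2\<phi>(2) L2(1) L2(3) zero lim(1)])
  then have 1: "(\<lambda>n. - l2_inner (lborel_on \<Omega>) \<phi> (g n)) \<longlonglongrightarrow> l2_inner (lborel_on \<Omega>) (dir_deriv v \<phi>) F"
    unfolding weak_deriv_inner[OF w \<phi> \<Omega> L2(1,2)] .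
  have "(\<lambda>n. - l2_inner (lborel_on \<Omega>) \<phi> (g n)) \<longlonglongrightarrow> - l2_inner (lborel_on \<Omega>) \<phi> G"
    by (rule tendsto_minus[OF l2_inner_tendsto[OF L2\<phi>(1) L2\<phi>(1) L2(2) L2(4) zero lim(2)]])
  with 1 show "l2_inner (lborel_on \<Omega>) (dir_deriv v \<phi>) F = - l2_inner (lborel_on \<Omega>) \<phi> G"
    by (rule LIMSEQ_unique)
qed (intro \<Omega> L2)+

section \<open>Translation invariance and integration by parts\<close>

lemma integral_translate:
  fixes f :: "'a::euclidean_space \<Rightarrow> 'b::{banach, second_countable_topology}"
  assumes [measurable]: "f \<in> borel_measurable borel"
  shows "(\<integral>x. f (x + c) \<partial>lborel) = (\<integral>x. f x \<partial>lborel)"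
    and "integrable lborel (\<lambda>x. f (x + c)) \<longleftrightarrow> integrable lborel f"
proof -
  have m: "(+) c \<in> measurable lborel borel" by measurable
  have "(\<integral>x. f x \<partial>lborel) = (\<integral>x. f x \<partial>distr lborel borel ((+) c))" by (simp add: lborel_distr_plus)
  also have "\<dots> = (\<integral>x. f (c + x) \<partial>lborel)" by (rule integral_distr[OF m assms])
  finally show "(\<integral>x. f (x + c) \<partial>lborel) = (\<integral>x. f x \<partial>lborel)" by (simp add: add.commute)
  have "integrable lborel f \<longleftrightarrow> integrable (distr lborel borel ((+) c)) f" by (simp add: lborel_distr_plus)
  also have "\<dots> \<longleftrightarrow> integrable lborel (\<lambda>x. f (c + x))" by (rule integrable_distr_eq[OF m assms])
  finally show "integrable lborel (\<lambda>x. f (x + c)) \<longleftrightarrow> integrable lborel f" by (simp add: add.commute)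
qed

lemma difference_quotient_tendsto:
  assumes "smooth f"
  shows "(\<lambda>n. real (Suc n) *\<^sub>R (f (x + (1 / real (Suc n)) *\<^sub>R v) - f x)) \<longlonglongrightarrow> dir_deriv v f x"
proof -
  have "((\<lambda>t. x + t *\<^sub>R v) has_derivative (\<lambda>t. t *\<^sub>R v)) (at 0)"
    by (auto intro!: derivative_eq_intros)
  moreover have "(f has_derivative (\<lambda>v. dir_deriv v f x)) (at (x + 0 *\<^sub>R v))"
    using smooth_has_derivative[OF assms] by simp
  ultimately have "((\<lambda>t. f (x + t *\<^sub>R v)) has_derivative (\<lambda>t. dir_deriv (t *\<^sub>R v) f x)) (at 0)"
    by (rule has_derivative_compose)
  moreover have "dir_deriv (t *\<^sub>R v) f x = t *\<^sub>R dir_deriv v f x" for t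
    using has_derivative_linear[OF smooth_has_derivative[OF assms]] linear_scale by fastforce
  ultimately have "((\<lambda>t. f (x + t *\<^sub>R v)) has_derivative (\<lambda>t. t *\<^sub>R dir_deriv v f x)) (at 0)"
    by simp
  then have lim: "((\<lambda>t. norm (f (x + (0 + t) *\<^sub>R v) - f (x + 0 *\<^sub>R v) - t *\<^sub>R dir_deriv v f x) / norm t) \<longlongrightarrow> 0) (at 0)"
    unfolding has_derivative_at by blast
  have "filterlim (\<lambda>n. 1 / real (Suc n)) (at 0) sequentially"
    unfolding filterlim_at using LIMSEQ_Suc[OF lim_1_over_n] by simp
  from filterlim_compose[OF lim this]
  have lim': "(\<lambda>n. norm (f (x + (1 / real (Suc n)) *\<^sub>R v) - f x - (1 / real (Suc n)) *\<^sub>R dir_deriv v f x) / norm (1 / real (Suc n))) \<longlonglongrightarrow> 0"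
    by simp
  have eq: "norm (w - (1 / real (Suc n)) *\<^sub>R d) / norm (1 / real (Suc n)) = norm (real (Suc n) *\<^sub>R w - d)" for n and w d :: 'b
  proof -
    have "real (Suc n) *\<^sub>R w - d = real (Suc n) *\<^sub>R (w - (1 / real (Suc n)) *\<^sub>R d)"
      by (simp add: scaleR_diff_right)
    then have "norm (real (Suc n) *\<^sub>R w - d) = real (Suc n) * norm (w - (1 / real (Suc n)) *\<^sub>R d)"
      by (simp only: norm_scaleR abs_of_nat)
    then show ?thesis by simp
  qed
  have "(\<lambda>n. norm (real (Suc n) *\<^sub>R (f (x + (1 / real (Suc n)) *\<^sub>R v) - f x) - dir_deriv v f x)) \<longlonglongrightarrow> 0"
    using lim' unfolding eq .
  then show ?thesis by (simp only: tendsto_norm_zero_iff LIM_zero_iff)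
qed

text \<open>By translation invariance every difference quotient of \<open>f\<close> has integral
  zero, and the quotients converge dominatedly to the derivative. The argument treats all dimensions
  and directions alike.\<close>

lemma integral_dir_deriv_eq_0:
  fixes f :: "'a::euclidean_space \<Rightarrow> complex"
  assumes f: "f \<in> test_functions UNIV" shows "(\<integral>x. dir_deriv v f x \<partial>lborel) = 0"
proof -
  have b: "f \<in> borel_measurable borel" by (rule test_functions_borel[OF f])
  obtain L where L: "L > 0" "\<And>x y. norm (f x - f y) \<le> L * norm (x - y)" by (rule test_functions_Lipschitz[OF f]) blast
  obtain K where K: "compact K" "\<And>x. x \<notin> K \<Longrightarrow> f x = 0" by (rule test_functionsE[OF f]) blast
  obtain B where B: "\<And>x. x \<in> K \<Longrightarrow> norm x \<le> B" using compact_imp_bounded[OF K(1)] by (auto simp: bounded_iff)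
  let ?s = "\<lambda>n x. real (Suc n) *\<^sub>R (f (x + (1 / real (Suc n)) *\<^sub>R v) - f x)"
  have z: "(\<integral>x. ?s n x \<partial>lborel) = 0" for n
  proof -
    have i: "integrable lborel f" by (rule test_functions_integrable[OF f])
    have "(\<integral>x. f (x + (1 / real (Suc n)) *\<^sub>R v) - f x \<partial>lborel)
      = (\<integral>x. f (x + (1 / real (Suc n)) *\<^sub>R v) \<partial>lborel) - (\<integral>x. f x \<partial>lborel)"
      by (intro Bochner_Integration.integral_diff i) (simp only: integral_translate(2)[OF b] i)
    also have "\<dots> = 0" unfolding integral_translate(1)[OF b] by simp
    finally show ?thesis by simp
  qed
  have "(\<lambda>n. \<integral>x. ?s n x \<partial>lborel) \<longlonglongrightarrow> (\<integral>x. dir_deriv v f x \<partial>lborel)"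
  proof (rule integral_dominated_convergence)
    show "dir_deriv v f \<in> borel_measurable lborel"
      using test_functions_borel[OF test_functions_dir_deriv[OF f]] by simp
    show "?s n \<in> borel_measurable lborel" for n using b by measurable
    show "AE x in lborel. (\<lambda>n. ?s n x) \<longlonglongrightarrow> dir_deriv v f x"
      by (intro AE_I2 difference_quotient_tendsto test_functions_smooth[OF f])
    \<comment> \<open>The steps have length at most \<open>norm v\<close>, so a quotient can be
      nonzero only within that distance of \<open>K\<close>; the Lipschitz constant bounds it
      there.\<close>
    show "integrable lborel (\<lambda>x. L * norm v * indicator (cball 0 (B + norm v)) x)"
      using emeasure_compact_finite[OF compact_cball]
      by (intro integrable_mult_right integrable_real_indicator) (auto simp: less_top)
    show "AE x in lborel. norm (?s n x) \<le> L * norm v * indicator (cball 0 (B + norm v)) x" for n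
    proof (rule AE_I2)
      fix x
      have n: "norm ((1 / real (Suc n)) *\<^sub>R v) \<le> norm v"
      proof -
        have "1 / real (Suc n) \<le> 1" by simp
        then have "(1 / real (Suc n)) * norm v \<le> 1 * norm v" by (rule mult_right_mono) simp
        then show ?thesis by simp
      qed
      show "norm (?s n x) \<le> L * norm v * indicator (cball 0 (B + norm v)) x"
      proof (cases "x \<in> cball 0 (B + norm v)")
        case True
        have "norm (f (x + (1 / real (Suc n)) *\<^sub>R v) - f x) \<le> L * norm ((1 / real (Suc n)) *\<^sub>R v)"
          using L(2)[of "x + (1 / real (Suc n)) *\<^sub>R v" x] by (simp only: add_diff_cancel_left')
        then have "norm (?s n x) \<le> real (Suc n) * (L * norm ((1 / real (Suc n)) *\<^sub>R v))"
          unfolding norm_scaleR[of "real (Suc n)"] abs_of_nat by (rule mult_left_mono) simp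
        also have "\<dots> = L * norm v" by simp
        finally show ?thesis using True by simp
      next
        case False
        then have x: "norm x > B + norm v" by simp
        then have "x \<notin> K" using B[of x] norm_ge_zero[of v] by auto
        moreover have "x + (1 / real (Suc n)) *\<^sub>R v \<notin> K"
        proof
          assume "x + (1 / real (Suc n)) *\<^sub>R v \<in> K"
          then have "norm (x + (1 / real (Suc n)) *\<^sub>R v) \<le> B" by (rule B)
          moreover have "norm x - norm ((1 / real (Suc n)) *\<^sub>R v) \<le> norm (x + (1 / real (Suc n)) *\<^sub>R v)"
            by (metis add_diff_cancel norm_triangle_ineq2 norm_minus_commute diff_add_cancel norm_diff_ineq)
          ultimately show False using x n by linarith
        qed
        ultimately show ?thesis using K(2) False by simp
      qed
    qed
  qed
  then show ?thesis unfolding z by (simp add: LIMSEQ_const_iff)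
qed

text \<open>The product of \<open>f\<close> with the conjugate of \<open>\<phi>\<close> is a test
  function, so the integral of its derivative vanishes. Its support lies in \<open>\<Omega>\<close>,
  and integrating over the whole space changes nothing.\<close>

lemma integral_test_product:
  fixes \<phi> f :: "'a::euclidean_space \<Rightarrow> complex"
  assumes \<phi>: "\<phi> \<in> test_functions \<Omega>" and f: "smooth f" and \<Omega>: "open \<Omega>"
  shows "(\<integral>x. cnj (dir_deriv v \<phi> x) * f x \<partial>lborel_on \<Omega>) = - (\<integral>x. cnj (\<phi> x) * dir_deriv v f x \<partial>lborel_on \<Omega>)"
proof -
  have c: "(\<lambda>x. cnj (\<phi> x)) \<in> test_functions \<Omega>" by (rule test_functions_compose_linear[OF \<phi> bounded_linear_cnj])
  have p: "(\<lambda>x. f x * cnj (\<phi> x)) \<in> test_functions \<Omega>" by (rule test_functions_mult[OF c f])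
  have e: "(\<integral>x. h x \<partial>lborel_on \<Omega>) = (\<integral>x. h x \<partial>lborel)" if "\<And>x. x \<notin> \<Omega> \<Longrightarrow> h x = 0" for h :: "'a \<Rightarrow> complex"
    using that unfolding integral_restrict_space[OF open_inter_space_lborel[OF \<Omega>]]
    by (intro Bochner_Integration.integral_cong) (auto simp: indicator_def)
  obtain K where K: "K \<subseteq> \<Omega>" "\<And>x. x \<notin> K \<Longrightarrow> \<phi> x = 0" "\<And>x v. x \<notin> K \<Longrightarrow> dir_deriv v \<phi> x = 0"
    by (rule test_functionsE[OF \<phi>]) blast
  have i1: "integrable lborel (\<lambda>x. dir_deriv v f x * cnj (\<phi> x))"
    by (rule test_functions_integrable[OF test_functions_mult[OF c smooth_dir_deriv[OF f]]])
  have i2: "integrable lborel (\<lambda>x. f x * cnj (dir_deriv v \<phi> x))"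
    by (rule test_functions_integrable[OF test_functions_mult[OF
          test_functions_compose_linear[OF test_functions_dir_deriv[OF \<phi>] bounded_linear_cnj] f]])
  have "0 = (\<integral>x. dir_deriv v (\<lambda>x. f x * cnj (\<phi> x)) x \<partial>lborel)"
    using integral_dir_deriv_eq_0[OF test_functions_mono[OF p]] by simp
  also have "\<dots> = (\<integral>x. dir_deriv v f x * cnj (\<phi> x) + f x * cnj (dir_deriv v \<phi> x) \<partial>lborel)"
    by (simp add: dir_deriv_complex_mult[OF f test_functions_smooth[OF c]] dir_deriv_cnj[OF test_functions_smooth[OF \<phi>]])
  also have "\<dots> = (\<integral>x. dir_deriv v f x * cnj (\<phi> x) \<partial>lborel) + (\<integral>x. f x * cnj (dir_deriv v \<phi> x) \<partial>lborel)"
    by (rule Bochner_Integration.integral_add[OF i1 i2])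
  finally have "0 = (\<integral>x. cnj (\<phi> x) * dir_deriv v f x \<partial>lborel) + (\<integral>x. cnj (dir_deriv v \<phi> x) * f x \<partial>lborel)"
    unfolding mult.commute[of "dir_deriv v f _"] mult.commute[of "f _"] .
  then have eq: "(\<integral>x. cnj (dir_deriv v \<phi> x) * f x \<partial>lborel) = - (\<integral>x. cnj (\<phi> x) * dir_deriv v f x \<partial>lborel)"
    by (metis add.commute eq_neg_iff_add_eq_0)
  have out: "\<phi> x = 0" "dir_deriv v \<phi> x = 0" if "x \<notin> \<Omega>" for x
    using K(1) that by (auto intro: K(2,3))
  have "(\<integral>x. cnj (dir_deriv v \<phi> x) * f x \<partial>lborel_on \<Omega>) = (\<integral>x. cnj (dir_deriv v \<phi> x) * f x \<partial>lborel)"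
    by (rule e) (simp add: out)
  moreover have "(\<integral>x. cnj (\<phi> x) * dir_deriv v f x \<partial>lborel_on \<Omega>) = (\<integral>x. cnj (\<phi> x) * dir_deriv v f x \<partial>lborel)"
    by (rule e) (simp add: out)
  ultimately show ?thesis using eq by simp
qed

lemma test_functions_weak_deriv:
  fixes u :: "'a::euclidean_space \<Rightarrow> complex"
  assumes "u \<in> test_functions \<Omega>'" "open \<Omega>" shows "weak_deriv \<Omega> v u (dir_deriv v u)"
proof (rule weak_derivI)
  show "u \<in> L2 (lborel_on \<Omega>)" "dir_deriv v u \<in> L2 (lborel_on \<Omega>)"
    using assms by (auto intro: test_functions_L2 test_functions_dir_deriv)
  fix \<phi> :: "'a \<Rightarrow> complex" assume "\<phi> \<in> test_functions \<Omega>"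
  then show "l2_inner (lborel_on \<Omega>) (dir_deriv v \<phi>) u = - l2_inner (lborel_on \<Omega>) \<phi> (dir_deriv v u)"
    unfolding l2_inner_def by (intro integral_test_product test_functions_smooth[OF assms(1)] assms(2))
qed (rule assms)

subsection \<open>Representation of functionals bounded on test functions\<close>

text \<open>The minimisation runs in the incomplete space of test functions, and completeness of
  \<open>L2\<close> is used only for the limit. The approximating sequence is part of the conclusion
  because it yields density of the test functions as a by-product.\<close>

lemma test_functions_riesz:
  fixes F :: "('a::euclidean_space \<Rightarrow> complex) \<Rightarrow> real"
  assumes \<Omega>: "open \<Omega>"
    and F_add: "\<And>u v t. u \<in> test_functions \<Omega> \<Longrightarrow> v \<in> test_functions \<Omega> \<Longrightarrow> F (\<lambda>z. u z + complex_of_real t * v z) = F u + t * F v"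
    and F_bound: "\<And>u. u \<in> test_functions \<Omega> \<Longrightarrow> \<bar>F u\<bar> \<le> C * l2_norm (lborel_on \<Omega>) u"
  obtains k u where "k \<in> L2 (lborel_on \<Omega>)" "\<And>n. u n \<in> test_functions \<Omega>"
    "(\<lambda>n. l2_norm (lborel_on \<Omega>) (\<lambda>x. u n x - k x)) \<longlonglongrightarrow> 0"
    "\<And>\<phi>. \<phi> \<in> test_functions \<Omega> \<Longrightarrow> F \<phi> = Re (l2_inner (lborel_on \<Omega>) \<phi> k)"
proof -
  let ?M = "lborel_on \<Omega>" and ?V = "test_functions \<Omega> :: ('a \<Rightarrow> complex) set"
  let ?B = "\<lambda>u v. Re (l2_inner ?M u v)"
  have L2: "u \<in> L2 ?M" if "u \<in> ?V" for u using that \<Omega> by (rule test_functions_L2)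
  have Buu: "?B u u = (l2_norm ?M u)^2" for u by (simp add: l2_inner_self)
  obtain u where u: "\<And>n. u n \<in> ?V"
    and d: "\<And>m n. ?B (\<lambda>z. u m z - u n z) (\<lambda>z. u m z - u n z) \<le> 2 / Suc m + 2 / Suc n"
    and lim: "\<And>v. v \<in> ?V \<Longrightarrow> (\<lambda>n. ?B v (u n)) \<longlonglongrightarrow> F v"
  proof (rule riesz_minimizing_sequence[of ?V ?B F "C^2"])
    show "(\<lambda>z. 0) \<in> ?V" by (rule test_functions_zero)
    show "(\<lambda>z. u z + complex_of_real t * v z) \<in> ?V" if "u \<in> ?V" "v \<in> ?V" for u v t
      by (intro test_functions_add test_functions_mult that smooth_const)
    show "?B w (\<lambda>z. u z + complex_of_real t * v z) = ?B w u + t * ?B w v" if "u \<in> ?V" "v \<in> ?V" "w \<in> ?V" for u v w t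
      using that by (simp add: l2_inner_add_right L2)
    show "?B u v = ?B v u" for u v by (subst l2_inner_commute[symmetric]) simp
    show "0 \<le> ?B u u" for u by (simp add: Buu)
    show "F (\<lambda>z. u z + complex_of_real t * v z) = F u + t * F v" if "u \<in> ?V" "v \<in> ?V" for u v t
      using that by (rule F_add)
    show "(F u)^2 \<le> C^2 * ?B u u" if "u \<in> ?V" for u
    proof -
      have "\<bar>F u\<bar>^2 \<le> (C * l2_norm ?M u)^2" by (rule power_mono[OF F_bound[OF that]]) simp
      then show ?thesis unfolding Buu by (simp add: power_mult_distrib)
    qed
  qed blast
  obtain k where k: "k \<in> L2 ?M" "(\<lambda>n. l2_norm ?M (\<lambda>x. u n x - k x)) \<longlonglongrightarrow> 0"
  proof (rule L2_complete_rate[of u ?M 2])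
    show "u n \<in> L2 ?M" for n by (rule L2[OF u])
    show "(l2_norm ?M (\<lambda>x. u m x - u n x))^2 \<le> 2 * (1 / real (Suc m) + 1 / real (Suc n))" for m n
      using d[of m n] unfolding Buu by (simp add: distrib_left)
  qed blast
  show ?thesis
  proof (rule that[OF k(1) u k(2)])
    fix \<phi> assume \<phi>: "\<phi> \<in> ?V"
    have z: "(\<lambda>n. l2_norm ?M (\<lambda>x. \<phi> x - \<phi> x)) \<longlonglongrightarrow> 0" by (simp add: l2_norm_def)
    have "(\<lambda>n. ?B \<phi> (u n)) \<longlonglongrightarrow> ?B \<phi> k"
      by (intro tendsto_Re l2_inner_tendsto L2 \<phi> u k z)
    with lim[OF \<phi>] show "F \<phi> = ?B \<phi> k" by (rule LIMSEQ_unique)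
  qed
qed

lemma L2_eq_if_test_inner_eq:
  fixes f g :: "'a::euclidean_space \<Rightarrow> complex"
  assumes \<Omega>: "open \<Omega>" and f: "f \<in> L2 (lborel_on \<Omega>)" and g: "g \<in> L2 (lborel_on \<Omega>)"
    and eq: "\<And>\<phi>. \<phi> \<in> test_functions \<Omega> \<Longrightarrow> l2_inner (lborel_on \<Omega>) \<phi> f = l2_inner (lborel_on \<Omega>) \<phi> g"
  shows "AE x in lborel_on \<Omega>. f x = g x"
proof -
  have d: "(\<lambda>x. f x - g x) \<in> L2 (lborel_on \<Omega>)" by (rule L2_diff[OF f g])
  have "AE x in lborel_on \<Omega>. f x - g x = 0"
  proof (rule fundamental_lemma[OF L2_loc_integrable[OF d \<Omega>] \<Omega>])
    fix \<phi> :: "'a \<Rightarrow> real" assume "\<phi> \<in> test_functions \<Omega>"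
    then have \<phi>: "(\<lambda>x. complex_of_real (\<phi> x)) \<in> test_functions \<Omega>"
      by (rule test_functions_compose_linear[OF _ bounded_linear_of_real])
    have "l2_inner (lborel_on \<Omega>) (\<lambda>x. complex_of_real (\<phi> x)) (\<lambda>x. f x - g x) = 0"
      unfolding l2_inner_diff_right[OF test_functions_L2[OF \<phi> \<Omega>] f g] using eq[OF \<phi>] by simp
    then show "(\<integral>x. \<phi> x *\<^sub>R (f x - g x) \<partial>lborel_on \<Omega>) = 0"
      unfolding l2_inner_def by (simp add: scaleR_conv_of_real)
  qed
  then show ?thesis by simp
qed

text \<open>Both sides are antilinear in \<open>\<phi>\<close>, so the real identity for
  \<open>\<i> * \<phi>\<close> is the identity of imaginary parts for \<open>\<phi>\<close>.\<close>

lemma inner_eq_of_Re_inner_eq: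
  assumes \<Omega>: "open \<Omega>" and f: "f \<in> L2 (lborel_on \<Omega>)"
    and G_i: "\<And>\<phi>. \<phi> \<in> test_functions \<Omega> \<Longrightarrow> G (\<lambda>x. \<i> * \<phi> x) = - \<i> * G \<phi>"
    and eq: "\<And>\<phi>. \<phi> \<in> test_functions \<Omega> \<Longrightarrow> Re (G \<phi>) = Re (l2_inner (lborel_on \<Omega>) \<phi> f)" and \<phi>: "\<phi> \<in> test_functions \<Omega>"
  shows "G \<phi> = l2_inner (lborel_on \<Omega>) \<phi> f"
proof -
  have "(\<lambda>x. \<i> * \<phi> x) \<in> test_functions \<Omega>" by (intro test_functions_mult \<phi> smooth_const)
  from eq[OF this] have "Im (G \<phi>) = Re (l2_inner (lborel_on \<Omega>) (\<lambda>x. \<i> * \<phi> x) f)" unfolding G_i[OF \<phi>] by simp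
  also have "l2_inner (lborel_on \<Omega>) (\<lambda>x. \<i> * \<phi> x) f = - \<i> * l2_inner (lborel_on \<Omega>) \<phi> f"
    unfolding l2_inner_def by (simp add: mult.assoc)
  finally have "Im (G \<phi>) = Im (l2_inner (lborel_on \<Omega>) \<phi> f)" by simp
  with eq[OF \<phi>] show ?thesis by (simp add: complex_eq_iff)
qed

text \<open>The functional \<open>\<phi> \<mapsto> Re (l2_inner M \<phi> f)\<close> is represented
  by a limit \<open>k\<close> of test functions, and the fundamental lemma forces
  \<open>f = k\<close> almost everywhere. No mollification enters, so that the latter can rely on
  density.\<close>

lemma test_functions_dense:
  fixes f :: "'a::euclidean_space \<Rightarrow> complex"
  assumes \<Omega>: "open \<Omega>" and f: "f \<in> L2 (lborel_on \<Omega>)"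
  obtains u where "\<And>n. u n \<in> test_functions \<Omega>" "(\<lambda>n. l2_norm (lborel_on \<Omega>) (\<lambda>x. u n x - f x)) \<longlonglongrightarrow> 0"
proof -
  let ?M = "lborel_on \<Omega>"
  obtain k u where k: "k \<in> L2 ?M" and u: "\<And>n. u n \<in> test_functions \<Omega>"
    and lim: "(\<lambda>n. l2_norm ?M (\<lambda>x. u n x - k x)) \<longlonglongrightarrow> 0"
    and eq: "\<And>\<phi>. \<phi> \<in> test_functions \<Omega> \<Longrightarrow> Re (l2_inner ?M \<phi> f) = Re (l2_inner ?M \<phi> k)"
  proof (rule test_functions_riesz[OF \<Omega>, of "\<lambda>\<phi>. Re (l2_inner ?M \<phi> f)" "l2_norm ?M f"])
    show "Re (l2_inner ?M (\<lambda>z. u z + complex_of_real t * v z) f) = Re (l2_inner ?M u f) + t * Re (l2_inner ?M v f)"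
      if "u \<in> test_functions \<Omega>" "v \<in> test_functions \<Omega>" for u v :: "'a \<Rightarrow> complex" and t
      using l2_inner_add_left[OF f test_functions_L2[OF that(1) \<Omega>] test_functions_L2[OF that(2) \<Omega>], of "complex_of_real t"] by simp
    show "\<bar>Re (l2_inner ?M u f)\<bar> \<le> l2_norm ?M f * l2_norm ?M u" if "u \<in> test_functions \<Omega>" for u :: "'a \<Rightarrow> complex"
      using l2_Cauchy_Schwarz[OF test_functions_L2[OF that \<Omega>] f] abs_Re_le_cmod[of "l2_inner ?M u f"]
      by (simp add: mult.commute)
  qed blast
  have "AE x in ?M. f x = k x"
  proof (rule L2_eq_if_test_inner_eq[OF \<Omega> f k])
    show "l2_inner ?M \<phi> f = l2_inner ?M \<phi> k" if "\<phi> \<in> test_functions \<Omega>" for \<phi>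
      by (rule inner_eq_of_Re_inner_eq[OF \<Omega> k _ eq that])
         (simp add: l2_inner_def mult.assoc)
  qed
  then have "l2_norm ?M (\<lambda>x. u n x - k x) = l2_norm ?M (\<lambda>x. u n x - f x)" for n
    using L2_measurable[OF test_functions_L2[OF u \<Omega>]] L2_measurable[OF k] L2_measurable[OF f]
    by (intro l2_norm_cong borel_measurable_diff) auto
  with lim show ?thesis by (intro that[of u] u) simp
qed

text \<open>The bound says that differentiating the test function is an L2-bounded functional; its
  representative is the weak derivative.\<close>

lemma weak_deriv_exists:
  fixes f :: "'a::euclidean_space \<Rightarrow> complex"
  assumes \<Omega>: "open \<Omega>" and f: "f \<in> L2 (lborel_on \<Omega>)"
    and bound: "\<And>\<phi>. \<phi> \<in> test_functions \<Omega> \<Longrightarrow> norm (l2_inner (lborel_on \<Omega>) (dir_deriv v \<phi>) f) \<le> C * l2_norm (lborel_on \<Omega>) \<phi>"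
  obtains g where "g \<in> L2 (lborel_on \<Omega>)" "weak_deriv \<Omega> v f g"
proof -
  let ?M = "lborel_on \<Omega>" and ?G = "\<lambda>\<phi>. - l2_inner (lborel_on \<Omega>) (dir_deriv v \<phi>) f"
  have L2': "dir_deriv v \<phi> \<in> L2 ?M" if "\<phi> \<in> test_functions \<Omega>" for \<phi> :: "'a \<Rightarrow> complex"
    using that \<Omega> by (intro test_functions_L2 test_functions_dir_deriv)
  obtain k where k: "k \<in> L2 ?M"
    and eq: "\<And>\<phi>. \<phi> \<in> test_functions \<Omega> \<Longrightarrow> Re (?G \<phi>) = Re (l2_inner ?M \<phi> k)"
  proof (rule test_functions_riesz[OF \<Omega>, of "\<lambda>\<phi>. Re (?G \<phi>)" C])
    show "Re (?G (\<lambda>z. u z + complex_of_real t * w z)) = Re (?G u) + t * Re (?G w)"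
      if "u \<in> test_functions \<Omega>" "w \<in> test_functions \<Omega>" for u w :: "'a \<Rightarrow> complex" and t
      using l2_inner_add_left[OF f L2'[OF that(1)] L2'[OF that(2)], of "complex_of_real t"]
      by (simp add: dir_deriv_add dir_deriv_cmult smooth_cmult test_functions_smooth[OF that(1)] test_functions_smooth[OF that(2)])
    show "\<bar>Re (?G u)\<bar> \<le> C * l2_norm ?M u" if "u \<in> test_functions \<Omega>" for u :: "'a \<Rightarrow> complex"
      using bound[OF that] abs_Re_le_cmod[of "l2_inner ?M (dir_deriv v u) f"] by simp
  qed blast
  have "weak_deriv \<Omega> v f k"
  proof (rule weak_derivI[OF \<Omega> f k])
    fix \<phi> :: "'a \<Rightarrow> complex" assume \<phi>: "\<phi> \<in> test_functions \<Omega>"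
    have "?G \<phi> = l2_inner ?M \<phi> k"
    proof (rule inner_eq_of_Re_inner_eq[OF \<Omega> k _ eq \<phi>])
      show "?G (\<lambda>x. \<i> * \<phi> x) = - \<i> * ?G \<phi>" if "\<phi> \<in> test_functions \<Omega>" for \<phi>
        using test_functions_smooth[OF that] by (simp add: dir_deriv_cmult l2_inner_def mult.assoc)
    qed
    then show "l2_inner ?M (dir_deriv v \<phi>) f = - l2_inner ?M \<phi> k" by (metis minus_minus)
  qed
  with k show ?thesis by (rule that)
qed

section \<open>Mollification\<close>

lemma H1_iff:
  "f \<in> H1 \<Omega> \<longleftrightarrow> f \<in> L2 (lborel_on \<Omega>) \<and> (\<forall>i\<in>Basis. \<exists>g\<in>L2 (lborel_on \<Omega>). weak_deriv \<Omega> i f g)"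
  by simp

lemma H2_iff:
  "f \<in> H2 \<Omega> \<longleftrightarrow> f \<in> L2 (lborel_on \<Omega>) \<and> (\<forall>i\<in>Basis. \<exists>g\<in>H1 \<Omega>. weak_deriv \<Omega> i f g)"
  by (simp add: numeral_2_eq_2)

lemma H1_D:
  assumes "f \<in> H1 \<Omega>" "open \<Omega>"
  shows "f \<in> L2 (lborel_on \<Omega>)" "i \<in> Basis \<Longrightarrow> weak_deriv \<Omega> i f (wderiv \<Omega> i f)" "i \<in> Basis \<Longrightarrow> wderiv \<Omega> i f \<in> L2 (lborel_on \<Omega>)"
  using assms wderiv_weak_deriv wderiv_L2 unfolding H1_iff by blast+

definition mollify :: "('a::euclidean_space \<Rightarrow> real) \<Rightarrow> ('a \<Rightarrow> complex) \<Rightarrow> 'a \<Rightarrow> complex" where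
  "mollify \<rho> h z = (\<integral>w. \<rho> (z - w) *\<^sub>R h w \<partial>lborel)"

lemma test_functions_reflect_borel:
  fixes \<rho> :: "'a::euclidean_space \<Rightarrow> real"
  assumes "\<rho> \<in> test_functions U" shows "(\<lambda>w. \<rho> (z - w)) \<in> borel_measurable borel"
  using smooth_borel[OF smooth_reflect[OF test_functions_smooth[OF assms]]] .

lemma integrable_bounded_scaleR:
  fixes h :: "'a \<Rightarrow> complex" and g :: "'a \<Rightarrow> real"
  assumes "integrable M h" "g \<in> borel_measurable M" "\<And>x. \<bar>g x\<bar> \<le> C"
  shows "integrable M (\<lambda>x. g x *\<^sub>R h x)"
proof (rule Bochner_Integration.integrable_bound)
  show "integrable M (\<lambda>x. C *\<^sub>R h x)" by (rule integrable_scaleR_right[OF assms(1)])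
  show "(\<lambda>x. g x *\<^sub>R h x) \<in> borel_measurable M"
    by (rule borel_measurable_scaleR[OF assms(2) borel_measurable_integrable[OF assms(1)]])
  show "AE x in M. norm (g x *\<^sub>R h x) \<le> norm (C *\<^sub>R h x)"
  proof (rule AE_I2)
    fix x
    have "\<bar>g x\<bar> \<le> \<bar>C\<bar>" using assms(3)[of x] by simp
    then show "norm (g x *\<^sub>R h x) \<le> norm (C *\<^sub>R h x)" unfolding norm_scaleR by (rule mult_right_mono) simp
  qed
qed

lemma mollify_integrable:
  fixes \<rho> :: "'a::euclidean_space \<Rightarrow> real" and h :: "'a \<Rightarrow> complex"
  assumes "\<rho> \<in> test_functions U" "integrable lborel h"
  shows "integrable lborel (\<lambda>w. \<rho> (z - w) *\<^sub>R h w)"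
proof -
  obtain C where C: "\<And>x. norm (\<rho> x) \<le> C" by (rule test_functions_bounded[OF assms(1)]) blast
  show ?thesis
    by (rule integrable_bounded_scaleR[OF assms(2), of _ C])
       (use C test_functions_reflect_borel[OF assms(1)] in simp_all)
qed

text \<open>The remainder is controlled uniformly in both points. This allows differentiation under
  the integral in the mollification without a dominated limit.\<close>

lemma smooth_taylor_bound:
  fixes \<rho> :: "'a::euclidean_space \<Rightarrow> real"
  assumes "\<rho> \<in> test_functions U"
  obtains C where "C \<ge> 0" "\<And>x y. \<bar>\<rho> y - \<rho> x - dir_deriv (y - x) \<rho> x\<bar> \<le> C * (norm (y - x))^2"
proof -
  have s: "smooth \<rho>" by (rule test_functions_smooth[OF assms])
  have "\<exists>L>0. \<forall>x y. norm (dir_deriv i \<rho> x - dir_deriv i \<rho> y) \<le> L * norm (x - y)" for i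
    by (rule test_functions_Lipschitz[OF test_functions_dir_deriv[OF assms]]) blast
  then obtain L where L: "\<And>i. L i > 0" "\<And>i x y. norm (dir_deriv i \<rho> x - dir_deriv i \<rho> y) \<le> L i * norm (x - y)" by metis
  let ?C = "\<Sum>i\<in>Basis. L i"
  have lin: "linear (\<lambda>v. dir_deriv v \<rho> x)" for x by (rule has_derivative_linear[OF smooth_has_derivative[OF s]])
  have expand: "dir_deriv v \<rho> x = (\<Sum>i\<in>Basis. (v \<bullet> i) *\<^sub>R dir_deriv i \<rho> x)" for v x
    using linear_sum[OF lin, of "\<lambda>i. (v \<bullet> i) *\<^sub>R i" Basis x] linear_scale[OF lin]
    by (simp add: euclidean_representation)
  have "\<bar>\<rho> y - \<rho> x - dir_deriv (y - x) \<rho> x\<bar> \<le> ?C * (norm (y - x))^2" for x y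
  proof -
    \<comment> \<open>With the linear part at \<open>x\<close> removed, the derivative at
      \<open>z\<close> is a difference of derivatives, small by their Lipschitz continuity; the mean
      value inequality supplies the second factor \<open>norm (y - x)\<close>.\<close>
    let ?g = "\<lambda>z. \<rho> z - dir_deriv z \<rho> x"
    have "norm (?g y - ?g x) \<le> (?C * norm (y - x)) * norm (y - x)"
    proof (rule differentiable_bound[where S="cball x (norm (y - x))"])
      show "(?g has_derivative (\<lambda>v. dir_deriv v \<rho> z - dir_deriv v \<rho> x)) (at z within cball x (norm (y - x)))" for z
        by (intro has_derivative_diff has_derivative_at_withinI[OF smooth_has_derivative[OF s]]
            linear_imp_has_derivative lin)
      fix z assume "z \<in> cball x (norm (y - x))"
      then have z: "norm (z - x) \<le> norm (y - x)" by (simp add: dist_norm norm_minus_commute)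
      show "onorm (\<lambda>v. dir_deriv v \<rho> z - dir_deriv v \<rho> x) \<le> ?C * norm (y - x)"
      proof (rule onorm_le)
        fix v :: 'a
        have "dir_deriv v \<rho> z - dir_deriv v \<rho> x = (\<Sum>i\<in>Basis. (v \<bullet> i) *\<^sub>R (dir_deriv i \<rho> z - dir_deriv i \<rho> x))"
          unfolding expand[of v] by (simp add: sum_subtractf right_diff_distrib)
        also have "norm \<dots> \<le> (\<Sum>i\<in>Basis. norm v * (L i * norm (y - x)))"
        proof (rule sum_norm_le)
          fix i :: 'a assume i: "i \<in> Basis"
          have "norm (dir_deriv i \<rho> z - dir_deriv i \<rho> x) \<le> L i * norm (y - x)"
            using L(2)[of i z x] mult_left_mono[OF z, of "L i"] L(1)[of i] by linarith
          then show "norm ((v \<bullet> i) *\<^sub>R (dir_deriv i \<rho> z - dir_deriv i \<rho> x)) \<le> norm v * (L i * norm (y - x))"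
            unfolding norm_scaleR using Basis_le_norm[OF i, of v] by (intro mult_mono) auto
        qed
        also have "\<dots> = ?C * norm (y - x) * norm v"
          unfolding sum_distrib_left[symmetric] sum_distrib_right[symmetric] by (rule mult.commute)
        finally show "norm (dir_deriv v \<rho> z - dir_deriv v \<rho> x) \<le> ?C * norm (y - x) * norm v" .
      qed
    qed (auto simp: dist_norm norm_minus_commute)
    moreover have "?g y - ?g x = \<rho> y - \<rho> x - dir_deriv (y - x) \<rho> x"
      using linear_diff[OF lin[of x], of y x] by simp
    ultimately show ?thesis by (simp add: power2_eq_square mult.assoc)
  qed
  moreover have "?C \<ge> 0" using L(1) by (intro sum_nonneg) (simp add: less_imp_le)
  ultimately show ?thesis using that by blast
qed

text \<open>Integrating the Taylor remainder against \<open>norm h\<close> leaves an error quadratic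
  in \<open>y - z\<close>, with the L1 norm of \<open>h\<close> as a factor.\<close>

lemma mollify_has_derivative:
  assumes \<rho>: "\<rho> \<in> test_functions U" and h: "integrable lborel h"
  shows "(mollify \<rho> h has_derivative (\<lambda>v. mollify (dir_deriv v \<rho>) h z)) (at z)"
proof -
  have s: "smooth \<rho>" by (rule test_functions_smooth[OF \<rho>])
  have lin: "linear (\<lambda>v. dir_deriv v \<rho> x)" for x by (rule has_derivative_linear[OF smooth_has_derivative[OF s]])
  note int = mollify_integrable[OF test_functions_dir_deriv[OF \<rho>] h]
  obtain C where C: "C \<ge> 0" "\<And>x y. \<bar>\<rho> y - \<rho> x - dir_deriv (y - x) \<rho> x\<bar> \<le> C * (norm (y - x))^2"
    by (rule smooth_taylor_bound[OF \<rho>]) blast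
  let ?N = "\<integral>w. norm (h w) \<partial>lborel"
  have "linear (\<lambda>v. mollify (dir_deriv v \<rho>) h z)"
  proof (rule linearI)
    fix a b :: 'a and r :: real
    show "mollify (dir_deriv (a + b) \<rho>) h z = mollify (dir_deriv a \<rho>) h z + mollify (dir_deriv b \<rho>) h z"
      unfolding mollify_def linear_add[OF lin] scaleR_add_left by (rule Bochner_Integration.integral_add[OF int int])
    show "mollify (dir_deriv (r *\<^sub>R a) \<rho>) h z = r *\<^sub>R mollify (dir_deriv a \<rho>) h z"
      unfolding mollify_def linear_scale[OF lin] real_scaleR_def scaleR_scaleR[symmetric]
      by (rule integral_scaleR_right)
  qed
  then have bl: "bounded_linear (\<lambda>v. mollify (dir_deriv v \<rho>) h z)" by (simp add: linear_conv_bounded_linear)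
  show ?thesis
  proof (rule has_derivativeI_sandwich[OF zero_less_one bl])
    fix y assume y: "y \<noteq> z"
    have i1: "integrable lborel (\<lambda>w. \<rho> (y - w) *\<^sub>R h w)" and i2: "integrable lborel (\<lambda>w. \<rho> (z - w) *\<^sub>R h w)"
      by (rule mollify_integrable[OF \<rho> h])+
    have "mollify \<rho> h y - mollify \<rho> h z - mollify (dir_deriv (y - z) \<rho>) h z
      = (\<integral>w. (\<rho> (y - w) *\<^sub>R h w - \<rho> (z - w) *\<^sub>R h w) - dir_deriv (y - z) \<rho> (z - w) *\<^sub>R h w \<partial>lborel)"
      unfolding mollify_def
      by (subst Bochner_Integration.integral_diff[OF Bochner_Integration.integrable_diff[OF i1 i2] int],
          subst Bochner_Integration.integral_diff[OF i1 i2]) (rule refl)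
    also have "norm \<dots> \<le> (\<integral>w. (C * (norm (y - z))^2) * norm (h w) \<partial>lborel)"
    proof (rule order_trans[OF integral_norm_bound integral_mono[OF integrable_norm]])
      show "integrable lborel (\<lambda>w. (\<rho> (y - w) *\<^sub>R h w - \<rho> (z - w) *\<^sub>R h w) - dir_deriv (y - z) \<rho> (z - w) *\<^sub>R h w)"
        by (rule Bochner_Integration.integrable_diff[OF Bochner_Integration.integrable_diff[OF i1 i2] int])
      show "integrable lborel (\<lambda>w. (C * (norm (y - z))^2) * norm (h w))"
        by (rule integrable_mult_right[OF integrable_norm[OF h]])
      fix w
      have "(\<rho> (y - w) *\<^sub>R h w - \<rho> (z - w) *\<^sub>R h w) - dir_deriv (y - z) \<rho> (z - w) *\<^sub>R h w
        = (\<rho> (y - w) - \<rho> (z - w) - dir_deriv ((y - w) - (z - w)) \<rho> (z - w)) *\<^sub>R h w"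
        by (simp add: scaleR_diff_left)
      also have "norm \<dots> = \<bar>\<rho> (y - w) - \<rho> (z - w) - dir_deriv ((y - w) - (z - w)) \<rho> (z - w)\<bar> * norm (h w)"
        by (rule norm_scaleR)
      also have "\<dots> \<le> (C * (norm ((y - w) - (z - w)))^2) * norm (h w)"
        by (rule mult_right_mono[OF C(2)]) simp
      finally show "norm ((\<rho> (y - w) *\<^sub>R h w - \<rho> (z - w) *\<^sub>R h w) - dir_deriv (y - z) \<rho> (z - w) *\<^sub>R h w) \<le> (C * (norm (y - z))^2) * norm (h w)"
        by simp
    qed
    also have "\<dots> = C * ?N * norm (y - z) * norm (y - z)" by (simp add: power2_eq_square mult_ac)
    finally show "norm (mollify \<rho> h y - mollify \<rho> h z - mollify (dir_deriv (y - z) \<rho>) h z) / norm (y - z) \<le> C * ?N * norm (y - z)"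
      using y by (simp add: pos_divide_le_eq)
  next
    have "((\<lambda>y. C * ?N * norm (y - z)) \<longlongrightarrow> C * ?N * norm (z - z)) (at z)" by (intro tendsto_intros)
    then show "((\<lambda>y. C * ?N * norm (y - z)) \<longlongrightarrow> 0) (at z)" by simp
  qed
qed

lemma dir_deriv_mollify:
  assumes "\<rho> \<in> test_functions U" "integrable lborel h"
  shows "dir_deriv v (mollify \<rho> h) = mollify (dir_deriv v \<rho>) h"
  by (rule ext, rule dir_deriv_eqI[OF mollify_has_derivative[OF assms]])

lemma smooth_mollify:
  fixes \<rho> :: "'a::euclidean_space \<Rightarrow> real"
  assumes \<rho>: "\<rho> \<in> test_functions U" and h: "integrable lborel h"
  shows "smooth (mollify \<rho> h)"
proof (rule smooth_coinduct[of _ "{mollify \<rho> h |\<rho>. \<rho> \<in> test_functions U}"])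
  show "mollify \<rho> h \<in> {mollify \<rho> h |\<rho>. \<rho> \<in> test_functions U}" using \<rho> by blast
  fix g v and x :: 'a assume "g \<in> {mollify \<rho> h |\<rho>. \<rho> \<in> test_functions U}"
  then obtain r where r: "g = mollify r h" "r \<in> test_functions U" by blast
  show "g differentiable (at x)"
    unfolding r(1) differentiable_def using mollify_has_derivative[OF r(2) h] by blast
  show "dir_deriv v g \<in> {mollify \<rho> h |\<rho>. \<rho> \<in> test_functions U}"
    unfolding r(1) dir_deriv_mollify[OF r(2) h] using test_functions_dir_deriv[OF r(2)] by blast
qed

text \<open>The support of a convolution lies in the sum of the supports.\<close>

lemma mollify_test_function:
  fixes \<rho> :: "'a::euclidean_space \<Rightarrow> real"
  assumes \<rho>: "\<rho> \<in> test_functions U" and h: "integrable lborel h" and K: "compact K" "\<And>x. x \<notin> K \<Longrightarrow> h x = 0"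
  shows "mollify \<rho> h \<in> test_functions UNIV"
proof -
  obtain K' where K': "compact K'" "\<And>x. x \<notin> K' \<Longrightarrow> \<rho> x = 0" by (rule test_functionsE[OF \<rho>]) blast
  show ?thesis
  proof (rule test_functionsI[OF smooth_mollify[OF \<rho> h] compact_sums[OF K'(1) K(1)]])
    fix z assume z: "z \<notin> {x + y |x y. x \<in> K' \<and> y \<in> K}"
    have "\<rho> (z - w) *\<^sub>R h w = 0" for w
    proof (cases "w \<in> K")
      case True
      then have "z - w \<notin> K'" using z by (metis (mono_tags, lifting) diff_add_cancel mem_Collect_eq)
      then show ?thesis by (simp add: K'(2))
    qed (simp add: K(2))
    then have "(\<lambda>w. \<rho> (z - w) *\<^sub>R h w) = (\<lambda>w. 0)" by (rule ext)
    then show "mollify \<rho> h z = 0" unfolding mollify_def by simp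
  qed simp
qed

lemma L2_lborel_on_UNIV: "lborel_on UNIV = (lborel :: 'a::euclidean_space measure)"
  by (rule measure_eqI) (simp_all add: sets_restrict_space emeasure_restrict_space)

section \<open>Invariance of Lebesgue measure and of \<open>L2\<close> under translation and
  reflection\<close>

lemma lborel_reflect: "distr lborel borel (\<lambda>x. c - x) = (lborel :: 'a::euclidean_space measure)"
  by (subst lborel_affine[of "-1" c]) (simp_all add: density_1)

lemma nn_integral_translate:
  fixes f :: "'a::euclidean_space \<Rightarrow> ennreal"
  assumes [measurable]: "f \<in> borel_measurable borel"
  shows "(\<integral>\<^sup>+x. f (x + c) \<partial>lborel) = (\<integral>\<^sup>+x. f x \<partial>lborel)"
proof -
  have "(\<integral>\<^sup>+x. f x \<partial>lborel) = (\<integral>\<^sup>+x. f x \<partial>distr lborel borel ((+) c))" by (simp add: lborel_distr_plus)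
  also have "\<dots> = (\<integral>\<^sup>+x. f (c + x) \<partial>lborel)" by (rule nn_integral_distr) measurable
  finally show ?thesis by (simp add: add.commute)
qed

lemma nn_integral_reflect:
  fixes f :: "'a::euclidean_space \<Rightarrow> ennreal"
  assumes [measurable]: "f \<in> borel_measurable borel"
  shows "(\<integral>\<^sup>+x. f (c - x) \<partial>lborel) = (\<integral>\<^sup>+x. f x \<partial>lborel)"
proof -
  have "(\<integral>\<^sup>+x. f x \<partial>lborel) = (\<integral>\<^sup>+x. f x \<partial>distr lborel borel (\<lambda>x. c - x))" by (simp add: lborel_reflect)
  also have "\<dots> = (\<integral>\<^sup>+x. f (c - x) \<partial>lborel)" by (rule nn_integral_distr) measurable
  finally show ?thesis by simp
qed

lemma integral_reflect:
  fixes f :: "'a::euclidean_space \<Rightarrow> complex"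
  assumes [measurable]: "f \<in> borel_measurable borel"
  shows "(\<integral>x. f (c - x) \<partial>lborel) = (\<integral>x. f x \<partial>lborel)"
proof -
  have "(\<integral>x. f x \<partial>lborel) = (\<integral>x. f x \<partial>distr lborel borel (\<lambda>x. c - x))" by (simp add: lborel_reflect)
  also have "\<dots> = (\<integral>x. f (c - x) \<partial>lborel)" by (rule integral_distr) measurable
  finally show ?thesis by simp
qed

lemma L2_of_nn_integral_eq:
  assumes f: "f \<in> L2 M" and g: "g \<in> borel_measurable N"
    and eq: "(\<integral>\<^sup>+x. ennreal ((norm (g x))^2) \<partial>N) = (\<integral>\<^sup>+x. ennreal ((norm (f x))^2) \<partial>M)"
  shows "g \<in> L2 N" "l2_norm N g = l2_norm M f"
proof -
  have le: "(\<integral>\<^sup>+x. ennreal ((norm (g x))^2) \<partial>N) \<le> ennreal ((l2_norm M f)^2)"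
    unfolding eq L2_nn_integral[OF f] by simp
  show gL: "g \<in> L2 N" by (rule L2_I_bound(1)[OF g le l2_norm_nonneg])
  show "l2_norm N g = l2_norm M f"
    using eq unfolding L2_nn_integral[OF f] L2_nn_integral[OF gL] by (simp add: l2_norm_nonneg)
qed

lemma L2_translate:
  fixes h :: "'a::euclidean_space \<Rightarrow> complex"
  assumes "h \<in> L2 lborel"
  shows "(\<lambda>x. h (x + c)) \<in> L2 lborel" "l2_norm lborel (\<lambda>x. h (x + c)) = l2_norm lborel h"
proof -
  have m [measurable]: "h \<in> borel_measurable borel" using L2_measurable[OF assms] by simp
  have m': "(\<lambda>x. h (x + c)) \<in> borel_measurable lborel" by measurable
  have eq: "(\<integral>\<^sup>+x. ennreal ((norm (h (x + c)))^2) \<partial>lborel) = (\<integral>\<^sup>+x. ennreal ((norm (h x))^2) \<partial>lborel)"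
    by (rule nn_integral_translate) measurable
  show "(\<lambda>x. h (x + c)) \<in> L2 lborel" "l2_norm lborel (\<lambda>x. h (x + c)) = l2_norm lborel h"
    by (rule L2_of_nn_integral_eq[OF assms m' eq])+
qed

lemma L2_reflect:
  fixes h :: "'a::euclidean_space \<Rightarrow> complex"
  assumes "h \<in> L2 lborel" shows "(\<lambda>x. h (c - x)) \<in> L2 lborel"
proof -
  have m [measurable]: "h \<in> borel_measurable borel" using L2_measurable[OF assms] by simp
  have m': "(\<lambda>x. h (c - x)) \<in> borel_measurable lborel" by measurable
  have eq: "(\<integral>\<^sup>+x. ennreal ((norm (h (c - x)))^2) \<partial>lborel) = (\<integral>\<^sup>+x. ennreal ((norm (h x))^2) \<partial>lborel)"
    by (rule nn_integral_reflect) measurable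
  show ?thesis by (rule L2_of_nn_integral_eq(1)[OF assms m' eq])
qed

section \<open>Continuity of translations and convergence of mollifications\<close>

lemma test_functions_L2_lborel: "\<phi> \<in> test_functions \<Omega> \<Longrightarrow> \<phi> \<in> L2 lborel"
  using test_functions_L2[OF _ open_UNIV] unfolding L2_lborel_on_UNIV .

lemma test_functions_translation_continuous:
  fixes \<phi> :: "'a::euclidean_space \<Rightarrow> complex"
  assumes "\<phi> \<in> test_functions \<Omega>" "e > 0"
  obtains \<delta> where "\<delta> > 0" "\<And>s. norm s < \<delta> \<Longrightarrow> l2_norm lborel (\<lambda>x. \<phi> (x + s) - \<phi> x) \<le> e"
proof -
  obtain L where L: "L > 0" "\<And>x y. norm (\<phi> x - \<phi> y) \<le> L * norm (x - y)" by (rule test_functions_Lipschitz[OF assms(1)]) blast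
  obtain K where K: "compact K" "\<And>x. x \<notin> K \<Longrightarrow> \<phi> x = 0" by (rule test_functionsE[OF assms(1)]) blast
  obtain B where B: "\<And>x. x \<in> K \<Longrightarrow> norm x \<le> B" using compact_imp_bounded[OF K(1)] by (auto simp: bounded_iff)
  have m [measurable]: "\<phi> \<in> borel_measurable borel" by (rule test_functions_borel[OF assms(1)])
  let ?D = "cball 0 (B + 1) :: 'a set"
  let ?m = "measure lborel ?D"
  have em: "emeasure lborel ?D = ennreal ?m"
    by (rule emeasure_eq_ennreal_measure) (metis emeasure_compact_finite compact_cball less_irrefl infinity_ennreal_def)
  \<comment> \<open>The 1 keeps both supports inside the ball of radius \<open>B + 1\<close>; the
    quotient makes Lipschitz bound times square root of the volume at most \<open>e\<close>. Adding
    1 to \<open>sqrt ?m\<close> excludes a zero denominator.\<close>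
  define \<delta> where "\<delta> = min 1 (e / (L * (sqrt ?m + 1)))"
  have "\<delta> > 0" using assms(2) L(1) by (simp add: \<delta>_def add_nonneg_pos)
  moreover have "l2_norm lborel (\<lambda>x. \<phi> (x + s) - \<phi> x) \<le> e" if s: "norm s < \<delta>" for s
  proof -
    have "l2_norm lborel (\<lambda>x. \<phi> (x + s) - \<phi> x) \<le> L * norm s * sqrt ?m"
    proof (rule L2_I_bound(2))
      show "(\<lambda>x. \<phi> (x + s) - \<phi> x) \<in> borel_measurable lborel" by measurable
      show "0 \<le> L * norm s * sqrt ?m" using L(1) by simp
      have "(\<integral>\<^sup>+x. ennreal ((norm (\<phi> (x + s) - \<phi> x))^2) \<partial>lborel) \<le> (\<integral>\<^sup>+x. ennreal ((L * norm s)^2) * indicator ?D x \<partial>lborel)"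
      proof (rule nn_integral_mono)
        fix x
        show "ennreal ((norm (\<phi> (x + s) - \<phi> x))^2) \<le> ennreal ((L * norm s)^2) * indicator ?D x"
        proof (cases "x \<in> ?D")
          case True
          have "norm (\<phi> (x + s) - \<phi> x) \<le> L * norm s" using L(2)[of "x + s" x] by simp
          then show ?thesis using True by (simp add: ennreal_leI power_mono)
        next
          case False
          then have x: "norm x > B + 1" by simp
          then have "x \<notin> K" using B[of x] by auto
          moreover have "x + s \<notin> K"
          proof
            assume "x + s \<in> K"
            then have "norm (x + s) \<le> B" by (rule B)
            moreover have "norm s < 1" using s by (simp add: \<delta>_def)
            moreover have "norm x \<le> norm (x + s) + norm s"
              by (metis add_diff_cancel_right' norm_triangle_ineq4)
            ultimately show False using x by linarith
          qed
          ultimately show ?thesis using K(2) by simp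
        qed
      qed
      also have "\<dots> = ennreal ((L * norm s)^2) * emeasure lborel ?D"
        by (rule nn_integral_cmult_indicator) simp
      also have "\<dots> = ennreal ((L * norm s * sqrt ?m)^2)"
        unfolding em by (simp add: power_mult_distrib flip: ennreal_mult)
      finally show "(\<integral>\<^sup>+x. ennreal ((norm (\<phi> (x + s) - \<phi> x))^2) \<partial>lborel) \<le> ennreal ((L * norm s * sqrt ?m)^2)" .
    qed
    also have "\<dots> \<le> L * (e / (L * (sqrt ?m + 1))) * sqrt ?m"
      using s L(1) by (intro mult_right_mono mult_left_mono) (auto simp: \<delta>_def)
    also have "\<dots> = e * (sqrt ?m / (sqrt ?m + 1))" using L(1) by simp
    also have "\<dots> \<le> e * 1"
    proof (rule mult_left_mono)
      show "sqrt ?m / (sqrt ?m + 1) \<le> 1"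
        by (subst divide_le_eq_1_pos) (auto intro: add_nonneg_pos)
    qed (use assms(2) in simp)
    finally show ?thesis by simp
  qed
  ultimately show ?thesis by (rule that)
qed

text \<open>An argument with three errors \<open>e / 3\<close>: translation is isometric, so
  approximating \<open>h\<close> by a test function costs the same before and after the
  shift.\<close>

lemma L2_translation_continuous:
  fixes h :: "'a::euclidean_space \<Rightarrow> complex"
  assumes h: "h \<in> L2 lborel" and e: "e > 0"
  obtains \<delta> where "\<delta> > 0" "\<And>s. norm s < \<delta> \<Longrightarrow> l2_norm lborel (\<lambda>x. h (x + s) - h x) \<le> e"
proof -
  have h': "h \<in> L2 (lborel_on UNIV)" using h unfolding L2_lborel_on_UNIV .
  obtain u where u: "\<And>n. u n \<in> test_functions UNIV" "(\<lambda>n. l2_norm lborel (\<lambda>x. u n x - h x)) \<longlonglongrightarrow> 0"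
    by (rule test_functions_dense[OF open_UNIV h', unfolded L2_lborel_on_UNIV]) blast
  have "\<forall>\<^sub>F n in sequentially. l2_norm lborel (\<lambda>x. u n x - h x) < e / 3"
    using order_tendstoD(2)[OF u(2), of "e/3"] e by simp
  from eventually_happens'[OF sequentially_bot this]
  obtain n where n: "l2_norm lborel (\<lambda>x. u n x - h x) < e / 3" by blast
  let ?\<phi> = "u n"
  have \<phi>: "?\<phi> \<in> L2 lborel" by (rule test_functions_L2_lborel[OF u(1)])
  have e3: "e / 3 > 0" using e by simp
  obtain \<delta> where \<delta>: "\<delta> > 0" "\<And>s. norm s < \<delta> \<Longrightarrow> l2_norm lborel (\<lambda>x. ?\<phi> (x + s) - ?\<phi> x) \<le> e / 3"
    by (rule test_functions_translation_continuous[OF u(1)[of n] e3]) blast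
  have "l2_norm lborel (\<lambda>x. h (x + s) - h x) \<le> e" if s: "norm s < \<delta>" for s
  proof -
    have 1: "l2_norm lborel (\<lambda>x. h (x + s) - ?\<phi> (x + s)) = l2_norm lborel (\<lambda>x. h x - ?\<phi> x)"
      by (rule L2_translate(2)[OF L2_diff[OF h \<phi>]])
    have "l2_norm lborel (\<lambda>x. h (x + s) - h x)
      \<le> l2_norm lborel (\<lambda>x. h (x + s) - ?\<phi> (x + s)) + l2_norm lborel (\<lambda>x. ?\<phi> (x + s) - h x)"
      by (rule l2_norm_triangle_diff[OF L2_translate(1)[OF h] L2_translate(1)[OF \<phi>] h])
    also have "\<dots> \<le> l2_norm lborel (\<lambda>x. h x - ?\<phi> x) + (l2_norm lborel (\<lambda>x. ?\<phi> (x + s) - ?\<phi> x) + l2_norm lborel (\<lambda>x. ?\<phi> x - h x))"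
      unfolding 1 by (rule add_left_mono[OF l2_norm_triangle_diff[OF L2_translate(1)[OF \<phi>] \<phi> h]])
    also have "\<dots> \<le> e"
      using n \<delta>(2)[OF s] l2_norm_minus_commute[of lborel h ?\<phi>] by linarith
    finally show ?thesis .
  qed
  with \<delta>(1) show ?thesis by (rule that)
qed

text \<open>Jensen's inequality for the probability density \<open>\<rho>\<close>, derived from
  Cauchy-Schwarz by splitting \<open>\<rho>\<close> into two square roots, one of which integrates
  to 1.\<close>

lemma mollify_error_pointwise:
  fixes h :: "'a::euclidean_space \<Rightarrow> complex"
  assumes h: "h \<in> L2 lborel" and \<rho>: "\<rho> \<in> test_functions U" "\<And>x. 0 \<le> \<rho> x" "(\<integral>x. \<rho> x \<partial>lborel) = 1"
  shows "ennreal ((norm (mollify \<rho> h z - h z))^2) \<le> (\<integral>\<^sup>+s. ennreal (\<rho> s) * ennreal ((norm (h (z - s) - h z))^2) \<partial>lborel)"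
proof -
  have mh [measurable]: "h \<in> borel_measurable borel" using L2_measurable[OF h] by simp
  have m\<rho> [measurable]: "\<rho> \<in> borel_measurable borel" by (rule test_functions_borel[OF \<rho>(1)])
  have i\<rho>: "integrable lborel \<rho>" by (rule test_functions_integrable[OF \<rho>(1)])
  have n\<rho>: "(\<integral>\<^sup>+s. ennreal (\<rho> s) \<partial>lborel) = 1"
    using nn_integral_eq_integral[OF i\<rho>] \<rho>(2,3) by simp
  have c\<rho>: "(\<lambda>s. complex_of_real (\<rho> s)) \<in> L2 lborel"
    by (rule test_functions_L2_lborel[OF test_functions_compose_linear[OF \<rho>(1) bounded_linear_of_real]])
  have i1: "integrable lborel (\<lambda>s. \<rho> s *\<^sub>R h (z - s))"
    using L2_integrable_mult[OF c\<rho> L2_reflect[OF h]] by (simp add: scaleR_conv_of_real)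
  have i2: "integrable lborel (\<lambda>s. \<rho> s *\<^sub>R h z)" by (rule integrable_scaleR_left[OF i\<rho>])
  have "mollify \<rho> h z = (\<integral>s. \<rho> s *\<^sub>R h (z - s) \<partial>lborel)"
    unfolding mollify_def using integral_reflect[of "\<lambda>s. \<rho> s *\<^sub>R h (z - s)" z] by simp
  moreover have "h z = (\<integral>s. \<rho> s *\<^sub>R h z \<partial>lborel)" using \<rho>(3) i\<rho> by simp
  ultimately have "mollify \<rho> h z - h z = (\<integral>s. \<rho> s *\<^sub>R h (z - s) - \<rho> s *\<^sub>R h z \<partial>lborel)"
    using Bochner_Integration.integral_diff[OF i1 i2] by simp
  then have "ennreal (norm (mollify \<rho> h z - h z)) \<le> (\<integral>\<^sup>+s. ennreal (norm (\<rho> s *\<^sub>R h (z - s) - \<rho> s *\<^sub>R h z)) \<partial>lborel)"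
    using integral_norm_bound_ennreal[OF Bochner_Integration.integrable_diff[OF i1 i2]] by simp
  also have "\<dots> = (\<integral>\<^sup>+s. ennreal (sqrt (\<rho> s)) * ennreal (sqrt (\<rho> s) * norm (h (z - s) - h z)) \<partial>lborel)"
  proof (rule nn_integral_cong)
    fix s
    have "norm (\<rho> s *\<^sub>R h (z - s) - \<rho> s *\<^sub>R h z) = sqrt (\<rho> s) * (sqrt (\<rho> s) * norm (h (z - s) - h z))"
      using \<rho>(2)[of s] by (simp flip: scaleR_diff_right mult.assoc)
    then show "ennreal (norm (\<rho> s *\<^sub>R h (z - s) - \<rho> s *\<^sub>R h z)) = ennreal (sqrt (\<rho> s)) * ennreal (sqrt (\<rho> s) * norm (h (z - s) - h z))"
      using \<rho>(2)[of s] by (simp add: ennreal_mult)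
  qed
  finally have "(ennreal (norm (mollify \<rho> h z - h z)))^2 \<le> (\<integral>\<^sup>+s. ennreal (sqrt (\<rho> s)) * ennreal (sqrt (\<rho> s) * norm (h (z - s) - h z)) \<partial>lborel)^2"
    by (rule power_mono) simp
  also have "\<dots> \<le> (\<integral>\<^sup>+s. (ennreal (sqrt (\<rho> s)))^2 \<partial>lborel) * (\<integral>\<^sup>+s. (ennreal (sqrt (\<rho> s) * norm (h (z - s) - h z)))^2 \<partial>lborel)"
    by (rule Cauchy_Schwarz_nn_integral) measurable
  also have "(\<integral>\<^sup>+s. (ennreal (sqrt (\<rho> s)))^2 \<partial>lborel) = 1"
    using \<rho>(2) by (simp add: ennreal_power n\<rho>)
  also have "(\<integral>\<^sup>+s. (ennreal (sqrt (\<rho> s) * norm (h (z - s) - h z)))^2 \<partial>lborel)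
    = (\<integral>\<^sup>+s. ennreal (\<rho> s) * ennreal ((norm (h (z - s) - h z))^2) \<partial>lborel)"
    by (rule nn_integral_cong) (simp add: ennreal_power power_mult_distrib \<rho>(2) ennreal_mult)
  finally show ?thesis by (simp add: ennreal_power)
qed

lemma mollify_L2:
  fixes h :: "'a::euclidean_space \<Rightarrow> complex"
  assumes h: "h \<in> L2 lborel" and ih: "integrable lborel h" and e: "e > 0"
  obtains \<delta> where "\<delta> > 0"
    "\<And>\<rho>. \<rho> \<in> test_functions (ball 0 \<delta>) \<Longrightarrow> (\<And>x. 0 \<le> \<rho> x) \<Longrightarrow> (\<integral>x. \<rho> x \<partial>lborel) = 1 \<Longrightarrow>
      (\<lambda>z. mollify \<rho> h z - h z) \<in> L2 lborel \<and> l2_norm lborel (\<lambda>z. mollify \<rho> h z - h z) \<le> e"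
proof -
  have mh [measurable]: "h \<in> borel_measurable borel" using L2_measurable[OF h] by simp
  obtain \<delta> where \<delta>: "\<delta> > 0" "\<And>s. norm s < \<delta> \<Longrightarrow> l2_norm lborel (\<lambda>x. h (x + s) - h x) \<le> e"
    by (rule L2_translation_continuous[OF h e]) blast
  show ?thesis
  proof (rule that[OF \<delta>(1)])
    fix \<rho> :: "'a \<Rightarrow> real"
    assume \<rho>: "\<rho> \<in> test_functions (ball 0 \<delta>)" "\<And>x. 0 \<le> \<rho> x" "(\<integral>x. \<rho> x \<partial>lborel) = 1"
    have m\<rho> [measurable]: "\<rho> \<in> borel_measurable borel" by (rule test_functions_borel[OF \<rho>(1)])
    have n\<rho>: "(\<integral>\<^sup>+s. ennreal (\<rho> s) \<partial>lborel) = 1"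
      using nn_integral_eq_integral[OF test_functions_integrable[OF \<rho>(1)]] \<rho>(2,3) by simp
    obtain K where K: "K \<subseteq> ball 0 \<delta>" "\<And>x. x \<notin> K \<Longrightarrow> \<rho> x = 0" by (rule test_functionsE[OF \<rho>(1)]) blast
    have mm: "(\<lambda>z. mollify \<rho> h z - h z) \<in> borel_measurable lborel"
      using smooth_borel[OF smooth_mollify[OF \<rho>(1) ih]] mh by simp
    have "(\<integral>\<^sup>+z. ennreal ((norm (mollify \<rho> h z - h z))^2) \<partial>lborel)
      \<le> (\<integral>\<^sup>+z. (\<integral>\<^sup>+s. ennreal (\<rho> s) * ennreal ((norm (h (z - s) - h z))^2) \<partial>lborel) \<partial>lborel)"
      by (rule nn_integral_mono) (rule mollify_error_pointwise[OF h \<rho>])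
    also have "\<dots> = (\<integral>\<^sup>+s. (\<integral>\<^sup>+z. ennreal (\<rho> s) * ennreal ((norm (h (z - s) - h z))^2) \<partial>lborel) \<partial>lborel)"
      by (rule lborel_pair.Fubini') measurable
    also have "\<dots> \<le> (\<integral>\<^sup>+s. ennreal (e^2) * ennreal (\<rho> s) \<partial>lborel)"
    proof (rule nn_integral_mono)
      fix s
      show "(\<integral>\<^sup>+z. ennreal (\<rho> s) * ennreal ((norm (h (z - s) - h z))^2) \<partial>lborel) \<le> ennreal (e^2) * ennreal (\<rho> s)"
      proof (cases "s \<in> K")
        case True
        then have s: "norm (- s) < \<delta>" using K(1) by auto
        have L: "(\<lambda>x. h (x + - s) - h x) \<in> L2 lborel" by (rule L2_diff[OF L2_translate(1)[OF h] h])
        have "(\<integral>\<^sup>+z. ennreal (\<rho> s) * ennreal ((norm (h (z - s) - h z))^2) \<partial>lborel)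
          = ennreal (\<rho> s) * (\<integral>\<^sup>+z. ennreal ((norm (h (z + - s) - h z))^2) \<partial>lborel)"
          by (subst nn_integral_cmult) (simp_all, measurable)
        also have "\<dots> = ennreal (\<rho> s) * ennreal ((l2_norm lborel (\<lambda>x. h (x + - s) - h x))^2)"
          unfolding L2_nn_integral[OF L] by (rule refl)
        also have "\<dots> \<le> ennreal (\<rho> s) * ennreal (e^2)"
          by (intro mult_left_mono ennreal_leI power_mono \<delta>(2)[OF s] l2_norm_nonneg) simp
        finally show ?thesis by (simp add: mult.commute)
      qed (simp add: K(2))
    qed
    also have "\<dots> = ennreal (e^2) * (\<integral>\<^sup>+s. ennreal (\<rho> s) \<partial>lborel)" by (rule nn_integral_cmult) simp
    also have "\<dots> = ennreal (e^2)" unfolding n\<rho> by simp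
    finally have le: "(\<integral>\<^sup>+z. ennreal ((norm (mollify \<rho> h z - h z))^2) \<partial>lborel) \<le> ennreal (e^2)" .
    show "(\<lambda>z. mollify \<rho> h z - h z) \<in> L2 lborel \<and> l2_norm lborel (\<lambda>z. mollify \<rho> h z - h z) \<le> e"
      using L2_I_bound[OF mm le] e by simp
  qed
qed

section \<open>Density of smooth functions in the Sobolev space of the strip\<close>

lemma L2_restrict:
  fixes F :: "'a::euclidean_space \<Rightarrow> complex"
  assumes F: "F \<in> L2 lborel" and \<Omega>: "open \<Omega>"
  shows "F \<in> L2 (lborel_on \<Omega>)" "l2_norm (lborel_on \<Omega>) F \<le> l2_norm lborel F"
proof -
  have m: "F \<in> borel_measurable (lborel_on \<Omega>)"
    by (rule measurable_restrict_space1[OF L2_measurable[OF F]])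
  have "(\<integral>\<^sup>+x. ennreal ((norm (F x))^2) \<partial>lborel_on \<Omega>) = (\<integral>\<^sup>+x. ennreal ((norm (F x))^2) * indicator \<Omega> x \<partial>lborel)"
    by (rule nn_integral_restrict_space[OF open_inter_space_lborel[OF \<Omega>]])
  also have "\<dots> \<le> (\<integral>\<^sup>+x. ennreal ((norm (F x))^2) \<partial>lborel)"
    by (rule nn_integral_mono) (simp add: indicator_def)
  also have "\<dots> = ennreal ((l2_norm lborel F)^2)" by (rule L2_nn_integral[OF F])
  finally have le: "(\<integral>\<^sup>+x. ennreal ((norm (F x))^2) \<partial>lborel_on \<Omega>) \<le> ennreal ((l2_norm lborel F)^2)" .
  show "F \<in> L2 (lborel_on \<Omega>)" "l2_norm (lborel_on \<Omega>) F \<le> l2_norm lborel F"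
    by (rule L2_I_bound[OF m le l2_norm_nonneg])+
qed

lemma L2_extend:
  fixes f :: "'a::euclidean_space \<Rightarrow> complex"
  assumes f: "f \<in> L2 (lborel_on \<Omega>)" and \<Omega>: "open \<Omega>"
  shows "(\<lambda>w. indicator \<Omega> w *\<^sub>R f w) \<in> L2 lborel"
proof (rule L2_of_nn_integral_eq(1)[OF f])
  show "(\<lambda>w. indicator \<Omega> w *\<^sub>R f w) \<in> borel_measurable lborel"
    using L2_measurable[OF f] unfolding borel_measurable_restrict_space_iff[OF open_inter_space_lborel[OF \<Omega>]] .
  show "(\<integral>\<^sup>+x. ennreal ((norm (indicator \<Omega> x *\<^sub>R f x))^2) \<partial>lborel) = (\<integral>\<^sup>+x. ennreal ((norm (f x))^2) \<partial>lborel_on \<Omega>)"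
    unfolding nn_integral_restrict_space[OF open_inter_space_lborel[OF \<Omega>]]
    by (rule nn_integral_cong) (simp add: indicator_def)
qed

lemma L2_test_scaleR:
  fixes f :: "'a::euclidean_space \<Rightarrow> complex" and \<theta> :: "'a \<Rightarrow> real"
  assumes \<theta>: "\<theta> \<in> test_functions U" and f: "f \<in> L2 (lborel_on \<Omega>)"
  shows "(\<lambda>w. \<theta> w *\<^sub>R f w) \<in> L2 (lborel_on \<Omega>)"
proof -
  obtain C where C: "\<And>x. norm (\<theta> x) \<le> C" by (rule test_functions_bounded[OF \<theta>]) blast
  have "(\<lambda>w. complex_of_real (\<theta> w) * f w) \<in> L2 (lborel_on \<Omega>)"
  proof (rule L2_bounded_mult[OF f])
    show "(\<lambda>w. complex_of_real (\<theta> w)) \<in> borel_measurable (lborel_on \<Omega>)"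
      using test_functions_borel[OF \<theta>] by (intro measurable_restrict_space1 borel_measurable_of_real) simp
    show "AE x in lborel_on \<Omega>. norm (complex_of_real (\<theta> x)) \<le> C" using C by simp
  qed
  then show ?thesis by (simp add: scaleR_conv_of_real)
qed

lemma test_scaleR_integrable:
  fixes f :: "'a::euclidean_space \<Rightarrow> complex" and \<theta> :: "'a \<Rightarrow> real"
  assumes \<theta>: "\<theta> \<in> test_functions U" and f: "f \<in> L2 (lborel_on \<Omega>)" and \<Omega>: "open \<Omega>"
  shows "integrable lborel (\<lambda>w. indicator \<Omega> w *\<^sub>R (\<theta> w *\<^sub>R f w))"
proof -
  have "(\<lambda>w. complex_of_real (\<theta> w)) \<in> L2 (lborel_on \<Omega>)"
    by (rule test_functions_L2[OF test_functions_compose_linear[OF \<theta> bounded_linear_of_real] \<Omega>])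
  from L2_integrable_mult[OF this f] show ?thesis
    unfolding integrable_restrict_space[OF open_inter_space_lborel[OF \<Omega>]] by (simp add: scaleR_conv_of_real)
qed

lemma mollify_restrict:
  fixes f :: "'a::euclidean_space \<Rightarrow> complex" and \<theta> :: "'a \<Rightarrow> real"
  assumes \<rho>: "\<rho> \<in> test_functions V" and \<theta>: "\<theta> \<in> test_functions U" and f: "f \<in> L2 (lborel_on \<Omega>)" and \<Omega>: "open \<Omega>"
  shows "mollify \<rho> (\<lambda>w. indicator \<Omega> w *\<^sub>R (\<theta> w *\<^sub>R f w)) z = (\<integral>w. (\<rho> (z - w) * \<theta> w) *\<^sub>R f w \<partial>lborel_on \<Omega>)"
    and "integrable (lborel_on \<Omega>) (\<lambda>w. (\<rho> (z - w) * \<theta> w) *\<^sub>R f w)"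
proof -
  have eq: "\<rho> (z - w) *\<^sub>R (indicator \<Omega> w *\<^sub>R (\<theta> w *\<^sub>R f w)) = indicator \<Omega> w *\<^sub>R ((\<rho> (z - w) * \<theta> w) *\<^sub>R f w)" for w
    by (simp add: indicator_def)
  show "mollify \<rho> (\<lambda>w. indicator \<Omega> w *\<^sub>R (\<theta> w *\<^sub>R f w)) z = (\<integral>w. (\<rho> (z - w) * \<theta> w) *\<^sub>R f w \<partial>lborel_on \<Omega>)"
    unfolding mollify_def eq integral_restrict_space[OF open_inter_space_lborel[OF \<Omega>]] by (rule refl)
  show "integrable (lborel_on \<Omega>) (\<lambda>w. (\<rho> (z - w) * \<theta> w) *\<^sub>R f w)"
    using mollify_integrable[OF \<rho> test_scaleR_integrable[OF \<theta> f \<Omega>], of z]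
    unfolding eq integrable_restrict_space[OF open_inter_space_lborel[OF \<Omega>]] .
qed

text \<open>The condition on \<open>z\<close> makes \<open>\<rho> (z - w) * \<theta> w\<close> a
  legitimate test function in \<open>w\<close>. Testing with it moves the derivative from the kernel
  to \<open>\<theta> f\<close>; the reflection \<open>z - w\<close> cancels the sign of the
  integration by parts.\<close>

lemma mollify_weak_deriv:
  fixes f g :: "'a::euclidean_space \<Rightarrow> complex" and \<theta> :: "'a \<Rightarrow> real"
  assumes w: "weak_deriv \<Omega> v f g" and f: "f \<in> L2 (lborel_on \<Omega>)" and g: "g \<in> L2 (lborel_on \<Omega>)" and \<Omega>: "open \<Omega>"
    and \<rho>: "\<rho> \<in> test_functions V" and \<theta>: "\<theta> \<in> test_functions U"
    and z: "(\<lambda>w. \<rho> (z - w) * \<theta> w) \<in> test_functions \<Omega>"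
  shows "mollify (dir_deriv v \<rho>) (\<lambda>w. indicator \<Omega> w *\<^sub>R (\<theta> w *\<^sub>R f w)) z
    = mollify \<rho> (\<lambda>w. indicator \<Omega> w *\<^sub>R (\<theta> w *\<^sub>R g w + dir_deriv v \<theta> w *\<^sub>R f w)) z"
proof -
  let ?M = "lborel_on \<Omega>"
  note s = test_functions_smooth[OF \<rho>] test_functions_smooth[OF \<theta>]
  note d\<theta> = test_functions_dir_deriv[OF \<theta>]
  have "dir_deriv v (\<lambda>w. \<rho> (z - w) *\<^sub>R \<theta> w) = (\<lambda>w. - dir_deriv v \<rho> (z - w) *\<^sub>R \<theta> w + \<rho> (z - w) *\<^sub>R dir_deriv v \<theta> w)"
    unfolding dir_deriv_scaleR[OF smooth_reflect[OF s(1)] s(2)] dir_deriv_reflect[OF s(1)] by (rule refl)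
  then have d: "dir_deriv v (\<lambda>w. \<rho> (z - w) * \<theta> w) = (\<lambda>w. \<rho> (z - w) * dir_deriv v \<theta> w - dir_deriv v \<rho> (z - w) * \<theta> w)"
    by (simp add: algebra_simps)
  note M1 = mollify_restrict[OF \<rho> test_functions_dir_deriv[OF \<theta>, of v] f \<Omega>, of z]
    and M2 = mollify_restrict[OF test_functions_dir_deriv[OF \<rho>, of v] \<theta> f \<Omega>, of z] and M3 = mollify_restrict[OF \<rho> \<theta> g \<Omega>, of z]
  have "(\<integral>x. dir_deriv v (\<lambda>w. \<rho> (z - w) * \<theta> w) x *\<^sub>R f x \<partial>?M) = - (\<integral>x. (\<rho> (z - x) * \<theta> x) *\<^sub>R g x \<partial>?M)"
    using w z unfolding weak_deriv_def by blast
  then have "(\<integral>x. (\<rho> (z - x) * dir_deriv v \<theta> x) *\<^sub>R f x \<partial>?M) - (\<integral>x. (dir_deriv v \<rho> (z - x) * \<theta> x) *\<^sub>R f x \<partial>?M)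
    = - (\<integral>x. (\<rho> (z - x) * \<theta> x) *\<^sub>R g x \<partial>?M)"
    unfolding d scaleR_diff_left Bochner_Integration.integral_diff[OF M1(2) M2(2)] .
  then have "mollify (dir_deriv v \<rho>) (\<lambda>w. indicator \<Omega> w *\<^sub>R (\<theta> w *\<^sub>R f w)) z
    = mollify \<rho> (\<lambda>w. indicator \<Omega> w *\<^sub>R (\<theta> w *\<^sub>R g w)) z + mollify \<rho> (\<lambda>w. indicator \<Omega> w *\<^sub>R (dir_deriv v \<theta> w *\<^sub>R f w)) z"
    unfolding M1(1) M2(1) M3(1) by (simp add: algebra_simps)
  also have "\<dots> = mollify \<rho> (\<lambda>w. indicator \<Omega> w *\<^sub>R (\<theta> w *\<^sub>R g w + dir_deriv v \<theta> w *\<^sub>R f w)) z"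
    unfolding mollify_def scaleR_add_right
    by (rule Bochner_Integration.integral_add[symmetric])
       (rule mollify_integrable[OF \<rho> test_scaleR_integrable[OF \<theta> g \<Omega>]] mollify_integrable[OF \<rho> test_scaleR_integrable[OF d\<theta> f \<Omega>]])+
  finally show ?thesis .
qed

text \<open>For a cutoff \<^term>\<open>\<theta>\<close> near a part of the boundary, the kernels \<^term>\<open>\<rho>\<close> are supported in directions
  pointing out of \<^term>\<open>\<Omega>\<close>, so that mollification at points of \<^term>\<open>\<Omega>\<close> only uses values from inside.\<close>

lemma mollify_approximation:
  fixes f :: "'a::euclidean_space \<Rightarrow> complex" and \<theta> :: "'a \<Rightarrow> real"
  assumes f: "f \<in> L2 (lborel_on \<Omega>)" and \<Omega>: "open \<Omega>"
    and g: "\<And>i. i \<in> Basis \<Longrightarrow> g i \<in> L2 (lborel_on \<Omega>) \<and> weak_deriv \<Omega> i f (g i)"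
    and \<theta>: "\<theta> \<in> test_functions U" and e: "e > 0"
    and kernel: "\<And>\<delta>. \<delta> > 0 \<Longrightarrow> \<exists>\<rho>. \<rho> \<in> test_functions (ball 0 \<delta>) \<and> (\<forall>x. 0 \<le> \<rho> x) \<and> (\<integral>x. \<rho> x \<partial>lborel) = 1 \<and>
      (\<forall>z\<in>\<Omega>. (\<lambda>w. \<rho> (z - w) * \<theta> w) \<in> test_functions \<Omega>)"
  obtains u where "u \<in> test_functions UNIV" "l2_norm (lborel_on \<Omega>) (\<lambda>z. u z - \<theta> z *\<^sub>R f z) \<le> e"
    "\<And>i. i \<in> Basis \<Longrightarrow> l2_norm (lborel_on \<Omega>) (\<lambda>z. dir_deriv i u z - (\<theta> z *\<^sub>R g i z + dir_deriv i \<theta> z *\<^sub>R f z)) \<le> e"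
proof -
  let ?M = "lborel_on \<Omega>"
  note d\<theta> = test_functions_dir_deriv[OF \<theta>]
  define h0 where "h0 = (\<lambda>w. indicator \<Omega> w *\<^sub>R (\<theta> w *\<^sub>R f w))"
  define h where "h i = (\<lambda>w. indicator \<Omega> w *\<^sub>R (\<theta> w *\<^sub>R g i w + dir_deriv i \<theta> w *\<^sub>R f w))" for i
  have h0: "h0 \<in> L2 lborel" "integrable lborel h0"
    unfolding h0_def by (rule L2_extend[OF L2_test_scaleR[OF \<theta> f] \<Omega>]) (rule test_scaleR_integrable[OF \<theta> f \<Omega>])
  have h: "h i \<in> L2 lborel" "integrable lborel (h i)" if i: "i \<in> Basis" for i
  proof -
    have gi: "g i \<in> L2 ?M" using g[OF i] by blast
    show "h i \<in> L2 lborel" unfolding h_def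
      by (rule L2_extend[OF L2_add[OF L2_test_scaleR[OF \<theta> gi] L2_test_scaleR[OF d\<theta> f]] \<Omega>])
    show "integrable lborel (h i)" unfolding h_def scaleR_add_right
      by (rule Bochner_Integration.integrable_add[OF test_scaleR_integrable[OF \<theta> gi \<Omega>] test_scaleR_integrable[OF d\<theta> f \<Omega>]])
  qed
  \<comment> \<open>A single kernel must serve for the function and for all its derivatives; the
    smallest of the finitely many radii is admissible for each of them.\<close>
  define good where "good H \<delta> \<longleftrightarrow> (\<forall>\<rho>. \<rho> \<in> test_functions (ball 0 \<delta>) \<longrightarrow> (\<forall>x. 0 \<le> \<rho> x) \<longrightarrow> (\<integral>x. \<rho> x \<partial>lborel) = 1 \<longrightarrow>
      (\<lambda>z. mollify \<rho> H z - H z) \<in> L2 lborel \<and> l2_norm lborel (\<lambda>z. mollify \<rho> H z - H z) \<le> e)" for H :: "'a \<Rightarrow> complex" and \<delta>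
  have ex: "\<exists>\<delta>>0. good H \<delta>" if "H \<in> L2 lborel" "integrable lborel H" for H
    by (rule mollify_L2[OF that e]) (unfold good_def, blast)
  obtain \<delta>0 where \<delta>0: "\<delta>0 > 0" "good h0 \<delta>0" using ex[OF h0] by blast
  have "\<forall>i. \<exists>d. i \<in> Basis \<longrightarrow> d > 0 \<and> good (h i) d" using ex h by blast
  from choice[OF this] obtain d where d: "\<And>i. i \<in> Basis \<Longrightarrow> d i > 0 \<and> good (h i) (d i)" by blast
  define \<delta> where "\<delta> = Min (insert \<delta>0 (d ` Basis))"
  have \<delta>: "\<delta> > 0" unfolding \<delta>_def using \<delta>0(1) d by (subst Min_gr_iff) auto
  have "\<delta> \<le> x" if "x \<in> insert \<delta>0 (d ` Basis)" for x unfolding \<delta>_def using that by (intro Min_le) auto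
  then have le: "\<delta> \<le> \<delta>0" "\<And>i. i \<in> Basis \<Longrightarrow> \<delta> \<le> d i" by auto
  obtain \<rho> where \<rho>: "\<rho> \<in> test_functions (ball 0 \<delta>)" "\<forall>x. 0 \<le> \<rho> x" "(\<integral>x. \<rho> x \<partial>lborel) = 1"
    and \<rho>z: "\<And>z. z \<in> \<Omega> \<Longrightarrow> (\<lambda>w. \<rho> (z - w) * \<theta> w) \<in> test_functions \<Omega>" using kernel[OF \<delta>] by blast
  have apply_good: "(\<lambda>z. mollify \<rho> H z - H z) \<in> L2 lborel \<and> l2_norm lborel (\<lambda>z. mollify \<rho> H z - H z) \<le> e"
    if "good H r" "\<delta> \<le> r" for H r
  proof -
    have "\<rho> \<in> test_functions (ball 0 r)" by (rule test_functions_mono[OF \<rho>(1)]) (use that(2) in auto)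
    then show ?thesis using that(1) \<rho>(2,3) unfolding good_def by blast
  qed
  have M0: "(\<lambda>z. mollify \<rho> h0 z - h0 z) \<in> L2 lborel" "l2_norm lborel (\<lambda>z. mollify \<rho> h0 z - h0 z) \<le> e"
    using apply_good[OF \<delta>0(2) le(1)] by auto
  obtain K where K: "compact K" "\<And>x. x \<notin> K \<Longrightarrow> \<theta> x = 0" by (rule test_functionsE[OF \<theta>]) blast
  have u: "mollify \<rho> h0 \<in> test_functions UNIV"
    by (rule mollify_test_function[OF \<rho>(1) h0(2) K(1)]) (simp add: h0_def K(2))
  have on: "l2_norm ?M F \<le> e" if "G \<in> L2 lborel" "l2_norm lborel G \<le> e" "\<And>z. z \<in> \<Omega> \<Longrightarrow> F z = G z"
    "F \<in> borel_measurable ?M" for F G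
  proof -
    have "l2_norm ?M F = l2_norm ?M G"
      using that(3,4) L2_measurable[OF L2_restrict(1)[OF that(1) \<Omega>]]
      by (intro l2_norm_cong) (auto intro!: AE_I2 simp: space_restrict_space)
    also have "\<dots> \<le> l2_norm lborel G" by (rule L2_restrict(2)[OF that(1) \<Omega>])
    finally show ?thesis using that(2) by simp
  qed
  show ?thesis
  proof (rule that[OF u])
    show "l2_norm ?M (\<lambda>z. mollify \<rho> h0 z - \<theta> z *\<^sub>R f z) \<le> e"
    proof (rule on[OF M0])
      show "mollify \<rho> h0 z - \<theta> z *\<^sub>R f z = mollify \<rho> h0 z - h0 z" if "z \<in> \<Omega>" for z
        using that by (simp add: h0_def)
      show "(\<lambda>z. mollify \<rho> h0 z - \<theta> z *\<^sub>R f z) \<in> borel_measurable ?M"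
        by (rule L2_measurable[OF L2_diff[OF test_functions_L2[OF u \<Omega>] L2_test_scaleR[OF \<theta> f]]])
    qed
    fix i :: 'a assume i: "i \<in> Basis"
    have gi: "g i \<in> L2 ?M" "weak_deriv \<Omega> i f (g i)" using g[OF i] by auto
    have Mi: "(\<lambda>z. mollify \<rho> (h i) z - h i z) \<in> L2 lborel" "l2_norm lborel (\<lambda>z. mollify \<rho> (h i) z - h i z) \<le> e"
      using apply_good[of "h i" "d i"] d[OF i] le(2)[OF i] by auto
    show "l2_norm ?M (\<lambda>z. dir_deriv i (mollify \<rho> h0) z - (\<theta> z *\<^sub>R g i z + dir_deriv i \<theta> z *\<^sub>R f z)) \<le> e"
    proof (rule on[OF Mi])
      fix z assume z: "z \<in> \<Omega>"
      have "dir_deriv i (mollify \<rho> h0) z = mollify (dir_deriv i \<rho>) h0 z"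
        unfolding dir_deriv_mollify[OF \<rho>(1) h0(2)] by (rule refl)
      also have "\<dots> = mollify \<rho> (h i) z"
        unfolding h0_def h_def by (rule mollify_weak_deriv[OF gi(2) f gi(1) \<Omega> \<rho>(1) \<theta> \<rho>z[OF z]])
      finally show "dir_deriv i (mollify \<rho> h0) z - (\<theta> z *\<^sub>R g i z + dir_deriv i \<theta> z *\<^sub>R f z) = mollify \<rho> (h i) z - h i z"
        using z by (simp add: h_def)
    next
      show "(\<lambda>z. dir_deriv i (mollify \<rho> h0) z - (\<theta> z *\<^sub>R g i z + dir_deriv i \<theta> z *\<^sub>R f z)) \<in> borel_measurable ?M"
        by (rule L2_measurable[OF L2_diff[OF test_functions_L2[OF test_functions_dir_deriv[OF u] \<Omega>]
                L2_add[OF L2_test_scaleR[OF \<theta> gi(1)] L2_test_scaleR[OF d\<theta> f]]]])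
    qed
  qed
qed

lemma mem_strip: "z \<in> strip \<epsilon> \<longleftrightarrow> 0 < snd z \<and> snd z < \<epsilon>"
  by (cases z) (simp add: strip_def)

lemma open_strip: "open (strip \<epsilon>)"
  unfolding strip_def by (intro open_Times) auto

lemma Basis_real_prod: "(Basis :: (real \<times> real) set) = {(1, 0), (0, 1)}"
  by (auto simp: Basis_prod_def)

subsection \<open>Cutoff functions\<close>

text \<open>Dilated copies of one bump. With parameter 2 the bump equals 1 at the origin, and by
  continuity this suffices for the dilations to tend to 1 pointwise.\<close>

definition plateau :: "nat \<Rightarrow> 'a::euclidean_space \<Rightarrow> real" where
  "plateau n z = box_bump (- One) One 2 ((1 / real (Suc n)) *\<^sub>R z)"

lemma bounded_linear_scale: "bounded_linear (\<lambda>z. c *\<^sub>R z)"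
  by (rule bounded_linear_scaleR_right)

lemma plateau_test_function: "plateau n \<in> test_functions UNIV"
proof -
  have t: "box_bump (- One) One 2 \<in> test_functions (box (- One) One :: 'a set)"
    by (rule box_bump_test_functions) simp
  obtain K where K: "compact K" "\<And>x. x \<notin> K \<Longrightarrow> box_bump (- One) One 2 (x::'a) = 0"
    by (rule test_functionsE[OF t]) blast
  have s: "smooth (\<lambda>z. box_bump (- One) One 2 ((1 / real (Suc n)) *\<^sub>R z + 0) :: real)"
    by (rule smooth_affine[OF bounded_linear_scale smooth_box_bump])
  show ?thesis
  proof (rule test_functionsI)
    show "smooth (plateau n)" using s by (simp add: plateau_def[abs_def])
    show "compact ((\<lambda>z. real (Suc n) *\<^sub>R z) ` K)"
      by (intro compact_continuous_image continuous_intros K(1))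
    fix x assume x: "x \<notin> (\<lambda>z. real (Suc n) *\<^sub>R z) ` K"
    have "(1 / real (Suc n)) *\<^sub>R x \<notin> K"
    proof
      assume "(1 / real (Suc n)) *\<^sub>R x \<in> K"
      then have "real (Suc n) *\<^sub>R ((1 / real (Suc n)) *\<^sub>R x) \<in> (\<lambda>z. real (Suc n) *\<^sub>R z) ` K" by (rule imageI)
      then show False using x by simp
    qed
    then show "plateau n x = 0" unfolding plateau_def by (rule K(2))
  qed simp
qed

lemma plateau_bounds: "0 \<le> plateau n z" "plateau n z \<le> 1"
  unfolding plateau_def by (rule box_bump_bounds)+

lemma plateau_tendsto: "(\<lambda>n. plateau n z) \<longlonglongrightarrow> 1"
proof -
  have b: "box_bump (- One) One 2 (0 :: 'a) = 1"
    by (simp add: box_bump_def step_1)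
  have "isCont (box_bump (- One) One 2) (0 :: 'a)"
    using smooth_continuous[OF smooth_box_bump[of "- One :: 'a" One 2], of UNIV] by (simp add: continuous_on_eq_continuous_at)
  moreover have "(\<lambda>n. (1 / real (Suc n)) *\<^sub>R z) \<longlonglongrightarrow> 0 *\<^sub>R z"
    by (intro tendsto_scaleR tendsto_const LIMSEQ_Suc lim_1_over_n)
  then have "(\<lambda>n. (1 / real (Suc n)) *\<^sub>R z) \<longlonglongrightarrow> 0" unfolding scaleR_zero_left .
  ultimately have "(\<lambda>n. box_bump (- One) One 2 ((1 / real (Suc n)) *\<^sub>R z)) \<longlonglongrightarrow> box_bump (- One) One 2 (0 :: 'a)"
    by (rule isCont_tendsto_compose)
  then show ?thesis unfolding b plateau_def .
qed

text \<open>The dilation gains a factor \<open>1 / Suc n\<close>, so in the product rule the term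
  with the differentiated cutoff disappears in the limit.\<close>

lemma plateau_dir_deriv:
  obtains C where "C \<ge> 0" "\<And>n z. \<bar>dir_deriv v (plateau n) (z :: 'a::euclidean_space)\<bar> \<le> C / real (Suc n)"
proof -
  have t: "box_bump (- One) One 2 \<in> test_functions (box (- One) One :: 'a set)"
    by (rule box_bump_test_functions) simp
  obtain C where C: "C > 0" "\<And>x. norm (dir_deriv v (box_bump (- One) One 2) (x::'a)) \<le> C"
    by (rule test_functions_bounded[OF test_functions_dir_deriv[OF t]]) blast
  have lin: "linear (\<lambda>v. dir_deriv v (box_bump (- One) One 2) x)" for x :: 'a
    by (rule has_derivative_linear[OF smooth_has_derivative[OF smooth_box_bump]])
  have "\<bar>dir_deriv v (plateau n) z\<bar> \<le> C / real (Suc n)" for n and z :: 'a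
  proof -
    have "dir_deriv v (\<lambda>z. box_bump (- One) One 2 ((1 / real (Suc n)) *\<^sub>R z + 0)) z
      = dir_deriv ((1 / real (Suc n)) *\<^sub>R v) (box_bump (- One) One 2) ((1 / real (Suc n)) *\<^sub>R z + 0)"
      unfolding dir_deriv_affine[OF bounded_linear_scale smooth_box_bump] by (rule refl)
    also have "\<dots> = (1 / real (Suc n)) *\<^sub>R dir_deriv v (box_bump (- One) One 2) ((1 / real (Suc n)) *\<^sub>R z + 0)"
      by (rule linear_scale[OF lin])
    finally have "dir_deriv v (plateau n) z = (1 / real (Suc n)) * dir_deriv v (box_bump (- One) One 2) ((1 / real (Suc n)) *\<^sub>R z)"
      by (simp add: plateau_def[abs_def])
    then show ?thesis using C(2)[of "(1 / real (Suc n)) *\<^sub>R z"] by (simp add: abs_mult divide_right_mono)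
  qed
  with C(1) show ?thesis by (intro that[of C]) auto
qed

lemma plateau_L2_tendsto:
  fixes f :: "'a::euclidean_space \<Rightarrow> complex"
  assumes f: "f \<in> L2 (lborel_on \<Omega>)"
  shows "(\<lambda>n. l2_norm (lborel_on \<Omega>) (\<lambda>z. plateau n z *\<^sub>R f z - f z)) \<longlonglongrightarrow> 0"
proof -
  let ?M = "lborel_on \<Omega>"
  have mp: "plateau n \<in> borel_measurable ?M" for n
    using test_functions_borel[OF plateau_test_function] by (intro measurable_restrict_space1) simp
  have mf: "f \<in> borel_measurable ?M" by (rule L2_measurable[OF f])
  have "(\<lambda>n. \<integral>z. (norm (plateau n z *\<^sub>R f z - f z))^2 \<partial>?M) \<longlonglongrightarrow> (\<integral>z. 0 \<partial>?M)"
  proof (rule integral_dominated_convergence)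
    show "(\<lambda>z. (norm (plateau n z *\<^sub>R f z - f z))^2) \<in> borel_measurable ?M" for n
      using mp[of n] mf by measurable
    show "integrable ?M (\<lambda>z. (norm (f z))^2)" by (rule L2_integrable_sq[OF f])
    show "AE z in ?M. (\<lambda>n. (norm (plateau n z *\<^sub>R f z - f z))^2) \<longlonglongrightarrow> 0"
    proof (rule AE_I2)
      fix z
      have "(\<lambda>n. (norm (plateau n z *\<^sub>R f z - f z))^2) \<longlonglongrightarrow> (norm (1 *\<^sub>R f z - f z))^2"
        by (intro tendsto_intros plateau_tendsto)
      then show "(\<lambda>n. (norm (plateau n z *\<^sub>R f z - f z))^2) \<longlonglongrightarrow> 0" by simp
    qed
    show "AE z in ?M. norm ((norm (plateau n z *\<^sub>R f z - f z))^2) \<le> (norm (f z))^2" for n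
    proof (rule AE_I2)
      fix z
      have "plateau n z *\<^sub>R f z - f z = (plateau n z - 1) *\<^sub>R f z" by (simp add: scaleR_diff_left)
      then have "norm (plateau n z *\<^sub>R f z - f z) = \<bar>plateau n z - 1\<bar> * norm (f z)" by simp
      also have "\<dots> \<le> 1 * norm (f z)" using plateau_bounds[of n z] by (intro mult_right_mono) auto
      finally have "norm (plateau n z *\<^sub>R f z - f z) \<le> norm (f z)" by simp
      then show "norm ((norm (plateau n z *\<^sub>R f z - f z))^2) \<le> (norm (f z))^2" by (simp add: power_mono)
    qed
  qed simp
  then have "(\<lambda>n. sqrt (\<integral>z. (norm (plateau n z *\<^sub>R f z - f z))^2 \<partial>?M)) \<longlonglongrightarrow> sqrt 0"
    by (intro tendsto_real_sqrt) simp
  then show ?thesis by (simp add: l2_norm_def)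
qed

lemma plateau_dir_deriv_L2_tendsto:
  fixes f :: "'a::euclidean_space \<Rightarrow> complex"
  assumes f: "f \<in> L2 (lborel_on \<Omega>)"
  shows "(\<lambda>n. l2_norm (lborel_on \<Omega>) (\<lambda>z. dir_deriv v (plateau n) z *\<^sub>R f z)) \<longlonglongrightarrow> 0"
proof -
  let ?M = "lborel_on \<Omega>"
  obtain C where C: "C \<ge> 0" "\<And>n z. \<bar>dir_deriv v (plateau n) (z :: 'a)\<bar> \<le> C / real (Suc n)" by (rule plateau_dir_deriv) blast
  have bnd: "l2_norm ?M (\<lambda>z. dir_deriv v (plateau n) z *\<^sub>R f z) \<le> C / real (Suc n) * l2_norm ?M f" for n
  proof -
    have "l2_norm ?M (\<lambda>z. complex_of_real (dir_deriv v (plateau n) z) * f z) \<le> C / real (Suc n) * l2_norm ?M f"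
    proof (rule l2_norm_bounded_mult[OF f])
      have "dir_deriv v (plateau n) \<in> borel_measurable (borel :: 'a measure)"
        by (rule test_functions_borel[OF test_functions_dir_deriv[OF plateau_test_function]])
      then show "(\<lambda>z. complex_of_real (dir_deriv v (plateau n) z)) \<in> borel_measurable ?M"
        by (intro measurable_restrict_space1 borel_measurable_of_real) simp
      show "AE x in ?M. norm (complex_of_real (dir_deriv v (plateau n) x)) \<le> C / real (Suc n)" using C(2) by simp
    qed (use C(1) in simp)
    then show ?thesis by (simp add: scaleR_conv_of_real)
  qed
  have "(\<lambda>n. C * (1 / real (Suc n)) * l2_norm ?M f) \<longlonglongrightarrow> C * 0 * l2_norm ?M f"
    by (intro tendsto_mult tendsto_const LIMSEQ_Suc lim_1_over_n)
  then have "(\<lambda>n. C / real (Suc n) * l2_norm ?M f) \<longlonglongrightarrow> 0" by simp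
  then show ?thesis
    by (rule Lim_null_comparison[rotated]) (use bnd in \<open>simp add: l2_norm_nonneg\<close>)
qed

text \<open>For \<open>\<sigma> = 1\<close> the cutoff lives below height \<open>c\<close> and the
  kernel on \<open>snd s < 0\<close>, so \<open>w = z - s\<close> lies above \<open>z\<close>: it
  stays positive in the second coordinate, while the cutoff keeps it below
  \<open>c < \<epsilon>\<close>. For \<open>\<sigma> = - 1\<close> everything is mirrored towards
  the upper line.\<close>

lemma strip_kernel_exists:
  fixes \<theta> :: "real \<times> real \<Rightarrow> real" and \<sigma> :: real
  assumes \<theta>: "smooth \<theta>" and c: "0 < c" "c < \<epsilon>" and \<delta>: "\<delta> > 0"
    and side: "\<sigma> = 1 \<and> (\<forall>z. snd z \<ge> c \<longrightarrow> \<theta> z = 0) \<or> \<sigma> = - 1 \<and> (\<forall>z. snd z \<le> c \<longrightarrow> \<theta> z = 0)"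
  shows "\<exists>\<rho>. \<rho> \<in> test_functions (ball 0 \<delta>) \<and> (\<forall>x. 0 \<le> \<rho> x) \<and> (\<integral>x. \<rho> x \<partial>lborel) = 1 \<and>
      (\<forall>z\<in>strip \<epsilon>. (\<lambda>w. \<rho> (z - w) * \<theta> w) \<in> test_functions (strip \<epsilon>))"
proof -
  let ?U = "ball 0 \<delta> \<inter> {s :: real \<times> real. \<sigma> * snd s < 0}"
  have "open {s :: real \<times> real. \<sigma> * snd s < 0}" by (intro open_Collect_less continuous_intros)
  then have "open ?U" by (rule open_Int[OF open_ball])
  moreover have "(0, - \<sigma> * \<delta> / 2) \<in> ?U" using \<delta> side by (auto simp: norm_Pair)
  ultimately obtain \<rho> :: "real \<times> real \<Rightarrow> real" where \<rho>: "\<rho> \<in> test_functions ?U" "\<And>x. 0 \<le> \<rho> x" "(\<integral>x. \<rho> x \<partial>lborel) = 1"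
    by (rule test_functions_normalized_exists) blast
  have "(\<lambda>w. \<rho> (z - w) * \<theta> w) \<in> test_functions (strip \<epsilon>)" if z: "z \<in> strip \<epsilon>" for z
  proof -
    obtain K where K: "compact K" "K \<subseteq> ?U" "\<And>x. x \<notin> K \<Longrightarrow> \<rho> x = 0" by (rule test_functionsE[OF \<rho>(1)]) blast
    \<comment> \<open>The first set carries the kernel, the second the cutoff; each bounds the
      distance from one of the two boundary lines.\<close>
    let ?K = "(\<lambda>s. z - s) ` K \<inter> {w. \<sigma> * snd w \<le> \<sigma> * c}"
    show ?thesis
    proof (rule test_functionsI)
      show "smooth (\<lambda>w. \<rho> (z - w) * \<theta> w)"
        by (rule smooth_mult[OF smooth_reflect[OF test_functions_smooth[OF \<rho>(1)]] \<theta>])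
      show "compact ?K"
        by (intro compact_Int_closed compact_continuous_image continuous_intros K(1) closed_Collect_le)
      show "?K \<subseteq> strip \<epsilon>"
      proof
        fix w assume w: "w \<in> ?K"
        then obtain s where s: "s \<in> K" "w = z - s" by blast
        have "\<sigma> * snd s < 0" using s(1) K(2) by auto
        moreover have "\<sigma> * snd w \<le> \<sigma> * c" using w by blast
        ultimately show "w \<in> strip \<epsilon>" using side z c s(2) by (auto simp: mem_strip)
      qed
      fix w assume w: "w \<notin> ?K"
      show "\<rho> (z - w) * \<theta> w = 0"
      proof (cases "w \<in> (\<lambda>s. z - s) ` K")
        case True
        then have "\<not> \<sigma> * snd w \<le> \<sigma> * c" using w by blast
        then have "\<theta> w = 0" using side by (metis mult_1 mult_minus1 neg_le_iff_le nle_le)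
        then show ?thesis by simp
      next
        case False
        have "z - w \<notin> K"
        proof
          assume "z - w \<in> K"
          then have "z - (z - w) \<in> (\<lambda>s. z - s) ` K" by (rule imageI)
          then show False using False by simp
        qed
        then show ?thesis using K(3) by simp
      qed
    qed
  qed
  moreover have "\<rho> \<in> test_functions (ball 0 \<delta>)" by (rule test_functions_mono[OF \<rho>(1)]) blast
  ultimately show ?thesis using \<rho>(2,3) by blast
qed

text \<open>The error is split into three thirds: truncation by a plateau, and mollification of a
  lower and an upper part. The two cutoffs add up to the plateau, so the derivatives of the
  splitting function cancel and only those of the plateau remain.\<close>

lemma H1_strip_approximation:
  assumes \<epsilon>: "\<epsilon> > 0" and f: "f \<in> H1 (strip \<epsilon>)" and e: "e > 0"
  obtains u where "u \<in> test_functions UNIV" "l2_norm (lborel_on (strip \<epsilon>)) (\<lambda>z. u z - f z) \<le> e"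
    "\<And>i. i \<in> Basis \<Longrightarrow> l2_norm (lborel_on (strip \<epsilon>)) (\<lambda>z. dir_deriv i u z - wderiv (strip \<epsilon>) i f z) \<le> e"
proof -
  let ?\<Omega> = "strip \<epsilon>" and ?M = "lborel_on (strip \<epsilon>)"
  note \<Omega> = open_strip[of \<epsilon>]
  define g where "g i = wderiv ?\<Omega> i f" for i
  have fL: "f \<in> L2 ?M" by (rule H1_D(1)[OF f \<Omega>])
  have g: "g i \<in> L2 ?M \<and> weak_deriv ?\<Omega> i f (g i)" if "i \<in> Basis" for i
    unfolding g_def using H1_D(2,3)[OF f \<Omega> that] by blast
  have gi: "g i \<in> L2 ?M" if "i \<in> Basis" for i using g[OF that] by blast
  have e3: "e / 3 > 0" using e by simp
  \<comment> \<open>This rises from 0 at height \<open>\<epsilon> / 3\<close> to 1 at height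
    \<open>2 * \<epsilon> / 3\<close>, so each part stays away from one of the boundary
    lines.\<close>
  let ?\<kappa> = "\<lambda>z::real \<times> real. step (3 / \<epsilon> * snd z + - 1)"
  have \<kappa>: "smooth ?\<kappa>"
    by (rule smooth_step_affine) (intro bounded_linear_const_mult bounded_linear_snd)
  have \<kappa>': "smooth (\<lambda>z. 1 + (-1) * ?\<kappa> z)" by (intro smooth_add smooth_mult smooth_const \<kappa>)
  have "\<forall>\<^sub>F n in sequentially. l2_norm ?M (\<lambda>z. plateau n z *\<^sub>R f z - f z) < e / 3"
    by (rule order_tendstoD(2)[OF plateau_L2_tendsto[OF fL] e3])
  moreover have "\<forall>\<^sub>F n in sequentially. \<forall>i\<in>Basis. l2_norm ?M (\<lambda>z. (plateau n z *\<^sub>R g i z + dir_deriv i (plateau n) z *\<^sub>R f z) - g i z) < e / 3"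
  proof (rule eventually_ball_finite, simp, rule ballI)
    fix i :: "real \<times> real" assume i: "i \<in> Basis"
    have "(\<lambda>n. l2_norm ?M (\<lambda>z. plateau n z *\<^sub>R g i z - g i z) + l2_norm ?M (\<lambda>z. dir_deriv i (plateau n) z *\<^sub>R f z)) \<longlonglongrightarrow> 0 + 0"
      by (intro tendsto_add plateau_L2_tendsto gi i plateau_dir_deriv_L2_tendsto fL)
    then have "(\<lambda>n. l2_norm ?M (\<lambda>z. plateau n z *\<^sub>R g i z - g i z) + l2_norm ?M (\<lambda>z. dir_deriv i (plateau n) z *\<^sub>R f z)) \<longlonglongrightarrow> 0" by simp
    from order_tendstoD(2)[OF this e3]
    show "\<forall>\<^sub>F n in sequentially. l2_norm ?M (\<lambda>z. (plateau n z *\<^sub>R g i z + dir_deriv i (plateau n) z *\<^sub>R f z) - g i z) < e / 3"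
    proof eventually_elim
      fix n assume le: "l2_norm ?M (\<lambda>z. plateau n z *\<^sub>R g i z - g i z) + l2_norm ?M (\<lambda>z. dir_deriv i (plateau n) z *\<^sub>R f z) < e / 3"
      have "l2_norm ?M (\<lambda>z. (plateau n z *\<^sub>R g i z - g i z) + dir_deriv i (plateau n) z *\<^sub>R f z)
        \<le> l2_norm ?M (\<lambda>z. plateau n z *\<^sub>R g i z - g i z) + l2_norm ?M (\<lambda>z. dir_deriv i (plateau n) z *\<^sub>R f z)"
        by (rule l2_norm_triangle[OF L2_diff[OF L2_test_scaleR[OF plateau_test_function gi[OF i]] gi[OF i]]
              L2_test_scaleR[OF test_functions_dir_deriv[OF plateau_test_function] fL]])
      moreover have "(\<lambda>z. (plateau n z *\<^sub>R g i z - g i z) + dir_deriv i (plateau n) z *\<^sub>R f z)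
        = (\<lambda>z. (plateau n z *\<^sub>R g i z + dir_deriv i (plateau n) z *\<^sub>R f z) - g i z)" by (simp add: algebra_simps)
      ultimately show "l2_norm ?M (\<lambda>z. (plateau n z *\<^sub>R g i z + dir_deriv i (plateau n) z *\<^sub>R f z) - g i z) < e / 3"
        using le by simp
    qed
  qed
  ultimately have "\<forall>\<^sub>F n in sequentially. l2_norm ?M (\<lambda>z. plateau n z *\<^sub>R f z - f z) < e / 3 \<and>
    (\<forall>i\<in>Basis. l2_norm ?M (\<lambda>z. (plateau n z *\<^sub>R g i z + dir_deriv i (plateau n) z *\<^sub>R f z) - g i z) < e / 3)"
    by (rule eventually_conj)
  from eventually_happens'[OF sequentially_bot this]
  obtain n where n0: "l2_norm ?M (\<lambda>z. plateau n z *\<^sub>R f z - f z) < e / 3"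
    and n1: "\<And>i. i \<in> Basis \<Longrightarrow> l2_norm ?M (\<lambda>z. (plateau n z *\<^sub>R g i z + dir_deriv i (plateau n) z *\<^sub>R f z) - g i z) < e / 3"
    by blast
  define \<theta>1 where "\<theta>1 z = plateau n z *\<^sub>R (1 + (-1) * ?\<kappa> z)" for z
  define \<theta>2 where "\<theta>2 z = plateau n z *\<^sub>R ?\<kappa> z" for z
  have \<theta>1: "\<theta>1 \<in> test_functions UNIV" unfolding \<theta>1_def[abs_def] by (rule test_functions_scaleR[OF plateau_test_function \<kappa>'])
  have \<theta>2: "\<theta>2 \<in> test_functions UNIV" unfolding \<theta>2_def[abs_def] by (rule test_functions_scaleR[OF plateau_test_function \<kappa>])
  have sum: "\<theta>1 z + \<theta>2 z = plateau n z" for z by (simp add: \<theta>1_def \<theta>2_def algebra_simps)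
  have dsum: "dir_deriv i \<theta>1 z + dir_deriv i \<theta>2 z = dir_deriv i (plateau n) z" for i z
    using fun_cong[OF dir_deriv_add[OF test_functions_smooth[OF \<theta>1] test_functions_smooth[OF \<theta>2], of i], of z]
    unfolding sum by simp
  have z1: "\<theta>1 z = 0" if "snd z \<ge> 2 * \<epsilon> / 3" for z
  proof -
    have "3 / \<epsilon> * snd z + - 1 \<ge> 1" using that \<epsilon> by (simp add: field_simps)
    then show ?thesis by (simp add: \<theta>1_def step_1)
  qed
  have z2: "\<theta>2 z = 0" if "snd z \<le> \<epsilon> / 3" for z
  proof -
    have "3 / \<epsilon> * snd z + - 1 \<le> 0" using that \<epsilon> by (simp add: field_simps)
    then show ?thesis by (simp add: \<theta>2_def step_0)
  qed
  have k1: "\<exists>\<rho>. \<rho> \<in> test_functions (ball 0 \<delta>) \<and> (\<forall>x. 0 \<le> \<rho> x) \<and> (\<integral>x. \<rho> x \<partial>lborel) = 1 \<and>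
      (\<forall>z\<in>?\<Omega>. (\<lambda>w. \<rho> (z - w) * \<theta>1 w) \<in> test_functions ?\<Omega>)" if "\<delta> > 0" for \<delta>
    by (rule strip_kernel_exists[OF test_functions_smooth[OF \<theta>1], of "2 * \<epsilon> / 3" \<epsilon> \<delta> 1]) (use \<epsilon> that z1 in auto)
  have k2: "\<exists>\<rho>. \<rho> \<in> test_functions (ball 0 \<delta>) \<and> (\<forall>x. 0 \<le> \<rho> x) \<and> (\<integral>x. \<rho> x \<partial>lborel) = 1 \<and>
      (\<forall>z\<in>?\<Omega>. (\<lambda>w. \<rho> (z - w) * \<theta>2 w) \<in> test_functions ?\<Omega>)" if "\<delta> > 0" for \<delta>
    by (rule strip_kernel_exists[OF test_functions_smooth[OF \<theta>2], of "\<epsilon> / 3" \<epsilon> \<delta> "-1"]) (use \<epsilon> that z2 in auto)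
  obtain u1 where u1: "u1 \<in> test_functions UNIV" "l2_norm ?M (\<lambda>z. u1 z - \<theta>1 z *\<^sub>R f z) \<le> e / 3"
    "\<And>i. i \<in> Basis \<Longrightarrow> l2_norm ?M (\<lambda>z. dir_deriv i u1 z - (\<theta>1 z *\<^sub>R g i z + dir_deriv i \<theta>1 z *\<^sub>R f z)) \<le> e / 3"
    by (rule mollify_approximation[OF fL \<Omega> g \<theta>1 e3 k1]) blast+
  obtain u2 where u2: "u2 \<in> test_functions UNIV" "l2_norm ?M (\<lambda>z. u2 z - \<theta>2 z *\<^sub>R f z) \<le> e / 3"
    "\<And>i. i \<in> Basis \<Longrightarrow> l2_norm ?M (\<lambda>z. dir_deriv i u2 z - (\<theta>2 z *\<^sub>R g i z + dir_deriv i \<theta>2 z *\<^sub>R f z)) \<le> e / 3"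
    by (rule mollify_approximation[OF fL \<Omega> g \<theta>2 e3 k2]) blast+
  have tri: "l2_norm ?M (\<lambda>z. (a z + b z) - c z) \<le> e"
    if L: "a \<in> L2 ?M" "b \<in> L2 ?M" "c \<in> L2 ?M" "a' \<in> L2 ?M" "b' \<in> L2 ?M"
      and le: "l2_norm ?M (\<lambda>z. a z - a' z) \<le> e / 3" "l2_norm ?M (\<lambda>z. b z - b' z) \<le> e / 3" "l2_norm ?M (\<lambda>z. (a' z + b' z) - c z) \<le> e / 3"
    for a b c a' b' :: "real \<times> real \<Rightarrow> complex"
  proof -
    have "l2_norm ?M (\<lambda>z. (a z + b z) - c z) \<le> l2_norm ?M (\<lambda>z. (a z + b z) - (a' z + b' z)) + l2_norm ?M (\<lambda>z. (a' z + b' z) - c z)"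
      by (rule l2_norm_triangle_diff[OF L2_add[OF L(1,2)] L2_add[OF L(4,5)] L(3)])
    moreover have "(\<lambda>z. (a z + b z) - (a' z + b' z)) = (\<lambda>z. (a z - a' z) + (b z - b' z))" by (simp add: algebra_simps)
    moreover have "l2_norm ?M (\<lambda>z. (a z - a' z) + (b z - b' z)) \<le> l2_norm ?M (\<lambda>z. a z - a' z) + l2_norm ?M (\<lambda>z. b z - b' z)"
      by (rule l2_norm_triangle[OF L2_diff[OF L(1,4)] L2_diff[OF L(2,5)]])
    ultimately show ?thesis using le by simp
  qed
  show ?thesis
  proof (rule that[OF test_functions_add[OF u1(1) u2(1)]])
    show "l2_norm ?M (\<lambda>z. (u1 z + u2 z) - f z) \<le> e"
    proof (rule tri[OF test_functions_L2[OF u1(1) \<Omega>] test_functions_L2[OF u2(1) \<Omega>] fL L2_test_scaleR[OF \<theta>1 fL] L2_test_scaleR[OF \<theta>2 fL] u1(2) u2(2)])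
      show "l2_norm ?M (\<lambda>z. (\<theta>1 z *\<^sub>R f z + \<theta>2 z *\<^sub>R f z) - f z) \<le> e / 3"
        unfolding scaleR_add_left[symmetric] sum using n0 by simp
    qed
    fix i :: "real \<times> real" assume i: "i \<in> Basis"
    have "l2_norm ?M (\<lambda>z. (dir_deriv i u1 z + dir_deriv i u2 z) - g i z) \<le> e"
    proof (rule tri[OF test_functions_L2[OF test_functions_dir_deriv[OF u1(1)] \<Omega>] test_functions_L2[OF test_functions_dir_deriv[OF u2(1)] \<Omega>] gi[OF i]
          L2_add[OF L2_test_scaleR[OF \<theta>1 gi[OF i]] L2_test_scaleR[OF test_functions_dir_deriv[OF \<theta>1] fL]]
          L2_add[OF L2_test_scaleR[OF \<theta>2 gi[OF i]] L2_test_scaleR[OF test_functions_dir_deriv[OF \<theta>2] fL]] u1(3)[OF i] u2(3)[OF i]])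
      have "(\<theta>1 z *\<^sub>R g i z + dir_deriv i \<theta>1 z *\<^sub>R f z) + (\<theta>2 z *\<^sub>R g i z + dir_deriv i \<theta>2 z *\<^sub>R f z)
        = (\<theta>1 z + \<theta>2 z) *\<^sub>R g i z + (dir_deriv i \<theta>1 z + dir_deriv i \<theta>2 z) *\<^sub>R f z" for z
        by (simp only: scaleR_add_left add.assoc add.left_commute)
      then show "l2_norm ?M (\<lambda>z. ((\<theta>1 z *\<^sub>R g i z + dir_deriv i \<theta>1 z *\<^sub>R f z) + (\<theta>2 z *\<^sub>R g i z + dir_deriv i \<theta>2 z *\<^sub>R f z)) - g i z) \<le> e / 3"
        unfolding sum dsum using n1[OF i] by simp
    qed
    then show "l2_norm ?M (\<lambda>z. dir_deriv i (\<lambda>x. u1 x + u2 x) z - wderiv ?\<Omega> i f z) \<le> e"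
      unfolding dir_deriv_add[OF test_functions_smooth[OF u1(1)] test_functions_smooth[OF u2(1)]] g_def .
  qed
qed

lemma H1_strip_dense:
  assumes \<epsilon>: "\<epsilon> > 0" and f: "f \<in> H1 (strip \<epsilon>)"
  obtains u where "\<And>n. u n \<in> test_functions UNIV" "(\<lambda>n. l2_norm (lborel_on (strip \<epsilon>)) (\<lambda>z. u n z - f z)) \<longlonglongrightarrow> 0"
    "\<And>i. i \<in> Basis \<Longrightarrow> (\<lambda>n. l2_norm (lborel_on (strip \<epsilon>)) (\<lambda>z. dir_deriv i (u n) z - wderiv (strip \<epsilon>) i f z)) \<longlonglongrightarrow> 0"
proof -
  let ?M = "lborel_on (strip \<epsilon>)"
  have "\<exists>u. u \<in> test_functions UNIV \<and> l2_norm ?M (\<lambda>z. u z - f z) \<le> 1 / real (Suc n) \<and>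
    (\<forall>i\<in>Basis. l2_norm ?M (\<lambda>z. dir_deriv i u z - wderiv (strip \<epsilon>) i f z) \<le> 1 / real (Suc n))" for n
  proof -
    have "1 / real (Suc n) > 0" by simp
    then show ?thesis by (rule H1_strip_approximation[OF \<epsilon> f]) blast
  qed
  then have "\<forall>n. \<exists>u. u \<in> test_functions UNIV \<and> l2_norm ?M (\<lambda>z. u z - f z) \<le> 1 / real (Suc n) \<and>
    (\<forall>i\<in>Basis. l2_norm ?M (\<lambda>z. dir_deriv i u z - wderiv (strip \<epsilon>) i f z) \<le> 1 / real (Suc n))" by blast
  from choice[OF this] obtain u where u: "\<And>n. u n \<in> test_functions UNIV" "\<And>n. l2_norm ?M (\<lambda>z. u n z - f z) \<le> 1 / real (Suc n)"
    "\<And>n i. i \<in> Basis \<Longrightarrow> l2_norm ?M (\<lambda>z. dir_deriv i (u n) z - wderiv (strip \<epsilon>) i f z) \<le> 1 / real (Suc n)" by blast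
  have lim: "a \<longlonglongrightarrow> 0" if "\<And>n. 0 \<le> a n" "\<And>n. a n \<le> 1 / real (Suc n)" for a :: "nat \<Rightarrow> real"
    by (rule Lim_null_comparison[OF _ LIMSEQ_Suc[OF lim_1_over_n]]) (use that in simp)
  show ?thesis by (rule that[OF u(1)]; rule lim) (use u(2,3) in \<open>auto simp: l2_norm_nonneg\<close>)
qed

section \<open>Traces on the boundary of the strip\<close>

lemma bounded_linear_Pair_left: "bounded_linear (\<lambda>x::real. (x, 0::real))"
  and bounded_linear_Pair_right: "bounded_linear (\<lambda>y::real. (0::real, y))"
  by (intro bounded_linear_Pair bounded_linear_ident bounded_linear_zero)+

lemma slice_dir_deriv:
  fixes u :: "real \<times> real \<Rightarrow> complex"
  assumes "smooth u"
  shows "dir_deriv 1 (\<lambda>x. u (x, y)) = (\<lambda>x. dir_deriv (1, 0) u (x, y))"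
    and "dir_deriv 1 (\<lambda>y. u (x, y)) = (\<lambda>y. dir_deriv (0, 1) u (x, y))"
  using dir_deriv_affine[OF bounded_linear_Pair_left assms, of 1 "(0, y)"]
    dir_deriv_affine[OF bounded_linear_Pair_right assms, of 1 "(x, 0)"] by simp_all

lemma slice_smooth:
  fixes u :: "real \<times> real \<Rightarrow> 'b::real_normed_vector"
  assumes "smooth u" shows "smooth (\<lambda>x. u (x, y))" "smooth (\<lambda>y. u (x, y))"
  using smooth_affine[OF bounded_linear_Pair_left assms, of "(0, y)"]
    smooth_affine[OF bounded_linear_Pair_right assms, of "(x, 0)"] by simp_all

lemma slice_test_function:
  fixes u :: "real \<times> real \<Rightarrow> 'b::real_normed_vector"
  assumes "u \<in> test_functions U" shows "(\<lambda>x. u (x, y)) \<in> test_functions UNIV"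
proof -
  obtain K where K: "compact K" "\<And>x. x \<notin> K \<Longrightarrow> u x = 0" by (rule test_functionsE[OF assms]) blast
  show ?thesis
  proof (rule test_functionsI)
    show "smooth (\<lambda>x. u (x, y))" by (rule slice_smooth(1)[OF test_functions_smooth[OF assms]])
    show "compact (fst ` K)" by (intro compact_continuous_image continuous_intros K(1))
    fix x assume "x \<notin> fst ` K"
    then have "(x, y) \<notin> K" by force
    then show "u (x, y) = 0" by (rule K(2))
  qed simp
qed

lemma has_vector_derivative_slice:
  fixes u :: "real \<times> real \<Rightarrow> complex"
  assumes "smooth u"
  shows "((\<lambda>y. u (x, y)) has_vector_derivative dir_deriv (0, 1) u (x, y)) (at y within S)"
proof -
  have s: "smooth (\<lambda>y. u (x, y))" by (rule slice_smooth(2)[OF assms])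
  have D: "((\<lambda>y. u (x, y)) has_derivative (\<lambda>v. dir_deriv v (\<lambda>y. u (x, y)) y)) (at y)"
    by (rule smooth_has_derivative[OF s])
  have "dir_deriv v (\<lambda>y. u (x, y)) y = v *\<^sub>R dir_deriv (0, 1) u (x, y)" for v
    using linear_scale[OF has_derivative_linear[OF D], of v 1] fun_cong[OF slice_dir_deriv(2)[OF assms, of x], of y] by simp
  then show ?thesis using has_derivative_at_withinI[OF D] by (simp add: has_vector_derivative_def)
qed

text \<open>Both orders are recorded: integrating in \<open>y\<close> first serves the normal
  derivative, integrating in \<open>x\<close> first the tangential one.\<close>

lemma strip_integral:
  fixes F :: "real \<times> real \<Rightarrow> complex"
  assumes F: "integrable lborel F"
  shows "(\<integral>z. F z \<partial>lborel_on (strip \<epsilon>)) = (\<integral>x. (\<integral>y. indicator {0<..<\<epsilon>} y *\<^sub>R F (x, y) \<partial>lborel) \<partial>lborel)"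
    and "(\<integral>z. F z \<partial>lborel_on (strip \<epsilon>)) = (\<integral>y. (\<integral>x. indicator {0<..<\<epsilon>} y *\<^sub>R F (x, y) \<partial>lborel) \<partial>lborel)"
proof -
  have i: "integrable (lborel \<Otimes>\<^sub>M lborel) (\<lambda>z. indicator (strip \<epsilon>) z *\<^sub>R F z)"
    unfolding lborel_prod using open_strip by (intro integrable_mult_indicator F) simp
  have e: "(\<integral>z. F z \<partial>lborel_on (strip \<epsilon>)) = (\<integral>z. indicator (strip \<epsilon>) z *\<^sub>R F z \<partial>(lborel \<Otimes>\<^sub>M lborel))"
    unfolding lborel_prod by (rule integral_restrict_space[OF open_inter_space_lborel[OF open_strip]])
  have ind: "indicator (strip \<epsilon>) (x, y) = (indicator {0<..<\<epsilon>} y :: real)" for x y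
    by (simp add: indicator_def mem_strip)
  show "(\<integral>z. F z \<partial>lborel_on (strip \<epsilon>)) = (\<integral>x. (\<integral>y. indicator {0<..<\<epsilon>} y *\<^sub>R F (x, y) \<partial>lborel) \<partial>lborel)"
    unfolding e lborel_pair.integral_fst'[OF i, symmetric] ind by (rule refl)
  have c: "(\<lambda>(x, y). indicator (strip \<epsilon>) (x, y) *\<^sub>R F (x, y)) = (\<lambda>z. indicator (strip \<epsilon>) z *\<^sub>R F z)"
    by (rule ext) (simp only: case_prod_unfold prod.collapse)
  have i': "integrable (lborel \<Otimes>\<^sub>M lborel) (\<lambda>(x, y). indicator (strip \<epsilon>) (x, y) *\<^sub>R F (x, y))"
    unfolding c by (rule i)
  have s: "(\<integral>z. indicator (strip \<epsilon>) z *\<^sub>R F z \<partial>(lborel \<Otimes>\<^sub>M lborel))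
    = (\<integral>y. (\<integral>x. indicator (strip \<epsilon>) (x, y) *\<^sub>R F (x, y) \<partial>lborel) \<partial>lborel)"
    using lborel_pair.integral_snd[OF i', symmetric] unfolding c .
  show "(\<integral>z. F z \<partial>lborel_on (strip \<epsilon>)) = (\<integral>y. (\<integral>x. indicator {0<..<\<epsilon>} y *\<^sub>R F (x, y) \<partial>lborel) \<partial>lborel)"
    unfolding e s ind by (rule refl)
qed

text \<open>The weight \<open>b\<close> depends on \<open>x\<close> only, so it leaves the inner
  integral, to which the fundamental theorem of calculus applies in \<open>y\<close>. The choices of
  \<open>b\<close> are the constant 1 and the Robin coefficient.\<close>

lemma strip_FTC:
  fixes U :: "real \<times> real \<Rightarrow> complex" and b :: "real \<Rightarrow> real"
  assumes U: "U \<in> test_functions V" and b: "b \<in> borel_measurable borel" "\<And>x. \<bar>b x\<bar> \<le> C" and \<epsilon>: "\<epsilon> > 0"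
  shows "(\<integral>z. b (fst z) *\<^sub>R dir_deriv (0, 1) U z \<partial>lborel_on (strip \<epsilon>)) = (\<integral>x. b x *\<^sub>R (U (x, \<epsilon>) - U (x, 0)) \<partial>lborel)"
proof -
  have s: "smooth U" by (rule test_functions_smooth[OF U])
  note dU = test_functions_dir_deriv[OF U, of "(0, 1)"]
  have "(\<lambda>z::real \<times> real. b (fst z)) \<in> borel_measurable borel"
    by (rule measurable_compose[OF borel_measurable_continuous_onI[OF continuous_on_fst[OF continuous_on_id]] b(1)])
  then have i: "integrable lborel (\<lambda>z. b (fst z) *\<^sub>R dir_deriv (0, 1) U z)"
    by (intro integrable_bounded_scaleR[OF test_functions_integrable[OF dU], of _ C] b(2)) simp
  have inner: "(\<integral>y. indicator {0<..<\<epsilon>} y *\<^sub>R (b x *\<^sub>R dir_deriv (0, 1) U (x, y)) \<partial>lborel) = b x *\<^sub>R (U (x, \<epsilon>) - U (x, 0))" for x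
  proof -
    have "(\<integral>y. indicator {0<..<\<epsilon>} y *\<^sub>R (b x *\<^sub>R dir_deriv (0, 1) U (x, y)) \<partial>lborel)
      = (\<integral>y. indicator {0..\<epsilon>} y *\<^sub>R (b x *\<^sub>R dir_deriv (0, 1) U (x, y)) \<partial>lborel)"
    proof (rule integral_cong_AE)
      have m: "(\<lambda>y. dir_deriv (0, 1) U (x, y)) \<in> borel_measurable borel"
        by (rule smooth_borel[OF slice_smooth(2)[OF test_functions_smooth[OF dU]]])
      show "(\<lambda>y. indicator {0<..<\<epsilon>} y *\<^sub>R (b x *\<^sub>R dir_deriv (0, 1) U (x, y))) \<in> borel_measurable lborel"
        "(\<lambda>y. indicator {0..\<epsilon>} y *\<^sub>R (b x *\<^sub>R dir_deriv (0, 1) U (x, y))) \<in> borel_measurable lborel"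
        using m by measurable
      \<comment> \<open>The strip is open whereas the fundamental theorem uses the closed interval;
        the two end points are null sets.\<close>
      have "AE y in lborel. y \<noteq> 0 \<and> y \<noteq> \<epsilon>" using AE_lborel_singleton[of 0] AE_lborel_singleton[of \<epsilon>] by eventually_elim simp
      then show "AE y in lborel. indicator {0<..<\<epsilon>} y *\<^sub>R (b x *\<^sub>R dir_deriv (0, 1) U (x, y)) = indicator {0..\<epsilon>} y *\<^sub>R (b x *\<^sub>R dir_deriv (0, 1) U (x, y))"
        by eventually_elim (auto simp: indicator_def)
    qed
    also have "\<dots> = (\<integral>y. b x *\<^sub>R (indicator {0..\<epsilon>} y *\<^sub>R dir_deriv (0, 1) U (x, y)) \<partial>lborel)"
      by (simp only: scaleR_left_commute)
    also have "\<dots> = b x *\<^sub>R (\<integral>y. indicator {0..\<epsilon>} y *\<^sub>R dir_deriv (0, 1) U (x, y) \<partial>lborel)"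
      by (rule integral_scaleR_right)
    also have "(\<integral>y. indicator {0..\<epsilon>} y *\<^sub>R dir_deriv (0, 1) U (x, y) \<partial>lborel) = U (x, \<epsilon>) - U (x, 0)"
    proof (rule integral_FTC_atLeastAtMost)
      show "0 \<le> \<epsilon>" using \<epsilon> by simp
      show "((\<lambda>y. U (x, y)) has_vector_derivative dir_deriv (0, 1) U (x, y)) (at y within {0..\<epsilon>})" for y
        by (rule has_vector_derivative_slice[OF s])
      show "continuous_on {0..\<epsilon>} (\<lambda>y. dir_deriv (0, 1) U (x, y))"
        by (rule smooth_continuous[OF slice_smooth(2)[OF test_functions_smooth[OF dU]]])
    qed
    finally show ?thesis .
  qed
  show ?thesis unfolding strip_integral(1)[OF i] fst_conv inner by (rule refl)
qed

lemma strip_tangential: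
  fixes U :: "real \<times> real \<Rightarrow> complex"
  assumes U: "U \<in> test_functions V"
  shows "(\<integral>z. dir_deriv (1, 0) U z \<partial>lborel_on (strip \<epsilon>)) = 0"
proof -
  have z: "(\<integral>x. indicator {0<..<\<epsilon>} y *\<^sub>R dir_deriv (1, 0) U (x, y) \<partial>lborel) = 0" for y
  proof -
    have "(\<integral>x. dir_deriv (1, 0) U (x, y) \<partial>lborel) = 0"
      using integral_dir_deriv_eq_0[OF slice_test_function[OF U, of y], of 1]
      unfolding slice_dir_deriv(1)[OF test_functions_smooth[OF U]] .
    then show ?thesis unfolding integral_scaleR_right by simp
  qed
  then show ?thesis
    unfolding strip_integral(2)[OF test_functions_integrable[OF test_functions_dir_deriv[OF U]]] z by simp
qed

section \<open>Green's formula and the trace estimate for test functions\<close>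

lemma test_product:
  fixes u v :: "'a::euclidean_space \<Rightarrow> complex"
  assumes u: "u \<in> test_functions U" and v: "v \<in> test_functions V"
  shows "(\<lambda>z. cnj (u z) * v z) \<in> test_functions V"
    and "dir_deriv i (\<lambda>z. cnj (u z) * v z) = (\<lambda>z. cnj (dir_deriv i u z) * v z + cnj (u z) * dir_deriv i v z)"
proof -
  note s = test_functions_smooth[OF u] test_functions_smooth[OF v]
  show "(\<lambda>z. cnj (u z) * v z) \<in> test_functions V" by (rule test_functions_mult[OF v smooth_cnj[OF s(1)]])
  show "dir_deriv i (\<lambda>z. cnj (u z) * v z) = (\<lambda>z. cnj (dir_deriv i u z) * v z + cnj (u z) * dir_deriv i v z)"
    unfolding dir_deriv_complex_mult[OF smooth_cnj[OF s(1)] s(2)] dir_deriv_cnj[OF s(1)] by (rule refl)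
qed

lemma Linf_mult_L2:
  fixes b :: "real \<Rightarrow> real" and f :: "real \<times> real \<Rightarrow> complex" and h :: "real \<Rightarrow> complex"
  assumes b: "b \<in> borel_measurable borel" "\<And>x. \<bar>b x\<bar> \<le> C"
  shows "f \<in> L2 (lborel_on \<Omega>) \<Longrightarrow> (\<lambda>z. complex_of_real (b (fst z)) * f z) \<in> L2 (lborel_on \<Omega>)"
    and "f \<in> L2 (lborel_on \<Omega>) \<Longrightarrow> l2_norm (lborel_on \<Omega>) (\<lambda>z. complex_of_real (b (fst z)) * f z) \<le> C * l2_norm (lborel_on \<Omega>) f"
    and "h \<in> L2 lborel \<Longrightarrow> (\<lambda>x. complex_of_real (b x) * h x) \<in> L2 lborel"
    and "h \<in> L2 lborel \<Longrightarrow> l2_norm lborel (\<lambda>x. complex_of_real (b x) * h x) \<le> C * l2_norm lborel h"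
proof -
  have C: "C \<ge> 0" using b(2)[of 0] by linarith
  have "(\<lambda>z::real \<times> real. b (fst z)) \<in> borel_measurable borel"
    by (rule measurable_compose[OF borel_measurable_continuous_onI[OF continuous_on_fst[OF continuous_on_id]] b(1)])
  then have m: "(\<lambda>z::real \<times> real. complex_of_real (b (fst z))) \<in> borel_measurable (lborel_on \<Omega>)"
    by (intro measurable_restrict_space1 borel_measurable_of_real) simp
  have m': "(\<lambda>x. complex_of_real (b x)) \<in> borel_measurable lborel" by (rule measurable_compose[OF _ borel_measurable_of_real]) (simp add: b(1))
  have B: "AE z in lborel_on \<Omega>. norm (complex_of_real (b (fst z))) \<le> C" "AE x in lborel. norm (complex_of_real (b x)) \<le> C"
    using b(2) by simp_all
  show "f \<in> L2 (lborel_on \<Omega>) \<Longrightarrow> (\<lambda>z. complex_of_real (b (fst z)) * f z) \<in> L2 (lborel_on \<Omega>)"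
    by (rule L2_bounded_mult[OF _ m B(1)])
  show "f \<in> L2 (lborel_on \<Omega>) \<Longrightarrow> l2_norm (lborel_on \<Omega>) (\<lambda>z. complex_of_real (b (fst z)) * f z) \<le> C * l2_norm (lborel_on \<Omega>) f"
    by (rule l2_norm_bounded_mult[OF _ m B(1) C])
  show "h \<in> L2 lborel \<Longrightarrow> (\<lambda>x. complex_of_real (b x) * h x) \<in> L2 lborel"
    by (rule L2_bounded_mult[OF _ m' B(2)])
  show "h \<in> L2 lborel \<Longrightarrow> l2_norm lborel (\<lambda>x. complex_of_real (b x) * h x) \<le> C * l2_norm lborel h"
    by (rule l2_norm_bounded_mult[OF _ m' B(2) C])
qed

lemma Linf_mult_tendsto:
  fixes b :: "real \<Rightarrow> real" and g :: "real \<times> real \<Rightarrow> complex" and h :: "real \<Rightarrow> complex"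
  assumes b: "b \<in> borel_measurable borel" "\<And>x. \<bar>b x\<bar> \<le> C"
  shows "(\<And>n. v n \<in> L2 (lborel_on \<Omega>)) \<Longrightarrow> g \<in> L2 (lborel_on \<Omega>) \<Longrightarrow> (\<lambda>n. l2_norm (lborel_on \<Omega>) (\<lambda>z. v n z - g z)) \<longlonglongrightarrow> 0 \<Longrightarrow>
      (\<lambda>n. l2_norm (lborel_on \<Omega>) (\<lambda>z. complex_of_real (b (fst z)) * v n z - complex_of_real (b (fst z)) * g z)) \<longlonglongrightarrow> 0"
    and "(\<And>n. w n \<in> L2 lborel) \<Longrightarrow> h \<in> L2 lborel \<Longrightarrow> (\<lambda>n. l2_norm lborel (\<lambda>x. w n x - h x)) \<longlonglongrightarrow> 0 \<Longrightarrow>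
      (\<lambda>n. l2_norm lborel (\<lambda>x. complex_of_real (b x) * w n x - complex_of_real (b x) * h x)) \<longlonglongrightarrow> 0"
proof -
  have z: "(\<lambda>n. C * a n) \<longlonglongrightarrow> 0" if "a \<longlonglongrightarrow> 0" for a :: "nat \<Rightarrow> real" using tendsto_mult_left[OF that, of C] by simp
  have cmp: "a \<longlonglongrightarrow> 0" if "\<And>n. 0 \<le> a n" "\<And>n. a n \<le> C * c n" "c \<longlonglongrightarrow> 0" for a c :: "nat \<Rightarrow> real"
    by (rule Lim_null_comparison[OF _ z[OF that(3)]]) (use that(1,2) in simp)
  show "(\<lambda>n. l2_norm (lborel_on \<Omega>) (\<lambda>z. complex_of_real (b (fst z)) * v n z - complex_of_real (b (fst z)) * g z)) \<longlonglongrightarrow> 0"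
    if v: "\<And>n. v n \<in> L2 (lborel_on \<Omega>)" and g: "g \<in> L2 (lborel_on \<Omega>)" and l: "(\<lambda>n. l2_norm (lborel_on \<Omega>) (\<lambda>z. v n z - g z)) \<longlonglongrightarrow> 0"
    unfolding right_diff_distrib[symmetric]
    by (rule cmp[OF l2_norm_nonneg Linf_mult_L2(2)[OF b L2_diff[OF v g]] l])
  show "(\<lambda>n. l2_norm lborel (\<lambda>x. complex_of_real (b x) * w n x - complex_of_real (b x) * h x)) \<longlonglongrightarrow> 0"
    if w: "\<And>n. w n \<in> L2 lborel" and h: "h \<in> L2 lborel" and l: "(\<lambda>n. l2_norm lborel (\<lambda>x. w n x - h x)) \<longlonglongrightarrow> 0"
    unfolding right_diff_distrib[symmetric]
    by (rule cmp[OF l2_norm_nonneg Linf_mult_L2(4)[OF b L2_diff[OF w h]] l])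
qed

lemma test_Green:
  fixes u v :: "real \<times> real \<Rightarrow> complex" and b :: "real \<Rightarrow> real"
  assumes u: "u \<in> test_functions U" and v: "v \<in> test_functions V" and b: "b \<in> borel_measurable borel" "\<And>x. \<bar>b x\<bar> \<le> C" and \<epsilon>: "\<epsilon> > 0"
  shows "l2_inner (lborel_on (strip \<epsilon>)) (dir_deriv (0, 1) u) (\<lambda>z. complex_of_real (b (fst z)) * v z)
      + l2_inner (lborel_on (strip \<epsilon>)) u (\<lambda>z. complex_of_real (b (fst z)) * dir_deriv (0, 1) v z)
    = l2_inner lborel (\<lambda>x. u (x, \<epsilon>)) (\<lambda>x. complex_of_real (b x) * v (x, \<epsilon>)) - l2_inner lborel (\<lambda>x. u (x, 0)) (\<lambda>x. complex_of_real (b x) * v (x, 0))"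
proof -
  let ?M = "lborel_on (strip \<epsilon>)"
  note L = test_functions_L2[OF _ open_strip[of \<epsilon>]]
  note bL = Linf_mult_L2(1)[OF b] and bL' = Linf_mult_L2(3)[OF b]
  note du = test_functions_dir_deriv[OF u, of "(0, 1)"] and dv = test_functions_dir_deriv[OF v, of "(0, 1)"]
  have "l2_inner ?M (dir_deriv (0, 1) u) (\<lambda>z. complex_of_real (b (fst z)) * v z)
      + l2_inner ?M u (\<lambda>z. complex_of_real (b (fst z)) * dir_deriv (0, 1) v z)
    = (\<integral>z. cnj (dir_deriv (0, 1) u z) * (complex_of_real (b (fst z)) * v z) + cnj (u z) * (complex_of_real (b (fst z)) * dir_deriv (0, 1) v z) \<partial>?M)"
    unfolding l2_inner_def
    by (rule Bochner_Integration.integral_add[OF L2_integrable_inner[OF L[OF du] bL[OF L[OF v]]] L2_integrable_inner[OF L[OF u] bL[OF L[OF dv]]], symmetric])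
  also have "\<dots> = (\<integral>z. b (fst z) *\<^sub>R dir_deriv (0, 1) (\<lambda>z. cnj (u z) * v z) z \<partial>?M)"
    unfolding test_product(2)[OF u v] by (simp add: scaleR_conv_of_real algebra_simps)
  also have "\<dots> = (\<integral>x. b x *\<^sub>R (cnj (u (x, \<epsilon>)) * v (x, \<epsilon>) - cnj (u (x, 0)) * v (x, 0)) \<partial>lborel)"
    by (rule strip_FTC[OF test_product(1)[OF u v] b \<epsilon>])
  also have "\<dots> = (\<integral>x. cnj (u (x, \<epsilon>)) * (complex_of_real (b x) * v (x, \<epsilon>)) - cnj (u (x, 0)) * (complex_of_real (b x) * v (x, 0)) \<partial>lborel)"
    by (simp add: scaleR_conv_of_real algebra_simps)
  also have "\<dots> = l2_inner lborel (\<lambda>x. u (x, \<epsilon>)) (\<lambda>x. complex_of_real (b x) * v (x, \<epsilon>)) - l2_inner lborel (\<lambda>x. u (x, 0)) (\<lambda>x. complex_of_real (b x) * v (x, 0))"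
    unfolding l2_inner_def
    by (rule Bochner_Integration.integral_diff; rule L2_integrable_inner; (rule bL')?;
        rule test_functions_L2_lborel[OF slice_test_function[OF u]] test_functions_L2_lborel[OF slice_test_function[OF v]])
  finally show ?thesis .
qed

lemma test_tangential:
  fixes u v :: "real \<times> real \<Rightarrow> complex"
  assumes u: "u \<in> test_functions U" and v: "v \<in> test_functions V"
  shows "l2_inner (lborel_on (strip \<epsilon>)) (dir_deriv (1, 0) u) v + l2_inner (lborel_on (strip \<epsilon>)) u (dir_deriv (1, 0) v) = 0"
proof -
  note L = test_functions_L2[OF _ open_strip[of \<epsilon>]]
  show ?thesis
    using strip_tangential[OF test_product(1)[OF u v], of \<epsilon>] unfolding test_product(2)[OF u v] l2_inner_def
    by (subst (asm) Bochner_Integration.integral_add[OF L2_integrable_inner[OF L[OF test_functions_dir_deriv[OF u]] L[OF v]]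
          L2_integrable_inner[OF L[OF u] L[OF test_functions_dir_deriv[OF v]]]])
qed

text \<open>Integrate the normal derivative of \<open>\<theta>\<close> times the squared modulus of
  \<open>u\<close>, where \<open>\<theta>\<close> is affine in \<open>y\<close>, 1 on the chosen
  line and 0 on the other. The boundary then contributes exactly the wanted norm, up to sign, and
  the slope \<open>1 / \<epsilon>\<close> enters the constant.\<close>

lemma test_trace_bound:
  fixes u :: "real \<times> real \<Rightarrow> complex"
  assumes u: "u \<in> test_functions U" and \<epsilon>: "\<epsilon> > 0" and y0: "y0 \<in> {0, \<epsilon>}"
  shows "l2_norm lborel (\<lambda>x. u (x, y0)) \<le> sqrt (1 / \<epsilon> + 1) *
    (l2_norm (lborel_on (strip \<epsilon>)) u + l2_norm (lborel_on (strip \<epsilon>)) (dir_deriv (0, 1) u))"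
proof -
  let ?M = "lborel_on (strip \<epsilon>)"
  let ?du = "dir_deriv (0, 1) u"
  \<comment> \<open>These are the coefficients of \<open>1 - y / \<epsilon>\<close> for the lower
    line and of \<open>y / \<epsilon>\<close> for the upper one.\<close>
  define c d where "c = (if y0 = 0 then 1 else 0 :: real)" and "d = (if y0 = 0 then - 1 / \<epsilon> else 1 / \<epsilon>)"
  define \<theta> where "\<theta> z = c + d * snd z" for z :: "real \<times> real"
  have blin: "bounded_linear (\<lambda>z::real \<times> real. d * snd z)" by (intro bounded_linear_const_mult bounded_linear_snd)
  have s\<theta>: "smooth \<theta>" unfolding \<theta>_def[abs_def] by (intro smooth_add smooth_const smooth_bounded_linear blin)
  have d\<theta>: "dir_deriv (0, 1) \<theta> = (\<lambda>z. d)"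
  proof
    fix z
    have "(\<theta> has_derivative (\<lambda>v. 0 + d * snd v)) (at z)" unfolding \<theta>_def[abs_def]
      by (intro has_derivative_add has_derivative_const bounded_linear_imp_has_derivative[OF blin])
    then show "dir_deriv (0, 1) \<theta> z = d" by (simp add: dir_deriv_eqI)
  qed
  have dabs: "\<bar>d\<bar> = 1 / \<epsilon>" using \<epsilon> by (simp add: d_def)
  have \<theta>_bound: "\<bar>\<theta> z\<bar> \<le> 1" if "z \<in> strip \<epsilon>" for z
    using that \<epsilon> by (auto simp: \<theta>_def c_def d_def mem_strip field_simps abs_le_iff)
  note L = test_functions_L2[OF _ open_strip[of \<epsilon>]]
  note du = test_functions_dir_deriv[OF u, of "(0, 1)"]
  let ?w = "\<lambda>z. cnj (u z) * u z"
  note w = test_product[OF u u]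

  have Ut: "(\<lambda>z. complex_of_real (\<theta> z) * ?w z) \<in> test_functions U"
    by (rule test_functions_mult[OF w(1) smooth_of_real[OF s\<theta>]])
  have dUt: "dir_deriv (0, 1) (\<lambda>z. complex_of_real (\<theta> z) * ?w z)
    = (\<lambda>z. complex_of_real d * ?w z + complex_of_real (\<theta> z) * (cnj (?du z) * u z + cnj (u z) * ?du z))"
    unfolding dir_deriv_complex_mult[OF smooth_of_real[OF s\<theta>] test_functions_smooth[OF w(1)]] dir_deriv_of_real[OF s\<theta>] d\<theta> w(2)
    by (rule refl)
  have eq: "(\<integral>z. dir_deriv (0, 1) (\<lambda>z. complex_of_real (\<theta> z) * ?w z) z \<partial>?M)
    = (\<integral>x. complex_of_real (\<theta> (x, \<epsilon>)) * ?w (x, \<epsilon>) - complex_of_real (\<theta> (x, 0)) * ?w (x, 0) \<partial>lborel)"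
    using strip_FTC[OF Ut, of "\<lambda>x. 1" 1 \<epsilon>] \<epsilon> by simp
  have "complex_of_real (\<theta> (x, \<epsilon>)) * ?w (x, \<epsilon>) - complex_of_real (\<theta> (x, 0)) * ?w (x, 0)
    = (if y0 = 0 then - 1 else 1) * (cnj (u (x, y0)) * u (x, y0))" for x
    using y0 \<epsilon> by (auto simp: \<theta>_def c_def d_def)
  then have "(\<integral>z. dir_deriv (0, 1) (\<lambda>z. complex_of_real (\<theta> z) * ?w z) z \<partial>?M)
    = (if y0 = 0 then - 1 else 1) * l2_inner lborel (\<lambda>x. u (x, y0)) (\<lambda>x. u (x, y0))"
    unfolding eq l2_inner_def by simp
  then have "(l2_norm lborel (\<lambda>x. u (x, y0)))^2 = norm (\<integral>z. dir_deriv (0, 1) (\<lambda>z. complex_of_real (\<theta> z) * ?w z) z \<partial>?M)"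
    by (simp add: norm_mult l2_inner_self norm_power)
  also have "\<dots> \<le> (\<integral>z. norm (dir_deriv (0, 1) (\<lambda>z. complex_of_real (\<theta> z) * ?w z) z) \<partial>?M)"
    by (rule integral_norm_bound)
  also have "\<dots> \<le> (\<integral>z. 1 / \<epsilon> * (norm (u z))^2 + 2 * (norm (u z) * norm (?du z)) \<partial>?M)"
  proof (rule integral_mono)
    show "integrable ?M (\<lambda>z. norm (dir_deriv (0, 1) (\<lambda>z. complex_of_real (\<theta> z) * ?w z) z))"
    proof (rule integrable_norm)
      have "integrable lborel (dir_deriv (0, 1) (\<lambda>z. complex_of_real (\<theta> z) * ?w z))"
        by (rule test_functions_integrable[OF test_functions_dir_deriv[OF Ut]])
      then show "integrable ?M (dir_deriv (0, 1) (\<lambda>z. complex_of_real (\<theta> z) * ?w z))"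
        unfolding integrable_restrict_space[OF open_inter_space_lborel[OF open_strip]]
        using open_strip by (intro integrable_mult_indicator) simp_all
    qed
    show "integrable ?M (\<lambda>z. 1 / \<epsilon> * (norm (u z))^2 + 2 * (norm (u z) * norm (?du z)))"
      by (intro Bochner_Integration.integrable_add integrable_mult_right L2_integrable_sq L2_integrable_norm_mult L[OF u] L[OF du])
    fix z assume "z \<in> space ?M"
    then have z: "z \<in> strip \<epsilon>" by (simp add: space_restrict_space)
    have "norm (dir_deriv (0, 1) (\<lambda>z. complex_of_real (\<theta> z) * ?w z) z)
      \<le> norm (complex_of_real d * ?w z) + norm (complex_of_real (\<theta> z) * (cnj (?du z) * u z + cnj (u z) * ?du z))"
      unfolding dUt by (rule norm_triangle_ineq)
    also have "norm (complex_of_real d * ?w z) = 1 / \<epsilon> * (norm (u z))^2"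
      by (simp add: norm_mult dabs power2_eq_square)
    also have "norm (complex_of_real (\<theta> z) * (cnj (?du z) * u z + cnj (u z) * ?du z)) \<le> 1 * (2 * (norm (u z) * norm (?du z)))"
      unfolding norm_mult
    proof (rule mult_mono)
      show "norm (complex_of_real (\<theta> z)) \<le> 1" using \<theta>_bound[OF z] by simp
      have "norm (cnj (?du z) * u z + cnj (u z) * ?du z) \<le> norm (cnj (?du z) * u z) + norm (cnj (u z) * ?du z)"
        by (rule norm_triangle_ineq)
      then show "norm (cnj (?du z) * u z + cnj (u z) * ?du z) \<le> 2 * (norm (u z) * norm (?du z))"
        by (simp add: norm_mult mult.commute)
    qed simp_all
    finally show "norm (dir_deriv (0, 1) (\<lambda>z. complex_of_real (\<theta> z) * ?w z) z) \<le> 1 / \<epsilon> * (norm (u z))^2 + 2 * (norm (u z) * norm (?du z))"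
      by simp
  qed
  also have "\<dots> = 1 / \<epsilon> * (l2_norm ?M u)^2 + 2 * (\<integral>z. norm (u z) * norm (?du z) \<partial>?M)"
    unfolding l2_norm_sq
    by (subst Bochner_Integration.integral_add[OF integrable_mult_right[OF L2_integrable_sq[OF L[OF u]]] integrable_mult_right[OF L2_integrable_norm_mult[OF L[OF u] L[OF du]]]])
       (simp only: integral_mult_right_zero)
  also have "\<dots> \<le> 1 / \<epsilon> * (l2_norm ?M u)^2 + 2 * (l2_norm ?M u * l2_norm ?M ?du)"
    using l2_Cauchy_Schwarz_norm[OF L[OF u] L[OF du]] by simp
  also have "\<dots> \<le> (1 / \<epsilon> + 1) * (l2_norm ?M u + l2_norm ?M ?du)^2"
  proof -
    define N D where "N = l2_norm ?M u" and "D = l2_norm ?M ?du"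
    have "0 \<le> N" "0 \<le> D" by (auto simp: N_def D_def l2_norm_nonneg)
    then have "N^2 \<le> (N + D)^2" "2 * (N * D) \<le> (N + D)^2" by (auto simp: power2_sum)
    then have "1 / \<epsilon> * N^2 + 2 * (N * D) \<le> 1 / \<epsilon> * (N + D)^2 + (N + D)^2"
      using \<epsilon> by (intro add_mono mult_left_mono) auto
    then show ?thesis unfolding N_def[symmetric] D_def[symmetric] by (simp add: distrib_right)
  qed
  finally have le: "(l2_norm lborel (\<lambda>x. u (x, y0)))^2 \<le> (1 / \<epsilon> + 1) * (l2_norm ?M u + l2_norm ?M ?du)^2" .
  have "0 \<le> 1 / \<epsilon> + 1" using \<epsilon> by simp
  then have "(l2_norm lborel (\<lambda>x. u (x, y0)))^2 \<le> (sqrt (1 / \<epsilon> + 1) * (l2_norm ?M u + l2_norm ?M ?du))^2"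
    using le by (simp add: power_mult_distrib)
  then show ?thesis
    by (rule power2_le_imp_le) (intro mult_nonneg_nonneg add_nonneg_nonneg l2_norm_nonneg real_sqrt_ge_zero \<open>0 \<le> 1 / \<epsilon> + 1\<close>)
qed

text \<open>Convergence in the \<open>H1\<close> norm, but with the derivatives compared separately,
  so that the weak derivative chosen for the difference \<open>u n - f\<close> never has to be
  handled.\<close>

definition H1_approx :: "real \<Rightarrow> (real \<times> real \<Rightarrow> complex) \<Rightarrow> (nat \<Rightarrow> real \<times> real \<Rightarrow> complex) \<Rightarrow> bool" where
  "H1_approx \<epsilon> f u \<longleftrightarrow> (\<forall>n. u n \<in> test_functions UNIV) \<and> (\<lambda>n. l2_norm (lborel_on (strip \<epsilon>)) (\<lambda>z. u n z - f z)) \<longlonglongrightarrow> 0 \<and>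
    (\<forall>i\<in>Basis. (\<lambda>n. l2_norm (lborel_on (strip \<epsilon>)) (\<lambda>z. dir_deriv i (u n) z - wderiv (strip \<epsilon>) i f z)) \<longlonglongrightarrow> 0)"

lemma H1_approxD:
  assumes "H1_approx \<epsilon> f u"
  shows "u n \<in> test_functions UNIV" "(\<lambda>n. l2_norm (lborel_on (strip \<epsilon>)) (\<lambda>z. u n z - f z)) \<longlonglongrightarrow> 0"
    "i \<in> Basis \<Longrightarrow> (\<lambda>n. l2_norm (lborel_on (strip \<epsilon>)) (\<lambda>z. dir_deriv i (u n) z - wderiv (strip \<epsilon>) i f z)) \<longlonglongrightarrow> 0"
    "u n \<in> L2 (lborel_on (strip \<epsilon>))" "dir_deriv i (u n) \<in> L2 (lborel_on (strip \<epsilon>))"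
  using assms test_functions_L2[OF _ open_strip] test_functions_dir_deriv unfolding H1_approx_def by blast+

lemma H1_approx_exists:
  assumes "\<epsilon> > 0" "f \<in> H1 (strip \<epsilon>)" obtains u where "H1_approx \<epsilon> f u"
proof -
  obtain u where "\<And>n. u n \<in> test_functions UNIV" "(\<lambda>n. l2_norm (lborel_on (strip \<epsilon>)) (\<lambda>z. u n z - f z)) \<longlonglongrightarrow> 0"
    "\<And>i. i \<in> Basis \<Longrightarrow> (\<lambda>n. l2_norm (lborel_on (strip \<epsilon>)) (\<lambda>z. dir_deriv i (u n) z - wderiv (strip \<epsilon>) i f z)) \<longlonglongrightarrow> 0"
    by (rule H1_strip_dense[OF assms]) blast
  then have "H1_approx \<epsilon> f u" unfolding H1_approx_def by blast
  then show ?thesis by (rule that)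
qed

text \<open>\<open>wderiv\<close> of the difference is a choice of its own; linearity and uniqueness
  of weak derivatives identify it almost everywhere with the difference of the derivatives.\<close>

lemma H1_norm_test_diff:
  assumes f: "f \<in> H1 (strip \<epsilon>)" and u: "u \<in> test_functions UNIV"
  shows "H1_norm (strip \<epsilon>) (\<lambda>z. u z - f z) = sqrt ((l2_norm (lborel_on (strip \<epsilon>)) (\<lambda>z. u z - f z))^2 +
    (\<Sum>i\<in>Basis. (l2_norm (lborel_on (strip \<epsilon>)) (\<lambda>z. dir_deriv i u z - wderiv (strip \<epsilon>) i f z))^2))"
proof -
  let ?\<Omega> = "strip \<epsilon>"
  note \<Omega> = open_strip[of \<epsilon>]
  have "l2_norm (lborel_on ?\<Omega>) (wderiv ?\<Omega> i (\<lambda>z. u z - f z)) = l2_norm (lborel_on ?\<Omega>) (\<lambda>z. dir_deriv i u z - wderiv ?\<Omega> i f z)"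
    if i: "i \<in> Basis" for i
  proof -
    note uL = test_functions_L2[OF u \<Omega>] and duL = test_functions_L2[OF test_functions_dir_deriv[OF u] \<Omega>]
    note fL = H1_D(1)[OF f \<Omega>] and df = H1_D(2,3)[OF f \<Omega> i]
    have "weak_deriv ?\<Omega> i (\<lambda>z. u z + (-1) * f z) (\<lambda>z. dir_deriv i u z + (-1) * wderiv ?\<Omega> i f z)"
      by (rule weak_deriv_add[OF test_functions_weak_deriv[OF u \<Omega>] df(1) \<Omega> uL duL fL df(2)])
    then have w: "weak_deriv ?\<Omega> i (\<lambda>z. u z - f z) (\<lambda>z. dir_deriv i u z - wderiv ?\<Omega> i f z)" by simp
    have L: "(\<lambda>z. dir_deriv i u z - wderiv ?\<Omega> i f z) \<in> L2 (lborel_on ?\<Omega>)" by (rule L2_diff[OF duL df(2)])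
    show ?thesis
      by (rule l2_norm_cong[OF L2_measurable[OF wderiv_L2[OF w \<Omega> L]] L2_measurable[OF L] wderiv_AE_eq[OF w \<Omega>]])
  qed
  then show ?thesis unfolding H1_norm_def by simp
qed

lemma H1_norm_tendsto_iff:
  assumes f: "f \<in> H1 (strip \<epsilon>)" and u: "\<And>n. u n \<in> test_functions UNIV"
  shows "(\<lambda>n. H1_norm (strip \<epsilon>) (\<lambda>z. u n z - f z)) \<longlonglongrightarrow> 0 \<longleftrightarrow> H1_approx \<epsilon> f u"
proof -
  let ?M = "lborel_on (strip \<epsilon>)"
  let ?H = "\<lambda>n. H1_norm (strip \<epsilon>) (\<lambda>z. u n z - f z)"
  let ?a = "\<lambda>n. l2_norm ?M (\<lambda>z. u n z - f z)" and ?b = "\<lambda>i n. l2_norm ?M (\<lambda>z. dir_deriv i (u n) z - wderiv (strip \<epsilon>) i f z)"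
  have H: "?H n = sqrt ((?a n)^2 + (\<Sum>i\<in>Basis. (?b i n)^2))" for n by (rule H1_norm_test_diff[OF f u])
  have nn: "0 \<le> (\<Sum>i\<in>Basis. (?b i n)^2)" for n by (rule sum_nonneg) simp
  show ?thesis
  proof
    assume l: "?H \<longlonglongrightarrow> 0"
    have cmp: "c \<longlonglongrightarrow> 0" if "\<And>n. 0 \<le> c n" "\<And>n. c n \<le> ?H n" for c
      by (rule Lim_null_comparison[OF always_eventually l]) (use that in simp)
    have a: "?a n \<le> ?H n" for n unfolding H using nn[of n] by (intro real_le_rsqrt) simp
    have b: "?b i n \<le> ?H n" if i: "i \<in> Basis" for i n
    proof -
      have "(?b i n)^2 \<le> (\<Sum>i\<in>Basis. (?b i n)^2)" by (rule member_le_sum[OF i]) simp_all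
      then show ?thesis unfolding H by (intro real_le_rsqrt) (simp add: add_increasing)
    qed
    show "H1_approx \<epsilon> f u" unfolding H1_approx_def
      by (intro conjI allI ballI u) (rule cmp[OF l2_norm_nonneg a], rule cmp[OF l2_norm_nonneg b])
  next
    assume A: "H1_approx \<epsilon> f u"
    have "(\<lambda>n. sqrt ((?a n)^2 + (\<Sum>i\<in>Basis. (?b i n)^2))) \<longlonglongrightarrow> sqrt (0^2 + (\<Sum>i\<in>(Basis::(real \<times> real) set). 0^2))"
      by (intro tendsto_real_sqrt tendsto_add tendsto_power tendsto_sum H1_approxD(2,3)[OF A])
    then show "?H \<longlonglongrightarrow> 0" unfolding H by simp
  qed
qed

lemma is_trace_iff:
  assumes "f \<in> H1 (strip \<epsilon>)"
  shows "is_trace \<epsilon> f t \<longleftrightarrow> (\<forall>y\<in>{0, \<epsilon>}. (\<lambda>x. t (x, y)) \<in> L2 lborel) \<and>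
    (\<exists>u. H1_approx \<epsilon> f u \<and> (\<forall>y\<in>{0, \<epsilon>}. (\<lambda>n. l2_norm lborel (\<lambda>x. u n (x, y) - t (x, y))) \<longlonglongrightarrow> 0))"
  unfolding is_trace_def using H1_norm_tendsto_iff[OF assms] H1_approxD(1) by blast

section \<open>Existence of traces and passage from test functions to \<open>H1\<close>\<close>

lemma slice_L2: "u \<in> test_functions V \<Longrightarrow> (\<lambda>x. u (x, y)) \<in> L2 lborel" for u :: "real \<times> real \<Rightarrow> complex"
  by (rule test_functions_L2_lborel[OF slice_test_function])

lemma slice_diff_bound:
  fixes u v :: "real \<times> real \<Rightarrow> complex"
  assumes u: "u \<in> test_functions UNIV" and v: "v \<in> test_functions UNIV" and \<epsilon>: "\<epsilon> > 0" and y: "y \<in> {0, \<epsilon>}"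
  shows "l2_norm lborel (\<lambda>x. u (x, y) - v (x, y)) \<le> sqrt (1 / \<epsilon> + 1) *
    (l2_norm (lborel_on (strip \<epsilon>)) (\<lambda>z. u z - v z) + l2_norm (lborel_on (strip \<epsilon>)) (\<lambda>z. dir_deriv (0, 1) u z - dir_deriv (0, 1) v z))"
proof -
  have m: "(\<lambda>z. (-1) * v z) \<in> test_functions UNIV" by (rule test_functions_mult[OF v smooth_const])
  have "dir_deriv (0, 1) (\<lambda>z. u z + (-1) * v z) = (\<lambda>z. dir_deriv (0, 1) u z + (-1) * dir_deriv (0, 1) v z)"
    unfolding dir_deriv_add[OF test_functions_smooth[OF u] test_functions_smooth[OF m]] dir_deriv_cmult[OF test_functions_smooth[OF v]]
    by (rule refl)
  with test_trace_bound[OF test_functions_add[OF u m] \<epsilon> y] show ?thesis by simp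
qed

text \<open>Two approximating sequences are allowed. With equal ones this is the Cauchy property of
  the boundary values; with different ones it shows that the trace does not depend on the
  sequence.\<close>

lemma slice_diff_tendsto:
  assumes f: "f \<in> H1 (strip \<epsilon>)" and A: "H1_approx \<epsilon> f u" "H1_approx \<epsilon> f v" and \<epsilon>: "\<epsilon> > 0" and y: "y \<in> {0, \<epsilon>}" and e: "e > 0"
  shows "\<exists>N. \<forall>m\<ge>N. \<forall>n\<ge>N. l2_norm lborel (\<lambda>x. u m (x, y) - v n (x, y)) < e"
proof -
  let ?M = "lborel_on (strip \<epsilon>)"
  let ?C = "sqrt (1 / \<epsilon> + 1)"
  have i: "(0, 1) \<in> (Basis :: (real \<times> real) set)" by (simp add: Basis_real_prod)
  note fL = H1_D(1)[OF f open_strip] and dfL = H1_D(3)[OF f open_strip i]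
  have C: "?C > 0" using \<epsilon> by (simp add: add_pos_pos)
  \<comment> \<open>Four distances enter, of both sequences from \<open>f\<close> and of both normal
    derivatives from that of \<open>f\<close>.\<close>
  define d where "d = e / (4 * ?C)"
  have d: "d > 0" using e C by (simp add: d_def)
  have "\<forall>\<^sub>F n in sequentially. l2_norm ?M (\<lambda>z. u n z - f z) < d \<and> l2_norm ?M (\<lambda>z. v n z - f z) < d \<and>
    l2_norm ?M (\<lambda>z. dir_deriv (0, 1) (u n) z - wderiv (strip \<epsilon>) (0, 1) f z) < d \<and>
    l2_norm ?M (\<lambda>z. dir_deriv (0, 1) (v n) z - wderiv (strip \<epsilon>) (0, 1) f z) < d"
    by (intro eventually_conj order_tendstoD(2)[OF _ d] H1_approxD(2,3)[OF A(1)] H1_approxD(2,3)[OF A(2)] i)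
  then obtain N where N: "\<And>n. n \<ge> N \<Longrightarrow> l2_norm ?M (\<lambda>z. u n z - f z) < d"
    "\<And>n. n \<ge> N \<Longrightarrow> l2_norm ?M (\<lambda>z. v n z - f z) < d"
    "\<And>n. n \<ge> N \<Longrightarrow> l2_norm ?M (\<lambda>z. dir_deriv (0, 1) (u n) z - wderiv (strip \<epsilon>) (0, 1) f z) < d"
    "\<And>n. n \<ge> N \<Longrightarrow> l2_norm ?M (\<lambda>z. dir_deriv (0, 1) (v n) z - wderiv (strip \<epsilon>) (0, 1) f z) < d"
    unfolding eventually_sequentially by blast
  have "l2_norm lborel (\<lambda>x. u m (x, y) - v n (x, y)) < e" if mn: "m \<ge> N" "n \<ge> N" for m n
  proof -
    have "l2_norm ?M (\<lambda>z. u m z - v n z) \<le> l2_norm ?M (\<lambda>z. u m z - f z) + l2_norm ?M (\<lambda>z. f z - v n z)"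
      by (rule l2_norm_triangle_diff[OF H1_approxD(4)[OF A(1)] fL H1_approxD(4)[OF A(2)]])
    moreover have "l2_norm ?M (\<lambda>z. dir_deriv (0, 1) (u m) z - dir_deriv (0, 1) (v n) z)
      \<le> l2_norm ?M (\<lambda>z. dir_deriv (0, 1) (u m) z - wderiv (strip \<epsilon>) (0, 1) f z) + l2_norm ?M (\<lambda>z. wderiv (strip \<epsilon>) (0, 1) f z - dir_deriv (0, 1) (v n) z)"
      by (rule l2_norm_triangle_diff[OF H1_approxD(5)[OF A(1)] dfL H1_approxD(5)[OF A(2)]])
    ultimately have "l2_norm ?M (\<lambda>z. u m z - v n z) + l2_norm ?M (\<lambda>z. dir_deriv (0, 1) (u m) z - dir_deriv (0, 1) (v n) z) < 4 * d"
      using N(1)[OF mn(1)] N(2)[OF mn(2)] N(3)[OF mn(1)] N(4)[OF mn(2)]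
        l2_norm_minus_commute[of ?M f "v n"] l2_norm_minus_commute[of ?M "wderiv (strip \<epsilon>) (0, 1) f" "dir_deriv (0, 1) (v n)"]
      by linarith
    then have "?C * (l2_norm ?M (\<lambda>z. u m z - v n z) + l2_norm ?M (\<lambda>z. dir_deriv (0, 1) (u m) z - dir_deriv (0, 1) (v n) z)) < ?C * (4 * d)"
      using C by (rule mult_strict_left_mono)
    moreover have "?C * (4 * d) = e" using C by (simp add: d_def)
    ultimately show ?thesis
      using slice_diff_bound[OF H1_approxD(1)[OF A(1), of m] H1_approxD(1)[OF A(2), of n] \<epsilon> y] by linarith
  qed
  then show ?thesis by blast
qed

text \<open>By the trace estimate the boundary values of an approximating sequence are Cauchy on
  both lines. The two limits are glued to one function on the plane, whose values off the lines are
  irrelevant.\<close>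

lemma is_trace_tr:
  assumes \<epsilon>: "\<epsilon> > 0" and f: "f \<in> H1 (strip \<epsilon>)"
  shows "is_trace \<epsilon> f (tr \<epsilon> f)"
proof -
  obtain u where A: "H1_approx \<epsilon> f u" by (rule H1_approx_exists[OF \<epsilon> f])
  have "\<exists>g\<in>L2 lborel. (\<lambda>n. l2_norm lborel (\<lambda>x. u n (x, y) - g x)) \<longlonglongrightarrow> 0" if y: "y \<in> {0, \<epsilon>}" for y
    by (rule L2_complete[of "\<lambda>n x. u n (x, y)" lborel, OF slice_L2[OF H1_approxD(1)[OF A]] slice_diff_tendsto[OF f A A \<epsilon> y]]) (assumption, rule bexI)
  then obtain g0 g1 where g: "g0 \<in> L2 lborel" "(\<lambda>n. l2_norm lborel (\<lambda>x. u n (x, 0) - g0 x)) \<longlonglongrightarrow> 0"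
    "g1 \<in> L2 lborel" "(\<lambda>n. l2_norm lborel (\<lambda>x. u n (x, \<epsilon>) - g1 x)) \<longlonglongrightarrow> 0" by blast
  define t where "t z = (if snd z = 0 then g0 (fst z) else g1 (fst z))" for z :: "real \<times> real"
  have "is_trace \<epsilon> f t" unfolding is_trace_iff[OF f] using g A \<epsilon> by (auto simp: t_def)
  then show ?thesis unfolding tr_def by (rule someI[of "is_trace \<epsilon> f"])
qed

lemma tr_L2: "\<epsilon> > 0 \<Longrightarrow> f \<in> H1 (strip \<epsilon>) \<Longrightarrow> y \<in> {0, \<epsilon>} \<Longrightarrow> (\<lambda>x. tr \<epsilon> f (x, y)) \<in> L2 lborel"
  using is_trace_tr is_trace_iff by blast

text \<open>\<open>is_trace\<close> only promises some approximating sequence; independence of the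
  sequence turns this into a statement about every one, which limits in Green's formula
  require.\<close>

lemma tr_tendsto:
  assumes \<epsilon>: "\<epsilon> > 0" and f: "f \<in> H1 (strip \<epsilon>)" and A: "H1_approx \<epsilon> f u" and y: "y \<in> {0, \<epsilon>}"
  shows "(\<lambda>n. l2_norm lborel (\<lambda>x. u n (x, y) - tr \<epsilon> f (x, y))) \<longlonglongrightarrow> 0"
proof -
  obtain v where v: "H1_approx \<epsilon> f v" "(\<lambda>n. l2_norm lborel (\<lambda>x. v n (x, y) - tr \<epsilon> f (x, y))) \<longlonglongrightarrow> 0"
    using is_trace_tr[OF \<epsilon> f] y unfolding is_trace_iff[OF f] by blast
  note uL = slice_L2[OF H1_approxD(1)[OF A]] and vL = slice_L2[OF H1_approxD(1)[OF v(1)]]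
  have "(\<lambda>n. l2_norm lborel (\<lambda>x. u n (x, y) - v n (x, y))) \<longlonglongrightarrow> 0"
  proof (rule LIMSEQ_I)
    fix e :: real assume "e > 0"
    from slice_diff_tendsto[OF f A v(1) \<epsilon> y this] obtain N where
      N: "\<And>m n. m \<ge> N \<Longrightarrow> n \<ge> N \<Longrightarrow> l2_norm lborel (\<lambda>x. u m (x, y) - v n (x, y)) < e" by blast
    show "\<exists>no. \<forall>n\<ge>no. norm (l2_norm lborel (\<lambda>x. u n (x, y) - v n (x, y)) - 0) < e"
      by (intro exI[of _ N] allI impI) (use N in \<open>simp add: l2_norm_nonneg\<close>)
  qed
  from tendsto_add[OF this v(2)]
  have "(\<lambda>n. l2_norm lborel (\<lambda>x. u n (x, y) - v n (x, y)) + l2_norm lborel (\<lambda>x. v n (x, y) - tr \<epsilon> f (x, y))) \<longlonglongrightarrow> 0" by simp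
  then show ?thesis
    by (rule Lim_null_comparison[OF always_eventually, rotated])
       (use l2_norm_triangle_diff[OF uL vL tr_L2[OF \<epsilon> f y]] in \<open>simp add: l2_norm_nonneg\<close>)
qed

lemma test_functions_H1:
  fixes u :: "'a::euclidean_space \<Rightarrow> complex"
  assumes "u \<in> test_functions V" "open \<Omega>" shows "u \<in> H1 \<Omega>"
  unfolding H1_iff
  using test_functions_L2[OF assms] test_functions_L2[OF test_functions_dir_deriv[OF assms(1)] assms(2)] test_functions_weak_deriv[OF assms] by blast

lemma tr_test_function:
  assumes \<epsilon>: "\<epsilon> > 0" and u: "u \<in> test_functions UNIV" and y: "y \<in> {0, \<epsilon>}"
  shows "AE x in lborel. tr \<epsilon> u (x, y) = u (x, y)"
proof -
  have H: "u \<in> H1 (strip \<epsilon>)" by (rule test_functions_H1[OF u open_strip])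
  have "l2_norm (lborel_on (strip \<epsilon>)) (\<lambda>z. dir_deriv i u z - wderiv (strip \<epsilon>) i u z) = 0" if i: "i \<in> Basis" for i
  proof -
    note L = test_functions_L2[OF test_functions_dir_deriv[OF u] open_strip[of \<epsilon>], of i]
    have "l2_norm (lborel_on (strip \<epsilon>)) (\<lambda>z. dir_deriv i u z - wderiv (strip \<epsilon>) i u z) = l2_norm (lborel_on (strip \<epsilon>)) (\<lambda>z. 0)"
      using wderiv_AE_eq[OF test_functions_weak_deriv[OF u open_strip, of \<epsilon> i] open_strip]
      by (intro l2_norm_cong L2_measurable[OF L2_diff[OF L H1_D(3)[OF H open_strip i]]]) auto
    then show ?thesis by (simp add: l2_norm_def)
  qed
  then have "H1_approx \<epsilon> u (\<lambda>n. u)" unfolding H1_approx_def using u by (simp add: l2_norm_def)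
  from tr_tendsto[OF \<epsilon> H this y] have "l2_norm lborel (\<lambda>x. u (x, y) - tr \<epsilon> u (x, y)) = 0"
    by (simp add: LIMSEQ_const_iff)
  from l2_norm_eq_0_AE[OF L2_diff[OF slice_L2[OF u] tr_L2[OF \<epsilon> H y]] this]
  show ?thesis by eventually_elim simp
qed

text \<open>Every pairing in the formula for test functions is L2-continuous, the boundary ones
  through the trace estimate, so density carries the formula over to \<open>H1\<close>.\<close>

lemma H1_Green:
  assumes \<epsilon>: "\<epsilon> > 0" and f: "f \<in> H1 (strip \<epsilon>)" and g: "g \<in> H1 (strip \<epsilon>)"
    and b: "b \<in> borel_measurable borel" "\<And>x. \<bar>b x\<bar> \<le> C"
  shows "l2_inner (lborel_on (strip \<epsilon>)) (wderiv (strip \<epsilon>) (0, 1) f) (\<lambda>z. complex_of_real (b (fst z)) * g z)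
      + l2_inner (lborel_on (strip \<epsilon>)) f (\<lambda>z. complex_of_real (b (fst z)) * wderiv (strip \<epsilon>) (0, 1) g z)
    = l2_inner lborel (\<lambda>x. tr \<epsilon> f (x, \<epsilon>)) (\<lambda>x. complex_of_real (b x) * tr \<epsilon> g (x, \<epsilon>))
      - l2_inner lborel (\<lambda>x. tr \<epsilon> f (x, 0)) (\<lambda>x. complex_of_real (b x) * tr \<epsilon> g (x, 0))"
proof -
  obtain u where u: "H1_approx \<epsilon> f u" by (rule H1_approx_exists[OF \<epsilon> f])
  obtain v where v: "H1_approx \<epsilon> g v" by (rule H1_approx_exists[OF \<epsilon> g])
  have i: "(0, 1) \<in> (Basis :: (real \<times> real) set)" by (simp add: Basis_real_prod)
  note fL = H1_D(1)[OF f open_strip] H1_D(3)[OF f open_strip i] and gL = H1_D(1)[OF g open_strip] H1_D(3)[OF g open_strip i]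
  note bL = Linf_mult_L2(1)[OF b] and bL' = Linf_mult_L2(3)[OF b]
  have y: "0 \<in> {0, \<epsilon>}" "\<epsilon> \<in> {0, \<epsilon>}" by auto
  have "(\<lambda>n. l2_inner (lborel_on (strip \<epsilon>)) (dir_deriv (0, 1) (u n)) (\<lambda>z. complex_of_real (b (fst z)) * v n z)
      + l2_inner (lborel_on (strip \<epsilon>)) (u n) (\<lambda>z. complex_of_real (b (fst z)) * dir_deriv (0, 1) (v n) z))
    \<longlonglongrightarrow> l2_inner (lborel_on (strip \<epsilon>)) (wderiv (strip \<epsilon>) (0, 1) f) (\<lambda>z. complex_of_real (b (fst z)) * g z)
      + l2_inner (lborel_on (strip \<epsilon>)) f (\<lambda>z. complex_of_real (b (fst z)) * wderiv (strip \<epsilon>) (0, 1) g z)"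
    by (intro tendsto_add l2_inner_tendsto bL fL gL H1_approxD(4,5)[OF u] H1_approxD(4,5)[OF v] H1_approxD(2)[OF u]
        H1_approxD(3)[OF u i] Linf_mult_tendsto(1)[OF b] H1_approxD(2)[OF v] H1_approxD(3)[OF v i])
  moreover have "(\<lambda>n. l2_inner lborel (\<lambda>x. u n (x, \<epsilon>)) (\<lambda>x. complex_of_real (b x) * v n (x, \<epsilon>))
      - l2_inner lborel (\<lambda>x. u n (x, 0)) (\<lambda>x. complex_of_real (b x) * v n (x, 0)))
    \<longlonglongrightarrow> l2_inner lborel (\<lambda>x. tr \<epsilon> f (x, \<epsilon>)) (\<lambda>x. complex_of_real (b x) * tr \<epsilon> g (x, \<epsilon>))
      - l2_inner lborel (\<lambda>x. tr \<epsilon> f (x, 0)) (\<lambda>x. complex_of_real (b x) * tr \<epsilon> g (x, 0))"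
    by (intro tendsto_diff l2_inner_tendsto bL' slice_L2[OF H1_approxD(1)[OF u]] slice_L2[OF H1_approxD(1)[OF v]] tr_L2[OF \<epsilon> f] tr_L2[OF \<epsilon> g] y
        tr_tendsto[OF \<epsilon> f u] tr_tendsto[OF \<epsilon> g v] Linf_mult_tendsto(2)[OF b])
  ultimately show ?thesis
    unfolding test_Green[OF H1_approxD(1)[OF u] H1_approxD(1)[OF v] b \<epsilon>] by (rule LIMSEQ_unique)
qed

lemma H1_tangential:
  assumes \<epsilon>: "\<epsilon> > 0" and f: "f \<in> H1 (strip \<epsilon>)" and g: "g \<in> H1 (strip \<epsilon>)"
  shows "l2_inner (lborel_on (strip \<epsilon>)) (wderiv (strip \<epsilon>) (1, 0) f) g + l2_inner (lborel_on (strip \<epsilon>)) f (wderiv (strip \<epsilon>) (1, 0) g) = 0"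
proof -
  obtain u where u: "H1_approx \<epsilon> f u" by (rule H1_approx_exists[OF \<epsilon> f])
  obtain v where v: "H1_approx \<epsilon> g v" by (rule H1_approx_exists[OF \<epsilon> g])
  have i: "(1, 0) \<in> (Basis :: (real \<times> real) set)" by (simp add: Basis_real_prod)
  note fL = H1_D(1)[OF f open_strip] H1_D(3)[OF f open_strip i] and gL = H1_D(1)[OF g open_strip] H1_D(3)[OF g open_strip i]
  have "(\<lambda>n. l2_inner (lborel_on (strip \<epsilon>)) (dir_deriv (1, 0) (u n)) (v n) + l2_inner (lborel_on (strip \<epsilon>)) (u n) (dir_deriv (1, 0) (v n)))
    \<longlonglongrightarrow> l2_inner (lborel_on (strip \<epsilon>)) (wderiv (strip \<epsilon>) (1, 0) f) g + l2_inner (lborel_on (strip \<epsilon>)) f (wderiv (strip \<epsilon>) (1, 0) g)"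
    by (intro tendsto_add l2_inner_tendsto fL gL H1_approxD(4,5)[OF u] H1_approxD(4,5)[OF v] H1_approxD(2)[OF u]
        H1_approxD(3)[OF u i] H1_approxD(2)[OF v] H1_approxD(3)[OF v i])
  then show ?thesis
    unfolding test_tangential[OF H1_approxD(1)[OF u] H1_approxD(1)[OF v]] by (simp add: LIMSEQ_const_iff)
qed

section \<open>Tangential regularity\<close>

text \<open>Explicit derivatives in place of \<open>wderiv\<close>: for sums, translates and
  products they are then given by formulas, with no almost everywhere identification of choices at
  each step.\<close>

definition weak_grad :: "real \<Rightarrow> (real \<times> real \<Rightarrow> complex) \<Rightarrow> (real \<times> real \<Rightarrow> complex) \<Rightarrow> (real \<times> real \<Rightarrow> complex) \<Rightarrow> bool" where
  "weak_grad \<epsilon> f fx fy \<longleftrightarrow> f \<in> L2 (lborel_on (strip \<epsilon>)) \<and> fx \<in> L2 (lborel_on (strip \<epsilon>)) \<and> fy \<in> L2 (lborel_on (strip \<epsilon>)) \<and>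
    weak_deriv (strip \<epsilon>) (1, 0) f fx \<and> weak_deriv (strip \<epsilon>) (0, 1) f fy"

lemma weak_gradD:
  assumes "weak_grad \<epsilon> f fx fy"
  shows "f \<in> L2 (lborel_on (strip \<epsilon>))" "fx \<in> L2 (lborel_on (strip \<epsilon>))" "fy \<in> L2 (lborel_on (strip \<epsilon>))"
    "weak_deriv (strip \<epsilon>) (1, 0) f fx" "weak_deriv (strip \<epsilon>) (0, 1) f fy"
  using assms unfolding weak_grad_def by blast+

lemma weak_grad_H1: "weak_grad \<epsilon> f fx fy \<Longrightarrow> f \<in> H1 (strip \<epsilon>)"
  unfolding H1_iff weak_grad_def Basis_real_prod by blast

lemma H1_weak_grad:
  assumes "f \<in> H1 (strip \<epsilon>)" shows "weak_grad \<epsilon> f (wderiv (strip \<epsilon>) (1, 0) f) (wderiv (strip \<epsilon>) (0, 1) f)"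
  unfolding weak_grad_def using H1_D[OF assms open_strip] by (simp add: Basis_real_prod)

lemma weak_grad_test:
  assumes "u \<in> test_functions V" shows "weak_grad \<epsilon> u (dir_deriv (1, 0) u) (dir_deriv (0, 1) u)"
  unfolding weak_grad_def
  using test_functions_L2[OF assms open_strip] test_functions_L2[OF test_functions_dir_deriv[OF assms] open_strip]
    test_functions_weak_deriv[OF assms open_strip] by blast

lemma weak_grad_add:
  assumes f: "weak_grad \<epsilon> f fx fy" and g: "weak_grad \<epsilon> g gx gy"
  shows "weak_grad \<epsilon> (\<lambda>z. f z + c * g z) (\<lambda>z. fx z + c * gx z) (\<lambda>z. fy z + c * gy z)"
  unfolding weak_grad_def
  by (intro conjI L2_add L2_cmult weak_gradD(1-3)[OF f] weak_gradD(1-3)[OF g]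
      weak_deriv_add[OF weak_gradD(4)[OF f] weak_gradD(4)[OF g] open_strip weak_gradD(1,2)[OF f] weak_gradD(1,2)[OF g]]
      weak_deriv_add[OF weak_gradD(5)[OF f] weak_gradD(5)[OF g] open_strip weak_gradD(1,3)[OF f] weak_gradD(1,3)[OF g]])

lemma weak_grad_diff:
  assumes f: "weak_grad \<epsilon> f fx fy" and g: "weak_grad \<epsilon> g gx gy"
  shows "weak_grad \<epsilon> (\<lambda>z. f z - g z) (\<lambda>z. fx z - gx z) (\<lambda>z. fy z - gy z)"
  using weak_grad_add[OF f g, of "-1"] by simp

lemma weak_grad_wderiv:
  assumes "weak_grad \<epsilon> f fx fy"
  shows "AE z in lborel_on (strip \<epsilon>). wderiv (strip \<epsilon>) (1, 0) f z = fx z"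
    "AE z in lborel_on (strip \<epsilon>). wderiv (strip \<epsilon>) (0, 1) f z = fy z"
  using wderiv_AE_eq[OF weak_gradD(4)[OF assms] open_strip] wderiv_AE_eq[OF weak_gradD(5)[OF assms] open_strip] by auto

section \<open>Translations along the strip and difference quotients\<close>

lemma strip_translate_measurable:
  fixes F :: "real \<times> real \<Rightarrow> complex"
  assumes "F \<in> borel_measurable (lborel_on (strip \<epsilon>))"
  shows "(\<lambda>z. F (z + (h, 0))) \<in> borel_measurable (lborel_on (strip \<epsilon>))"
    and "(\<integral>z. F (z + (h, 0)) \<partial>lborel_on (strip \<epsilon>)) = (\<integral>z. F z \<partial>lborel_on (strip \<epsilon>))"
    and "(\<integral>\<^sup>+z. ennreal ((norm (F (z + (h, 0))))^2) \<partial>lborel_on (strip \<epsilon>)) = (\<integral>\<^sup>+z. ennreal ((norm (F z))^2) \<partial>lborel_on (strip \<epsilon>))"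
proof -
  note o = open_inter_space_lborel[OF open_strip[of \<epsilon>]]
  have m: "(\<lambda>z. indicator (strip \<epsilon>) z *\<^sub>R F z) \<in> borel_measurable borel"
    using assms unfolding borel_measurable_restrict_space_iff[OF o] by simp
  have ind: "indicator (strip \<epsilon>) (z + (h, 0)) = (indicator (strip \<epsilon>) z :: real)"
    and ind': "indicator (strip \<epsilon>) (z + (h, 0)) = (indicator (strip \<epsilon>) z :: ennreal)" for z
    by (simp_all add: indicator_def mem_strip)
  have mt: "(\<lambda>z. z + (h, 0)) \<in> measurable borel (borel :: (real \<times> real) measure)" by measurable
  show "(\<lambda>z. F (z + (h, 0))) \<in> borel_measurable (lborel_on (strip \<epsilon>))"
    unfolding borel_measurable_restrict_space_iff[OF o]
    using measurable_compose[OF mt m] unfolding ind by simp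
  show "(\<integral>z. F (z + (h, 0)) \<partial>lborel_on (strip \<epsilon>)) = (\<integral>z. F z \<partial>lborel_on (strip \<epsilon>))"
    unfolding integral_restrict_space[OF o] using integral_translate(1)[OF m, of "(h, 0)"] unfolding ind .
  have e: "ennreal ((norm (indicator (strip \<epsilon>) z *\<^sub>R F z))^2) = ennreal ((norm (F z))^2) * indicator (strip \<epsilon>) z"
    for F :: "real \<times> real \<Rightarrow> complex" and z by (simp add: indicator_def)
  have m2: "(\<lambda>z. ennreal ((norm (indicator (strip \<epsilon>) z *\<^sub>R F z))^2)) \<in> borel_measurable borel" using m by measurable
  show "(\<integral>\<^sup>+z. ennreal ((norm (F (z + (h, 0))))^2) \<partial>lborel_on (strip \<epsilon>)) = (\<integral>\<^sup>+z. ennreal ((norm (F z))^2) \<partial>lborel_on (strip \<epsilon>))"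
    unfolding nn_integral_restrict_space[OF o] using nn_integral_translate[OF m2, of "(h, 0)"] unfolding e ind' .
qed

lemma L2_strip_translate:
  fixes f :: "real \<times> real \<Rightarrow> complex"
  assumes "f \<in> L2 (lborel_on (strip \<epsilon>))"
  shows "(\<lambda>z. f (z + (h, 0))) \<in> L2 (lborel_on (strip \<epsilon>))"
    and "l2_norm (lborel_on (strip \<epsilon>)) (\<lambda>z. f (z + (h, 0))) = l2_norm (lborel_on (strip \<epsilon>)) f"
  using L2_of_nn_integral_eq[OF assms strip_translate_measurable(1,3)[OF L2_measurable[OF assms]]] by blast+

lemma l2_inner_strip_translate:
  fixes f g :: "real \<times> real \<Rightarrow> complex"
  assumes f: "f \<in> L2 (lborel_on (strip \<epsilon>))" and g: "g \<in> L2 (lborel_on (strip \<epsilon>))"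
  shows "l2_inner (lborel_on (strip \<epsilon>)) (\<lambda>z. f (z + (h, 0))) g = l2_inner (lborel_on (strip \<epsilon>)) f (\<lambda>z. g (z + (- h, 0)))"
proof -
  have "(\<lambda>z. cnj (f z) * g (z + (- h, 0))) \<in> borel_measurable (lborel_on (strip \<epsilon>))"
    by (rule borel_measurable_integrable[OF L2_integrable_inner[OF f L2_strip_translate(1)[OF g]]])
  from strip_translate_measurable(2)[OF this, of h] show ?thesis
    unfolding l2_inner_def by (simp add: add.assoc flip: zero_prod_def)
qed

lemma weak_deriv_translate:
  assumes w: "weak_deriv (strip \<epsilon>) v f g" and f: "f \<in> L2 (lborel_on (strip \<epsilon>))" and g: "g \<in> L2 (lborel_on (strip \<epsilon>))"
  shows "weak_deriv (strip \<epsilon>) v (\<lambda>z. f (z + (h, 0))) (\<lambda>z. g (z + (h, 0)))"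
proof (rule weak_derivI[OF open_strip L2_strip_translate(1)[OF f] L2_strip_translate(1)[OF g]])
  fix \<phi> :: "real \<times> real \<Rightarrow> complex" assume \<phi>: "\<phi> \<in> test_functions (strip \<epsilon>)"
  let ?M = "lborel_on (strip \<epsilon>)"
  note L = test_functions_L2[OF _ open_strip[of \<epsilon>]]
  have t: "(\<lambda>z. \<phi> (z + (- h, 0))) \<in> test_functions (strip \<epsilon>)"
    by (rule test_functions_translate[OF \<phi>]) (simp add: mem_strip)
  have "l2_inner ?M (dir_deriv v \<phi>) (\<lambda>z. f (z + (h, 0))) = l2_inner ?M (\<lambda>z. dir_deriv v \<phi> (z + (- h, 0))) f"
    using l2_inner_strip_translate[OF L[OF test_functions_dir_deriv[OF \<phi>]] f, where h = "- h"] by simp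
  also have "(\<lambda>z. dir_deriv v \<phi> (z + (- h, 0))) = dir_deriv v (\<lambda>z. \<phi> (z + (- h, 0)))"
    by (rule dir_deriv_translate[OF test_functions_smooth[OF \<phi>], symmetric])
  also have "l2_inner ?M \<dots> f = - l2_inner ?M (\<lambda>z. \<phi> (z + (- h, 0))) g"
    by (rule weak_deriv_inner[OF w t open_strip f g])
  also have "l2_inner ?M (\<lambda>z. \<phi> (z + (- h, 0))) g = l2_inner ?M \<phi> (\<lambda>z. g (z + (h, 0)))"
    using l2_inner_strip_translate[OF L[OF \<phi>] g, where h = "- h"] by simp
  finally show "l2_inner ?M (dir_deriv v \<phi>) (\<lambda>z. f (z + (h, 0))) = - l2_inner ?M \<phi> (\<lambda>z. g (z + (h, 0)))" .
qed

lemma weak_grad_translate: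
  assumes "weak_grad \<epsilon> f fx fy"
  shows "weak_grad \<epsilon> (\<lambda>z. f (z + (h, 0))) (\<lambda>z. fx (z + (h, 0))) (\<lambda>z. fy (z + (h, 0)))"
  unfolding weak_grad_def
  by (intro conjI L2_strip_translate(1) weak_gradD[OF assms] weak_deriv_translate)

text \<open>Fundamental theorem of calculus on the horizontal segment from \<open>z\<close>, then
  Cauchy-Schwarz against the indicator of \<open>{0..h}\<close>, which contributes the factor
  \<open>h\<close>.\<close>

lemma test_difference_pointwise:
  fixes u :: "real \<times> real \<Rightarrow> complex"
  assumes u: "u \<in> test_functions V" and h: "h > 0"
  shows "ennreal ((norm (u (z + (h, 0)) - u z))^2) \<le>
    ennreal h * (\<integral>\<^sup>+s. indicator {0..h} s * ennreal ((norm (dir_deriv (1, 0) u (z + (s, 0))))^2) \<partial>lborel)"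
proof -
  have s: "smooth u" by (rule test_functions_smooth[OF u])
  let ?d = "\<lambda>s. dir_deriv (1, 0) u (z + (s, 0))"
  have lin: "bounded_linear (\<lambda>s::real. (s, 0::real))" by (rule bounded_linear_Pair_left)
  have sv: "smooth (\<lambda>s. v ((s, 0) + z))" if "smooth v" for v :: "real \<times> real \<Rightarrow> complex"
    by (rule smooth_affine[OF lin that])
  have dsm: "smooth ?d" using sv[OF smooth_dir_deriv[OF s]] by (simp add: add.commute)
  then have dm: "?d \<in> borel_measurable borel" by (rule smooth_borel)
  have "((\<lambda>s. u (z + (s, 0))) has_vector_derivative ?d s) (at s within S)" for s S
  proof -
    have D: "((\<lambda>s. u ((s, 0) + z)) has_derivative (\<lambda>v. dir_deriv v (\<lambda>s. u ((s, 0) + z)) s)) (at s)"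
      by (rule smooth_has_derivative[OF sv[OF s]])
    have "dir_deriv v (\<lambda>s. u ((s, 0) + z)) s = v *\<^sub>R ?d s" for v
      using linear_scale[OF has_derivative_linear[OF D], of v 1] fun_cong[OF dir_deriv_affine[OF lin s, of 1 z], of s]
      by (simp add: add.commute)
    then show ?thesis using has_derivative_at_withinI[OF D] by (simp add: has_vector_derivative_def add.commute)
  qed
  then have "(\<integral>s. indicator {0..h} s *\<^sub>R ?d s \<partial>lborel) = u (z + (h, 0)) - u (z + (0, 0))"
    using h by (intro integral_FTC_atLeastAtMost smooth_continuous[OF dsm]) auto
  then have eq: "u (z + (h, 0)) - u z = (\<integral>s. indicator {0..h} s *\<^sub>R ?d s \<partial>lborel)"
    by (simp flip: zero_prod_def)
  have int: "integrable lborel (\<lambda>s. indicator {0..h} s *\<^sub>R ?d s)"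
    by (rule borel_integrable_compact[OF compact_Icc smooth_continuous[OF dsm]])
  have "ennreal (norm (u (z + (h, 0)) - u z)) \<le> (\<integral>\<^sup>+s. ennreal (norm (indicator {0..h} s *\<^sub>R ?d s)) \<partial>lborel)"
    unfolding eq by (rule integral_norm_bound_ennreal[OF int])
  also have "\<dots> = (\<integral>\<^sup>+s. indicator {0..h} s * (indicator {0..h} s * ennreal (norm (?d s))) \<partial>lborel)"
    by (rule nn_integral_cong) (simp add: indicator_def)
  finally have "(ennreal (norm (u (z + (h, 0)) - u z)))^2 \<le> (\<integral>\<^sup>+s. indicator {0..h} s * (indicator {0..h} s * ennreal (norm (?d s))) \<partial>lborel)^2"
    by (rule power_mono) simp
  also have "\<dots> \<le> (\<integral>\<^sup>+s. (indicator {0..h} s)^2 \<partial>lborel) * (\<integral>\<^sup>+s. (indicator {0..h} s * ennreal (norm (?d s)))^2 \<partial>lborel)"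
    by (rule Cauchy_Schwarz_nn_integral) (use dm in measurable)
  also have "(\<integral>\<^sup>+s. (indicator {0..h} s :: ennreal)^2 \<partial>lborel) = (\<integral>\<^sup>+s. indicator {0..h} s \<partial>lborel)"
    by (rule nn_integral_cong) (simp add: indicator_def)
  also have "\<dots> = ennreal h" using h by simp
  also have "(\<integral>\<^sup>+s. (indicator {0..h} s * ennreal (norm (?d s)))^2 \<partial>lborel) = (\<integral>\<^sup>+s. indicator {0..h} s * ennreal ((norm (?d s))^2) \<partial>lborel)"
    by (rule nn_integral_cong) (simp add: indicator_def ennreal_power)
  finally show ?thesis by (simp add: ennreal_power)
qed

text \<open>After an exchange of the integrals each shift \<open>s\<close> contributes the same
  norm, because the strip is invariant under it. One factor \<open>h\<close> is the length of the
  interval, the other comes from the pointwise bound.\<close>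

lemma test_difference_bound:
  fixes u :: "real \<times> real \<Rightarrow> complex"
  assumes u: "u \<in> test_functions V" and h: "h > 0"
  shows "l2_norm (lborel_on (strip \<epsilon>)) (\<lambda>z. u (z + (h, 0)) - u z) \<le> h * l2_norm (lborel_on (strip \<epsilon>)) (dir_deriv (1, 0) u)"
proof -
  let ?M = "lborel_on (strip \<epsilon>)" and ?I = "indicator (strip \<epsilon>) :: real \<times> real \<Rightarrow> ennreal"
  note o = open_inter_space_lborel[OF open_strip[of \<epsilon>]]
  have uL: "u \<in> L2 ?M" and dL: "dir_deriv (1, 0) u \<in> L2 ?M"
    using test_functions_L2[OF u open_strip] test_functions_L2[OF test_functions_dir_deriv[OF u] open_strip] by auto
  have md [measurable]: "dir_deriv (1, 0) u \<in> borel_measurable borel" by (rule test_functions_borel[OF test_functions_dir_deriv[OF u]])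
  have ms [measurable]: "strip \<epsilon> \<in> sets borel" using open_strip by simp
  let ?g = "\<lambda>z. ennreal ((norm (dir_deriv (1, 0) u z))^2) * ?I z"
  have mg: "?g \<in> borel_measurable borel" by measurable
  have ind: "?I (z + (s, 0)) = ?I z" for z s by (simp add: indicator_def mem_strip)
  have G: "(\<integral>\<^sup>+z. ?g z \<partial>lborel) = ennreal ((l2_norm ?M (dir_deriv (1, 0) u))^2)"
    using L2_nn_integral[OF dL] unfolding nn_integral_restrict_space[OF o] .
  show ?thesis
  proof (rule L2_I_bound(2)[OF L2_measurable[OF L2_diff[OF L2_strip_translate(1)[OF uL] uL]]])
    have "(\<integral>\<^sup>+z. ennreal ((norm (u (z + (h, 0)) - u z))^2) \<partial>?M) = (\<integral>\<^sup>+z. ennreal ((norm (u (z + (h, 0)) - u z))^2) * ?I z \<partial>lborel)"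
      by (rule nn_integral_restrict_space[OF o])
    also have "\<dots> \<le> (\<integral>\<^sup>+z. ennreal h * (\<integral>\<^sup>+s. indicator {0..h} s * ?g (z + (s, 0)) \<partial>lborel) \<partial>lborel)"
    proof (rule nn_integral_mono)
      fix z
      show "ennreal ((norm (u (z + (h, 0)) - u z))^2) * ?I z \<le> ennreal h * (\<integral>\<^sup>+s. indicator {0..h} s * ?g (z + (s, 0)) \<partial>lborel)"
        unfolding ind using test_difference_pointwise[OF u h, of z]
        by (cases "z \<in> strip \<epsilon>") simp_all
    qed
    also have "\<dots> = ennreal h * (\<integral>\<^sup>+z. (\<integral>\<^sup>+s. indicator {0..h} s * ?g (z + (s, 0)) \<partial>lborel) \<partial>lborel)"
      by (rule nn_integral_cmult) measurable
    also have "(\<integral>\<^sup>+z. (\<integral>\<^sup>+s. indicator {0..h} s * ?g (z + (s, 0)) \<partial>lborel) \<partial>lborel)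
      = (\<integral>\<^sup>+s. (\<integral>\<^sup>+z. indicator {0..h} s * ?g (z + (s, 0)) \<partial>lborel) \<partial>lborel)"
      by (rule lborel_pair.Fubini'[symmetric]) measurable
    also have "\<dots> = (\<integral>\<^sup>+s. indicator {0..h} s * (\<integral>\<^sup>+z. ?g z \<partial>lborel) \<partial>lborel)"
    proof (rule nn_integral_cong)
      fix s
      have "(\<integral>\<^sup>+z. indicator {0..h} s * ?g (z + (s, 0)) \<partial>lborel) = indicator {0..h} s * (\<integral>\<^sup>+z. ?g (z + (s, 0)) \<partial>lborel)"
        by (rule nn_integral_cmult) measurable
      then show "(\<integral>\<^sup>+z. indicator {0..h} s * ?g (z + (s, 0)) \<partial>lborel) = indicator {0..h} s * (\<integral>\<^sup>+z. ?g z \<partial>lborel)"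
        unfolding nn_integral_translate[OF mg] .
    qed
    also have "\<dots> = (\<integral>\<^sup>+s. indicator {0..h} s \<partial>lborel) * (\<integral>\<^sup>+z. ?g z \<partial>lborel)"
      by (rule nn_integral_multc) measurable
    also have "(\<integral>\<^sup>+s. indicator {0..h} s \<partial>lborel) = ennreal h" using h by simp
    also have "ennreal h * (ennreal h * (\<integral>\<^sup>+z. ?g z \<partial>lborel)) = ennreal ((h * l2_norm ?M (dir_deriv (1, 0) u))^2)"
      unfolding G using h by (simp add: power2_eq_square mult_ac flip: ennreal_mult)
    finally show "(\<integral>\<^sup>+z. ennreal ((norm (u (z + (h, 0)) - u z))^2) \<partial>?M) \<le> ennreal ((h * l2_norm ?M (dir_deriv (1, 0) u))^2)" .
    show "0 \<le> h * l2_norm ?M (dir_deriv (1, 0) u)" using h by (simp add: l2_norm_nonneg)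
  qed
qed

lemma difference_bound:
  assumes \<epsilon>: "\<epsilon> > 0" and f: "weak_grad \<epsilon> f fx fy" and h: "h > 0"
  shows "l2_norm (lborel_on (strip \<epsilon>)) (\<lambda>z. f (z + (h, 0)) - f z) \<le> h * l2_norm (lborel_on (strip \<epsilon>)) fx"
proof -
  let ?M = "lborel_on (strip \<epsilon>)"
  note fH = weak_grad_H1[OF f] and fL = weak_gradD(1-3)[OF f]
  obtain u where u: "H1_approx \<epsilon> f u" by (rule H1_approx_exists[OF \<epsilon> fH])
  have i: "(1, 0) \<in> (Basis :: (real \<times> real) set)" by (simp add: Basis_real_prod)
  let ?a = "\<lambda>n. l2_norm ?M (\<lambda>z. u n z - f z)" and ?b = "\<lambda>n. l2_norm ?M (\<lambda>z. dir_deriv (1, 0) (u n) z - fx z)"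
  have b: "l2_norm ?M (\<lambda>z. dir_deriv (1, 0) (u n) z - wderiv (strip \<epsilon>) (1, 0) f z) = ?b n" for n
    using weak_grad_wderiv(1)[OF f] H1_D(3)[OF fH open_strip i] fL H1_approxD(5)[OF u]
    by (intro l2_norm_cong L2_measurable L2_diff) auto
  have la: "?a \<longlonglongrightarrow> 0" by (rule H1_approxD(2)[OF u])
  have lb: "?b \<longlonglongrightarrow> 0" using H1_approxD(3)[OF u i] unfolding b .
  have "l2_norm ?M (\<lambda>z. f (z + (h, 0)) - f z) \<le> 2 * ?a n + h * (l2_norm ?M fx + ?b n)" for n
  proof -
    note uL = H1_approxD(4)[OF u, of n]
    have 1: "l2_norm ?M (\<lambda>z. f (z + (h, 0)) - u n (z + (h, 0))) = ?a n"
      using L2_strip_translate(2)[OF L2_diff[OF fL(1) uL], of h] l2_norm_minus_commute[of ?M f "u n"] by simp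
    have "l2_norm ?M (\<lambda>z. f (z + (h, 0)) - f z)
      \<le> l2_norm ?M (\<lambda>z. f (z + (h, 0)) - u n (z + (h, 0))) + l2_norm ?M (\<lambda>z. u n (z + (h, 0)) - f z)"
      by (rule l2_norm_triangle_diff[OF L2_strip_translate(1)[OF fL(1)] L2_strip_translate(1)[OF uL] fL(1)])
    moreover have "l2_norm ?M (\<lambda>z. u n (z + (h, 0)) - f z) \<le> l2_norm ?M (\<lambda>z. u n (z + (h, 0)) - u n z) + ?a n"
      by (rule l2_norm_triangle_diff[OF L2_strip_translate(1)[OF uL] uL fL(1)])
    moreover have "l2_norm ?M (\<lambda>z. u n (z + (h, 0)) - u n z) \<le> h * l2_norm ?M (dir_deriv (1, 0) (u n))"
      by (rule test_difference_bound[OF H1_approxD(1)[OF u] h])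
    moreover have "h * l2_norm ?M (dir_deriv (1, 0) (u n)) \<le> h * (l2_norm ?M fx + ?b n)"
      using h by (intro mult_left_mono l2_norm_le_diff H1_approxD(5)[OF u] fL) simp
    ultimately show ?thesis unfolding 1 by linarith
  qed
  moreover have "(\<lambda>n. 2 * ?a n + h * (l2_norm ?M fx + ?b n)) \<longlonglongrightarrow> 2 * 0 + h * (l2_norm ?M fx + 0)"
    by (intro tendsto_intros la lb)
  ultimately show ?thesis by (intro LIMSEQ_le_const[where X="\<lambda>n. 2 * ?a n + h * (l2_norm ?M fx + ?b n)"]) auto
qed

text \<open>Weak convergence of the difference quotients: against test functions by dominated
  convergence, against a general \<open>f\<close> by density, the quotients being bounded in L2
  uniformly in \<open>n\<close>.\<close>

lemma difference_quotient_inner_tendsto: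
  fixes \<phi> f :: "real \<times> real \<Rightarrow> complex"
  assumes \<phi>: "\<phi> \<in> test_functions V" and f: "f \<in> L2 (lborel_on (strip \<epsilon>))"
  shows "(\<lambda>n. l2_inner (lborel_on (strip \<epsilon>)) (\<lambda>z. real (Suc n) *\<^sub>R (\<phi> (z + (1 / real (Suc n), 0)) - \<phi> z)) f)
    \<longlonglongrightarrow> l2_inner (lborel_on (strip \<epsilon>)) (dir_deriv (1, 0) \<phi>) f"
proof -
  let ?M = "lborel_on (strip \<epsilon>)"
  let ?s = "\<lambda>n z. real (Suc n) *\<^sub>R (\<phi> (z + (1 / real (Suc n), 0)) - \<phi> z)"
  have \<phi>L: "\<phi> \<in> L2 ?M" and dL: "dir_deriv (1, 0) \<phi> \<in> L2 ?M"
    using test_functions_L2[OF \<phi> open_strip] test_functions_L2[OF test_functions_dir_deriv[OF \<phi>] open_strip] by auto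
  have sL: "?s n \<in> L2 ?M" for n
    using L2_cmult[OF L2_diff[OF L2_strip_translate(1)[OF \<phi>L, of "1 / real (Suc n)"] \<phi>L], of "complex_of_real (real (Suc n))"]
    unfolding scaleR_conv_of_real .
  have bound: "l2_norm ?M (?s n) \<le> l2_norm ?M (dir_deriv (1, 0) \<phi>)" for n
  proof -
    have "l2_norm ?M (?s n) = real (Suc n) * l2_norm ?M (\<lambda>z. \<phi> (z + (1 / real (Suc n), 0)) - \<phi> z)"
      unfolding scaleR_conv_of_real l2_norm_cmult by (simp only: norm_of_real abs_of_nat)
    also have "\<dots> \<le> real (Suc n) * (1 / real (Suc n) * l2_norm ?M (dir_deriv (1, 0) \<phi>))"
      by (intro mult_left_mono test_difference_bound[OF \<phi>]) simp_all
    finally show ?thesis by simp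
  qed
  have "(\<lambda>n. l2_inner ?M (?s n) g) \<longlonglongrightarrow> l2_inner ?M (dir_deriv (1, 0) \<phi>) g" if g: "g \<in> test_functions (strip \<epsilon>)" for g
  proof -
    obtain L where L: "L > 0" "\<And>x y. norm (\<phi> x - \<phi> y) \<le> L * norm (x - y)" by (rule test_functions_Lipschitz[OF \<phi>]) blast
    have gL: "g \<in> L2 ?M" by (rule test_functions_L2[OF g open_strip])
    have ig: "integrable ?M g"
      using integrable_mult_indicator[OF _ test_functions_integrable[OF g], of "strip \<epsilon>"] open_strip
      unfolding integrable_restrict_space[OF open_inter_space_lborel[OF open_strip]] by simp
    show ?thesis unfolding l2_inner_def
    proof (rule integral_dominated_convergence)
      show "(\<lambda>z. cnj (dir_deriv (1, 0) \<phi> z) * g z) \<in> borel_measurable ?M"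
        by (rule borel_measurable_integrable[OF L2_integrable_inner[OF dL gL]])
      show "(\<lambda>z. cnj (?s n z) * g z) \<in> borel_measurable ?M" for n
        by (rule borel_measurable_integrable[OF L2_integrable_inner[OF sL gL]])
      show "integrable ?M (\<lambda>z. L * norm (g z))" by (rule integrable_mult_right[OF integrable_norm[OF ig]])
      show "AE z in ?M. (\<lambda>n. cnj (?s n z) * g z) \<longlonglongrightarrow> cnj (dir_deriv (1, 0) \<phi> z) * g z"
      proof (rule AE_I2)
        fix z
        have "(\<lambda>n. ?s n z) \<longlonglongrightarrow> dir_deriv (1, 0) \<phi> z"
          using difference_quotient_tendsto[OF test_functions_smooth[OF \<phi>], of z "(1, 0)"] by simp
        then show "(\<lambda>n. cnj (?s n z) * g z) \<longlonglongrightarrow> cnj (dir_deriv (1, 0) \<phi> z) * g z"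
          by (intro tendsto_mult tendsto_cnj tendsto_const)
      qed
      show "AE z in ?M. norm (cnj (?s n z) * g z) \<le> L * norm (g z)" for n
      proof (rule AE_I2)
        fix z
        have "norm (\<phi> (z + (1 / real (Suc n), 0)) - \<phi> z) \<le> L * (1 / real (Suc n))"
          using L(2)[of "z + (1 / real (Suc n), 0)" z] by (simp add: norm_Pair)
        then have "real (Suc n) * norm (\<phi> (z + (1 / real (Suc n), 0)) - \<phi> z) \<le> real (Suc n) * (L * (1 / real (Suc n)))"
          by (rule mult_left_mono) simp
        then have "norm (?s n z) \<le> L" unfolding norm_scaleR abs_of_nat by simp
        then show "norm (cnj (?s n z) * g z) \<le> L * norm (g z)"
          unfolding norm_mult complex_mod_cnj by (rule mult_right_mono) simp
      qed
    qed
  qed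
  note test_lim = this
  obtain g where g: "\<And>k. g k \<in> test_functions (strip \<epsilon>)" "(\<lambda>k. l2_norm ?M (\<lambda>z. g k z - f z)) \<longlonglongrightarrow> 0"
    by (rule test_functions_dense[OF open_strip f]) blast
  let ?D = "l2_norm ?M (dir_deriv (1, 0) \<phi>)"
  show ?thesis
  proof (rule LIMSEQ_I)
    fix e :: real assume e: "e > 0"
    \<comment> \<open>Replacing \<open>f\<close> by a test function leaves two errors, each at most
      \<open>?D * r\<close>. The added 1 excludes division by zero.\<close>
    define r where "r = e / 4 / (?D + 1)"
    have D: "?D \<ge> 0" by (rule l2_norm_nonneg)
    have r: "r > 0" unfolding r_def using e D by (intro divide_pos_pos) simp_all
    from eventually_happens'[OF sequentially_bot order_tendstoD(2)[OF g(2) r]]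
    obtain k where k: "l2_norm ?M (\<lambda>z. g k z - f z) < r" by blast
    have gL: "g k \<in> L2 ?M" by (rule test_functions_L2[OF g(1) open_strip])
    have e2: "e / 2 > 0" using e by simp
    from LIMSEQ_D[OF test_lim[OF g(1), of k] e2] obtain N where
      N: "\<And>n. n \<ge> N \<Longrightarrow> norm (l2_inner ?M (?s n) (g k) - l2_inner ?M (dir_deriv (1, 0) \<phi>) (g k)) < e / 2" by blast
    have small: "norm (l2_inner ?M w (\<lambda>z. g k z - f z)) \<le> ?D * r" if "w \<in> L2 ?M" "l2_norm ?M w \<le> ?D" for w
    proof -
      have "norm (l2_inner ?M w (\<lambda>z. g k z - f z)) \<le> l2_norm ?M w * l2_norm ?M (\<lambda>z. g k z - f z)"
        by (rule l2_Cauchy_Schwarz[OF that(1) L2_diff[OF gL f]])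
      also have "\<dots> \<le> ?D * r" using that(2) k D by (intro mult_mono) (auto simp: l2_norm_nonneg)
      finally show ?thesis .
    qed
    have Dr: "?D * r \<le> e / 4"
    proof -
      have cancel: "x * (c / x) = c" if "x \<noteq> 0" for x c :: real using that by simp
      have "?D * r \<le> (?D + 1) * r" using r by (intro mult_right_mono) simp_all
      also have "\<dots> = e / 4" unfolding r_def by (rule cancel) (use D in linarith)
      finally show ?thesis .
    qed
    have add3: "norm (a - (b - c)) < e" if "norm a < e / 2" "norm b \<le> e / 4" "norm c \<le> e / 4" for a b c :: complex
      using norm_triangle_ineq4[of a "b - c"] norm_triangle_ineq4[of b c] that by linarith
    show "\<exists>no. \<forall>n\<ge>no. norm (l2_inner ?M (?s n) f - l2_inner ?M (dir_deriv (1, 0) \<phi>) f) < e"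
    proof (intro exI allI impI)
      fix n assume n: "N \<le> n"
      have split: "l2_inner ?M (?s n) f - l2_inner ?M (dir_deriv (1, 0) \<phi>) f
        = (l2_inner ?M (?s n) (g k) - l2_inner ?M (dir_deriv (1, 0) \<phi>) (g k))
          - (l2_inner ?M (?s n) (\<lambda>z. g k z - f z) - l2_inner ?M (dir_deriv (1, 0) \<phi>) (\<lambda>z. g k z - f z))"
        unfolding l2_inner_diff_right[OF sL gL f] l2_inner_diff_right[OF dL gL f] by simp
      have b: "norm (l2_inner ?M (?s n) (\<lambda>z. g k z - f z)) \<le> e / 4"
        by (rule order_trans[OF small[OF sL[of n] bound[of n]] Dr])
      have c: "norm (l2_inner ?M (dir_deriv (1, 0) \<phi>) (\<lambda>z. g k z - f z)) \<le> e / 4"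
        by (rule order_trans[OF small[OF dL order_refl] Dr])
      show "norm (l2_inner ?M (?s n) f - l2_inner ?M (dir_deriv (1, 0) \<phi>) f) < e"
        unfolding split by (rule add3[OF N[OF n] b c])
    qed
  qed
qed

lemma difference_quotient_inner_shift:
  fixes \<phi> f :: "real \<times> real \<Rightarrow> complex"
  assumes \<phi>: "\<phi> \<in> L2 (lborel_on (strip \<epsilon>))" and f: "f \<in> L2 (lborel_on (strip \<epsilon>))"
  shows "l2_inner (lborel_on (strip \<epsilon>)) (\<lambda>z. real (Suc n) *\<^sub>R (\<phi> (z + (h, 0)) - \<phi> z)) f
    = real (Suc n) *\<^sub>R l2_inner (lborel_on (strip \<epsilon>)) \<phi> (\<lambda>z. f (z + (- h, 0)) - f z)"
proof -
  let ?M = "lborel_on (strip \<epsilon>)"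
  have "l2_inner ?M (\<lambda>z. real (Suc n) *\<^sub>R (\<phi> (z + (h, 0)) - \<phi> z)) f = real (Suc n) *\<^sub>R l2_inner ?M (\<lambda>z. \<phi> (z + (h, 0)) - \<phi> z) f"
    unfolding l2_inner_def complex_cnj_scaleR mult_scaleR_left by (rule integral_scaleR_right)
  also have "l2_inner ?M (\<lambda>z. \<phi> (z + (h, 0)) - \<phi> z) f = l2_inner ?M \<phi> (\<lambda>z. f (z + (- h, 0)) - f z)"
    unfolding l2_inner_diff_left[OF f L2_strip_translate(1)[OF \<phi>] \<phi>] l2_inner_diff_right[OF \<phi> L2_strip_translate(1)[OF f] f]
      l2_inner_strip_translate[OF \<phi> f] by (rule refl)
  finally show ?thesis .
qed

text \<open>Shifting moves the difference quotient from \<open>\<phi>\<close> to \<open>f\<close>,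
  where \<open>K\<close> bounds it uniformly. In the limit the derivative of \<open>\<phi>\<close>
  paired with \<open>f\<close> is a bounded functional of \<open>\<phi>\<close>.\<close>

lemma weak_deriv_tangential_exists:
  assumes f: "f \<in> L2 (lborel_on (strip \<epsilon>))"
    and K: "\<And>h. h > 0 \<Longrightarrow> l2_norm (lborel_on (strip \<epsilon>)) (\<lambda>z. f (z + (h, 0)) - f z) \<le> K * h"
  obtains g where "g \<in> L2 (lborel_on (strip \<epsilon>))" "weak_deriv (strip \<epsilon>) (1, 0) f g"
proof (rule weak_deriv_exists[OF open_strip f])
  let ?M = "lborel_on (strip \<epsilon>)"
  fix \<phi> :: "real \<times> real \<Rightarrow> complex" assume \<phi>: "\<phi> \<in> test_functions (strip \<epsilon>)"
  have \<phi>L: "\<phi> \<in> L2 ?M" by (rule test_functions_L2[OF \<phi> open_strip])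
  let ?s = "\<lambda>n z. real (Suc n) *\<^sub>R (\<phi> (z + (1 / real (Suc n), 0)) - \<phi> z)"
  have bound: "norm (l2_inner ?M (?s n) f) \<le> K * l2_norm ?M \<phi>" for n
  proof -
    let ?h = "1 / real (Suc n)"
    have h: "?h > 0" by simp
    have fh: "(\<lambda>z. f (z + (- ?h, 0)) - f z) \<in> L2 ?M" by (rule L2_diff[OF L2_strip_translate(1)[OF f] f])
    \<comment> \<open>The adjoint of a forward difference is a backward one; translating by
      \<open>?h\<close> turns it into a forward difference of the same norm, to which the hypothesis
      applies.\<close>
    have "l2_norm ?M (\<lambda>z. f (z + (- ?h, 0)) - f z) = l2_norm ?M (\<lambda>z. f z - f (z + (?h, 0)))"
      using L2_strip_translate(2)[OF fh, of ?h] by (simp add: add.assoc flip: zero_prod_def)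
    also have "\<dots> = l2_norm ?M (\<lambda>z. f (z + (?h, 0)) - f z)" by (rule l2_norm_minus_commute)
    also have "\<dots> \<le> K * ?h" by (rule K[OF h])
    finally have le: "l2_norm ?M (\<lambda>z. f (z + (- ?h, 0)) - f z) \<le> K * ?h" .
    have "norm (l2_inner ?M (?s n) f) = real (Suc n) * norm (l2_inner ?M \<phi> (\<lambda>z. f (z + (- ?h, 0)) - f z))"
      unfolding difference_quotient_inner_shift[OF \<phi>L f] norm_scaleR abs_of_nat by (rule refl)
    also have "\<dots> \<le> real (Suc n) * (l2_norm ?M \<phi> * (K * ?h))"
      by (intro mult_left_mono order_trans[OF l2_Cauchy_Schwarz[OF \<phi>L fh]] le l2_norm_nonneg) simp
    also have "\<dots> = K * l2_norm ?M \<phi>" by simp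
    finally show ?thesis .
  qed
  show "norm (l2_inner ?M (dir_deriv (1, 0) \<phi>) f) \<le> K * l2_norm ?M \<phi>"
    by (rule LIMSEQ_le_const2[OF tendsto_norm[OF difference_quotient_inner_tendsto[OF \<phi> f]]]) (use bound in blast)
qed

text \<open>Symmetry of the mixed derivatives: the difference quotients in the first direction commute with
  differentiation in the second one.\<close>

lemma weak_deriv_mixed:
  assumes f: "weak_grad \<epsilon> f fx fy" and k: "k \<in> L2 (lborel_on (strip \<epsilon>))" "weak_deriv (strip \<epsilon>) (1, 0) fy k"
  shows "weak_deriv (strip \<epsilon>) (0, 1) fx k"
proof (rule weak_derivI[OF open_strip weak_gradD(2)[OF f] k(1)])
  let ?M = "lborel_on (strip \<epsilon>)"
  note fD = weak_gradD[OF f]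
  fix \<phi> :: "real \<times> real \<Rightarrow> complex" assume \<phi>: "\<phi> \<in> test_functions (strip \<epsilon>)"
  note d\<phi> = test_functions_dir_deriv[OF \<phi>]
  let ?s = "\<lambda>\<phi> n z. real (Suc n) *\<^sub>R (\<phi> (z + (1 / real (Suc n), 0)) - \<phi> z) :: complex"
  have t: "?s \<phi> n \<in> test_functions (strip \<epsilon>)" for n
  proof -
    have 1: "(\<lambda>z. \<phi> (z + (1 / real (Suc n), 0))) \<in> test_functions (strip \<epsilon>)"
      by (rule test_functions_translate[OF \<phi>]) (simp add: mem_strip)
    have "(\<lambda>z. complex_of_real (real (Suc n)) * (\<phi> (z + (1 / real (Suc n), 0)) + (-1) * \<phi> z)) \<in> test_functions (strip \<epsilon>)"
      by (rule test_functions_mult[OF test_functions_add[OF 1 test_functions_mult[OF \<phi> smooth_const]] smooth_const])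
    then show ?thesis unfolding scaleR_conv_of_real by simp
  qed
  have s: "smooth \<phi>" by (rule test_functions_smooth[OF \<phi>])
  have d: "dir_deriv (0, 1) (?s \<phi> n) = ?s (dir_deriv (0, 1) \<phi>) n" for n
  proof
    fix z
    have "((\<lambda>z. \<phi> (z + (1 / real (Suc n), 0))) has_derivative (\<lambda>v. dir_deriv v \<phi> (z + (1 / real (Suc n), 0)))) (at z)"
      using smooth_has_derivative[OF smooth_translate[OF s], of "(1 / real (Suc n), 0)" z] unfolding dir_deriv_translate[OF s] .
    then have "(?s \<phi> n has_derivative (\<lambda>v. real (Suc n) *\<^sub>R (dir_deriv v \<phi> (z + (1 / real (Suc n), 0)) - dir_deriv v \<phi> z))) (at z)"
      by (intro has_derivative_scaleR_right has_derivative_diff smooth_has_derivative[OF s])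
    then show "dir_deriv (0, 1) (?s \<phi> n) z = ?s (dir_deriv (0, 1) \<phi>) n z" by (rule dir_deriv_eqI)
  qed
  have "(\<lambda>n. l2_inner ?M (?s (dir_deriv (0, 1) \<phi>) n) f) \<longlonglongrightarrow> l2_inner ?M (dir_deriv (1, 0) (dir_deriv (0, 1) \<phi>)) f"
    by (rule difference_quotient_inner_tendsto[OF d\<phi> fD(1)])
  moreover have "l2_inner ?M (?s (dir_deriv (0, 1) \<phi>) n) f = - l2_inner ?M (?s \<phi> n) fy" for n
    unfolding d[symmetric] by (rule weak_deriv_inner[OF fD(5) t open_strip fD(1,3)])
  ultimately have 1: "(\<lambda>n. - l2_inner ?M (?s \<phi> n) fy) \<longlonglongrightarrow> l2_inner ?M (dir_deriv (1, 0) (dir_deriv (0, 1) \<phi>)) f"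
    by simp
  have 2: "(\<lambda>n. - l2_inner ?M (?s \<phi> n) fy) \<longlonglongrightarrow> - l2_inner ?M (dir_deriv (1, 0) \<phi>) fy"
    by (rule tendsto_minus[OF difference_quotient_inner_tendsto[OF \<phi> fD(3)]])
  \<comment> \<open>One sequence has two limits, read as quotients of the normal derivative of
    \<open>\<phi>\<close> against \<open>f\<close> and as quotients of \<open>\<phi>\<close> against
    \<open>fy\<close>. Only first derivatives of \<open>f\<close> are involved.\<close>
  have "l2_inner ?M (dir_deriv (1, 0) (dir_deriv (0, 1) \<phi>)) f = - l2_inner ?M (dir_deriv (1, 0) \<phi>) fy"
    by (rule LIMSEQ_unique[OF 1 2])
  moreover have "l2_inner ?M (dir_deriv (1, 0) (dir_deriv (0, 1) \<phi>)) f = - l2_inner ?M (dir_deriv (0, 1) \<phi>) fx"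
    by (rule weak_deriv_inner[OF fD(4) d\<phi> open_strip fD(1,2)])
  moreover have "l2_inner ?M (dir_deriv (1, 0) \<phi>) fy = - l2_inner ?M \<phi> k"
    by (rule weak_deriv_inner[OF k(2) \<phi> open_strip fD(3) k(1)])
  ultimately show "l2_inner ?M (dir_deriv (0, 1) \<phi>) fx = - l2_inner ?M \<phi> k" by (metis minus_minus)
qed

text \<open>With \<open>S\<close> the Euclidean norm of the pair \<open>X\<close>, \<open>Y\<close>
  the hypothesis implies \<open>S * S \<le> S * ((A + B) * h)\<close>, and one factor
  \<open>S\<close> cancels.\<close>

lemma sum_squares_le_imp:
  fixes X Y A B h :: real
  assumes "X^2 + Y^2 \<le> h * (Y * A + X * B)" "0 \<le> X" "0 \<le> Y" "0 \<le> A" "0 \<le> B" "0 \<le> h"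
  shows "X \<le> (A + B) * h" "Y \<le> (A + B) * h"
proof -
  define S where "S = sqrt (X^2 + Y^2)"
  have S: "X \<le> S" "Y \<le> S" "0 \<le> S" by (auto simp: S_def intro: real_le_rsqrt)
  have "S * S = X^2 + Y^2" by (simp add: S_def)
  also have "\<dots> \<le> h * (Y * A + X * B)" by (rule assms(1))
  also have "\<dots> \<le> h * (S * A + S * B)" using S assms by (intro mult_left_mono add_mono mult_right_mono) auto
  finally have "S * S \<le> S * ((A + B) * h)" by (simp add: algebra_simps)
  moreover have "0 \<le> (A + B) * h" using assms by simp
  ultimately have "S \<le> (A + B) * h"
    using S(3) by (cases "S = 0") (simp_all add: mult_le_cancel_left)
  then show "X \<le> (A + B) * h" "Y \<le> (A + B) * h" using S by auto
qed

text \<open>Testing the weak equation with the second difference of \<^term>\<open>\<psi>\<close> in the tangential direction bounds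
  the difference quotients of its gradient.\<close>

lemma tangential_difference_bound:
  assumes \<epsilon>: "\<epsilon> > 0" and \<psi>: "weak_grad \<epsilon> \<psi> \<psi>x \<psi>y" and q: "weak_grad \<epsilon> q qx qy" and g: "g \<in> L2 (lborel_on (strip \<epsilon>))"
    and eq: "\<And>\<phi> \<phi>x \<phi>y. weak_grad \<epsilon> \<phi> \<phi>x \<phi>y \<Longrightarrow>
      l2_inner (lborel_on (strip \<epsilon>)) \<phi>x \<psi>x + l2_inner (lborel_on (strip \<epsilon>)) \<phi>y \<psi>y + l2_inner (lborel_on (strip \<epsilon>)) \<phi>y q
        = l2_inner (lborel_on (strip \<epsilon>)) \<phi> g"
    and h: "h > 0"
  shows "l2_norm (lborel_on (strip \<epsilon>)) (\<lambda>z. \<psi>x (z + (h, 0)) - \<psi>x z) \<le> (l2_norm (lborel_on (strip \<epsilon>)) qx + l2_norm (lborel_on (strip \<epsilon>)) g) * h"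
    and "l2_norm (lborel_on (strip \<epsilon>)) (\<lambda>z. \<psi>y (z + (h, 0)) - \<psi>y z) \<le> (l2_norm (lborel_on (strip \<epsilon>)) qx + l2_norm (lborel_on (strip \<epsilon>)) g) * h"
proof -
  let ?M = "lborel_on (strip \<epsilon>)"
  define d where "d f = (\<lambda>z. f (z + (h, 0)) - f z)" for f :: "real \<times> real \<Rightarrow> complex"
  define d' where "d' f = (\<lambda>z. f (z + (- h, 0)) - f z)" for f :: "real \<times> real \<Rightarrow> complex"
  have dL: "d f \<in> L2 ?M" if "f \<in> L2 ?M" for f unfolding d_def by (rule L2_diff[OF L2_strip_translate(1)[OF that] that])
  have d'L: "d' f \<in> L2 ?M" if "f \<in> L2 ?M" for f unfolding d'_def by (rule L2_diff[OF L2_strip_translate(1)[OF that] that])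
  have w: "weak_grad \<epsilon> (d \<psi>) (d \<psi>x) (d \<psi>y)" unfolding d_def by (rule weak_grad_diff[OF weak_grad_translate[OF \<psi>] \<psi>])
  have w': "weak_grad \<epsilon> (d' (d \<psi>)) (d' (d \<psi>x)) (d' (d \<psi>y))" unfolding d'_def by (rule weak_grad_diff[OF weak_grad_translate[OF w] w])
  note wL = weak_gradD(1-3)[OF w] and \<psi>L = weak_gradD(1-3)[OF \<psi>] and qL = weak_gradD(1-3)[OF q]
  have shift: "l2_inner ?M (d' f) k = l2_inner ?M f (d k)" if "f \<in> L2 ?M" "k \<in> L2 ?M" for f k
    unfolding d_def d'_def l2_inner_diff_left[OF that(2) L2_strip_translate(1)[OF that(1)] that(1)]
      l2_inner_diff_right[OF that(1) L2_strip_translate(1)[OF that(2)] that(2)] l2_inner_strip_translate[OF that] by simp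
  let ?X = "l2_norm ?M (d \<psi>x)" and ?Y = "l2_norm ?M (d \<psi>y)"
  \<comment> \<open>The backward difference \<open>d'\<close> is the adjoint of \<open>d\<close>, so
    testing with \<open>d' (d \<psi>)\<close> produces the squared norms of the differenced
    gradient. Only \<open>q\<close> is differenced as well; \<open>g\<close> keeps its
    place.\<close>
  have "complex_of_real (?X^2) + complex_of_real (?Y^2) = l2_inner ?M (d' (d \<psi>)) g - l2_inner ?M (d \<psi>y) (d q)"
    using eq[OF w'] unfolding shift[OF wL(2) \<psi>L(2)] shift[OF wL(3) \<psi>L(3)] shift[OF wL(3) qL(1)] l2_inner_self
    by (simp add: algebra_simps)
  then have "?X^2 + ?Y^2 = Re (l2_inner ?M (d' (d \<psi>)) g - l2_inner ?M (d \<psi>y) (d q))"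
    by (metis of_real_add Re_complex_of_real)
  also have "\<dots> \<le> norm (l2_inner ?M (d' (d \<psi>)) g - l2_inner ?M (d \<psi>y) (d q))" by (rule complex_Re_le_cmod)
  also have "\<dots> \<le> norm (l2_inner ?M (d' (d \<psi>)) g) + norm (l2_inner ?M (d \<psi>y) (d q))" by (rule norm_triangle_ineq4)
  also have "\<dots> \<le> l2_norm ?M (d' (d \<psi>)) * l2_norm ?M g + ?Y * l2_norm ?M (d q)"
    by (intro add_mono l2_Cauchy_Schwarz d'L dL g wL \<psi>L qL)
  also have "l2_norm ?M (d' (d \<psi>)) = l2_norm ?M (d (d \<psi>))"
  proof -
    have "l2_norm ?M (d' (d \<psi>)) = l2_norm ?M (\<lambda>z. d' (d \<psi>) (z + (h, 0)))"
      by (rule L2_strip_translate(2)[OF d'L[OF wL(1)], symmetric])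
    also have "\<dots> = l2_norm ?M (\<lambda>z. d \<psi> z - d \<psi> (z + (h, 0)))"
      unfolding d'_def by (simp add: add.assoc flip: zero_prod_def)
    also have "\<dots> = l2_norm ?M (d (d \<psi>))" unfolding d_def[of "d \<psi>"] by (rule l2_norm_minus_commute)
    finally show ?thesis .
  qed
  also have "l2_norm ?M (d (d \<psi>)) * l2_norm ?M g + ?Y * l2_norm ?M (d q) \<le> (h * ?X) * l2_norm ?M g + ?Y * (h * l2_norm ?M qx)"
    using difference_bound[OF \<epsilon> w h] difference_bound[OF \<epsilon> q h] unfolding d_def[symmetric]
    by (intro add_mono mult_right_mono mult_left_mono l2_norm_nonneg)
  finally have le: "?X^2 + ?Y^2 \<le> h * (?Y * l2_norm ?M qx + ?X * l2_norm ?M g)" by (simp add: algebra_simps)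
  have h0: "0 \<le> h" using h by simp
  show "l2_norm ?M (\<lambda>z. \<psi>x (z + (h, 0)) - \<psi>x z) \<le> (l2_norm ?M qx + l2_norm ?M g) * h"
    "l2_norm ?M (\<lambda>z. \<psi>y (z + (h, 0)) - \<psi>y z) \<le> (l2_norm ?M qx + l2_norm ?M g) * h"
    using sum_squares_le_imp[OF le l2_norm_nonneg l2_norm_nonneg l2_norm_nonneg l2_norm_nonneg h0] unfolding d_def by auto
qed

text \<open>In the application \<open>q\<close> is \<open>\<alpha> \<psi>\<close>, and
  \<open>g\<close> is the right-hand side minus \<open>\<alpha>\<close> times the normal derivative
  of \<open>\<psi>\<close>. This division leaves a single term to be differenced besides the
  gradient, and its tangential derivative is square-integrable.\<close>

lemma weak_solution_regular:
  assumes \<epsilon>: "\<epsilon> > 0" and \<psi>: "weak_grad \<epsilon> \<psi> \<psi>x \<psi>y" and q: "weak_grad \<epsilon> q qx qy" and g: "g \<in> L2 (lborel_on (strip \<epsilon>))"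
    and eq: "\<And>\<phi> \<phi>x \<phi>y. weak_grad \<epsilon> \<phi> \<phi>x \<phi>y \<Longrightarrow>
      l2_inner (lborel_on (strip \<epsilon>)) \<phi>x \<psi>x + l2_inner (lborel_on (strip \<epsilon>)) \<phi>y \<psi>y + l2_inner (lborel_on (strip \<epsilon>)) \<phi>y q
        = l2_inner (lborel_on (strip \<epsilon>)) \<phi> g"
  obtains \<psi>xx \<psi>xy where "weak_grad \<epsilon> \<psi>x \<psi>xx \<psi>xy" "weak_grad \<epsilon> \<psi>y \<psi>xy (\<lambda>z. - (g z + \<psi>xx z + qy z))"
proof -
  let ?M = "lborel_on (strip \<epsilon>)"
  note \<psi>L = weak_gradD[OF \<psi>] and qL = weak_gradD[OF q]
  note bnd = tangential_difference_bound[OF \<epsilon> \<psi> q g eq]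
  obtain \<psi>xx where xx: "\<psi>xx \<in> L2 ?M" "weak_deriv (strip \<epsilon>) (1, 0) \<psi>x \<psi>xx"
    by (rule weak_deriv_tangential_exists[OF \<psi>L(2)]) (rule bnd(1), assumption+)
  obtain \<psi>xy where xy: "\<psi>xy \<in> L2 ?M" "weak_deriv (strip \<epsilon>) (1, 0) \<psi>y \<psi>xy"
    by (rule weak_deriv_tangential_exists[OF \<psi>L(3)]) (rule bnd(2), assumption+)
  have yx: "weak_deriv (strip \<epsilon>) (0, 1) \<psi>x \<psi>xy" by (rule weak_deriv_mixed[OF \<psi> xy])
  let ?r = "\<lambda>z. - (g z + \<psi>xx z + qy z)"
  have rL: "?r \<in> L2 ?M" by (intro L2_uminus L2_add g xx qL)
  have "weak_deriv (strip \<epsilon>) (0, 1) \<psi>y ?r"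
  proof (rule weak_derivI[OF open_strip \<psi>L(3) rL])
    fix \<phi> :: "real \<times> real \<Rightarrow> complex" assume \<phi>: "\<phi> \<in> test_functions (strip \<epsilon>)"
    have \<phi>L: "\<phi> \<in> L2 ?M" by (rule test_functions_L2[OF \<phi> open_strip])
    have a1: "l2_inner ?M (dir_deriv (1, 0) \<phi>) \<psi>x = - l2_inner ?M \<phi> \<psi>xx"
      by (rule weak_deriv_inner[OF xx(2) \<phi> open_strip \<psi>L(2) xx(1)])
    have a2: "l2_inner ?M (dir_deriv (0, 1) \<phi>) q = - l2_inner ?M \<phi> qy"
      by (rule weak_deriv_inner[OF qL(5) \<phi> open_strip qL(1,3)])
    have a3: "l2_inner ?M \<phi> ?r = - (l2_inner ?M \<phi> g + l2_inner ?M \<phi> \<psi>xx + l2_inner ?M \<phi> qy)"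
    proof -
      have s1: "l2_inner ?M \<phi> (\<lambda>z. (g z + 1 * \<psi>xx z) + 1 * qy z) = l2_inner ?M \<phi> g + l2_inner ?M \<phi> \<psi>xx + l2_inner ?M \<phi> qy"
        unfolding l2_inner_add_right[OF \<phi>L L2_add[OF g L2_cmult[OF xx(1)]] qL(3)] l2_inner_add_right[OF \<phi>L g xx(1)] by simp
      have neg: "l2_inner ?M \<phi> (\<lambda>z. - s z) = - l2_inner ?M \<phi> s" for s by (simp add: l2_inner_def)
      show ?thesis unfolding neg using s1 by simp
    qed
    show "l2_inner ?M (dir_deriv (0, 1) \<phi>) \<psi>y = - l2_inner ?M \<phi> ?r"
      using eq[OF weak_grad_test[OF \<phi>]] unfolding a1 a2 a3 by (simp add: algebra_simps)
  qed
  then show ?thesis using that[of \<psi>xx \<psi>xy] xx xy yx \<psi>L rL unfolding weak_grad_def by blast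
qed

section \<open>The Robin form and the Robin Laplacian\<close>

lemma bounded_set_integrable:
  fixes a :: "real \<Rightarrow> real"
  assumes "a \<in> borel_measurable borel" "\<And>x. \<bar>a x\<bar> \<le> C" "compact K"
  shows "set_integrable lborel K a"
  unfolding set_integrable_def
proof (rule Bochner_Integration.integrable_bound)
  have K: "K \<in> sets lborel" using assms(3) by (simp add: compact_imp_closed borel_closed)
  show "integrable lborel (\<lambda>x. C * indicator K x :: real)"
    using emeasure_compact_finite[OF assms(3)] K by (intro integrable_mult_right integrable_real_indicator) (auto simp: less_top)
  have "a \<in> borel_measurable lborel" using assms(1) by simp
  then show "(\<lambda>x. indicator K x *\<^sub>R a x) \<in> borel_measurable lborel"
    using K by (intro borel_measurable_scaleR borel_measurable_indicator)
  show "AE x in lborel. norm (indicator K x *\<^sub>R a x) \<le> norm (C * indicator K x)"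
  proof (rule AE_I2)
    fix x
    have "\<bar>a x\<bar> \<le> \<bar>C\<bar>" using assms(2)[of x] by linarith
    then show "norm (indicator K x *\<^sub>R a x) \<le> norm (C * indicator K x)" by (simp add: indicator_def)
  qed
qed

lemma Linf_bounded_representative:
  assumes "f \<in> Linf lborel"
  obtains a C where "a \<in> borel_measurable borel" "\<And>x::real. \<bar>a x\<bar> \<le> C" "AE x in lborel. f x = a x"
proof -
  obtain C where C: "f \<in> borel_measurable borel" "AE x in lborel. \<bar>f x\<bar> \<le> C" using assms unfolding Linf_def by auto
  have "(\<lambda>x. if \<bar>f x\<bar> \<le> C then f x else 0) \<in> borel_measurable borel" using C(1) by measurable
  moreover have "\<bar>if \<bar>f x\<bar> \<le> C then f x else 0\<bar> \<le> max C 0" for x by simp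
  moreover have "AE x in lborel. f x = (if \<bar>f x\<bar> \<le> C then f x else 0)" using C(2) by eventually_elim simp
  ultimately show ?thesis by (rule that)
qed

text \<open>Bounds that hold everywhere, rather than almost everywhere, pass to functions of
  \<open>fst z\<close> on the strip and to every horizontal slice without null sets in the product
  space.\<close>

lemma W1inf_bounded_representative:
  assumes "\<alpha> \<in> W1inf"
  obtains a b C where "a \<in> borel_measurable borel" "b \<in> borel_measurable borel" "\<And>x. \<bar>a x\<bar> \<le> C" "\<And>x. \<bar>b x\<bar> \<le> C"
    "AE x in lborel. \<alpha> x = a x" "weak_deriv UNIV 1 a b"
proof -
  obtain g where \<alpha>: "\<alpha> \<in> Linf lborel" and g: "g \<in> Linf lborel" and w: "weak_deriv UNIV 1 \<alpha> g"
    using assms unfolding W1inf_def by blast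
  obtain a A where a: "a \<in> borel_measurable borel" "\<And>x. \<bar>a x\<bar> \<le> A" "AE x in lborel. \<alpha> x = a x"
    by (rule Linf_bounded_representative[OF \<alpha>]) blast
  obtain b B where b: "b \<in> borel_measurable borel" "\<And>x. \<bar>b x\<bar> \<le> B" "AE x in lborel. g x = b x"
    by (rule Linf_bounded_representative[OF g]) blast
  have m: "\<alpha> \<in> borel_measurable borel" "g \<in> borel_measurable borel" using \<alpha> g unfolding Linf_def by auto
  have cong: "(\<integral>x. \<psi> x *\<^sub>R f x \<partial>lborel) = (\<integral>x. \<psi> x *\<^sub>R f' x \<partial>lborel)"
    if "\<psi> \<in> test_functions UNIV" "f \<in> borel_measurable borel" "f' \<in> borel_measurable borel" "AE x in lborel. f x = f' x"
    for \<psi> f f' :: "real \<Rightarrow> real"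
  proof (rule integral_cong_AE)
    have m: "\<psi> \<in> borel_measurable lborel" "f \<in> borel_measurable lborel" "f' \<in> borel_measurable lborel"
      using that test_functions_borel[OF that(1)] by simp_all
    show "(\<lambda>x. \<psi> x *\<^sub>R f x) \<in> borel_measurable lborel" "(\<lambda>x. \<psi> x *\<^sub>R f' x) \<in> borel_measurable lborel"
      by (rule borel_measurable_scaleR[OF m(1,2)] borel_measurable_scaleR[OF m(1,3)])+
    show "AE x in lborel. \<psi> x *\<^sub>R f x = \<psi> x *\<^sub>R f' x" using that(4) by eventually_elim simp
  qed
  have "weak_deriv UNIV 1 a b"
    unfolding weak_deriv_def L2_lborel_on_UNIV
  proof (intro conjI allI impI)
    show "loc_integrable UNIV a" "loc_integrable UNIV b"
      unfolding loc_integrable_def using bounded_set_integrable[OF a(1,2)] bounded_set_integrable[OF b(1,2)] by blast+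
    fix \<phi> :: "real \<Rightarrow> real" assume \<phi>: "\<phi> \<in> test_functions UNIV"
    have "(\<integral>x. dir_deriv 1 \<phi> x *\<^sub>R \<alpha> x \<partial>lborel) = - (\<integral>x. \<phi> x *\<^sub>R g x \<partial>lborel)"
      using w \<phi> unfolding weak_deriv_def L2_lborel_on_UNIV by blast
    then show "(\<integral>x. dir_deriv 1 \<phi> x *\<^sub>R a x \<partial>lborel) = - (\<integral>x. \<phi> x *\<^sub>R b x \<partial>lborel)"
      unfolding cong[OF test_functions_dir_deriv[OF \<phi>] m(1) a(1,3)] cong[OF \<phi> m(2) b(1,3)] .
  qed
  moreover have "\<bar>a x\<bar> \<le> max A B" "\<bar>b x\<bar> \<le> max A B" for x using a(2)[of x] b(2)[of x] by auto
  ultimately show ?thesis by (rule that[OF a(1) b(1) _ _ a(3), rotated 2])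
qed

section \<open>Second-order Sobolev functions and boundary data\<close>

lemma l2_inner_real_mult_left:
  "l2_inner M (\<lambda>z. complex_of_real (r z) * f z) g = l2_inner M f (\<lambda>z. complex_of_real (r z) * g z)"
  unfolding l2_inner_def by (simp add: mult_ac)

lemma l2_inner_minus_right: "l2_inner M f (\<lambda>z. - g z) = - l2_inner M f g"
  by (simp add: l2_inner_def)

lemma weak_grad_cong:
  assumes f: "weak_grad \<epsilon> f fx fy" and g: "g \<in> L2 (lborel_on (strip \<epsilon>))" and eq: "AE z in lborel_on (strip \<epsilon>). f z = g z"
  shows "weak_grad \<epsilon> g fx fy"
  unfolding weak_grad_def
  using weak_deriv_cong[OF weak_gradD(4)[OF f] open_strip weak_gradD(1,2)[OF f] g weak_gradD(2)[OF f] eq]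
    weak_deriv_cong[OF weak_gradD(5)[OF f] open_strip weak_gradD(1,3)[OF f] g weak_gradD(3)[OF f] eq] g weak_gradD(2,3)[OF f]
  by simp

text \<open>\<open>H2\<close> only provides some derivative in \<open>H1\<close>; the chosen one
  agrees with it almost everywhere, and \<open>H1\<close> is insensitive to null sets.\<close>

lemma H2_wderiv_H1:
  assumes \<psi>: "\<psi> \<in> H2 (strip \<epsilon>)" and i: "i \<in> Basis" shows "wderiv (strip \<epsilon>) i \<psi> \<in> H1 (strip \<epsilon>)"
proof -
  obtain g where g: "g \<in> H1 (strip \<epsilon>)" "weak_deriv (strip \<epsilon>) i \<psi> g" using \<psi> i unfolding H2_iff by blast
  have gL: "g \<in> L2 (lborel_on (strip \<epsilon>))" by (rule H1_D(1)[OF g(1) open_strip])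
  have "AE z in lborel_on (strip \<epsilon>). g z = wderiv (strip \<epsilon>) i \<psi> z"
    using wderiv_AE_eq[OF g(2) open_strip] by eventually_elim simp
  then show ?thesis
    by (rule weak_grad_H1[OF weak_grad_cong[OF H1_weak_grad[OF g(1)] wderiv_L2[OF g(2) open_strip gL]]])
qed

lemma H2_subset_H1: "\<psi> \<in> H2 (strip \<epsilon>) \<Longrightarrow> \<psi> \<in> H1 (strip \<epsilon>)"
  unfolding H2_iff H1_iff[of \<psi>] using H1_D(1)[OF _ open_strip] by blast

text \<open>Separated variables: \<open>s\<close> times a bump in \<open>y\<close> that is 1 at
  \<open>y0\<close> and vanishes from distance \<open>\<epsilon>\<close> on. Stating both
  \<open>y0 + \<epsilon>\<close> and \<open>y0 - \<epsilon>\<close> lets either boundary line be the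
  one with the prescribed values.\<close>

lemma boundary_test_function:
  fixes s :: "real \<Rightarrow> complex"
  assumes s: "s \<in> test_functions UNIV" and \<epsilon>: "\<epsilon> > 0"
  obtains \<phi> :: "real \<times> real \<Rightarrow> complex" where "\<phi> \<in> test_functions UNIV" "\<And>x. \<phi> (x, y0) = s x"
    "\<And>x. \<phi> (x, y0 + \<epsilon>) = 0" "\<And>x. \<phi> (x, y0 - \<epsilon>) = 0"
proof -
  \<comment> \<open>The factors depend on \<open>3 / \<epsilon> * (y - y0) + 2\<close> and on its
    mirror image: the product is 1 up to distance \<open>\<epsilon> / 3\<close> from
    \<open>y0\<close> and 0 from \<open>2 * \<epsilon> / 3\<close> on.\<close>
  define \<kappa> where "\<kappa> y = step (3 / \<epsilon> * y + (2 - 3 / \<epsilon> * y0)) * step (- (3 / \<epsilon>) * y + (2 + 3 / \<epsilon> * y0))" for y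
  have \<kappa>: "smooth \<kappa>" unfolding \<kappa>_def[abs_def]
    by (rule smooth_mult[OF smooth_step_affine[OF bounded_linear_mult_right] smooth_step_affine[OF bounded_linear_mult_right]])
  have \<kappa>0: "\<kappa> y0 = 1" unfolding \<kappa>_def by (simp add: step_1)
  have out: "\<kappa> y = 0" if "\<epsilon> \<le> \<bar>y - y0\<bar>" for y
  proof (cases "y \<le> y0")
    case True
    then have "y \<le> y0 - \<epsilon>" using that by simp
    then have "3 / \<epsilon> * y \<le> 3 / \<epsilon> * (y0 - \<epsilon>)" using \<epsilon> by (intro mult_left_mono) simp_all
    also have "\<dots> = 3 / \<epsilon> * y0 - 3" using \<epsilon> by (simp add: right_diff_distrib)
    finally have "3 / \<epsilon> * y + (2 - 3 / \<epsilon> * y0) \<le> 0" by simp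
    then show ?thesis unfolding \<kappa>_def by (simp add: step_0)
  next
    case False
    then have "y0 + \<epsilon> \<le> y" using that by simp
    then have "3 / \<epsilon> * (y0 + \<epsilon>) \<le> 3 / \<epsilon> * y" using \<epsilon> by (intro mult_left_mono) simp_all
    moreover have "3 / \<epsilon> * (y0 + \<epsilon>) = 3 / \<epsilon> * y0 + 3" using \<epsilon> by (simp add: distrib_left)
    ultimately have "- (3 / \<epsilon>) * y + (2 + 3 / \<epsilon> * y0) \<le> 0" by simp
    then show ?thesis unfolding \<kappa>_def by (simp add: step_0)
  qed
  obtain K where K: "compact K" "\<And>x. x \<notin> K \<Longrightarrow> s x = 0" by (rule test_functionsE[OF s]) blast
  have "(\<lambda>z. \<kappa> (snd z) *\<^sub>R s (fst z)) \<in> test_functions UNIV"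
  proof (rule test_functionsI)
    have "smooth (\<lambda>z::real \<times> real. \<kappa> (snd z + 0))" by (rule smooth_affine[OF bounded_linear_snd \<kappa>])
    moreover have "smooth (\<lambda>z::real \<times> real. s (fst z + 0))" by (rule smooth_affine[OF bounded_linear_fst test_functions_smooth[OF s]])
    ultimately show "smooth (\<lambda>z. \<kappa> (snd z) *\<^sub>R s (fst z))" unfolding add_0_right by (rule smooth_scaleR)
    show "compact (K \<times> {y0 - \<epsilon>..y0 + \<epsilon>})" by (rule compact_Times[OF K(1) compact_Icc])
    fix z assume z: "z \<notin> K \<times> {y0 - \<epsilon>..y0 + \<epsilon>}"
    show "\<kappa> (snd z) *\<^sub>R s (fst z) = 0"
    proof (cases "fst z \<in> K")
      case True
      then have "\<epsilon> \<le> \<bar>snd z - y0\<bar>" using z by (auto simp: mem_Times_iff)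
      then show ?thesis by (simp add: out)
    qed (simp add: K(2))
  qed simp
  then show ?thesis by (rule that) (use \<epsilon> in \<open>simp_all add: \<kappa>0 out\<close>)
qed

text \<open>\<^term>\<open>a\<close> and \<^term>\<open>b\<close> are everywhere bounded Borel representatives of \<^term>\<open>\<alpha>\<close> and of its weak
  derivative.\<close>

locale robin_strip =
  fixes \<epsilon> :: real and \<alpha> a b :: "real \<Rightarrow> real" and C :: real
  assumes \<epsilon>: "\<epsilon> > 0"
    and a: "a \<in> borel_measurable borel" "\<And>x. \<bar>a x\<bar> \<le> C"
    and b: "b \<in> borel_measurable borel" "\<And>x. \<bar>b x\<bar> \<le> C"
    and \<alpha>_eq: "AE x in lborel. \<alpha> x = a x" and \<alpha>: "\<alpha> \<in> borel_measurable borel"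
    and a_deriv: "weak_deriv UNIV 1 a b"
begin

abbreviation "M \<equiv> lborel_on (strip \<epsilon>)"
abbreviation "ma f \<equiv> (\<lambda>z :: real \<times> real. complex_of_real (a (fst z)) * f z)"
abbreviation "mb f \<equiv> (\<lambda>z :: real \<times> real. complex_of_real (b (fst z)) * f z)"

section \<open>Multiplication by the coefficient\<close>

lemma ma_L2: "f \<in> L2 M \<Longrightarrow> ma f \<in> L2 M" and mb_L2: "f \<in> L2 M \<Longrightarrow> mb f \<in> L2 M"
  by (rule Linf_mult_L2(1)[OF a], assumption) (rule Linf_mult_L2(1)[OF b], assumption)

lemma ma_norm: "f \<in> L2 M \<Longrightarrow> l2_norm M (ma f) \<le> C * l2_norm M f"
  by (rule Linf_mult_L2(2)[OF a])

lemma one_dim_product_rule: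
  fixes s :: "real \<Rightarrow> complex"
  assumes s: "s \<in> test_functions UNIV"
  shows "(\<integral>x. a x *\<^sub>R dir_deriv 1 s x + b x *\<^sub>R s x \<partial>lborel) = 0"
proof -
  note sm = test_functions_smooth[OF s] and ds = test_functions_dir_deriv[OF s, of 1]
  have ma: "a \<in> borel_measurable lborel" "b \<in> borel_measurable lborel" using a(1) b(1) by simp_all
  have i1: "integrable lborel (\<lambda>x. a x *\<^sub>R dir_deriv 1 s x)" by (rule integrable_bounded_scaleR[OF test_functions_integrable[OF ds] ma(1) a(2)])
  have i2: "integrable lborel (\<lambda>x. b x *\<^sub>R s x)" by (rule integrable_bounded_scaleR[OF test_functions_integrable[OF s] ma(2) b(2)])
  have part: "L (\<integral>x. a x *\<^sub>R dir_deriv 1 s x + b x *\<^sub>R s x \<partial>lborel) = 0" if L: "bounded_linear L" for L :: "complex \<Rightarrow> real"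
  proof -
    interpret bounded_linear L by (rule L)
    have Ls: "(\<lambda>x. L (s x)) \<in> test_functions UNIV" by (rule test_functions_compose_linear[OF s L])
    have "(\<integral>x. dir_deriv 1 (\<lambda>x. L (s x)) x *\<^sub>R a x \<partial>lborel) = - (\<integral>x. L (s x) *\<^sub>R b x \<partial>lborel)"
      using a_deriv Ls unfolding weak_deriv_def L2_lborel_on_UNIV by blast
    then have eq: "(\<integral>x. L (a x *\<^sub>R dir_deriv 1 s x) \<partial>lborel) = - (\<integral>x. L (b x *\<^sub>R s x) \<partial>lborel)"
      unfolding dir_deriv_bounded_linear[OF L sm] scaleR by (simp add: mult.commute)
    have "L (\<integral>x. a x *\<^sub>R dir_deriv 1 s x + b x *\<^sub>R s x \<partial>lborel) = L (\<integral>x. a x *\<^sub>R dir_deriv 1 s x \<partial>lborel) + L (\<integral>x. b x *\<^sub>R s x \<partial>lborel)"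
      unfolding Bochner_Integration.integral_add[OF i1 i2] by (rule add)
    also have "\<dots> = (\<integral>x. L (a x *\<^sub>R dir_deriv 1 s x) \<partial>lborel) + (\<integral>x. L (b x *\<^sub>R s x) \<partial>lborel)"
      unfolding integral_bounded_linear[OF L i1] integral_bounded_linear[OF L i2] by (rule refl)
    finally show ?thesis using eq by simp
  qed
  show ?thesis using part[OF bounded_linear_Re] part[OF bounded_linear_Im] by (simp add: complex_eq_iff)
qed

text \<open>With the inner integral taken along \<open>x\<close>, the one-dimensional identity makes
  every horizontal slice vanish.\<close>

lemma strip_product_rule:
  fixes w :: "real \<times> real \<Rightarrow> complex"
  assumes w: "w \<in> test_functions V"
  shows "(\<integral>z. a (fst z) *\<^sub>R dir_deriv (1, 0) w z + b (fst z) *\<^sub>R w z \<partial>M) = 0"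
proof -
  have m: "(\<lambda>z::real \<times> real. r (fst z)) \<in> borel_measurable lborel" if "r \<in> borel_measurable borel" for r :: "real \<Rightarrow> real"
    using measurable_compose[OF borel_measurable_continuous_onI[OF continuous_on_fst[OF continuous_on_id]] that] by simp
  have i: "integrable lborel (\<lambda>z. a (fst z) *\<^sub>R dir_deriv (1, 0) w z + b (fst z) *\<^sub>R w z)"
    by (rule Bochner_Integration.integrable_add;
        rule integrable_bounded_scaleR[OF test_functions_integrable[OF test_functions_dir_deriv[OF w]] m[OF a(1)] a(2)]
          integrable_bounded_scaleR[OF test_functions_integrable[OF w] m[OF b(1)] b(2)])
  have z: "(\<integral>x. indicator {0<..<\<epsilon>} y *\<^sub>R (a x *\<^sub>R dir_deriv (1, 0) w (x, y) + b x *\<^sub>R w (x, y)) \<partial>lborel) = 0" for y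
    unfolding integral_scaleR_right
    using one_dim_product_rule[OF slice_test_function[OF w, of y]] unfolding slice_dir_deriv(1)[OF test_functions_smooth[OF w]]
    by simp
  show ?thesis unfolding strip_integral(2)[OF i] fst_conv z by simp
qed

text \<open>Tangentially, the product rule is applied to the test function
  \<open>cnj (\<phi> z) * u z\<close>. In the normal direction the coefficient is constant, and
  Green's formula has no boundary term since \<open>\<phi>\<close> is supported in the open
  strip.\<close>

lemma weak_grad_ma_test:
  fixes u :: "real \<times> real \<Rightarrow> complex"
  assumes u: "u \<in> test_functions V"
  shows "weak_grad \<epsilon> (ma u) (\<lambda>z. mb u z + ma (dir_deriv (1, 0) u) z) (ma (dir_deriv (0, 1) u))"
proof -
  note L = test_functions_L2[OF _ open_strip[of \<epsilon>]]
  note uL = L[OF u] and dxL = L[OF test_functions_dir_deriv[OF u, of "(1, 0)"]] and dyL = L[OF test_functions_dir_deriv[OF u, of "(0, 1)"]]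
  have X: "weak_deriv (strip \<epsilon>) (1, 0) (ma u) (\<lambda>z. mb u z + ma (dir_deriv (1, 0) u) z)"
  proof (rule weak_derivI[OF open_strip ma_L2[OF uL] L2_add[OF mb_L2[OF uL] ma_L2[OF dxL]]])
    fix \<phi> :: "real \<times> real \<Rightarrow> complex" assume \<phi>: "\<phi> \<in> test_functions (strip \<epsilon>)"
    note \<phi>L = L[OF \<phi>] and d\<phi>L = L[OF test_functions_dir_deriv[OF \<phi>, of "(1, 0)"]]
    have "l2_inner M (dir_deriv (1, 0) \<phi>) (ma u) + l2_inner M \<phi> (\<lambda>z. mb u z + ma (dir_deriv (1, 0) u) z)
      = (\<integral>z. cnj (dir_deriv (1, 0) \<phi> z) * ma u z + cnj (\<phi> z) * (mb u z + ma (dir_deriv (1, 0) u) z) \<partial>M)"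
      unfolding l2_inner_def
      by (rule Bochner_Integration.integral_add[OF L2_integrable_inner[OF d\<phi>L ma_L2[OF uL]]
            L2_integrable_inner[OF \<phi>L L2_add[OF mb_L2[OF uL] ma_L2[OF dxL]]], symmetric])
    also have "\<dots> = (\<integral>z. a (fst z) *\<^sub>R dir_deriv (1, 0) (\<lambda>z. cnj (\<phi> z) * u z) z + b (fst z) *\<^sub>R (cnj (\<phi> z) * u z) \<partial>M)"
      unfolding test_product(2)[OF \<phi> u] by (simp add: scaleR_conv_of_real algebra_simps)
    also have "\<dots> = 0" by (rule strip_product_rule[OF test_product(1)[OF \<phi> u]])
    finally show "l2_inner M (dir_deriv (1, 0) \<phi>) (ma u) = - l2_inner M \<phi> (\<lambda>z. mb u z + ma (dir_deriv (1, 0) u) z)"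
      by (simp only: eq_neg_iff_add_eq_0)
  qed
  have Y: "weak_deriv (strip \<epsilon>) (0, 1) (ma u) (ma (dir_deriv (0, 1) u))"
  proof (rule weak_derivI[OF open_strip ma_L2[OF uL] ma_L2[OF dyL]])
    fix \<phi> :: "real \<times> real \<Rightarrow> complex" assume \<phi>: "\<phi> \<in> test_functions (strip \<epsilon>)"
    obtain K where K: "K \<subseteq> strip \<epsilon>" "\<And>z. z \<notin> K \<Longrightarrow> \<phi> z = 0" by (rule test_functionsE[OF \<phi>]) blast
    have "\<phi> (x, \<epsilon>) = 0" "\<phi> (x, 0) = 0" for x
      using K(1) by (auto intro!: K(2) dest!: subsetD simp: mem_strip)
    then have "l2_inner M (dir_deriv (0, 1) \<phi>) (ma u) + l2_inner M \<phi> (ma (dir_deriv (0, 1) u)) = 0"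
      unfolding test_Green[OF \<phi> u a \<epsilon>] by (simp add: l2_inner_def)
    then show "l2_inner M (dir_deriv (0, 1) \<phi>) (ma u) = - l2_inner M \<phi> (ma (dir_deriv (0, 1) u))"
      by (simp only: eq_neg_iff_add_eq_0)
  qed
  show ?thesis unfolding weak_grad_def
    using X Y ma_L2[OF uL] L2_add[OF mb_L2[OF uL] ma_L2[OF dxL]] ma_L2[OF dyL] by blast
qed

text \<open>Limit of the case of test functions, weak derivatives being closed. Here the boundedness
  of \<open>b\<close> is what puts \<open>\<alpha> f\<close> into \<open>H1\<close>.\<close>

lemma weak_grad_ma:
  assumes f: "weak_grad \<epsilon> f fx fy"
  shows "weak_grad \<epsilon> (ma f) (\<lambda>z. mb f z + ma fx z) (ma fy)"
proof -
  note fH = weak_grad_H1[OF f] and fL = weak_gradD(1-3)[OF f]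
  obtain u where u: "H1_approx \<epsilon> f u" by (rule H1_approx_exists[OF \<epsilon> fH])
  have i: "(1, 0) \<in> (Basis :: (real \<times> real) set)" "(0, 1) \<in> (Basis :: (real \<times> real) set)" by (simp_all add: Basis_real_prod)
  have "l2_norm M (\<lambda>z. dir_deriv (1, 0) (u n) z - wderiv (strip \<epsilon>) (1, 0) f z) = l2_norm M (\<lambda>z. dir_deriv (1, 0) (u n) z - fx z)"
    "l2_norm M (\<lambda>z. dir_deriv (0, 1) (u n) z - wderiv (strip \<epsilon>) (0, 1) f z) = l2_norm M (\<lambda>z. dir_deriv (0, 1) (u n) z - fy z)" for n
    using weak_grad_wderiv[OF f] H1_D(3)[OF fH open_strip i(1)] H1_D(3)[OF fH open_strip i(2)] fL H1_approxD(5)[OF u]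
    by (intro l2_norm_cong L2_measurable L2_diff; auto)+
  note e = this
  have l0: "(\<lambda>n. l2_norm M (\<lambda>z. u n z - f z)) \<longlonglongrightarrow> 0" by (rule H1_approxD(2)[OF u])
  have lx: "(\<lambda>n. l2_norm M (\<lambda>z. dir_deriv (1, 0) (u n) z - fx z)) \<longlonglongrightarrow> 0" using H1_approxD(3)[OF u i(1)] unfolding e .
  have ly: "(\<lambda>n. l2_norm M (\<lambda>z. dir_deriv (0, 1) (u n) z - fy z)) \<longlonglongrightarrow> 0" using H1_approxD(3)[OF u i(2)] unfolding e .
  note uL = H1_approxD(4,5)[OF u]
  note W = weak_gradD[OF weak_grad_ma_test[OF H1_approxD(1)[OF u]]]
  have L: "ma f \<in> L2 M" "(\<lambda>z. mb f z + ma fx z) \<in> L2 M" "ma fy \<in> L2 M"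
    by (rule ma_L2[OF fL(1)] L2_add[OF mb_L2[OF fL(1)] ma_L2[OF fL(2)]] ma_L2[OF fL(3)])+
  have t0: "(\<lambda>n. l2_norm M (\<lambda>z. ma (u n) z - ma f z)) \<longlonglongrightarrow> 0" by (rule Linf_mult_tendsto(1)[OF a uL(1) fL(1) l0])
  have tb: "(\<lambda>n. l2_norm M (\<lambda>z. mb (u n) z - mb f z)) \<longlonglongrightarrow> 0" by (rule Linf_mult_tendsto(1)[OF b uL(1) fL(1) l0])
  have tx: "(\<lambda>n. l2_norm M (\<lambda>z. ma (dir_deriv (1, 0) (u n)) z - ma fx z)) \<longlonglongrightarrow> 0" by (rule Linf_mult_tendsto(1)[OF a uL(2) fL(2) lx])
  have ty: "(\<lambda>n. l2_norm M (\<lambda>z. ma (dir_deriv (0, 1) (u n)) z - ma fy z)) \<longlonglongrightarrow> 0" by (rule Linf_mult_tendsto(1)[OF a uL(2) fL(3) ly])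
  have tbx: "(\<lambda>n. l2_norm M (\<lambda>z. (mb (u n) z + ma (dir_deriv (1, 0) (u n)) z) - (mb f z + ma fx z))) \<longlonglongrightarrow> 0"
    using L2_tendsto_diff[OF mb_L2[OF uL(1)] mb_L2[OF fL(1)] ma_L2[OF uL(2)] ma_L2[OF fL(2)] tb tx, of 1] by simp
  have "weak_deriv (strip \<epsilon>) (1, 0) (ma f) (\<lambda>z. mb f z + ma fx z)"
    by (rule weak_deriv_closed[OF W(4) open_strip W(1) W(2) L(1) L(2) t0 tbx])
  moreover have "weak_deriv (strip \<epsilon>) (0, 1) (ma f) (ma fy)"
    by (rule weak_deriv_closed[OF W(5) open_strip W(1) W(3) L(1) L(3) t0 ty])
  ultimately show ?thesis unfolding weak_grad_def using L by blast
qed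

text \<open>Green's formula turns the boundary term into a volume term, so that no traces are left.\<close>

lemma robin_form_weak_grad:
  assumes \<phi>: "weak_grad \<epsilon> \<phi> \<phi>x \<phi>y" and \<psi>: "weak_grad \<epsilon> \<psi> \<psi>x \<psi>y"
  shows "robin_form \<epsilon> \<alpha> \<phi> \<psi> = l2_inner M \<phi>x \<psi>x + l2_inner M \<phi>y \<psi>y + l2_inner M \<phi>y (ma \<psi>) + l2_inner M \<phi> (ma \<psi>y)"
proof -
  let ?dx = "wderiv (strip \<epsilon>) (1, 0)" and ?dy = "wderiv (strip \<epsilon>) (0, 1)"
  have H: "\<phi> \<in> H1 (strip \<epsilon>)" "\<psi> \<in> H1 (strip \<epsilon>)" by (rule weak_grad_H1[OF \<phi>], rule weak_grad_H1[OF \<psi>])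
  note \<phi>D = weak_gradD[OF H1_weak_grad[OF H(1)]] and \<psi>D = weak_gradD[OF H1_weak_grad[OF H(2)]]
  have bulk: "(\<integral>z. (\<Sum>i\<in>Basis. cnj (wderiv (strip \<epsilon>) i \<phi> z) * wderiv (strip \<epsilon>) i \<psi> z) \<partial>M) = l2_inner M (?dx \<phi>) (?dx \<psi>) + l2_inner M (?dy \<phi>) (?dy \<psi>)"
    unfolding l2_inner_def Basis_real_prod
    using Bochner_Integration.integral_add[OF L2_integrable_inner[OF \<phi>D(2) \<psi>D(2)] L2_integrable_inner[OF \<phi>D(3) \<psi>D(3)]] by simp
  have y: "0 \<in> {0, \<epsilon>}" "\<epsilon> \<in> {0, \<epsilon>}" by auto
  note trL = tr_L2[OF \<epsilon> H(1)] tr_L2[OF \<epsilon> H(2)]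
  note aL = Linf_mult_L2(3)[OF a]
  have "(\<integral>x. complex_of_real (\<alpha> x) * (cnj (tr \<epsilon> \<phi> (x, \<epsilon>)) * tr \<epsilon> \<psi> (x, \<epsilon>) - cnj (tr \<epsilon> \<phi> (x, 0)) * tr \<epsilon> \<psi> (x, 0)) \<partial>lborel)
    = (\<integral>x. cnj (tr \<epsilon> \<phi> (x, \<epsilon>)) * (complex_of_real (a x) * tr \<epsilon> \<psi> (x, \<epsilon>)) - cnj (tr \<epsilon> \<phi> (x, 0)) * (complex_of_real (a x) * tr \<epsilon> \<psi> (x, 0)) \<partial>lborel)"
  proof (rule integral_cong_AE)
    have m: "(\<lambda>x. tr \<epsilon> \<phi> (x, 0)) \<in> borel_measurable borel" "(\<lambda>x. tr \<epsilon> \<phi> (x, \<epsilon>)) \<in> borel_measurable borel"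
      "(\<lambda>x. tr \<epsilon> \<psi> (x, 0)) \<in> borel_measurable borel" "(\<lambda>x. tr \<epsilon> \<psi> (x, \<epsilon>)) \<in> borel_measurable borel"
      using L2_measurable[OF trL(1)[OF y(1)]] L2_measurable[OF trL(1)[OF y(2)]] L2_measurable[OF trL(2)[OF y(1)]] L2_measurable[OF trL(2)[OF y(2)]]
      by simp_all
    note [measurable] = m \<alpha> a(1)
    show "(\<lambda>x. complex_of_real (\<alpha> x) * (cnj (tr \<epsilon> \<phi> (x, \<epsilon>)) * tr \<epsilon> \<psi> (x, \<epsilon>) - cnj (tr \<epsilon> \<phi> (x, 0)) * tr \<epsilon> \<psi> (x, 0))) \<in> borel_measurable lborel"
      "(\<lambda>x. cnj (tr \<epsilon> \<phi> (x, \<epsilon>)) * (complex_of_real (a x) * tr \<epsilon> \<psi> (x, \<epsilon>)) - cnj (tr \<epsilon> \<phi> (x, 0)) * (complex_of_real (a x) * tr \<epsilon> \<psi> (x, 0))) \<in> borel_measurable lborel"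
      by measurable
    show "AE x in lborel. complex_of_real (\<alpha> x) * (cnj (tr \<epsilon> \<phi> (x, \<epsilon>)) * tr \<epsilon> \<psi> (x, \<epsilon>) - cnj (tr \<epsilon> \<phi> (x, 0)) * tr \<epsilon> \<psi> (x, 0))
      = cnj (tr \<epsilon> \<phi> (x, \<epsilon>)) * (complex_of_real (a x) * tr \<epsilon> \<psi> (x, \<epsilon>)) - cnj (tr \<epsilon> \<phi> (x, 0)) * (complex_of_real (a x) * tr \<epsilon> \<psi> (x, 0))"
      using \<alpha>_eq by eventually_elim (simp add: algebra_simps)
  qed
  also have "\<dots> = l2_inner lborel (\<lambda>x. tr \<epsilon> \<phi> (x, \<epsilon>)) (\<lambda>x. complex_of_real (a x) * tr \<epsilon> \<psi> (x, \<epsilon>))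
      - l2_inner lborel (\<lambda>x. tr \<epsilon> \<phi> (x, 0)) (\<lambda>x. complex_of_real (a x) * tr \<epsilon> \<psi> (x, 0))"
    unfolding l2_inner_def
    by (rule Bochner_Integration.integral_diff; rule L2_integrable_inner; (rule aL)?; rule trL; simp)
  also have "\<dots> = l2_inner M (?dy \<phi>) (ma \<psi>) + l2_inner M \<phi> (ma (?dy \<psi>))"
    by (rule H1_Green[OF \<epsilon> H a, symmetric])
  finally have "robin_form \<epsilon> \<alpha> \<phi> \<psi> = l2_inner M (?dx \<phi>) (?dx \<psi>) + l2_inner M (?dy \<phi>) (?dy \<psi>) + (l2_inner M (?dy \<phi>) (ma \<psi>) + l2_inner M \<phi> (ma (?dy \<psi>)))"
    unfolding robin_form_def bulk by (rule arg_cong)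
  moreover have "l2_inner M (?dx \<phi>) (?dx \<psi>) = l2_inner M \<phi>x \<psi>x"
    by (rule l2_inner_cong; (rule L2_measurable)?;
        rule \<phi>D \<psi>D weak_gradD(2)[OF \<phi>] weak_gradD(2)[OF \<psi>] weak_grad_wderiv(1)[OF \<phi>] weak_grad_wderiv(1)[OF \<psi>])
  moreover have "l2_inner M (?dy \<phi>) (?dy \<psi>) = l2_inner M \<phi>y \<psi>y"
    by (rule l2_inner_cong; (rule L2_measurable)?;
        rule \<phi>D \<psi>D weak_gradD(3)[OF \<phi>] weak_gradD(3)[OF \<psi>] weak_grad_wderiv(2)[OF \<phi>] weak_grad_wderiv(2)[OF \<psi>])
  moreover have "l2_inner M (?dy \<phi>) (ma \<psi>) = l2_inner M \<phi>y (ma \<psi>)"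
    by (rule l2_inner_cong[OF L2_measurable[OF \<phi>D(3)] L2_measurable[OF weak_gradD(3)[OF \<phi>]] L2_measurable[OF ma_L2[OF \<psi>D(1)]]
          L2_measurable[OF ma_L2[OF \<psi>D(1)]] weak_grad_wderiv(2)[OF \<phi>]]) simp
  moreover have "l2_inner M \<phi> (ma (?dy \<psi>)) = l2_inner M \<phi> (ma \<psi>y)"
  proof (rule l2_inner_cong[OF L2_measurable[OF \<phi>D(1)] L2_measurable[OF \<phi>D(1)] L2_measurable[OF ma_L2[OF \<psi>D(3)]]
          L2_measurable[OF ma_L2[OF weak_gradD(3)[OF \<psi>]]]])
    show "AE z in M. ma (?dy \<psi>) z = ma \<psi>y z" using weak_grad_wderiv(2)[OF \<psi>] by eventually_elim simp
  qed simp
  ultimately show ?thesis by (simp only: add.assoc)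
qed

section \<open>The Robin form as a hermitian form\<close>

lemma robin_form_add_right:
  assumes "\<phi> \<in> H1 (strip \<epsilon>)" "\<psi> \<in> H1 (strip \<epsilon>)" "\<psi>' \<in> H1 (strip \<epsilon>)"
  shows "robin_form \<epsilon> \<alpha> \<phi> (\<lambda>z. \<psi> z + c * \<psi>' z) = robin_form \<epsilon> \<alpha> \<phi> \<psi> + c * robin_form \<epsilon> \<alpha> \<phi> \<psi>'"
proof -
  note W = H1_weak_grad[OF assms(1)] H1_weak_grad[OF assms(2)] H1_weak_grad[OF assms(3)]
  note D1 = weak_gradD(1-3)[OF W(1)] and D2 = weak_gradD(1-3)[OF W(2)] and D3 = weak_gradD(1-3)[OF W(3)]
  have m: "ma (\<lambda>z. f z + c * h z) = (\<lambda>z. ma f z + c * ma h z)" for f h by (rule ext) (simp add: algebra_simps)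
  show ?thesis
    unfolding robin_form_weak_grad[OF W(1) weak_grad_add[OF W(2,3)]] robin_form_weak_grad[OF W(1,2)] robin_form_weak_grad[OF W(1,3)] m
      l2_inner_add_right[OF D1(2) D2(2) D3(2)] l2_inner_add_right[OF D1(3) D2(3) D3(3)]
      l2_inner_add_right[OF D1(3) ma_L2[OF D2(1)] ma_L2[OF D3(1)]] l2_inner_add_right[OF D1(1) ma_L2[OF D2(3)] ma_L2[OF D3(3)]]
    by (simp only: distrib_left add_ac)
qed

lemma robin_form_hermitian:
  assumes "\<phi> \<in> H1 (strip \<epsilon>)" "\<psi> \<in> H1 (strip \<epsilon>)"
  shows "cnj (robin_form \<epsilon> \<alpha> \<phi> \<psi>) = robin_form \<epsilon> \<alpha> \<psi> \<phi>"
  unfolding robin_form_weak_grad[OF H1_weak_grad[OF assms(1)] H1_weak_grad[OF assms(2)]]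
    robin_form_weak_grad[OF H1_weak_grad[OF assms(2)] H1_weak_grad[OF assms(1)]]
    complex_cnj_add l2_inner_commute l2_inner_real_mult_left by (simp only: add_ac)

lemma robin_form_ii_left:
  assumes "\<phi> \<in> H1 (strip \<epsilon>)" "\<psi> \<in> H1 (strip \<epsilon>)"
  shows "(\<lambda>z. \<i> * \<phi> z) \<in> H1 (strip \<epsilon>)" "robin_form \<epsilon> \<alpha> (\<lambda>z. \<i> * \<phi> z) \<psi> = - \<i> * robin_form \<epsilon> \<alpha> \<phi> \<psi>"
proof -
  \<comment> \<open>This writes the scalar multiple in the shape \<open>f + c * g\<close>, for which
    linearity is available.\<close>
  have e: "(\<lambda>z. \<phi> z + (\<i> - 1) * \<phi> z) = (\<lambda>z. \<i> * \<phi> z)" by (rule ext) (simp add: algebra_simps)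
  show H: "(\<lambda>z. \<i> * \<phi> z) \<in> H1 (strip \<epsilon>)"
    using weak_grad_H1[OF weak_grad_add[OF H1_weak_grad[OF assms(1)] H1_weak_grad[OF assms(1)], of "\<i> - 1"]] unfolding e .
  have "robin_form \<epsilon> \<alpha> \<psi> (\<lambda>z. \<i> * \<phi> z) = \<i> * robin_form \<epsilon> \<alpha> \<psi> \<phi>"
    using robin_form_add_right[OF assms(2,1,1), of "\<i> - 1"] unfolding e by (simp add: algebra_simps)
  then have "cnj (robin_form \<epsilon> \<alpha> \<psi> (\<lambda>z. \<i> * \<phi> z)) = - \<i> * cnj (robin_form \<epsilon> \<alpha> \<psi> \<phi>)" by simp
  then show "robin_form \<epsilon> \<alpha> (\<lambda>z. \<i> * \<phi> z) \<psi> = - \<i> * robin_form \<epsilon> \<alpha> \<phi> \<psi>"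
    unfolding robin_form_hermitian[OF assms(2) H] robin_form_hermitian[OF assms(2,1)] .
qed

subsection \<open>Solvability of the shifted equation\<close>

text \<open>\<open>2 * C^2\<close> is the price in Young's inequality for giving away only half of
  the squared norm of \<open>fy\<close>; the 1 leaves a full squared norm of
  \<open>f\<close>.\<close>

abbreviation "shift \<equiv> 2 * C^2 + 1"

lemma robin_form_coercive:
  assumes "weak_grad \<epsilon> f fx fy"
  shows "(l2_norm M fx)^2 + (l2_norm M fy)^2 / 2 + (l2_norm M f)^2 \<le> Re (robin_form \<epsilon> \<alpha> f f + complex_of_real shift * l2_inner M f f)"
proof -
  note D = weak_gradD(1-3)[OF assms]
  let ?X = "l2_norm M fx" and ?Y = "l2_norm M fy" and ?N = "l2_norm M f"
  have c: "l2_inner M f (ma fy) = cnj (l2_inner M fy (ma f))" unfolding l2_inner_commute l2_inner_real_mult_left by (rule refl)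
  have "\<bar>Re (l2_inner M fy (ma f))\<bar> \<le> ?Y * (C * ?N)"
    by (intro order_trans[OF abs_Re_le_cmod] order_trans[OF l2_Cauchy_Schwarz[OF D(3) ma_L2[OF D(1)]]]
        mult_left_mono ma_norm D l2_norm_nonneg)
  moreover have "2 * (?Y * (C * ?N)) \<le> ?Y^2 / 2 + 2 * C^2 * ?N^2"
    using zero_le_power2[of "?Y - 2 * (C * ?N)"] by (simp add: power2_eq_square field_simps)
  ultimately have "- (?Y^2 / 2 + 2 * C^2 * ?N^2) \<le> 2 * Re (l2_inner M fy (ma f))" by linarith
  moreover have "Re (robin_form \<epsilon> \<alpha> f f + complex_of_real shift * l2_inner M f f)
    = ?X^2 + ?Y^2 + 2 * Re (l2_inner M fy (ma f)) + shift * ?N^2"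
    unfolding robin_form_weak_grad[OF assms assms] c l2_inner_self by simp
  ultimately show ?thesis by (simp add: algebra_simps)
qed

text \<open>Coercivity makes the minimising sequence Cauchy together with both derivatives. The
  limit is taken in the volume version of the form, each term of which is an L2 pairing.\<close>

lemma shifted_equation_solvable:
  assumes f: "f \<in> L2 M"
  obtains \<psi> where "\<psi> \<in> H1 (strip \<epsilon>)"
    "\<And>\<phi>. \<phi> \<in> H1 (strip \<epsilon>) \<Longrightarrow> robin_form \<epsilon> \<alpha> \<phi> \<psi> + complex_of_real shift * l2_inner M \<phi> \<psi> = l2_inner M \<phi> f"
proof -
  let ?V = "H1 (strip \<epsilon>)"
  let ?dx = "wderiv (strip \<epsilon>) (1, 0)" and ?dy = "wderiv (strip \<epsilon>) (0, 1)"
  define Q where "Q u v = robin_form \<epsilon> \<alpha> u v + complex_of_real shift * l2_inner M u v" for u v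
  have VL: "u \<in> L2 M" if "u \<in> ?V" for u by (rule H1_D(1)[OF that open_strip])
  have Vadd: "(\<lambda>z. u z + c * v z) \<in> ?V" if "u \<in> ?V" "v \<in> ?V" for u v c
    by (rule weak_grad_H1[OF weak_grad_add[OF H1_weak_grad[OF that(1)] H1_weak_grad[OF that(2)]]])
  have Qadd: "Q w (\<lambda>z. u z + c * v z) = Q w u + c * Q w v" if "u \<in> ?V" "v \<in> ?V" "w \<in> ?V" for u v w c
    unfolding Q_def robin_form_add_right[OF that(3,1,2)] l2_inner_add_right[OF VL[OF that(3)] VL[OF that(1)] VL[OF that(2)]]
    by (simp add: algebra_simps)
  have Qherm: "cnj (Q u v) = Q v u" if "u \<in> ?V" "v \<in> ?V" for u v
    unfolding Q_def complex_cnj_add complex_cnj_mult robin_form_hermitian[OF that] l2_inner_commute by simp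
  have coercive: "(l2_norm M ux)^2 + (l2_norm M uy)^2 / 2 + (l2_norm M u)^2 \<le> Re (Q u u)" if "weak_grad \<epsilon> u ux uy" for u ux uy
    unfolding Q_def by (rule robin_form_coercive[OF that])
  have norm_le: "(l2_norm M u)^2 \<le> Re (Q u u)" if "u \<in> ?V" for u
    using coercive[OF H1_weak_grad[OF that]] zero_le_power2[of "l2_norm M (?dx u)"] zero_le_power2[of "l2_norm M (?dy u)"] by linarith
  obtain u where u: "\<And>n. u n \<in> ?V"
    and d: "\<And>m n. Re (Q (\<lambda>z. u m z - u n z) (\<lambda>z. u m z - u n z)) \<le> 2 / Suc m + 2 / Suc n"
    and lim: "\<And>v. v \<in> ?V \<Longrightarrow> (\<lambda>n. Re (Q v (u n))) \<longlonglongrightarrow> Re (l2_inner M v f)"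
  proof (rule riesz_minimizing_sequence[of ?V "\<lambda>u v. Re (Q u v)" "\<lambda>v. Re (l2_inner M v f)" "(l2_norm M f)^2"])
    show "(\<lambda>z. 0) \<in> ?V" by (rule test_functions_H1[OF test_functions_zero open_strip])
    show "(\<lambda>z. u z + complex_of_real t * v z) \<in> ?V" if "u \<in> ?V" "v \<in> ?V" for u v t by (rule Vadd[OF that])
    show "Re (Q w (\<lambda>z. u z + complex_of_real t * v z)) = Re (Q w u) + t * Re (Q w v)" if "u \<in> ?V" "v \<in> ?V" "w \<in> ?V" for u v w t
      unfolding Qadd[OF that] by simp
    show "Re (Q u v) = Re (Q v u)" if "u \<in> ?V" "v \<in> ?V" for u v
      unfolding Qherm[OF that, symmetric] by simp
    show "0 \<le> Re (Q u u)" if "u \<in> ?V" for u by (rule order_trans[OF zero_le_power2 norm_le[OF that]])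
    show "Re (l2_inner M (\<lambda>z. u z + complex_of_real t * v z) f) = Re (l2_inner M u f) + t * Re (l2_inner M v f)"
      if "u \<in> ?V" "v \<in> ?V" for u v t
      unfolding l2_inner_add_left[OF f VL[OF that(1)] VL[OF that(2)]] by simp
    show "(Re (l2_inner M u f))^2 \<le> (l2_norm M f)^2 * Re (Q u u)" if "u \<in> ?V" for u
    proof -
      have "\<bar>Re (l2_inner M u f)\<bar>^2 \<le> (l2_norm M u * l2_norm M f)^2"
        by (rule power_mono[OF order_trans[OF abs_Re_le_cmod l2_Cauchy_Schwarz[OF VL[OF that] f]]]) simp
      also have "\<dots> = (l2_norm M f)^2 * (l2_norm M u)^2" by (simp add: power_mult_distrib)
      also have "\<dots> \<le> (l2_norm M f)^2 * Re (Q u u)" by (rule mult_left_mono[OF norm_le[OF that]]) simp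
      finally show ?thesis by simp
    qed
  qed blast
  note W = H1_weak_grad[OF u]
  note uL = weak_gradD(1-3)[OF W]
  have co: "(l2_norm M (\<lambda>z. ?dx (u m) z - ?dx (u n) z))^2 + (l2_norm M (\<lambda>z. ?dy (u m) z - ?dy (u n) z))^2 / 2 + (l2_norm M (\<lambda>z. u m z - u n z))^2
    \<le> 2 / Suc m + 2 / Suc n" for m n
    by (rule order_trans[OF coercive[OF weak_grad_diff[OF W W]] d])
  have rates: "(l2_norm M (\<lambda>z. u m z - u n z))^2 \<le> 4 * (1 / real (Suc m) + 1 / real (Suc n))"
    "(l2_norm M (\<lambda>z. ?dx (u m) z - ?dx (u n) z))^2 \<le> 4 * (1 / real (Suc m) + 1 / real (Suc n))"
    "(l2_norm M (\<lambda>z. ?dy (u m) z - ?dy (u n) z))^2 \<le> 4 * (1 / real (Suc m) + 1 / real (Suc n))" for m n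
  proof -
    \<comment> \<open>The common constant is 4 because \<open>Y\<close> carries the factor 1/2 in
      the coercivity estimate.\<close>
    have gen: "N \<le> 4 * (p + q) \<and> X \<le> 4 * (p + q) \<and> Y \<le> 4 * (p + q)"
      if "X + Y / 2 + N \<le> 2 * p + 2 * q" "0 \<le> X" "0 \<le> Y" "0 \<le> N" for X Y N p q :: real
    proof -
      have "N \<le> 4 * (p + q)" using that by argo
      moreover have "X \<le> 4 * (p + q)" using that by argo
      moreover have "Y \<le> 4 * (p + q)" using that by argo
      ultimately show ?thesis by blast
    qed
    have "2 / real (Suc k) = 2 * (1 / real (Suc k))" for k by simp
    note gen[OF co[of m n, unfolded this] zero_le_power2 zero_le_power2 zero_le_power2]
    then show "(l2_norm M (\<lambda>z. u m z - u n z))^2 \<le> 4 * (1 / real (Suc m) + 1 / real (Suc n))"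
      "(l2_norm M (\<lambda>z. ?dx (u m) z - ?dx (u n) z))^2 \<le> 4 * (1 / real (Suc m) + 1 / real (Suc n))"
      "(l2_norm M (\<lambda>z. ?dy (u m) z - ?dy (u n) z))^2 \<le> 4 * (1 / real (Suc m) + 1 / real (Suc n))" by blast+
  qed
  obtain \<psi> where \<psi>: "\<psi> \<in> L2 M" "(\<lambda>n. l2_norm M (\<lambda>z. u n z - \<psi> z)) \<longlonglongrightarrow> 0" by (rule L2_complete_rate[OF uL(1) rates(1)])
  obtain \<psi>x where \<psi>x: "\<psi>x \<in> L2 M" "(\<lambda>n. l2_norm M (\<lambda>z. ?dx (u n) z - \<psi>x z)) \<longlonglongrightarrow> 0" by (rule L2_complete_rate[OF uL(2) rates(2)])
  obtain \<psi>y where \<psi>y: "\<psi>y \<in> L2 M" "(\<lambda>n. l2_norm M (\<lambda>z. ?dy (u n) z - \<psi>y z)) \<longlonglongrightarrow> 0" by (rule L2_complete_rate[OF uL(3) rates(3)])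
  have WG: "weak_grad \<epsilon> \<psi> \<psi>x \<psi>y" unfolding weak_grad_def
    using \<psi>(1) \<psi>x(1) \<psi>y(1) weak_deriv_closed[OF weak_gradD(4)[OF W] open_strip uL(1,2) \<psi>(1) \<psi>x(1) \<psi>(2) \<psi>x(2)]
      weak_deriv_closed[OF weak_gradD(5)[OF W] open_strip uL(1,3) \<psi>(1) \<psi>y(1) \<psi>(2) \<psi>y(2)] by blast
  have \<psi>H: "\<psi> \<in> ?V" by (rule weak_grad_H1[OF WG])
  have Re_eq: "Re (Q \<phi> \<psi>) = Re (l2_inner M \<phi> f)" if \<phi>: "\<phi> \<in> ?V" for \<phi>
  proof -
    note W\<phi> = H1_weak_grad[OF \<phi>]
    note \<phi>D = weak_gradD(1-3)[OF W\<phi>]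
    have zero: "(\<lambda>n. l2_norm M (\<lambda>x. v x - v x)) \<longlonglongrightarrow> 0" for v :: "real \<times> real \<Rightarrow> complex" by (simp add: l2_norm_def)
    have t: "(\<lambda>n. l2_inner M v (w n)) \<longlonglongrightarrow> l2_inner M v W"
      if "v \<in> L2 M" "\<And>n. w n \<in> L2 M" "W \<in> L2 M" "(\<lambda>n. l2_norm M (\<lambda>z. w n z - W z)) \<longlonglongrightarrow> 0" for v w W
      by (rule l2_inner_tendsto[OF that(1,1,2,3) zero that(4)])
    have ta: "(\<lambda>n. l2_inner M v (ma (w n))) \<longlonglongrightarrow> l2_inner M v (ma W)"
      if "v \<in> L2 M" "\<And>n. w n \<in> L2 M" "W \<in> L2 M" "(\<lambda>n. l2_norm M (\<lambda>z. w n z - W z)) \<longlonglongrightarrow> 0" for v w W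
      by (rule t[OF that(1) ma_L2[OF that(2)] ma_L2[OF that(3)] Linf_mult_tendsto(1)[OF a that(2,3,4)]])
    have "(\<lambda>n. Q \<phi> (u n)) \<longlonglongrightarrow> Q \<phi> \<psi>"
      unfolding Q_def robin_form_weak_grad[OF W\<phi> W] robin_form_weak_grad[OF W\<phi> WG]
      by (intro tendsto_add tendsto_mult tendsto_const t[OF \<phi>D(2) uL(2) \<psi>x] t[OF \<phi>D(3) uL(3) \<psi>y] ta[OF \<phi>D(3) uL(1) \<psi>]
          ta[OF \<phi>D(1) uL(3) \<psi>y] t[OF \<phi>D(1) uL(1) \<psi>])
    from LIMSEQ_unique[OF tendsto_Re[OF this] lim[OF \<phi>]] show ?thesis .
  qed
  \<comment> \<open>The minimisation is real; inserting \<open>\<i> * \<phi>\<close> supplies the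
    imaginary part.\<close>
  have "Q \<phi> \<psi> = l2_inner M \<phi> f" if \<phi>: "\<phi> \<in> ?V" for \<phi>
  proof -
    have i: "l2_inner M (\<lambda>z. \<i> * \<phi> z) h = - \<i> * l2_inner M \<phi> h" for h unfolding l2_inner_def by (simp add: mult.assoc)
    have "Q (\<lambda>z. \<i> * \<phi> z) \<psi> = - \<i> * Q \<phi> \<psi>"
      unfolding Q_def robin_form_ii_left(2)[OF \<phi> \<psi>H] i by (simp add: algebra_simps)
    then have "Im (Q \<phi> \<psi>) = Im (l2_inner M \<phi> f)"
      using Re_eq[OF robin_form_ii_left(1)[OF \<phi> \<psi>H]] unfolding i by simp
    with Re_eq[OF \<phi>] show ?thesis by (simp add: complex_eq_iff)
  qed
  then show ?thesis using that[OF \<psi>H] unfolding Q_def by blast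
qed

subsection \<open>Green's formula and the boundary condition\<close>

text \<open>The two boundary conditions differ only by the overall sign coming from the outer
  normal, so one expression covers both lines. It is written with the bounded representative
  \<open>a\<close>.\<close>

abbreviation "robin_trace \<psi> y \<equiv> (\<lambda>x. tr \<epsilon> (wderiv (strip \<epsilon>) (0, 1) \<psi>) (x, y) + complex_of_real (a x) * tr \<epsilon> \<psi> (x, y))"

lemma robin_trace_L2:
  assumes "\<psi> \<in> H2 (strip \<epsilon>)" "y \<in> {0, \<epsilon>}" shows "robin_trace \<psi> y \<in> L2 lborel"
proof -
  have "(0, 1) \<in> (Basis :: (real \<times> real) set)" by (simp add: Basis_real_prod)
  then show ?thesis
    by (intro L2_add tr_L2[OF \<epsilon> H2_wderiv_H1[OF assms(1)] assms(2)] Linf_mult_L2(3)[OF a] tr_L2[OF \<epsilon> H2_subset_H1[OF assms(1)] assms(2)])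
qed

lemma neg_laplacian_strip:
  "neg_laplacian (strip \<epsilon>) \<psi> = (\<lambda>z. - (wderiv (strip \<epsilon>) (1, 0) (wderiv (strip \<epsilon>) (1, 0) \<psi>) z + wderiv (strip \<epsilon>) (0, 1) (wderiv (strip \<epsilon>) (0, 1) \<psi>) z))"
  by (rule ext) (simp add: neg_laplacian_def Basis_real_prod)

lemma neg_laplacian_L2:
  assumes "\<psi> \<in> H2 (strip \<epsilon>)" shows "neg_laplacian (strip \<epsilon>) \<psi> \<in> L2 M"
proof -
  have i: "(1, 0) \<in> (Basis :: (real \<times> real) set)" "(0, 1) \<in> (Basis :: (real \<times> real) set)" by (simp_all add: Basis_real_prod)
  show ?thesis unfolding neg_laplacian_strip
    by (rule L2_uminus[OF L2_add[OF H1_D(3)[OF H2_wderiv_H1[OF assms i(1)] open_strip i(1)] H1_D(3)[OF H2_wderiv_H1[OF assms i(2)] open_strip i(2)]]])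
qed

text \<open>Three integrations by parts: a tangential one without boundary term, a normal one with
  weight 1 for the normal derivative of \<open>\<psi>\<close>, and one with weight \<open>a\<close>
  for \<open>\<psi>\<close>. The boundary terms of the last two add up to
  \<open>robin_trace\<close>.\<close>

lemma robin_form_Green:
  assumes \<phi>: "\<phi> \<in> H1 (strip \<epsilon>)" and \<psi>: "\<psi> \<in> H2 (strip \<epsilon>)"
  shows "robin_form \<epsilon> \<alpha> \<phi> \<psi> = l2_inner M \<phi> (neg_laplacian (strip \<epsilon>) \<psi>)
    + (l2_inner lborel (\<lambda>x. tr \<epsilon> \<phi> (x, \<epsilon>)) (robin_trace \<psi> \<epsilon>) - l2_inner lborel (\<lambda>x. tr \<epsilon> \<phi> (x, 0)) (robin_trace \<psi> 0))"
proof -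
  let ?dx = "wderiv (strip \<epsilon>) (1, 0)" and ?dy = "wderiv (strip \<epsilon>) (0, 1)"
  have i: "(1, 0) \<in> (Basis :: (real \<times> real) set)" "(0, 1) \<in> (Basis :: (real \<times> real) set)" by (simp_all add: Basis_real_prod)
  have \<psi>H: "\<psi> \<in> H1 (strip \<epsilon>)" by (rule H2_subset_H1[OF \<psi>])
  have xH: "?dx \<psi> \<in> H1 (strip \<epsilon>)" and yH: "?dy \<psi> \<in> H1 (strip \<epsilon>)" using H2_wderiv_H1[OF \<psi>] i by auto
  have xxL: "?dx (?dx \<psi>) \<in> L2 M" and yyL: "?dy (?dy \<psi>) \<in> L2 M" using H1_D(3)[OF xH open_strip i(1)] H1_D(3)[OF yH open_strip i(2)] .
  have \<phi>L: "\<phi> \<in> L2 M" by (rule H1_D(1)[OF \<phi> open_strip])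
  let ?t = "\<lambda>f y. (\<lambda>x. tr \<epsilon> f (x, y))" and ?at = "\<lambda>f y. (\<lambda>x. complex_of_real (a x) * tr \<epsilon> f (x, y))"
  have T: "l2_inner M (?dx \<phi>) (?dx \<psi>) + l2_inner M \<phi> (?dx (?dx \<psi>)) = 0" by (rule H1_tangential[OF \<epsilon> \<phi> xH])
  have "l2_inner M (?dy \<phi>) (\<lambda>z. complex_of_real 1 * ?dy \<psi> z) + l2_inner M \<phi> (\<lambda>z. complex_of_real 1 * ?dy (?dy \<psi>) z)
    = l2_inner lborel (?t \<phi> \<epsilon>) (\<lambda>x. complex_of_real 1 * tr \<epsilon> (?dy \<psi>) (x, \<epsilon>)) - l2_inner lborel (?t \<phi> 0) (\<lambda>x. complex_of_real 1 * tr \<epsilon> (?dy \<psi>) (x, 0))"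
    using H1_Green[OF \<epsilon> \<phi> yH, of "\<lambda>x. 1" 1] by simp
  then have G: "l2_inner M (?dy \<phi>) (?dy \<psi>) + l2_inner M \<phi> (?dy (?dy \<psi>)) = l2_inner lborel (?t \<phi> \<epsilon>) (?t (?dy \<psi>) \<epsilon>) - l2_inner lborel (?t \<phi> 0) (?t (?dy \<psi>) 0)"
    by simp
  have A: "l2_inner M (?dy \<phi>) (ma \<psi>) + l2_inner M \<phi> (ma (?dy \<psi>)) = l2_inner lborel (?t \<phi> \<epsilon>) (?at \<psi> \<epsilon>) - l2_inner lborel (?t \<phi> 0) (?at \<psi> 0)"
    by (rule H1_Green[OF \<epsilon> \<phi> \<psi>H a])
  have N: "l2_inner M \<phi> (neg_laplacian (strip \<epsilon>) \<psi>) = - (l2_inner M \<phi> (?dx (?dx \<psi>)) + l2_inner M \<phi> (?dy (?dy \<psi>)))"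
    unfolding neg_laplacian_strip l2_inner_minus_right using l2_inner_add_right[OF \<phi>L xxL yyL, of 1] by simp
  have R: "l2_inner lborel (?t \<phi> y) (robin_trace \<psi> y) = l2_inner lborel (?t \<phi> y) (?t (?dy \<psi>) y) + l2_inner lborel (?t \<phi> y) (?at \<psi> y)"
    if y: "y \<in> {0, \<epsilon>}" for y
    using l2_inner_add_right[OF tr_L2[OF \<epsilon> \<phi> y] tr_L2[OF \<epsilon> yH y] Linf_mult_L2(3)[OF a tr_L2[OF \<epsilon> \<psi>H y]], of 1] by simp
  have y: "0 \<in> {0, \<epsilon>}" "\<epsilon> \<in> {0, \<epsilon>}" by auto
  have alg: "p + q + r + s = - (p' + q') + ((t1 + s1) - (t0 + s0))"
    if "p + p' = 0" "q + q' = t1 - t0" "r + s = s1 - s0" for p q r s p' q' t1 t0 s1 s0 :: complex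
  proof -
    have "p = - p'" "q = t1 - t0 - q'" using that(1,2) by (auto simp: eq_neg_iff_add_eq_0 algebra_simps)
    then have "p + q + (r + s) = - (p' + q') + ((t1 + s1) - (t0 + s0))" unfolding that(3) by simp
    then show ?thesis by (simp only: add.assoc)
  qed
  show ?thesis
    unfolding robin_form_weak_grad[OF H1_weak_grad[OF \<phi>] H1_weak_grad[OF \<psi>H]] N R[OF y(1)] R[OF y(2)]
    by (rule alg[OF T G A])
qed

lemma robin_dom_iff:
  "\<psi> \<in> robin_dom \<epsilon> \<alpha> \<longleftrightarrow> \<psi> \<in> H2 (strip \<epsilon>) \<and> (\<forall>y\<in>{0, \<epsilon>}. AE x in lborel. robin_trace \<psi> y x = 0)"
proof -
  have "(AE x in lborel. - tr \<epsilon> (wderiv (strip \<epsilon>) (0, 1) \<psi>) (x, 0) - complex_of_real (\<alpha> x) * tr \<epsilon> \<psi> (x, 0) = 0 \<and>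
     tr \<epsilon> (wderiv (strip \<epsilon>) (0, 1) \<psi>) (x, \<epsilon>) + complex_of_real (\<alpha> x) * tr \<epsilon> \<psi> (x, \<epsilon>) = 0)
    \<longleftrightarrow> (AE x in lborel. robin_trace \<psi> 0 x = 0 \<and> robin_trace \<psi> \<epsilon> x = 0)"
  proof -
    have neg: "(- p - q = 0) = (p + q = 0)" for p q :: complex
      by (metis minus_add_distrib neg_equal_0_iff_equal diff_conv_add_uminus)
    show ?thesis
      unfolding neg
    proof
      assume "AE x in lborel. tr \<epsilon> (wderiv (strip \<epsilon>) (0, 1) \<psi>) (x, 0) + complex_of_real (\<alpha> x) * tr \<epsilon> \<psi> (x, 0) = 0 \<and>
        tr \<epsilon> (wderiv (strip \<epsilon>) (0, 1) \<psi>) (x, \<epsilon>) + complex_of_real (\<alpha> x) * tr \<epsilon> \<psi> (x, \<epsilon>) = 0"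
      with \<alpha>_eq show "AE x in lborel. robin_trace \<psi> 0 x = 0 \<and> robin_trace \<psi> \<epsilon> x = 0"
        by eventually_elim simp
    next
      assume "AE x in lborel. robin_trace \<psi> 0 x = 0 \<and> robin_trace \<psi> \<epsilon> x = 0"
      with \<alpha>_eq show "AE x in lborel. tr \<epsilon> (wderiv (strip \<epsilon>) (0, 1) \<psi>) (x, 0) + complex_of_real (\<alpha> x) * tr \<epsilon> \<psi> (x, 0) = 0 \<and>
        tr \<epsilon> (wderiv (strip \<epsilon>) (0, 1) \<psi>) (x, \<epsilon>) + complex_of_real (\<alpha> x) * tr \<epsilon> \<psi> (x, \<epsilon>) = 0"
        by eventually_elim simp
    qed
  qed
  then show ?thesis unfolding robin_dom_def by simp
qed

lemma robin_form_domain: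
  assumes \<phi>: "\<phi> \<in> H1 (strip \<epsilon>)" and \<psi>: "\<psi> \<in> robin_dom \<epsilon> \<alpha>"
  shows "robin_form \<epsilon> \<alpha> \<phi> \<psi> = l2_inner M \<phi> (neg_laplacian (strip \<epsilon>) \<psi>)"
proof -
  have H: "\<psi> \<in> H2 (strip \<epsilon>)" using \<psi> unfolding robin_dom_iff by blast
  have z: "l2_inner lborel (\<lambda>x. tr \<epsilon> \<phi> (x, y)) (robin_trace \<psi> y) = 0" if y: "y \<in> {0, \<epsilon>}" for y
  proof -
    have "AE x in lborel. cnj (tr \<epsilon> \<phi> (x, y)) * robin_trace \<psi> y x = 0"
    proof -
      have "AE x in lborel. robin_trace \<psi> y x = 0" using \<psi> y unfolding robin_dom_iff by blast
      then show ?thesis by eventually_elim (simp only: mult_zero_right)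
    qed
    then show ?thesis unfolding l2_inner_def by (rule integral_eq_zero_AE)
  qed
  show ?thesis unfolding robin_form_Green[OF \<phi> H] using z by simp
qed

text \<open>The hypothesis couples the two lines. Functions with arbitrary values \<open>s\<close>
  on one line and 0 on the other separate them, and the fundamental lemma on the line
  concludes.\<close>

lemma robin_trace_zero:
  assumes \<psi>: "\<psi> \<in> H2 (strip \<epsilon>)" and y: "y \<in> {0, \<epsilon>}"
    and eq: "\<And>\<phi>. \<phi> \<in> H1 (strip \<epsilon>) \<Longrightarrow> l2_inner lborel (\<lambda>x. tr \<epsilon> \<phi> (x, \<epsilon>)) (robin_trace \<psi> \<epsilon>) = l2_inner lborel (\<lambda>x. tr \<epsilon> \<phi> (x, 0)) (robin_trace \<psi> 0)"
  shows "AE x in lborel. robin_trace \<psi> y x = 0"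
proof -
  note RL = robin_trace_L2[OF \<psi>]
  have "AE x in lborel_on UNIV. robin_trace \<psi> y x = 0"
  proof (rule L2_eq_if_test_inner_eq[OF open_UNIV])
    show "robin_trace \<psi> y \<in> L2 (lborel_on UNIV)" unfolding L2_lborel_on_UNIV by (rule RL[OF y])
    show "(\<lambda>x. 0) \<in> L2 (lborel_on UNIV)" by (rule L2_zero)
    fix s :: "real \<Rightarrow> complex" assume s: "s \<in> test_functions UNIV"
    obtain \<phi> where \<phi>: "\<phi> \<in> test_functions UNIV" "\<And>x. \<phi> (x, y) = s x" "\<And>x. \<phi> (x, y + \<epsilon>) = 0" "\<And>x. \<phi> (x, y - \<epsilon>) = 0"
      by (rule boundary_test_function[OF s \<epsilon>]) blast
    have tr\<phi>: "l2_inner lborel (\<lambda>x. tr \<epsilon> \<phi> (x, y')) (robin_trace \<psi> y') = l2_inner lborel (\<lambda>x. \<phi> (x, y')) (robin_trace \<psi> y')"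
      if y': "y' \<in> {0, \<epsilon>}" for y'
      using tr_test_function[OF \<epsilon> \<phi>(1) y']
      by (intro l2_inner_cong L2_measurable[OF tr_L2[OF \<epsilon> test_functions_H1[OF \<phi>(1) open_strip] y']] L2_measurable[OF slice_L2[OF \<phi>(1)]]
          L2_measurable[OF RL[OF y']]) simp_all
    have e: "l2_inner lborel (\<lambda>x. \<phi> (x, \<epsilon>)) (robin_trace \<psi> \<epsilon>) = l2_inner lborel (\<lambda>x. \<phi> (x, 0)) (robin_trace \<psi> 0)"
      using eq[OF test_functions_H1[OF \<phi>(1) open_strip]] tr\<phi> by simp
    have zero: "l2_inner lborel (\<lambda>x. 0) h = 0" for h :: "real \<Rightarrow> complex" by (simp add: l2_inner_def)
    have "l2_inner lborel s (robin_trace \<psi> y) = 0"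
    proof (cases "y = 0")
      case True
      then show ?thesis using e \<phi>(2,3) zero by simp
    next
      case False
      then have "y = \<epsilon>" using y by blast
      then show ?thesis using e \<phi>(2,4) zero by simp
    qed
    then show "l2_inner (lborel_on UNIV) s (robin_trace \<psi> y) = l2_inner (lborel_on UNIV) s (\<lambda>x. 0)"
      unfolding L2_lborel_on_UNIV by (simp add: l2_inner_def)
  qed
  then show ?thesis unfolding L2_lborel_on_UNIV .
qed

lemma form_operator_regular:
  assumes \<psi>: "\<psi> \<in> H1 (strip \<epsilon>)" and \<eta>: "\<eta> \<in> L2 M"
    and eq: "\<And>\<phi>. \<phi> \<in> H1 (strip \<epsilon>) \<Longrightarrow> robin_form \<epsilon> \<alpha> \<phi> \<psi> = l2_inner M \<phi> \<eta>"
  shows "(\<psi>, \<eta>) \<in> robin_laplacian \<epsilon> \<alpha>"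
proof -
  let ?dx = "wderiv (strip \<epsilon>) (1, 0)" and ?dy = "wderiv (strip \<epsilon>) (0, 1)"
  note W = H1_weak_grad[OF \<psi>]
  note \<psi>D = weak_gradD(1-3)[OF W]
  \<comment> \<open>Of the two volume terms replacing the boundary term, this one is paired with
    \<open>\<phi>\<close> itself and can go to the right-hand side.\<close>
  let ?g = "\<lambda>z. \<eta> z - ma (?dy \<psi>) z"
  have gL: "?g \<in> L2 M" by (rule L2_diff[OF \<eta> ma_L2[OF \<psi>D(3)]])
  have weak: "l2_inner M \<phi>x (?dx \<psi>) + l2_inner M \<phi>y (?dy \<psi>) + l2_inner M \<phi>y (ma \<psi>) = l2_inner M \<phi> ?g"
    if \<phi>: "weak_grad \<epsilon> \<phi> \<phi>x \<phi>y" for \<phi> \<phi>x \<phi>y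
    using eq[OF weak_grad_H1[OF \<phi>]]
    unfolding robin_form_weak_grad[OF \<phi> W] l2_inner_diff_right[OF weak_gradD(1)[OF \<phi>] \<eta> ma_L2[OF \<psi>D(3)]]
    by (simp only: eq_diff_eq)
  obtain \<psi>xx \<psi>xy where x: "weak_grad \<epsilon> (?dx \<psi>) \<psi>xx \<psi>xy"
    and y: "weak_grad \<epsilon> (?dy \<psi>) \<psi>xy (\<lambda>z. - (?g z + \<psi>xx z + ma (?dy \<psi>) z))"
    by (rule weak_solution_regular[OF \<epsilon> W weak_grad_ma[OF W] gL weak])
  have H2: "\<psi> \<in> H2 (strip \<epsilon>)"
    unfolding H2_iff Basis_real_prod
    using \<psi>D(1) weak_gradD(4,5)[OF W] weak_grad_H1[OF x] weak_grad_H1[OF y] by blast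
  \<comment> \<open>The normal derivative of \<open>ma \<psi>\<close> cancels the same term inside
    \<open>?g\<close>, so the coefficient drops out of the equation in the interior.\<close>
  have lap: "AE z in M. \<eta> z = neg_laplacian (strip \<epsilon>) \<psi> z"
    using weak_grad_wderiv(1)[OF x] weak_grad_wderiv(2)[OF y]
    by eventually_elim (simp add: neg_laplacian_strip)
  have "l2_inner lborel (\<lambda>x. tr \<epsilon> \<phi> (x, \<epsilon>)) (robin_trace \<psi> \<epsilon>) = l2_inner lborel (\<lambda>x. tr \<epsilon> \<phi> (x, 0)) (robin_trace \<psi> 0)"
    if \<phi>: "\<phi> \<in> H1 (strip \<epsilon>)" for \<phi>
  proof -
    have \<phi>L: "\<phi> \<in> L2 M" by (rule H1_D(1)[OF \<phi> open_strip])
    have "l2_inner M \<phi> \<eta> = l2_inner M \<phi> (neg_laplacian (strip \<epsilon>) \<psi>)"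
      by (rule l2_inner_cong[OF L2_measurable[OF \<phi>L] L2_measurable[OF \<phi>L] L2_measurable[OF \<eta>] L2_measurable[OF neg_laplacian_L2[OF H2]] _ lap]) simp
    then show ?thesis using eq[OF \<phi>] unfolding robin_form_Green[OF \<phi> H2] by simp
  qed
  then have "AE x in lborel. robin_trace \<psi> y x = 0" if "y \<in> {0, \<epsilon>}" for y by (rule robin_trace_zero[OF H2 that])
  then have "\<psi> \<in> robin_dom \<epsilon> \<alpha>" unfolding robin_dom_iff using H2 by blast
  then show ?thesis unfolding robin_laplacian_def using \<eta> lap by blast
qed

lemma robin_laplacian_eq_form_operator:
  "robin_laplacian \<epsilon> \<alpha> = form_operator M (H1 (strip \<epsilon>)) (robin_form \<epsilon> \<alpha>)"
proof (rule set_eqI)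
  fix p :: "(real \<times> real \<Rightarrow> complex) \<times> (real \<times> real \<Rightarrow> complex)"
  obtain \<psi> \<eta> where p: "p = (\<psi>, \<eta>)" by (cases p)
  show "p \<in> robin_laplacian \<epsilon> \<alpha> \<longleftrightarrow> p \<in> form_operator M (H1 (strip \<epsilon>)) (robin_form \<epsilon> \<alpha>)"
  proof
    assume "p \<in> robin_laplacian \<epsilon> \<alpha>"
    then have \<psi>: "\<psi> \<in> robin_dom \<epsilon> \<alpha>" and \<eta>: "\<eta> \<in> L2 M" and lap: "AE z in M. \<eta> z = neg_laplacian (strip \<epsilon>) \<psi> z"
      unfolding p robin_laplacian_def by auto
    have H2: "\<psi> \<in> H2 (strip \<epsilon>)" using \<psi> unfolding robin_dom_iff by blast
    have "robin_form \<epsilon> \<alpha> \<phi> \<psi> = l2_inner M \<phi> \<eta>" if \<phi>: "\<phi> \<in> H1 (strip \<epsilon>)" for \<phi>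
    proof -
      have \<phi>L: "\<phi> \<in> L2 M" by (rule H1_D(1)[OF \<phi> open_strip])
      have "l2_inner M \<phi> \<eta> = l2_inner M \<phi> (neg_laplacian (strip \<epsilon>) \<psi>)"
        by (rule l2_inner_cong[OF L2_measurable[OF \<phi>L] L2_measurable[OF \<phi>L] L2_measurable[OF \<eta>] L2_measurable[OF neg_laplacian_L2[OF H2]] _ lap]) simp
      then show ?thesis using robin_form_domain[OF \<phi> \<psi>] by simp
    qed
    then show "p \<in> form_operator M (H1 (strip \<epsilon>)) (robin_form \<epsilon> \<alpha>)"
      unfolding p form_operator_def using \<eta> H2_subset_H1[OF H2] by blast
  next
    assume "p \<in> form_operator M (H1 (strip \<epsilon>)) (robin_form \<epsilon> \<alpha>)"
    then show "p \<in> robin_laplacian \<epsilon> \<alpha>"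
      unfolding p form_operator_def by (auto intro: form_operator_regular simp del: sobolev.simps)
  qed
qed

lemma robin_laplacian_iff:
  "(\<psi>, \<eta>) \<in> robin_laplacian \<epsilon> \<alpha> \<longleftrightarrow> \<psi> \<in> H1 (strip \<epsilon>) \<and> \<eta> \<in> L2 M \<and> (\<forall>\<phi>\<in>H1 (strip \<epsilon>). robin_form \<epsilon> \<alpha> \<phi> \<psi> = l2_inner M \<phi> \<eta>)"
  unfolding robin_laplacian_eq_form_operator form_operator_def by blast

subsection \<open>Self-adjointness\<close>

text \<open>This provides a dense part of the domain. As \<open>u\<close> is compactly supported in
  the strip it may serve as a test function for \<open>ma \<phi>\<close>, and the two volume terms
  that stand for the boundary term cancel.\<close>

lemma test_function_robin_laplacian:
  assumes u: "u \<in> test_functions (strip \<epsilon>)"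
  shows "(u, \<lambda>z. - (dir_deriv (1, 0) (dir_deriv (1, 0) u) z + dir_deriv (0, 1) (dir_deriv (0, 1) u) z)) \<in> robin_laplacian \<epsilon> \<alpha>"
  unfolding robin_laplacian_iff
proof (intro conjI ballI)
  let ?dx = "dir_deriv (1, 0)" and ?dy = "dir_deriv (0, 1)"
  note L = test_functions_L2[OF _ open_strip[of \<epsilon>]]
  note du = test_functions_dir_deriv[OF u]
  note W = weak_grad_test[OF u]
  have xx: "?dx (?dx u) \<in> L2 M" and yy: "?dy (?dy u) \<in> L2 M" using L[OF test_functions_dir_deriv[OF du]] by auto
  show "u \<in> H1 (strip \<epsilon>)" by (rule test_functions_H1[OF u open_strip])
  show "(\<lambda>z. - (?dx (?dx u) z + ?dy (?dy u) z)) \<in> L2 M" by (rule L2_uminus[OF L2_add[OF xx yy]])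
  fix \<phi> assume \<phi>: "\<phi> \<in> H1 (strip \<epsilon>)"
  note W\<phi> = H1_weak_grad[OF \<phi>]
  note \<phi>D = weak_gradD[OF W\<phi>]
  let ?wx = "wderiv (strip \<epsilon>) (1, 0) \<phi>" and ?wy = "wderiv (strip \<epsilon>) (0, 1) \<phi>"
  have flip: "l2_inner M w (dir_deriv v u) = - l2_inner M \<phi> (dir_deriv v (dir_deriv v u))"
    if "weak_deriv (strip \<epsilon>) v \<phi> w" "w \<in> L2 M" for v w
  proof -
    have "l2_inner M (dir_deriv v (dir_deriv v u)) \<phi> = - l2_inner M (dir_deriv v u) w"
      by (rule weak_deriv_inner[OF that(1) du open_strip \<phi>D(1) that(2)])
    then have "cnj (l2_inner M (dir_deriv v (dir_deriv v u)) \<phi>) = - cnj (l2_inner M (dir_deriv v u) w)" by simp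
    then show ?thesis unfolding l2_inner_commute by simp
  qed
  have "l2_inner M ?wy (ma u) + l2_inner M \<phi> (ma (?dy u)) = 0"
  proof -
    have "l2_inner M (?dy u) (ma \<phi>) = - l2_inner M u (ma ?wy)"
      using weak_deriv_inner[OF weak_gradD(5)[OF weak_grad_ma[OF W\<phi>]] u open_strip ma_L2[OF \<phi>D(1)] ma_L2[OF \<phi>D(3)]] .
    then have "cnj (l2_inner M (?dy u) (ma \<phi>)) = - cnj (l2_inner M u (ma ?wy))" by simp
    then show ?thesis unfolding l2_inner_commute l2_inner_real_mult_left by simp
  qed
  moreover have "l2_inner M \<phi> (\<lambda>z. - (?dx (?dx u) z + ?dy (?dy u) z)) = - (l2_inner M \<phi> (?dx (?dx u)) + l2_inner M \<phi> (?dy (?dy u)))"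
    unfolding l2_inner_minus_right using l2_inner_add_right[OF \<phi>D(1) xx yy, of 1] by simp
  ultimately show "robin_form \<epsilon> \<alpha> \<phi> u = l2_inner M \<phi> (\<lambda>z. - (?dx (?dx u) z + ?dy (?dy u) z))"
    unfolding robin_form_weak_grad[OF W\<phi> W] flip[OF \<phi>D(4,2)] flip[OF \<phi>D(5,3)] by (simp add: add.assoc)
qed

lemma robin_laplacian_dense: "densely_defined M (robin_laplacian \<epsilon> \<alpha>)"
  unfolding densely_defined_def
proof (intro conjI ballI allI impI subsetI)
  fix \<psi> assume "\<psi> \<in> Domain (robin_laplacian \<epsilon> \<alpha>)"
  then show "\<psi> \<in> L2 M" using H1_D(1)[OF _ open_strip] unfolding Domain_iff robin_laplacian_iff by blast
next
  fix f :: "real \<times> real \<Rightarrow> complex" and e :: real assume f: "f \<in> L2 M" and e: "e > 0"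
  obtain u where u: "\<And>n. u n \<in> test_functions (strip \<epsilon>)" "(\<lambda>n. l2_norm M (\<lambda>z. u n z - f z)) \<longlonglongrightarrow> 0"
    by (rule test_functions_dense[OF open_strip f]) blast
  from eventually_happens'[OF sequentially_bot order_tendstoD(2)[OF u(2) e]]
  obtain n where n: "l2_norm M (\<lambda>z. u n z - f z) < e" by blast
  have "u n \<in> Domain (robin_laplacian \<epsilon> \<alpha>)" by (rule DomainI[OF test_function_robin_laplacian[OF u(1)]])
  moreover have "l2_norm M (\<lambda>z. f z - u n z) < e" using n l2_norm_minus_commute[of M f "u n"] by simp
  ultimately show "\<exists>\<psi>\<in>Domain (robin_laplacian \<epsilon> \<alpha>). l2_norm M (\<lambda>z. f z - \<psi> z) < e" by blast
qed

lemma robin_laplacian_symmetric: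
  assumes "(u, v) \<in> robin_laplacian \<epsilon> \<alpha>" "(\<psi>, \<eta>) \<in> robin_laplacian \<epsilon> \<alpha>"
  shows "l2_inner M u \<eta> = l2_inner M v \<psi>"
proof -
  note A = assms[unfolded robin_laplacian_iff]
  have "l2_inner M u \<eta> = robin_form \<epsilon> \<alpha> u \<psi>" using A by metis
  also have "\<dots> = cnj (robin_form \<epsilon> \<alpha> \<psi> u)" using A robin_form_hermitian by metis
  also have "robin_form \<epsilon> \<alpha> \<psi> u = l2_inner M \<psi> v" using A by metis
  finally show ?thesis unfolding l2_inner_commute .
qed

lemma robin_laplacian_shift_surjective:
  assumes f: "f \<in> L2 M"
  obtains \<psi> where "(\<psi>, \<lambda>z. f z - complex_of_real shift * \<psi> z) \<in> robin_laplacian \<epsilon> \<alpha>"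
proof -
  obtain \<psi> where \<psi>: "\<psi> \<in> H1 (strip \<epsilon>)"
    "\<And>\<phi>. \<phi> \<in> H1 (strip \<epsilon>) \<Longrightarrow> robin_form \<epsilon> \<alpha> \<phi> \<psi> + complex_of_real shift * l2_inner M \<phi> \<psi> = l2_inner M \<phi> f"
    by (rule shifted_equation_solvable[OF f]) blast
  have \<psi>L: "\<psi> \<in> L2 M" by (rule H1_D(1)[OF \<psi>(1) open_strip])
  have "robin_form \<epsilon> \<alpha> \<phi> \<psi> = l2_inner M \<phi> (\<lambda>z. f z - complex_of_real shift * \<psi> z)" if \<phi>: "\<phi> \<in> H1 (strip \<epsilon>)" for \<phi>
  proof -
    have "l2_inner M \<phi> (\<lambda>z. f z + (- complex_of_real shift) * \<psi> z) = l2_inner M \<phi> f + (- complex_of_real shift) * l2_inner M \<phi> \<psi>"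
      by (rule l2_inner_add_right[OF H1_D(1)[OF \<phi> open_strip] f \<psi>L])
    moreover have "(\<lambda>z. f z + (- complex_of_real shift) * \<psi> z) = (\<lambda>z. f z - complex_of_real shift * \<psi> z)"
      by (simp only: diff_conv_add_uminus mult_minus_left)
    moreover have "r = x" if "r + c * i = F" "x = F + (- c) * i" for r c i F x :: complex
      using that by auto
    ultimately show ?thesis using \<psi>(2)[OF \<phi>] by metis
  qed
  moreover have "(\<lambda>z. f z - complex_of_real shift * \<psi> z) \<in> L2 M" by (rule L2_diff[OF f L2_cmult[OF \<psi>L]])
  ultimately show ?thesis using that \<psi>(1) unfolding robin_laplacian_iff by blast
qed

text \<open>Let \<open>w\<close> solve the shifted equation with right-hand side
  \<open>v + c u\<close>. Then \<open>u - w\<close> is orthogonal to the range of the shifted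
  operator, which is all of L2. Since the shift is real, the same surjectivity statement produces
  \<open>w\<close> and describes that range.\<close>

lemma adjoint_subset:
  assumes uv: "(u, v) \<in> adjoint_op M (robin_laplacian \<epsilon> \<alpha>)"
  shows "(u, v) \<in> robin_laplacian \<epsilon> \<alpha>"
proof -
  let ?c = "complex_of_real shift"
  have u: "u \<in> L2 M" and v: "v \<in> L2 M" and adj: "\<And>\<psi> \<eta>. (\<psi>, \<eta>) \<in> robin_laplacian \<epsilon> \<alpha> \<Longrightarrow> l2_inner M u \<eta> = l2_inner M v \<psi>"
    using uv unfolding adjoint_op_def by auto
  let ?f = "\<lambda>z. v z + ?c * u z"
  have f: "?f \<in> L2 M" by (rule L2_add[OF v L2_cmult[OF u]])
  obtain w where w: "(w, \<lambda>z. ?f z - ?c * w z) \<in> robin_laplacian \<epsilon> \<alpha>" by (rule robin_laplacian_shift_surjective[OF f])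
  have wH: "w \<in> H1 (strip \<epsilon>)" using w unfolding robin_laplacian_iff by blast
  have wL: "w \<in> L2 M" by (rule H1_D(1)[OF wH open_strip])
  let ?d = "\<lambda>z. u z - w z"
  have d: "?d \<in> L2 M" by (rule L2_diff[OF u wL])
  \<comment> \<open>\<open>u - w\<close> itself is written as an element of the range, so
    orthogonality gives that its norm is zero.\<close>
  obtain \<psi> where \<psi>: "(\<psi>, \<lambda>z. ?d z - ?c * \<psi> z) \<in> robin_laplacian \<epsilon> \<alpha>" by (rule robin_laplacian_shift_surjective[OF d])
  have \<psi>L: "\<psi> \<in> L2 M" using \<psi> H1_D(1)[OF _ open_strip] unfolding robin_laplacian_iff by blast
  have r: "(\<lambda>z. ?d z - ?c * \<psi> z) \<in> L2 M" by (rule L2_diff[OF d L2_cmult[OF \<psi>L]])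
  have 1: "l2_inner M u (\<lambda>z. ?d z - ?c * \<psi> z) = l2_inner M v \<psi>" by (rule adj[OF \<psi>])
  have 2: "l2_inner M w (\<lambda>z. ?d z - ?c * \<psi> z) = l2_inner M (\<lambda>z. ?f z - ?c * w z) \<psi>" by (rule robin_laplacian_symmetric[OF w \<psi>])
  have "l2_inner M ?d (\<lambda>z. ?d z - ?c * \<psi> z) = l2_inner M v \<psi> - l2_inner M (\<lambda>z. ?f z - ?c * w z) \<psi>"
    unfolding l2_inner_diff_left[OF r u wL] 1 2 by (rule refl)
  also have "\<dots> = l2_inner M (\<lambda>z. v z - (?f z - ?c * w z)) \<psi>"
    by (rule l2_inner_diff_left[OF \<psi>L v L2_diff[OF f L2_cmult[OF wL]], symmetric])
  also have "(\<lambda>z. v z - (?f z - ?c * w z)) = (\<lambda>z. 0 + (- ?c) * ?d z)" by (rule ext) (simp add: algebra_simps)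
  also have "l2_inner M (\<lambda>z. 0 + (- ?c) * ?d z) \<psi> = - ?c * l2_inner M ?d \<psi>"
    unfolding l2_inner_add_left[OF \<psi>L L2_zero d] by (simp add: l2_inner_def)
  finally have 3: "l2_inner M ?d (\<lambda>z. ?d z - ?c * \<psi> z) = - ?c * l2_inner M ?d \<psi>" .
  have e: "(\<lambda>z. ?d z - ?c * \<psi> z) = (\<lambda>z. ?d z + (- ?c) * \<psi> z)"
    by (simp only: diff_conv_add_uminus mult_minus_left)
  have "l2_inner M ?d ?d + (- ?c) * l2_inner M ?d \<psi> = - ?c * l2_inner M ?d \<psi>"
    using 3 unfolding e l2_inner_add_right[OF d d \<psi>L] .
  then have "l2_inner M ?d ?d = 0" by (simp only: add_cancel_left_left)
  then have "l2_norm M ?d = 0" unfolding l2_inner_self by simp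
  from l2_norm_eq_0_AE[OF d this] have AE: "AE z in M. w z = u z" by eventually_elim simp
  \<comment> \<open>The pair with \<open>u\<close> and \<open>v\<close> themselves must be shown to
    belong to the graph; the derivatives of the almost everywhere equal \<open>w\<close> serve for
    \<open>u\<close>.\<close>
  have W: "weak_grad \<epsilon> u (wderiv (strip \<epsilon>) (1, 0) w) (wderiv (strip \<epsilon>) (0, 1) w)"
    by (rule weak_grad_cong[OF H1_weak_grad[OF wH] u AE])
  have "robin_form \<epsilon> \<alpha> \<phi> u = l2_inner M \<phi> v" if \<phi>: "\<phi> \<in> H1 (strip \<epsilon>)" for \<phi>
  proof -
    note W\<phi> = H1_weak_grad[OF \<phi>]
    note \<phi>D = weak_gradD(1-3)[OF W\<phi>]
    have "l2_inner M (wderiv (strip \<epsilon>) (0, 1) \<phi>) (ma u) = l2_inner M (wderiv (strip \<epsilon>) (0, 1) \<phi>) (ma w)"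
    proof (rule l2_inner_cong[OF L2_measurable[OF \<phi>D(3)] L2_measurable[OF \<phi>D(3)] L2_measurable[OF ma_L2[OF u]] L2_measurable[OF ma_L2[OF wL]]])
      show "AE z in M. ma u z = ma w z" using AE by eventually_elim simp
    qed simp
    then have "robin_form \<epsilon> \<alpha> \<phi> u = robin_form \<epsilon> \<alpha> \<phi> w"
      unfolding robin_form_weak_grad[OF W\<phi> W] robin_form_weak_grad[OF W\<phi> H1_weak_grad[OF wH]] by simp
    also have "\<dots> = l2_inner M \<phi> (\<lambda>z. ?f z - ?c * w z)" using w \<phi> unfolding robin_laplacian_iff by blast
    also have "\<dots> = l2_inner M \<phi> v"
    proof (rule l2_inner_cong[OF L2_measurable[OF \<phi>D(1)] L2_measurable[OF \<phi>D(1)] L2_measurable[OF L2_diff[OF f L2_cmult[OF wL]]] L2_measurable[OF v]])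
      show "AE z in M. ?f z - ?c * w z = v z" using AE by eventually_elim simp
    qed simp
    finally show ?thesis .
  qed
  then show ?thesis unfolding robin_laplacian_iff using weak_grad_H1[OF W] v by blast
qed

lemma robin_laplacian_self_adjoint: "self_adjoint M (robin_laplacian \<epsilon> \<alpha>)"
  unfolding self_adjoint_def
proof (intro conjI robin_laplacian_dense set_eqI)
  fix p :: "(real \<times> real \<Rightarrow> complex) \<times> (real \<times> real \<Rightarrow> complex)"
  obtain u v where p: "p = (u, v)" by (cases p)
  show "p \<in> adjoint_op M (robin_laplacian \<epsilon> \<alpha>) \<longleftrightarrow> p \<in> robin_laplacian \<epsilon> \<alpha>"
    unfolding p
  proof
    assume "(u, v) \<in> adjoint_op M (robin_laplacian \<epsilon> \<alpha>)"
    then show "(u, v) \<in> robin_laplacian \<epsilon> \<alpha>" by (rule adjoint_subset)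
  next
    assume A: "(u, v) \<in> robin_laplacian \<epsilon> \<alpha>"
    then have L: "u \<in> L2 M" "v \<in> L2 M" using H1_D(1)[OF _ open_strip] unfolding robin_laplacian_iff by blast+
    show "(u, v) \<in> adjoint_op M (robin_laplacian \<epsilon> \<alpha>)"
      unfolding adjoint_op_def using L robin_laplacian_symmetric[OF A] by auto
  qed
qed

text \<open>Taking adjoints reverses inclusions, so \<open>T\<close> contained in the Robin
  Laplacian implies that the latter, equal to its adjoint, is contained in the adjoint of
  \<open>T\<close>, which is \<open>T\<close>.\<close>

lemma self_adjoint_restriction_eq:
  assumes T: "self_adjoint M T"
    and sub: "\<forall>(\<psi>, \<eta>)\<in>T. \<psi> \<in> H1 (strip \<epsilon>) \<and> (\<forall>\<phi>\<in>H1 (strip \<epsilon>). robin_form \<epsilon> \<alpha> \<phi> \<psi> = l2_inner M \<phi> \<eta>)"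
  shows "T = robin_laplacian \<epsilon> \<alpha>"
proof -
  have TL: "p \<in> robin_laplacian \<epsilon> \<alpha>" if "p \<in> T" for p
  proof -
    obtain \<psi> \<eta> where p: "p = (\<psi>, \<eta>)" by (cases p)
    \<comment> \<open>Square integrability of \<open>\<eta>\<close> is not contained in the form
      identity; it comes from \<open>T\<close> being an adjoint.\<close>
    have "(\<psi>, \<eta>) \<in> adjoint_op M T" using T that unfolding self_adjoint_def p by simp
    then have "\<eta> \<in> L2 M" unfolding adjoint_op_def by auto
    then show ?thesis unfolding p robin_laplacian_iff using sub that unfolding p by blast
  qed
  have "p \<in> T" if "p \<in> robin_laplacian \<epsilon> \<alpha>" for p
  proof -
    have "p \<in> adjoint_op M (robin_laplacian \<epsilon> \<alpha>)"
      using robin_laplacian_self_adjoint that unfolding self_adjoint_def by simp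
    then have "p \<in> adjoint_op M T" unfolding adjoint_op_def using TL by fast
    then show ?thesis using T unfolding self_adjoint_def by simp
  qed
  with TL show ?thesis by blast
qed

end

theorem theorem6:
  fixes \<epsilon> :: real and \<alpha> :: "real \<Rightarrow> real"
  assumes "\<epsilon> > 0" and "\<alpha> \<in> W1inf"
  shows "self_adjoint (lborel_on (strip \<epsilon>)) (robin_laplacian \<epsilon> \<alpha>) \<and>
    robin_laplacian \<epsilon> \<alpha> = form_operator (lborel_on (strip \<epsilon>)) (H1 (strip \<epsilon>)) (robin_form \<epsilon> \<alpha>) \<and>
    (\<forall>T. self_adjoint (lborel_on (strip \<epsilon>)) T \<and>
         (\<forall>(\<psi>, \<eta>) \<in> T. \<psi> \<in> H1 (strip \<epsilon>) \<and>
            (\<forall>\<phi> \<in> H1 (strip \<epsilon>). robin_form \<epsilon> \<alpha> \<phi> \<psi> = l2_inner (lborel_on (strip \<epsilon>)) \<phi> \<eta>))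
       \<longrightarrow> T = robin_laplacian \<epsilon> \<alpha>) \<and>
    (\<forall>\<phi> \<in> H1 (strip \<epsilon>). \<forall>\<psi> \<in> robin_dom \<epsilon> \<alpha>.
       robin_form \<epsilon> \<alpha> \<phi> \<psi> = l2_inner (lborel_on (strip \<epsilon>)) \<phi> (neg_laplacian (strip \<epsilon>) \<psi>))"
proof -
  \<comment> \<open>The form and the boundary condition see \<open>\<alpha>\<close> only up to null
    sets, so bounded representatives of it and of its derivative can carry the whole
    argument.\<close>
  obtain a b C where ab: "a \<in> borel_measurable borel" "b \<in> borel_measurable borel" "\<And>x. \<bar>a x\<bar> \<le> C" "\<And>x. \<bar>b x\<bar> \<le> C"
    "AE x in lborel. \<alpha> x = a x" "weak_deriv UNIV 1 a b"
    by (rule W1inf_bounded_representative[OF assms(2)]) blast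
  have "\<alpha> \<in> borel_measurable borel" using assms(2) by (simp add: W1inf_def Linf_def)
  then interpret robin_strip \<epsilon> \<alpha> a b C by unfold_locales (use assms(1) ab in auto)
  show ?thesis
    using robin_laplacian_self_adjoint robin_laplacian_eq_form_operator self_adjoint_restriction_eq robin_form_domain by blast
qed

end
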